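(* Let $L$ be the matrix quadratic pencil $$Y''+(\rho^2 I+2i\rho Q_1(x)+Q_0(x))Y=0,\quad x\in(0,\pi),\qquad U(Y)=0,\quad V(Y)=0,$$ described in the context, satisfying conditions (I) and (II) stated there. Then $L$ has a countable set of eigenvalues, and: (i) the eigenvalues can be numbered (counting with their multiplicities) as $\{\rho_{nq}\}_{n\in w,\,q=1,\dots,m}$, where $w:=\{\pm0,\pm1,\pm2,\dots\}$, so that $$\rho_{nq}=n+\omega_q+O(n^{-1}),\quad |n|\to\infty,\quad q=1,\dots,m,\qquad \omega_q\in[0,1);$$ (ii) for some sufficiently large $N$, all the eigenvalues $\rho_{nq}$ with $|n|\ge N$ are real. The poles of the Weyl matrix $M(\rho)$ coincide with the eigenvalues of $L$. Moreover, for some sufficiently large $N$: (iii) the poles of $M(\rho)$ at $\rho_{nq}$, $|n|\ge N$, are simple; (iv) the weight matrices $\alpha_{nq}:=\operatorname{Res}_{\rho=\rho_{nq}}M(\rho)$, $|n|\ge N$, satisfy $$\sum_{s\in J_q}\frac{\alpha_{ns}}{m_{ns}}=\frac{1}{\pi n}(I-h_1)^{-1}W^\dagger I_qW(I+h_1)^{-1}+O(n^{-2}),\quad |n|\to\infty,\quad q=1,\dots,m,$$ and $\operatorname{rank}\alpha_{nq}=m_{nq}$, where $m_{nq}$ is the multiplicity of the eigenvalue $\rho_{nq}$ and $\omega_q$, $J_q$, $I_q$, $W$ are as in the context.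
   Context: **The pencil.** $m\ge1$; $I$ is the $m\times m$ identity matrix; $\dagger$ denotes conjugate transpose; $\rho\in\mathbb C$ is the spectral parameter. $Y(x)$ is a column $m$-vector (or an $m\times m$ matrix). $Q_1,Q_0$ are complex $m\times m$ matrix functions on $[0,\pi]$, the entries of $Q_1$ lying in the Sobolev space $W_1^1[0,\pi]$ and those of $Q_0$ in $L_1(0,\pi)$. $h_0,h_1,H_0,H_1$ are constant complex $m\times m$ matrices, and $$U(Y):=Y'(0)+(i\rho h_1+h_0)Y(0),\qquad V(Y):=Y'(\pi)+(i\rho H_1+H_0)Y(\pi).$$ Conditions: (I) $\det(I\pm h_1)\ne0$, $\det(I\pm H_1)\ne0$; (II) $Q_1^\dagger(x)=-Q_1(x)$, $Q_0^\dagger(x)=Q_0(x)$ for a.e. $x$; $h_1^\dagger=-h_1$, $H_1^\dagger=-H_1$, $h_0^\dagger=h_0$, $H_0^\dagger=H_0$. **Spectral characteristics.** An eigenvalue of $L$ is a value $\rho$ for which the boundary value problem has a nonzero vector solution. Let $\varphi(x,\rho)$ be the matrix solution of the equation with $\varphi(0,\rho)=I$, $U(\varphi)=0$. The eigenvalues are the zeros of the entire function $\det V(\varphi(\cdot,\rho))$, and the multiplicity of an eigenvalue is its multiplicity as a zero of this function. The Weyl solution $\Phi(x,\rho)$ is the matrix solution with $U(\Phi)=I$, $V(\Phi)=0$; the Weyl matrix is $M(\rho):=\Phi(0,\rho)$. In $w=\{\pm0,\pm1,\pm2,\dots\}$ the symbols $+0$ and $-0$ are two distinct indices, both with numerical value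 $0$. **Notation in the asymptotics.** Let $P_\pm(x)$ solve $P_\pm'(x)=\pm Q_1(x)P_\pm(x)$, $P_\pm(0)=I$ (unitary under (II)). Put $$A=P_-^{-1}(\pi)(I+H_1)^{-1}(I-H_1)P_+(\pi)(I+h_1)(I-h_1)^{-1},$$ which is a unitary matrix, and write $A=W^\dagger\,\mathrm{diag}\{\mu_1,\dots,\mu_m\}\,W$ with $W$ unitary. The numbers $\omega_q\in[0,1)$ are defined by $\mu_q=e^{2\pi i\omega_q}$. $J_q=\{s:\omega_s=\omega_q\}$, and $I_q$ is the diagonal $m\times m$ matrix whose $j$-th diagonal entry is $1$ if $j\in J_q$ and $0$ otherwise. *)

theory Defs
  imports "HOL-Complex_Analysis.Complex_Analysis" "HOL-Library.Landau_Symbols"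
begin

section \<open>Complex matrices\<close>

definition hermitian_conj :: "complex^'n^'m \<Rightarrow> complex^'m^'n"  ("(_\<^sup>\<dagger>)" [1000] 999) where
  "A\<^sup>\<dagger> = (\<chi> i j. cnj (A $ j $ i))"

definition unitary_mat :: "complex^'m^'m \<Rightarrow> bool" where
  "unitary_mat A \<longleftrightarrow> A\<^sup>\<dagger> ** A = mat 1 \<and> A ** A\<^sup>\<dagger> = mat 1"

definition diag_mat :: "('m \<Rightarrow> complex) \<Rightarrow> complex^'m^'m" where
  "diag_mat d = (\<chi> i j. if i = j then d i else 0)"

text \<open>Poles and residues of a matrix function are taken entrywise; the order of a pole is the
  largest order of a pole of an entry.\<close>

definition matrix_pole :: "(complex \<Rightarrow> complex^'m^'m) \<Rightarrow> complex \<Rightarrow> bool" where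
  "matrix_pole F z \<longleftrightarrow>
     (\<forall>i j. isolated_singularity_at (\<lambda>\<rho>. F \<rho> $ i $ j) z \<and> not_essential (\<lambda>\<rho>. F \<rho> $ i $ j) z) \<and>
     (\<exists>i j. is_pole (\<lambda>\<rho>. F \<rho> $ i $ j) z)"

definition simple_matrix_pole :: "(complex \<Rightarrow> complex^'m^'m) \<Rightarrow> complex \<Rightarrow> bool" where
  "simple_matrix_pole F z \<longleftrightarrow> matrix_pole F z \<and>
     (\<forall>i j. is_pole (\<lambda>\<rho>. F \<rho> $ i $ j) z \<longrightarrow> zorder (\<lambda>\<rho>. F \<rho> $ i $ j) z = -1)"

definition matrix_residue :: "(complex \<Rightarrow> complex^'m^'m) \<Rightarrow> complex \<Rightarrow> complex^'m^'m" where
  "matrix_residue F z = (\<chi> i j. residue (\<lambda>\<rho>. F \<rho> $ i $ j) z)"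


section \<open>The Sobolev space W_1^1[0,pi]\<close>

text \<open>Elements are represented by their absolutely continuous representatives; the derivative
  is an integrable function, determined up to a null set.\<close>

definition has_W11_derivative ::
    "(real \<Rightarrow> 'a::euclidean_space) \<Rightarrow> (real \<Rightarrow> 'a) \<Rightarrow> bool" where
  "has_W11_derivative f g \<longleftrightarrow> g absolutely_integrable_on {0..pi} \<and>
     (\<forall>x\<in>{0..pi}. f x = f 0 + integral {0..x} g)"

definition in_W11 :: "(real \<Rightarrow> 'a::euclidean_space) \<Rightarrow> bool" where
  "in_W11 f \<longleftrightarrow> (\<exists>g. has_W11_derivative f g)"


section \<open>The pencil\<close>

record ('m::finite) pencil =
  Q1 :: "real \<Rightarrow> complex^'m^'m"
  Q0 :: "real \<Rightarrow> complex^'m^'m"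
  h1 :: "complex^'m^'m"
  h0 :: "complex^'m^'m"
  H1 :: "complex^'m^'m"
  H0 :: "complex^'m^'m"

text \<open>One-sided at the end points of the interval.\<close>

definition deriv_I :: "(real \<Rightarrow> 'a::real_normed_vector) \<Rightarrow> real \<Rightarrow> 'a" where
  "deriv_I Y x = vector_derivative Y (at x within {0..pi})"

text \<open>The unknown \<open>Y\<close> has \<open>m\<close> rows and any number of columns: vector solutions have
  column type \<open>1\<close>, matrix solutions column type \<open>'m\<close>. Scalar multiples of the identity are
  \<open>mat c\<close>. A solution is continuously differentiable with absolutely continuous derivative;
  \<open>Y2\<close> is its second derivative.\<close>

definition solves :: "'m::finite pencil \<Rightarrow> complex \<Rightarrow> (real \<Rightarrow> complex^'k^'m) \<Rightarrow> bool" where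
  "solves L \<rho> Y \<longleftrightarrow>
     (\<forall>x\<in>{0..pi}. Y differentiable (at x within {0..pi})) \<and>
     (\<exists>Y2. has_W11_derivative (deriv_I Y) Y2 \<and>
        (AE x in lebesgue_on {0..pi}.
           Y2 x + (mat (\<rho>\<^sup>2) + mat (2 * \<i> * \<rho>) ** Q1 L x + Q0 L x) ** Y x = 0))"

definition bc_U :: "'m::finite pencil \<Rightarrow> complex \<Rightarrow> (real \<Rightarrow> complex^'k^'m) \<Rightarrow> complex^'k^'m" where
  "bc_U L \<rho> Y = deriv_I Y 0 + (mat (\<i> * \<rho>) ** h1 L + h0 L) ** Y 0"

definition bc_V :: "'m::finite pencil \<Rightarrow> complex \<Rightarrow> (real \<Rightarrow> complex^'k^'m) \<Rightarrow> complex^'k^'m" where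
  "bc_V L \<rho> Y = deriv_I Y pi + (mat (\<i> * \<rho>) ** H1 L + H0 L) ** Y pi"


section \<open>Spectral characteristics\<close>

definition eigenvalues :: "'m::finite pencil \<Rightarrow> complex set" where
  "eigenvalues L = {\<rho>. \<exists>Y :: real \<Rightarrow> complex^1^'m.
     solves L \<rho> Y \<and> bc_U L \<rho> Y = 0 \<and> bc_V L \<rho> Y = 0 \<and> (\<exists>x\<in>{0..pi}. Y x \<noteq> 0)}"

text \<open>On \<open>[0,pi]\<close> the choices below are unique; outside, the functions carry no meaning. The
  Weyl solution does not exist when \<open>\<rho>\<close> is an eigenvalue, where \<open>weyl_matrix\<close> is a junk value
  (which affects neither poles nor residues).\<close>

definition phi :: "'m::finite pencil \<Rightarrow> complex \<Rightarrow> real \<Rightarrow> complex^'m^'m" where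
  "phi L \<rho> = (SOME Y. solves L \<rho> Y \<and> Y 0 = mat 1 \<and> bc_U L \<rho> Y = 0)"

definition multiplicity_ev :: "'m::finite pencil \<Rightarrow> complex \<Rightarrow> nat" where
  "multiplicity_ev L z = nat (zorder (\<lambda>\<rho>. det (bc_V L \<rho> (phi L \<rho>))) z)"

definition weyl_solution :: "'m::finite pencil \<Rightarrow> complex \<Rightarrow> real \<Rightarrow> complex^'m^'m" where
  "weyl_solution L \<rho> = (SOME Y. solves L \<rho> Y \<and> bc_U L \<rho> Y = mat 1 \<and> bc_V L \<rho> Y = 0)"

definition weyl_matrix :: "'m::finite pencil \<Rightarrow> complex \<Rightarrow> complex^'m^'m" where
  "weyl_matrix L \<rho> = weyl_solution L \<rho> 0"


section \<open>Numbering of the eigenvalues\<close>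

text \<open>The index set \<open>{\<plusminus>0, \<plusminus>1, \<plusminus>2, \<dots>}\<close>; \<open>Pos 0\<close> and \<open>Neg 0\<close> are
  distinct indices with the same numerical value.\<close>

datatype windex = Pos nat | Neg nat

primrec wval :: "windex \<Rightarrow> int" where
  "wval (Pos k) = int k"
| "wval (Neg k) = - int k"

definition windex_at_infinity :: "windex filter" where
  "windex_at_infinity = filtercomap (\<lambda>n. \<bar>wval n\<bar>) at_top"

definition numbers_eigenvalues :: "'m::finite pencil \<Rightarrow> (windex \<Rightarrow> 'm \<Rightarrow> complex) \<Rightarrow> bool" where
  "numbers_eigenvalues L r \<longleftrightarrow>
     range (\<lambda>(n, q). r n q) = eigenvalues L \<and>
     (\<forall>z\<in>eigenvalues L. finite {(n, q). r n q = z} \<and>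
        card {(n, q). r n q = z} = multiplicity_ev L z)"

end

theory Submission
  imports Defs
begin

text \<open>
  With \<open>\<Delta>(\<rho>) = V(\<phi>(\<cdot>, \<rho>))\<close> and \<open>\<Theta>(\<rho>) = V(S(\<cdot>, \<rho>))\<close>, where \<open>S\<close> is the solution with
  \<open>S(0) = 0\<close>, \<open>S'(0) = I\<close>, the eigenvalues are the zeros of \<open>det \<Delta>\<close> and \<open>\<Delta> M = - \<Theta>\<close>.
  Since \<open>e\<^bsup>i\<rho>x\<^esup> P\<^sub>-(x) C\<^sub>1 + e\<^bsup>-i\<rho>x\<^esup> P\<^sub>+(x) C\<^sub>2\<close> solves the equation up to an error without the factor \<open>\<rho>\<close>,
  \<open>\<Delta>(\<rho>)\<close> is \<open>(i\<rho>/2) e\<^bsup>-i\<rho>\<pi>\<^esup> (I + H\<^sub>1) P\<^sub>-(\<pi>) (e\<^bsup>2\<pi>i\<rho>\<^esup> - A + O(1/\<rho>)) (I - h\<^sub>1)\<close>, with the error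
  relative to \<open>max 1 |e\<^bsup>2\<pi>i\<rho>\<^esup>|\<close>. Rouche's theorem on discs of radius \<open>C/|n|\<close> around \<open>n + \<omega>\<^sub>q\<close> and on large discs
  counts the eigenvalues; the factor \<open>\<rho>\<^sup>m\<close> of the main term accounts for the doubled index 0.

  Pairing the equation with an eigenfunction gives \<open>a \<rho>\<^sup>2 + b \<rho> + c = 0\<close> with real coefficients, \<open>a > 0\<close> and
  \<open>c \<le> C a\<close>. For large \<open>|\<rho>|\<close> this excludes nonreal eigenvalues, and also Jordan chains of \<open>\<Delta>\<close> at real
  ones; hence the poles of \<open>M\<close> are simple and the rank of the residue is the multiplicity. Finally the
  residues of \<open>M\<close> near \<open>n + \<omega>\<^sub>q\<close> sum up to a contour integral over a circle of fixed radius, on which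
  \<open>M\<close> is within \<open>O(1/n\<^sup>2)\<close> of an explicit function.
\<close>

text \<open>The main term has an error without the factor \<rho> because \<open>P_minus\<close> and
  \<open>P_plus\<close> cancel exactly the contribution of 2 i \<rho> Q_1; what remains is
  integrable since Q_1 lies in W_1^1. As Q_0 is only integrable, second derivatives exist merely as
  densities, so the calculus rests on integral identities throughout. The estimates keep the
  distance \<delta> to the points n + \<omega>_q as a parameter: \<delta> of order 1/|n| localizes
  the eigenvalues, a fixed \<delta> gives the weight matrices. Coinciding \<omega>_q are the
  obstacle. Eigenvalues near a common n + \<omega>_q may split or merge, and from outside only their
  total multiplicity and the sum of their residues are controlled. Division by the multiplicity
  makes each distinct eigenvalue count once. That no pole of M cancels against \<Theta> rests on the
  full row rank of (\<Delta>, \<Theta>), which expresses solvability of the Cauchy problem at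
  \<pi>.\<close>

no_notation fps_nth (infixl "$" 75)

section \<open>Matrices and absolutely continuous functions\<close>

lemma norm_matrix_sq:
  fixes A :: "complex^'n^'m"
  shows "(norm A)\<^sup>2 = (\<Sum>i\<in>UNIV. \<Sum>j\<in>UNIV. (cmod (A $ i $ j))\<^sup>2)"
  by (simp add: norm_vec_def L2_set_def sum_nonneg)

text \<open>The norm carried by the type of nested vectors is the Frobenius norm, so Cauchy-Schwarz
  for each entry of the product suffices. The constant is 1, and the resulting
  \<open>bounded_bilinear\<close> instance supplies the product, continuity and linearity rules for
  \<open>**\<close> used everywhere below.\<close>

lemma norm_matrix_mult_le:
  fixes A :: "complex^'n^'m" and B :: "complex^'k^'n"
  shows "norm (A ** B) \<le> norm A * norm B"
proof -
  have entry: "(cmod ((A ** B) $ i $ j))\<^sup>2 \<le> (\<Sum>k\<in>UNIV. (cmod (A $ i $ k))\<^sup>2) * (\<Sum>k\<in>UNIV. (cmod (B $ k $ j))\<^sup>2)"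
    for i j
  proof -
    have "cmod ((A ** B) $ i $ j) \<le> (\<Sum>k\<in>UNIV. cmod (A $ i $ k) * cmod (B $ k $ j))"
      unfolding matrix_matrix_mult_def by (simp add: norm_mult sum_norm_le)
    then have "(cmod ((A ** B) $ i $ j))\<^sup>2 \<le> (\<Sum>k\<in>UNIV. cmod (A $ i $ k) * cmod (B $ k $ j))\<^sup>2"
      by (simp add: power_mono)
    also have "\<dots> \<le> (\<Sum>k\<in>UNIV. (cmod (A $ i $ k))\<^sup>2) * (\<Sum>k\<in>UNIV. (cmod (B $ k $ j))\<^sup>2)"
      by (rule Cauchy_Schwarz_ineq_sum)
    finally show ?thesis .
  qed
  have "(norm (A ** B))\<^sup>2 \<le> (\<Sum>i\<in>UNIV. \<Sum>j\<in>UNIV. (\<Sum>k\<in>UNIV. (cmod (A $ i $ k))\<^sup>2) * (\<Sum>k\<in>UNIV. (cmod (B $ k $ j))\<^sup>2))"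
    unfolding norm_matrix_sq[of "A ** B"] by (intro sum_mono entry)
  also have "\<dots> = (norm A)\<^sup>2 * (\<Sum>j\<in>UNIV. \<Sum>k\<in>UNIV. (cmod (B $ k $ j))\<^sup>2)"
    by (simp add: norm_matrix_sq sum_product)
  also have "\<dots> = (norm A * norm B)\<^sup>2"
    by (subst sum.swap) (simp add: norm_matrix_sq power_mult_distrib)
  finally show ?thesis
    by (rule power2_le_imp_le) simp
qed

lemma bounded_bilinear_matrix_mult:
  "bounded_bilinear ((**) :: complex^'n^'m \<Rightarrow> complex^'k^'n \<Rightarrow> complex^'k^'m)"
proof
  show "\<exists>K. \<forall>(a::complex^'n^'m) (b::complex^'k^'n). norm (a ** b) \<le> norm a * norm b * K"
    by (rule exI[of _ 1]) (simp add: norm_matrix_mult_le)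
qed (simp_all add: vec_eq_iff matrix_matrix_mult_def distrib_left distrib_right sum.distrib
      scaleR_sum_right)

interpretation matrix_mult: bounded_bilinear
  "(**) :: complex^'n^'m \<Rightarrow> complex^'k^'n \<Rightarrow> complex^'k^'m"
  by (rule bounded_bilinear_matrix_mult)

lemma mat_mult_nth [simp]:
  fixes A :: "complex^'k^'m"
  shows "(mat c ** A) $ i $ j = c * A $ i $ j"
proof -
  have "(mat c ** A) $ i $ j = (\<Sum>k\<in>UNIV. if k = i then c * A $ k $ j else 0)"
    unfolding matrix_matrix_mult_def mat_def vec_lambda_beta by (rule sum.cong) auto
  then show ?thesis by simp
qed

lemma mat_commute:
  fixes A :: "complex^'k^'m"
  shows "A ** mat c = mat c ** A"
proof -
  have "(A ** mat c) $ i $ j = (\<Sum>k\<in>UNIV. if k = j then c * A $ i $ k else 0)" for i j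
    unfolding matrix_matrix_mult_def mat_def vec_lambda_beta by (rule sum.cong) (auto simp: mult.commute)
  then show ?thesis by (simp add: vec_eq_iff)
qed

lemma mat_mult_mat [simp]: "mat a ** mat b = (mat (a * b) :: complex^'m^'m)"
  by (simp add: vec_eq_iff) (simp add: mat_def)

lemma mat_mult_mat_assoc [simp]:
  fixes A :: "complex^'k^'m"
  shows "mat a ** (mat b ** A) = mat (a * b) ** A"
  by (simp add: matrix_mul_assoc)

lemma mult_mat_mult:
  fixes A :: "complex^'n^'m" and B :: "complex^'k^'n"
  shows "A ** (mat c ** B) = mat c ** (A ** B)"
  unfolding matrix_mul_assoc mat_commute[of A c] ..

lemma mat_add: "mat (a + b) = mat a + (mat b :: 'a::monoid_add^'m^'m)"
  by (simp add: vec_eq_iff mat_def)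

lemma mat_scaleR: "mat (r *\<^sub>R b) = r *\<^sub>R (mat b :: complex^'m^'m)"
  by (simp add: vec_eq_iff mat_def)

lemma norm_mat_mult [simp]: "norm (mat c ** A) = cmod c * norm (A :: complex^'k^'m)"
proof -
  have "(norm (mat c ** A))\<^sup>2 = (cmod c * norm A)\<^sup>2"
    by (simp add: norm_matrix_sq norm_mult power_mult_distrib sum_distrib_left)
  then show ?thesis by (simp add: power2_eq_iff_nonneg)
qed

lemma bounded_linear_mat: "bounded_linear (mat :: complex \<Rightarrow> complex^'m^'m)"
proof -
  have "linear (mat :: complex \<Rightarrow> complex^'m^'m)"
    by (rule linearI) (simp_all add: mat_add mat_scaleR)
  then show ?thesis by (simp add: linear_conv_bounded_linear)
qed

section \<open>Calculus of absolutely continuous functions on [0, \<pi>]\<close>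

lemma has_W11_derivativeD:
  assumes "has_W11_derivative f g"
  shows "g absolutely_integrable_on {0..pi}" "\<And>x. x \<in> {0..pi} \<Longrightarrow> f x = f 0 + integral {0..x} g"
  using assms unfolding has_W11_derivative_def by blast+

lemma has_W11_derivativeI:
  assumes "g absolutely_integrable_on {0..pi}" "\<And>x. x \<in> {0..pi} \<Longrightarrow> f x = f 0 + integral {0..x} g"
  shows "has_W11_derivative f g"
  using assms unfolding has_W11_derivative_def by blast

lemma has_W11_derivative_nth: 
  assumes "has_W11_derivative f g" "0 \<le> y" "y \<le> x" "x \<le> pi"
  shows "integral {y..x} g = f x - f y" "g integrable_on {y..x}"
proof -
  have g: "g integrable_on {0..pi}"
    using has_W11_derivativeD(1)[OF assms(1)] absolutely_integrable_on_def by blast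
  have gx: "g integrable_on {0..x}"
    by (rule integrable_on_subinterval[OF g]) (use assms in auto)
  show "g integrable_on {y..x}"
    by (rule integrable_on_subinterval[OF g]) (use assms in auto)
  have "integral {0..y} g + integral {y..x} g = integral {0..x} g"
    by (rule Henstock_Kurzweil_Integration.integral_combine) (use assms gx in auto)
  moreover have "f x = f 0 + integral {0..x} g" "f y = f 0 + integral {0..y} g"
    by (rule has_W11_derivativeD(2)[OF assms(1)], use assms(2-4) in auto)+
  ultimately show "integral {y..x} g = f x - f y"
    by (metis add_diff_cancel_left add_diff_cancel_left')
qed

lemma has_W11_derivative_continuous:
  assumes "has_W11_derivative f g"
  shows "continuous_on {0..pi} f"
proof -
  have g: "g integrable_on {0..pi}"
    using has_W11_derivativeD(1)[OF assms] absolutely_integrable_on_def by blast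
  have "continuous_on {0..pi} (\<lambda>x. f 0 + integral {0..x} g)"
    by (intro continuous_intros indefinite_integral_continuous_1 g)
  then show ?thesis
    by (rule continuous_on_eq) (rule has_W11_derivativeD(2)[OF assms, symmetric])
qed

lemma absolutely_integrable_continuous_prod:
  fixes prod :: "'a::euclidean_space \<Rightarrow> 'b::euclidean_space \<Rightarrow> 'c::euclidean_space"
  assumes "bounded_bilinear prod" "continuous_on {a..b::real} f" "g absolutely_integrable_on {a..b}"
  shows "(\<lambda>x. prod (f x) (g x)) absolutely_integrable_on {a..b}"
proof (rule absolutely_integrable_bounded_measurable_product[where h=prod])
  show "bilinear prod" using assms(1) by (simp add: bilinear_conv_bounded_bilinear)
  show "f \<in> borel_measurable (lebesgue_on {a..b})"
    by (rule continuous_imp_measurable_on_sets_lebesgue[OF assms(2)]) auto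
  show "bounded (f ` {a..b})"
    by (intro compact_imp_bounded compact_continuous_image assms) auto
qed (use assms in auto)

lemma absolutely_integrable_prod_continuous:
  fixes prod :: "'a::euclidean_space \<Rightarrow> 'b::euclidean_space \<Rightarrow> 'c::euclidean_space"
  assumes "bounded_bilinear prod" "f absolutely_integrable_on {a..b::real}" "continuous_on {a..b} g"
  shows "(\<lambda>x. prod (f x) (g x)) absolutely_integrable_on {a..b}"
  using absolutely_integrable_continuous_prod[OF bounded_bilinear.flip[OF assms(1)] assms(3,2)] .

text \<open>Chains short increments together, by induction on the number of steps of length
  \<delta>. With \<open>V\<close> an arbitrarily small multiple of an indefinite integral it shows
  that \<open>H\<close> is constant, which takes the place of almost everywhere differentiation in
  the product rule.\<close>

lemma local_increment_bound:
  fixes H :: "real \<Rightarrow> 'a::real_normed_vector"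
  assumes "\<delta> > 0"
    and loc: "\<And>x y. 0 \<le> y \<Longrightarrow> y \<le> x \<Longrightarrow> x \<le> b \<Longrightarrow> x - y \<le> \<delta> \<Longrightarrow> norm (H x - H y) \<le> V x - V y"
    and "0 \<le> x" "x \<le> b"
  shows "norm (H x - H 0) \<le> V x - V 0"
proof -
  have "\<forall>x. 0 \<le> x \<longrightarrow> x \<le> b \<longrightarrow> x \<le> real n * \<delta> \<longrightarrow> norm (H x - H 0) \<le> V x - V 0" for n
  proof (induction n)
    case 0
    show ?case
    proof (intro allI impI)
      fix x :: real assume "0 \<le> x" "x \<le> b" "x \<le> real 0 * \<delta>"
      then have "x = 0" by simp
      then show "norm (H x - H 0) \<le> V x - V 0" by simp
    qed
  next
    case (Suc n)
    show ?case
    proof (intro allI impI)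
      fix x assume x: "0 \<le> x" "x \<le> b" "x \<le> real (Suc n) * \<delta>"
      define y where "y = max 0 (x - \<delta>)"
      have "norm (H y - H 0) \<le> V y - V 0"
        by (rule Suc.IH[rule_format]) (use x \<open>\<delta> > 0\<close> in \<open>auto simp: y_def algebra_simps max_def\<close>)
      moreover have "norm (H x - H y) \<le> V x - V y"
        by (rule loc) (use x \<open>\<delta> > 0\<close> in \<open>auto simp: y_def max_def\<close>)
      moreover have "norm (H x - H 0) \<le> norm (H x - H y) + norm (H y - H 0)"
        using norm_triangle_ineq[of "H x - H y" "H y - H 0"] by simp
      ultimately show "norm (H x - H 0) \<le> V x - V 0" by linarith
    qed
  qed
  moreover obtain n where "x \<le> real n * \<delta>"
    using reals_Archimedean3[OF \<open>\<delta> > 0\<close>] by (meson less_imp_le)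
  ultimately show ?thesis using assms by blast
qed

text \<open>Over a short interval the increment of \<open>H\<close> is the integral of
  \<open>prod (f s) (G x - G s) - prod (F s - F y) (g s)\<close>. Uniform continuity of
  \<open>F\<close> and \<open>G\<close> makes this a small multiple of the integral of |f| + |g|;
  these bounds add up to an arbitrarily small total, so \<open>H\<close> is constant.\<close>

lemma has_W11_derivative_prod:
  fixes prod :: "'a::euclidean_space \<Rightarrow> 'b::euclidean_space \<Rightarrow> 'c::euclidean_space"
  assumes bb: "bounded_bilinear prod" and F: "has_W11_derivative F f" and G: "has_W11_derivative G g"
  shows "has_W11_derivative (\<lambda>x. prod (F x) (G x)) (\<lambda>x. prod (f x) (G x) + prod (F x) (g x))"
proof -
  interpret bounded_bilinear prod by fact
  define P where "P x = prod (f x) (G x) + prod (F x) (g x)" for x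
  have cF: "continuous_on {0..pi} F" and cG: "continuous_on {0..pi} G"
    using F G has_W11_derivative_continuous by auto
  have fa: "f absolutely_integrable_on {0..pi}" and ga: "g absolutely_integrable_on {0..pi}"
    using has_W11_derivativeD(1) F G by blast+
  have P1: "(\<lambda>x. prod (f x) (G x)) absolutely_integrable_on {0..pi}"
    by (rule absolutely_integrable_prod_continuous[OF bb fa cG])
  have P2: "(\<lambda>x. prod (F x) (g x)) absolutely_integrable_on {0..pi}"
    by (rule absolutely_integrable_continuous_prod[OF bb cF ga])
  have Pa: "P absolutely_integrable_on {0..pi}"
    unfolding P_def using P1 P2 by (rule set_integral_add)
  have PW: "has_W11_derivative (\<lambda>x. integral {0..x} P) P"
    using Pa by (simp add: has_W11_derivative_def)
  have V: "(\<lambda>x. norm (f x) + norm (g x)) absolutely_integrable_on {0..pi}"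
    using absolutely_integrable_norm[OF fa] absolutely_integrable_norm[OF ga] 
    by (auto simp: o_def intro: set_integral_add)
  have VW: "has_W11_derivative (\<lambda>x. integral {0..x} (\<lambda>x. norm (f x) + norm (g x))) (\<lambda>x. norm (f x) + norm (g x))"
    using V by (simp add: has_W11_derivative_def)
  define H where "H x = prod (F x) (G x) - integral {0..x} P" for x
  obtain K where K: "K > 0" "\<And>a b. norm (prod a b) \<le> norm a * norm b * K"
    using pos_bounded by auto
  have "norm (H x - H 0) \<le> e" if x: "x \<in> {0..pi}" and "e > 0" for x e
  proof -
    define I where "I = integral {0..x} (\<lambda>x. norm (f x) + norm (g x))"
    have I0: "I \<ge> 0" unfolding I_def by (rule integral_nonneg) (use has_W11_derivative_nth(2)[OF VW, of 0 x] x in auto)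
    \<comment> \<open>The product of K, \<epsilon> and I must stay below \<open>e\<close>; I + 1
      instead of I avoids a division by zero.\<close>
    define \<epsilon> where "\<epsilon> = e / ((I + 1) * K)"
    have "\<epsilon> > 0" using I0 K \<open>e > 0\<close> by (simp add: \<epsilon>_def)
    obtain d1 where d1: "d1 > 0" "\<And>x y. x \<in> {0..pi} \<Longrightarrow> y \<in> {0..pi} \<Longrightarrow> dist y x < d1 \<Longrightarrow> dist (F y) (F x) < \<epsilon>"
      using compact_uniformly_continuous[OF cF] \<open>\<epsilon> > 0\<close> unfolding uniformly_continuous_on_def by (meson compact_Icc)
    obtain d2 where d2: "d2 > 0" "\<And>x y. x \<in> {0..pi} \<Longrightarrow> y \<in> {0..pi} \<Longrightarrow> dist y x < d2 \<Longrightarrow> dist (G y) (G x) < \<epsilon>"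
      using compact_uniformly_continuous[OF cG] \<open>\<epsilon> > 0\<close> unfolding uniformly_continuous_on_def by (meson compact_Icc)
    define d where "d = min d1 d2 / 2"
    have "d > 0" using d1 d2 by (simp add: d_def)
    have "norm (H x - H 0) \<le> K * \<epsilon> * integral {0..x} (\<lambda>x. norm (f x) + norm (g x))
       - K * \<epsilon> * integral {0..0} (\<lambda>x. norm (f x) + norm (g x))"
    proof (rule local_increment_bound[where \<delta>=d and b=pi and V="\<lambda>x. K * \<epsilon> * integral {0..x} (\<lambda>x. norm (f x) + norm (g x))"])
      fix x y assume xy: "0 \<le> y" "y \<le> x" "x \<le> pi" "x - y \<le> d"
      have fi: "f integrable_on {y..x}" and gi: "g integrable_on {y..x}"
        using has_W11_derivative_nth(2)[OF F xy(1-3)] has_W11_derivative_nth(2)[OF G xy(1-3)] by auto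
      have Pi: "P integrable_on {y..x}" using has_W11_derivative_nth(2)[OF PW xy(1-3)] by auto
      have "prod (F x - F y) (G x) = integral {y..x} (\<lambda>s. prod (f s) (G x))"
        using integral_linear[OF fi bounded_linear_left[of "G x"]] has_W11_derivative_nth(1)[OF F xy(1-3)]
        by (simp add: o_def)
      moreover have "prod (F y) (G x - G y) = integral {y..x} (\<lambda>s. prod (F y) (g s))"
        using integral_linear[OF gi bounded_linear_right[of "F y"]] has_W11_derivative_nth(1)[OF G xy(1-3)]
        by (simp add: o_def)
      moreover have i1: "(\<lambda>s. prod (f s) (G x)) integrable_on {y..x}"
        using integrable_linear[OF fi bounded_linear_left[of "G x"]] by (simp add: o_def)
      moreover have i2: "(\<lambda>s. prod (F y) (g s)) integrable_on {y..x}"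
        using integrable_linear[OF gi bounded_linear_right[of "F y"]] by (simp add: o_def)
      moreover have "H x - H y = prod (F x - F y) (G x) + prod (F y) (G x - G y) - integral {y..x} P"
        using has_W11_derivative_nth(1)[OF PW xy(1-3)] by (simp add: H_def diff_left diff_right)
      ultimately have "H x - H y = integral {y..x} (\<lambda>s. prod (f s) (G x) + prod (F y) (g s) - P s)"
        using Pi by (simp add: Henstock_Kurzweil_Integration.integral_add Henstock_Kurzweil_Integration.integral_diff integrable_add)
      also have "norm \<dots> \<le> integral {y..x} (\<lambda>s. K * \<epsilon> * (norm (f s) + norm (g s)))"
      proof (rule integral_norm_bound_integral)
        show "(\<lambda>s. prod (f s) (G x) + prod (F y) (g s) - P s) integrable_on {y..x}"
          using i1 i2 Pi by (intro integrable_add integrable_diff)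
        show "(\<lambda>s. K * \<epsilon> * (norm (f s) + norm (g s))) integrable_on {y..x}"
          using has_W11_derivative_nth(2)[OF VW xy(1-3)] by (rule integrable_on_mult_right)
        fix s assume s: "s \<in> {y..x}"
        have "norm (F s - F y) \<le> \<epsilon>"
          using d1(2)[of y s] s xy \<open>d > 0\<close> d1(1) d2(1) by (auto simp: dist_norm d_def min_def split: if_splits)
        then have "norm (prod (F s - F y) (g s)) \<le> \<epsilon> * norm (g s) * K"
          by (rule order_trans[OF K(2), OF mult_right_mono[OF mult_right_mono]]) (use K in auto)
        moreover have "norm (G x - G s) \<le> \<epsilon>"
          using d2(2)[of s x] s xy \<open>d > 0\<close> d1(1) d2(1) by (auto simp: dist_norm d_def min_def split: if_splits)
        then have "norm (prod (f s) (G x - G s)) \<le> norm (f s) * \<epsilon> * K"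
          by (rule order_trans[OF K(2), OF mult_right_mono[OF mult_left_mono]]) (use K in auto) 
        moreover have "prod (f s) (G x) + prod (F y) (g s) - P s = prod (f s) (G x - G s) - prod (F s - F y) (g s)"
          by (simp add: P_def diff_left diff_right)
        ultimately show "norm (prod (f s) (G x) + prod (F y) (g s) - P s) \<le> K * \<epsilon> * (norm (f s) + norm (g s))"
          by (smt (verit, best) norm_triangle_ineq4 distrib_left mult.commute mult.left_commute)
      qed
      also have "\<dots> = K * \<epsilon> * integral {0..x} (\<lambda>x. norm (f x) + norm (g x)) - K * \<epsilon> * integral {0..y} (\<lambda>x. norm (f x) + norm (g x))"
        using has_W11_derivative_nth(1)[OF VW xy(1-3)] by (simp add: right_diff_distrib)
      finally show "norm (H x - H y) \<le> \<dots>" .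
    qed (use x \<open>d > 0\<close> in auto)
    also have "\<dots> = e * (I / (I + 1))" using K(1) I0 by (simp add: \<epsilon>_def I_def[symmetric])
    also have "\<dots> \<le> e" using I0 \<open>e > 0\<close> by (simp add: field_simps)
    finally show ?thesis .
  qed
  have H0: "norm (H x - H 0) \<le> 0" if "x \<in> {0..pi}" for x
  proof (rule field_le_epsilon)
    fix e :: real assume "0 < e"
    then have "norm (H x - H 0) \<le> e" by (rule \<open>\<And>x e. x \<in> {0..pi} \<Longrightarrow> 0 < e \<Longrightarrow> norm (H x - H 0) \<le> e\<close>[OF that])
    then show "norm (H x - H 0) \<le> 0 + e" by simp
  qed
  have H: "H x = H 0" if "x \<in> {0..pi}" for x using H0[OF that] by simp
  have "prod (F x) (G x) = prod (F 0) (G 0) + integral {0..x} P" if "x \<in> {0..pi}" for x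
    using H[OF that] by (simp add: H_def diff_eq_eq)
  then have "has_W11_derivative (\<lambda>x. prod (F x) (G x)) P"
    by (rule has_W11_derivativeI[OF Pa])
  then show ?thesis by (simp add: P_def[abs_def])
qed

lemma has_W11_derivative_of_continuous:
  assumes "\<And>x. x \<in> {0..pi} \<Longrightarrow> (f has_vector_derivative g x) (at x within {0..pi})"
    and "continuous_on {0..pi} g"
  shows "has_W11_derivative f g"
proof -
  have "integral {0..x} g = f x - f 0" if "x \<in> {0..pi}" for x
  proof (rule integral_unique, rule fundamental_theorem_of_calculus)
    show "(f has_vector_derivative g y) (at y within {0..x})" if "y \<in> {0..x}" for y
      by (rule has_vector_derivative_within_subset[OF assms(1)]) (use that \<open>x \<in> _\<close> in auto)
  qed (use that in auto)
  then show ?thesis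
    using absolutely_integrable_continuous_real[OF assms(2)] by (simp add: has_W11_derivative_def)
qed

lemma has_W11_derivative_add:
  assumes "has_W11_derivative f f'" "has_W11_derivative g g'"
  shows "has_W11_derivative (\<lambda>x. f x + g x) (\<lambda>x. f' x + g' x)"
proof (rule has_W11_derivativeI)
  show "(\<lambda>x. f' x + g' x) absolutely_integrable_on {0..pi}"
    by (rule set_integral_add(1)) (use assms has_W11_derivativeD(1) in blast)+
  fix x assume x: "x \<in> {0..pi}"
  have "integral {0..x} (\<lambda>x. f' x + g' x) = integral {0..x} f' + integral {0..x} g'"
    by (rule Henstock_Kurzweil_Integration.integral_add)
       (use has_W11_derivative_nth(2)[OF assms(1), of 0 x] has_W11_derivative_nth(2)[OF assms(2), of 0 x] x in auto)
  then show "f x + g x = f 0 + g 0 + integral {0..x} (\<lambda>x. f' x + g' x)"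
    using has_W11_derivativeD(2)[OF assms(1) x] has_W11_derivativeD(2)[OF assms(2) x] by simp
qed

lemma has_W11_derivative_linear:
  assumes "has_W11_derivative f f'" "bounded_linear h"
  shows "has_W11_derivative (\<lambda>x. h (f x)) (\<lambda>x. h (f' x))"
proof (rule has_W11_derivativeI)
  interpret bounded_linear h by fact
  show "(\<lambda>x. h (f' x)) absolutely_integrable_on {0..pi}"
    using absolutely_integrable_linear[OF has_W11_derivativeD(1)[OF assms(1)] assms(2)]
    by (simp add: o_def)
  fix x assume x: "x \<in> {0..pi}"
  have "integral {0..x} (\<lambda>x. h (f' x)) = h (integral {0..x} f')"
    using integral_linear[OF has_W11_derivative_nth(2)[OF assms(1), of 0 x] assms(2)] x by (simp add: o_def)
  then show "h (f x) = h (f 0) + integral {0..x} (\<lambda>x. h (f' x))"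
    using has_W11_derivativeD(2)[OF assms(1) x] by (simp add: add)
qed

lemma has_W11_derivative_diff:
  assumes "has_W11_derivative f f'" "has_W11_derivative g g'"
  shows "has_W11_derivative (\<lambda>x. f x - g x) (\<lambda>x. f' x - g' x)"
  using has_W11_derivative_add[OF assms(1) has_W11_derivative_linear[OF assms(2) bounded_linear_minus[OF bounded_linear_ident]]]
  by simp

lemma has_W11_derivative_cong:
  assumes "has_W11_derivative f f'" "\<And>x. x \<in> {0..pi} \<Longrightarrow> f x = g x" 
    "\<And>x. x \<in> {0..pi} \<Longrightarrow> f' x = g' x"
  shows "has_W11_derivative g g'"
proof -
  have "integral {0..x} f' = integral {0..x} g'" if "x \<in> {0..pi}" for x
    by (rule Henstock_Kurzweil_Integration.integral_cong) (use that assms in auto)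
  moreover have "g' absolutely_integrable_on {0..pi}"
    by (rule absolutely_integrable_spike[OF has_W11_derivativeD(1)[OF assms(1)], where S="{}"])
       (use assms(3) in auto)
  moreover have "g x = g 0 + integral {0..x} f'" if "x \<in> {0..pi}" for x
    using has_W11_derivativeD(2)[OF assms(1) that] assms(2)[OF that] assms(2)[of 0] by simp
  ultimately show ?thesis
    by (intro has_W11_derivativeI) metis+
qed

text \<open>Chain rule for powers of an absolutely continuous function, by induction from the
  product rule. It is the source of the factorials both in Gronwall's inequality and in the Picard
  series.\<close>

lemma integral_antiderivative_power:
  fixes q :: "real \<Rightarrow> real"
  assumes q: "q absolutely_integrable_on {0..pi}"
  defines "Q \<equiv> \<lambda>x. integral {0..x} q"
  assumes x: "x \<in> {0..pi}"
  shows "(\<lambda>t. q t * Q t ^ n) integrable_on {0..x}"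
    and "integral {0..x} (\<lambda>t. q t * Q t ^ n) = Q x ^ Suc n / real (Suc n)"
proof -
  have Q: "has_W11_derivative Q q"
    by (rule has_W11_derivativeI) (simp_all add: q Q_def)
  have *: "has_W11_derivative (\<lambda>x. Q x ^ Suc n) (\<lambda>x. real (Suc n) * (q x * Q x ^ n))" for n
  proof (induction n)
    case 0
    then show ?case using Q by simp
  next
    case (Suc n)
    show ?case
      using has_W11_derivative_prod[OF bounded_bilinear_mult Q Suc]
      by (rule has_W11_derivative_cong) (simp_all add: algebra_simps)
  qed
  have "has_W11_derivative (\<lambda>x. inverse (real (Suc n)) * Q x ^ Suc n) (\<lambda>x. inverse (real (Suc n)) * (real (Suc n) * (q x * Q x ^ n)))"
    by (rule has_W11_derivative_linear[OF *]) (rule bounded_linear_mult_right)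
  then have **: "has_W11_derivative (\<lambda>x. inverse (real (Suc n)) * Q x ^ Suc n) (\<lambda>x. q x * Q x ^ n)"
    by (rule has_W11_derivative_cong) simp_all
  show "(\<lambda>t. q t * Q t ^ n) integrable_on {0..x}"
    using has_W11_derivative_nth(2)[OF **, of 0 x] x by auto
  have "Q 0 = 0" by (simp add: Q_def)
  then show "integral {0..x} (\<lambda>t. q t * Q t ^ n) = Q x ^ Suc n / real (Suc n)"
    using has_W11_derivative_nth(1)[OF **, of 0 x] x by (simp add: field_simps)
qed

text \<open>The integral inequality is inserted into itself n times: the bound becomes c times a
  partial sum of the exponential series plus the remainder B Q^n / n!, and then n tends to infinity.
  No pointwise derivative of Q is involved, so an integrable \<open>q\<close> is admissible.\<close>

lemma gronwall:
  fixes q v :: "real \<Rightarrow> real"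
  assumes q: "q absolutely_integrable_on {0..pi}" "\<And>x. x \<in> {0..pi} \<Longrightarrow> 0 \<le> q x"
    and v: "continuous_on {0..pi} v" "\<And>x. x \<in> {0..pi} \<Longrightarrow> v x \<le> c + integral {0..x} (\<lambda>t. q t * v t)"
    and x: "x \<in> {0..pi}"
  shows "v x \<le> c * exp (integral {0..x} q)"
proof -
  define Q where "Q x = integral {0..x} q" for x
  have qi: "q integrable_on {0..x}" if "x \<in> {0..pi}" for x
    using integral_antiderivative_power(1)[OF q(1) that, of 0] by simp
  have Q0: "Q x \<ge> 0" if "x \<in> {0..pi}" for x
    unfolding Q_def using that q(2) by (intro integral_nonneg qi) auto
  have "bounded (v ` {0..pi})" by (intro compact_imp_bounded compact_continuous_image v) auto
  \<comment> \<open>Any bound of |v| starts the iteration; it disappears in the limit.\<close>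
  then obtain B where B: "\<And>x. x \<in> {0..pi} \<Longrightarrow> \<bar>v x\<bar> \<le> B" 
    unfolding bounded_iff by (metis imageI real_norm_def)
  have qv: "(\<lambda>t. q t * v t) integrable_on {0..x}" if "x \<in> {0..pi}" for x
  proof -
    have "(\<lambda>t. q t * v t) absolutely_integrable_on {0..pi}"
      by (rule absolutely_integrable_prod_continuous[OF bounded_bilinear_mult q(1) v(1)])
    then have "(\<lambda>t. q t * v t) integrable_on {0..pi}"
      by (rule set_lebesgue_integral_eq_integral(1))
    then show ?thesis
      by (rule integrable_on_subinterval) (use that in auto)
  qed
  have *: "\<forall>x\<in>{0..pi}. v x \<le> c * (\<Sum>k<n. Q x ^ k / fact k) + B * (Q x ^ n / fact n)" for n
  proof (induction n)
    case 0
    then show ?case using B by force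
  next
    case (Suc n)
    show ?case
    proof
      fix x assume x: "x \<in> {0..pi}"
      define w where "w t = c * (\<Sum>k<n. (q t * Q t ^ k) / fact k) + B * ((q t * Q t ^ n) / fact n)" for t
      note pw = integral_antiderivative_power[OF q(1) x, folded Q_def]
      have wI: "(w has_integral (c * (\<Sum>k<n. (Q x ^ Suc k / real (Suc k)) / fact k) + B * ((Q x ^ Suc n / real (Suc n)) / fact n))) {0..x}"
        unfolding w_def
        by (intro has_integral_add has_integral_mult_right has_integral_sum has_integral_divide)
           (use pw in \<open>auto simp: has_integral_iff simp del: power_Suc of_nat_Suc\<close>)
      have "integral {0..x} (\<lambda>t. q t * v t) \<le> integral {0..x} w"
      proof (rule integral_le)
        fix t assume t: "t \<in> {0..x}"
        then have "q t * v t \<le> q t * (c * (\<Sum>k<n. Q t ^ k / fact k) + B * (Q t ^ n / fact n))"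
          using Suc x q(2)[of t] by (intro mult_left_mono) auto
        also have "\<dots> = w t" by (simp add: w_def sum_distrib_left algebra_simps)
        finally show "q t * v t \<le> w t" .
      qed (use qv[OF x] wI in auto)
      also have "\<dots> = c * (\<Sum>k<n. (Q x ^ Suc k / fact (Suc k))) + B * (Q x ^ Suc n / fact (Suc n))"
        using wI by (simp add: integral_unique field_simps)
      finally have "v x \<le> c + c * (\<Sum>k<n. (Q x ^ Suc k / fact (Suc k))) + B * (Q x ^ Suc n / fact (Suc n))"
        using v(2)[OF x] by simp
      also have "\<dots> = c * (\<Sum>k<Suc n. (Q x ^ k / fact k)) + B * (Q x ^ Suc n / fact (Suc n))"
        unfolding sum.lessThan_Suc_shift by (simp add: algebra_simps)
      finally show "v x \<le> c * (\<Sum>k<Suc n. (Q x ^ k / fact k)) + B * (Q x ^ Suc n / fact (Suc n))" .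
    qed
  qed
  have sums: "(\<lambda>n. Q x ^ n / fact n) sums exp (Q x)"
    using exp_converges[of "Q x"] by (simp add: divide_inverse mult.commute)
  have "(\<lambda>n. \<Sum>k<n. Q x ^ k / fact k) \<longlonglongrightarrow> exp (Q x)" "(\<lambda>n. Q x ^ n / fact n) \<longlonglongrightarrow> 0"
    using sums[unfolded sums_def] summable_LIMSEQ_zero[OF sums_summable[OF sums]] by simp_all
  then have "(\<lambda>n. c * (\<Sum>k<n. Q x ^ k / fact k) + B * (Q x ^ n / fact n)) \<longlonglongrightarrow> c * exp (Q x) + B * 0"
    by (rule tendsto_add[OF tendsto_mult_left tendsto_mult_left])
  then have "v x \<le> c * exp (Q x) + B * 0"
    by (rule LIMSEQ_le_const) (rule exI[of _ 0], intro allI impI, rule bspec[OF * x])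
  then show ?thesis by (simp add: Q_def)
qed

section \<open>The initial value problem\<close>

definition coef :: "'m::finite pencil \<Rightarrow> complex \<Rightarrow> real \<Rightarrow> complex^'m^'m" where
  "coef L \<rho> x = mat (\<rho>\<^sup>2) + mat (2 * \<i> * \<rho>) ** Q1 L x + Q0 L x"

text \<open>The derivative is carried along as \<open>Z\<close>, and the second derivative is the
  right hand side itself. This absorbs the almost everywhere equation of \<open>solves\<close>,
  because a W_1^1 derivative is determined only up to null sets; \<open>solves_iff_sol\<close> makes
  the passage.\<close>

definition sol :: "'m::finite pencil \<Rightarrow> complex \<Rightarrow> (real \<Rightarrow> complex^'k^'m) \<Rightarrow> (real \<Rightarrow> complex^'k^'m) \<Rightarrow> bool" where
  "sol L \<rho> Y Z \<longleftrightarrow> (\<forall>x\<in>{0..pi}. (Y has_vector_derivative Z x) (at x within {0..pi})) \<and>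
     has_W11_derivative Z (\<lambda>x. - (coef L \<rho> x ** Y x))"

lemma deriv_I_eq:
  assumes "(Y has_vector_derivative Z) (at x within {0..pi})" "x \<in> {0..pi}"
  shows "deriv_I Y x = Z"
  unfolding deriv_I_def
  using assms by (intro vector_derivative_within_cbox[of 0 pi, unfolded cbox_interval]) auto

lemma sol_deriv_I:
  assumes "sol L \<rho> Y Z" "x \<in> {0..pi}"
  shows "deriv_I Y x = Z x"
  using assms by (intro deriv_I_eq) (auto simp: sol_def)

lemma sol_continuous:
  assumes "sol L \<rho> Y Z"
  shows "continuous_on {0..pi} Y" "continuous_on {0..pi} Z"
proof -
  show "continuous_on {0..pi} Y"
    using assms has_vector_derivative_continuous 
    unfolding sol_def continuous_on_eq_continuous_within by blast
  show "continuous_on {0..pi} Z"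
    using assms has_W11_derivative_continuous unfolding sol_def by blast
qed

lemma AE_negligible:
  assumes "AE x in lebesgue_on {0..pi}. P x"
  shows "negligible {x\<in>{0..pi}. \<not> P x}"
proof -
  have "AE x in lebesgue. x \<in> {0..pi} \<longrightarrow> P x"
    using assms by (subst (asm) AE_restrict_space_iff) auto
  then obtain N where N: "N \<in> null_sets lebesgue" "{x. \<not> (x \<in> {0..pi} \<longrightarrow> P x)} \<subseteq> N"
    unfolding eventually_ae_filter by auto
  then have "negligible N" by (simp add: negligible_iff_null_sets)
  then show ?thesis by (rule negligible_subset) (use N in auto)
qed

lemma has_W11_derivative_spike:
  assumes "has_W11_derivative f g" "negligible N" "\<And>x. x \<in> {0..pi} - N \<Longrightarrow> g x = g' x"
  shows "has_W11_derivative f g'"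
proof (rule has_W11_derivativeI)
  show "g' absolutely_integrable_on {0..pi}"
    by (rule absolutely_integrable_spike[OF has_W11_derivativeD(1)[OF assms(1)] assms(2)])
       (use assms(3) in force)
  fix x :: real assume x: "x \<in> {0..pi}"
  have "integral {0..x} g = integral {0..x} g'"
    by (rule integral_spike[OF assms(2)]) (use assms(3) x in force)
  then show "f x = f 0 + integral {0..x} g'"
    using has_W11_derivativeD(2)[OF assms(1) x] by simp
qed

lemma solves_iff_sol: "solves L \<rho> Y \<longleftrightarrow> sol L \<rho> Y (deriv_I Y)"
proof
  assume s: "solves L \<rho> Y"
  then obtain Y2 where Y2: "has_W11_derivative (deriv_I Y) Y2"
    and ae: "AE x in lebesgue_on {0..pi}. Y2 x + coef L \<rho> x ** Y x = 0"
    unfolding solves_def coef_def by blast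
  have "has_W11_derivative (deriv_I Y) (\<lambda>x. - (coef L \<rho> x ** Y x))"
    by (rule has_W11_derivative_spike[OF Y2 AE_negligible[OF ae]]) (auto simp: add_eq_0_iff2)
  moreover have "(Y has_vector_derivative deriv_I Y x) (at x within {0..pi})" if "x \<in> {0..pi}" for x
    using s that unfolding solves_def deriv_I_def vector_derivative_works[symmetric] by blast
  ultimately show "sol L \<rho> Y (deriv_I Y)" by (auto simp: sol_def)
next
  assume s: "sol L \<rho> Y (deriv_I Y)"
  then show "solves L \<rho> Y"
    unfolding solves_def sol_def coef_def[symmetric]
    by (intro conjI exI[of _ "\<lambda>x. - (coef L \<rho> x ** Y x)"])
       (auto simp: has_vector_derivative_def intro: differentiableI)
qed

lemma sol_imp_solves:
  assumes "sol L \<rho> Y Z"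
  shows "solves L \<rho> Y"
proof -
  have "has_W11_derivative (deriv_I Y) (\<lambda>x. - (coef L \<rho> x ** Y x))"
    by (rule has_W11_derivative_cong[of Z "\<lambda>x. - (coef L \<rho> x ** Y x)"])
      (use assms sol_deriv_I[OF assms] in \<open>auto simp: sol_def\<close>)
  then show ?thesis
    using assms sol_deriv_I[OF assms] unfolding solves_iff_sol by (simp add: sol_def)
qed

lemma has_vector_derivative_matrix_mult_right:
  fixes A :: "complex^'j^'k" and Y :: "real \<Rightarrow> complex^'k^'m"
  assumes "(Y has_vector_derivative Z) F"
  shows "((\<lambda>x. Y x ** A) has_vector_derivative Z ** A) F"
  by (rule bounded_linear.has_vector_derivative[OF matrix_mult.bounded_linear_left assms])

lemma sol_mult:
  fixes Y :: "real \<Rightarrow> complex^'k^'m::finite" and A :: "complex^'j^'k"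
  assumes "sol L \<rho> Y Z"
  shows "sol L \<rho> (\<lambda>x. Y x ** A) (\<lambda>x. Z x ** A)"
  unfolding sol_def
proof (intro conjI ballI)
  fix x assume "x \<in> {0..pi}"
  then show "((\<lambda>x. Y x ** A) has_vector_derivative Z x ** A) (at x within {0..pi})"
    using assms by (intro has_vector_derivative_matrix_mult_right) (auto simp: sol_def)
next
  have "has_W11_derivative Z (\<lambda>x. - (coef L \<rho> x ** Y x))" using assms by (simp add: sol_def)
  from has_W11_derivative_linear[OF this matrix_mult.bounded_linear_left, of A]
  show "has_W11_derivative (\<lambda>x. Z x ** A) (\<lambda>x. - (coef L \<rho> x ** (Y x ** A)))"
    by (simp add: matrix_mult.minus_left matrix_mul_assoc)
qed

lemma sol_add:
  fixes Y :: "real \<Rightarrow> complex^'k^'m::finite"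
  assumes "sol L \<rho> Y Z" "sol L \<rho> Y' Z'"
  shows "sol L \<rho> (\<lambda>x. Y x + Y' x) (\<lambda>x. Z x + Z' x)"
  unfolding sol_def
proof (intro conjI ballI)
  fix x assume "x \<in> {0..pi}"
  then show "((\<lambda>x. Y x + Y' x) has_vector_derivative Z x + Z' x) (at x within {0..pi})"
    using assms by (intro has_vector_derivative_add) (auto simp: sol_def)
next
  have "has_W11_derivative Z (\<lambda>x. - (coef L \<rho> x ** Y x))" 
    "has_W11_derivative Z' (\<lambda>x. - (coef L \<rho> x ** Y' x))" using assms by (simp_all add: sol_def)
  from has_W11_derivative_add[OF this]
  show "has_W11_derivative (\<lambda>x. Z x + Z' x) (\<lambda>x. - (coef L \<rho> x ** (Y x + Y' x)))"
    by (simp add: matrix_mult.add_right)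
qed

lemma sol_diff:
  fixes Y :: "real \<Rightarrow> complex^'k^'m::finite"
  assumes "sol L \<rho> Y Z" "sol L \<rho> Y' Z'"
  shows "sol L \<rho> (\<lambda>x. Y x - Y' x) (\<lambda>x. Z x - Z' x)"
proof -
  have "sol L \<rho> (\<lambda>x. Y x + Y' x ** (- mat 1)) (\<lambda>x. Z x + Z' x ** (- mat 1))"
    by (intro sol_add sol_mult assms)
  then show ?thesis by (simp add: matrix_mult.minus_right)
qed

lemma sol_W11:
  assumes "sol L \<rho> Y Z"
  shows "has_W11_derivative Y Z" "has_W11_derivative Z (\<lambda>x. - (coef L \<rho> x ** Y x))"
proof -
  show "has_W11_derivative Y Z"
    by (rule has_W11_derivative_of_continuous[OF _ sol_continuous(2)[OF assms]])
      (use assms in \<open>simp add: sol_def\<close>)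
  show "has_W11_derivative Z (\<lambda>x. - (coef L \<rho> x ** Y x))" using assms by (simp add: sol_def)
qed

section \<open>The Volterra integral equation and its bounds\<close>

locale regular_pencil =
  fixes L :: "'m::finite pencil"
  assumes Q1_cont: "continuous_on {0..pi} (Q1 L)"
    and Q0_L1: "Q0 L absolutely_integrable_on {0..pi}"
begin

lemma coef_L1: "coef L \<rho> absolutely_integrable_on {0..pi}"
proof -
  have "(\<lambda>x. mat (\<rho>\<^sup>2) + mat (2 * \<i> * \<rho>) ** Q1 L x) absolutely_integrable_on {0..pi}"
    by (intro absolutely_integrable_continuous_real continuous_intros matrix_mult.continuous_on Q1_cont)
  from set_integral_add(1)[OF this Q0_L1] show ?thesis by (simp add: coef_def[abs_def])
qed

lemma coef_mult_L1:
  fixes f :: "real \<Rightarrow> complex^'k^'m"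
  assumes "continuous_on {0..pi} f"
  shows "(\<lambda>x. coef L \<rho> x ** f x) absolutely_integrable_on {0..pi}"
  by (rule absolutely_integrable_prod_continuous[OF bounded_bilinear_matrix_mult coef_L1 assms])

text \<open>Integrable majorant of the coefficient, uniform in the disc |\<rho>| \<le> R; this
  uniformity is what makes the Picard series converge locally uniformly in \<rho>.\<close>

definition kap :: "real \<Rightarrow> real \<Rightarrow> real" where
  "kap R x = R\<^sup>2 * norm (mat 1 :: complex^'m^'m) + 2 * R * norm (Q1 L x) + norm (Q0 L x)"

lemma norm_mat: "norm (mat c :: complex^'m^'m) = cmod c * norm (mat 1 :: complex^'m^'m)"
proof -
  have "norm (mat c ** mat 1 :: complex^'m^'m) = cmod c * norm (mat 1 :: complex^'m^'m)"
    by (rule norm_mat_mult)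
  then show ?thesis by simp
qed

lemma kap: 
  assumes "cmod \<rho> \<le> R"
  shows "norm (coef L \<rho> x) \<le> kap R x" and "0 \<le> kap R x"
proof -
  have R: "0 \<le> R" using assms norm_ge_zero order_trans by blast
  show "0 \<le> kap R x" unfolding kap_def using R by simp
  have "norm (coef L \<rho> x) \<le> norm (mat (\<rho>\<^sup>2) :: complex^'m^'m) + norm (mat (2 * \<i> * \<rho>) ** Q1 L x) + norm (Q0 L x)"
    unfolding coef_def by norm
  also have "norm (mat (\<rho>\<^sup>2) :: complex^'m^'m) = (cmod \<rho>)\<^sup>2 * norm (mat 1 :: complex^'m^'m)"
    unfolding norm_mat[of "\<rho>\<^sup>2"] by (simp add: norm_power)
  also have "\<dots> \<le> R\<^sup>2 * norm (mat 1 :: complex^'m^'m)"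
    using assms by (intro mult_right_mono power_mono) auto
  also have "norm (mat (2 * \<i> * \<rho>) ** Q1 L x) = 2 * cmod \<rho> * norm (Q1 L x)"
    by (simp add: norm_mult)
  also have "\<dots> \<le> 2 * R * norm (Q1 L x)"
    using assms by (intro mult_right_mono) auto
  finally show "norm (coef L \<rho> x) \<le> kap R x" by (simp add: kap_def)
qed

lemma kap_L1: "kap R absolutely_integrable_on {0..pi}"
proof -
  have "(\<lambda>x. R\<^sup>2 * norm (mat 1 :: complex^'m^'m) + 2 * R * norm (Q1 L x)) absolutely_integrable_on {0..pi}"
    by (intro absolutely_integrable_continuous_real continuous_intros Q1_cont)
  from set_integral_add(1)[OF this absolutely_integrable_norm[OF Q0_L1]] show ?thesis
    by (simp add: kap_def[abs_def] o_def)
qed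

lemma kap_integrable: "x \<in> {0..pi} \<Longrightarrow> kap R integrable_on {0..x}"
  using integral_antiderivative_power(1)[OF kap_L1, where n=0 and x=x] by simp

definition K :: "real \<Rightarrow> real \<Rightarrow> real" where "K R x = integral {0..x} (kap R)"

lemma K_mono: 
  assumes "0 \<le> R" "0 \<le> x" "x \<le> y" "y \<le> pi"
  shows "K R x \<le> K R y"
  unfolding K_def
  by (rule integral_subset_le) (use assms kap(2)[of 0 R] kap_integrable in auto)

lemma K_nonneg: "0 \<le> R \<Longrightarrow> 0 \<le> x \<Longrightarrow> x \<le> pi \<Longrightarrow> 0 \<le> K R x"
  using K_mono[of R 0 x] by (simp add: K_def)

lemma integrable_subset_0: "(g :: real \<Rightarrow> 'e::euclidean_space) absolutely_integrable_on {0..pi} \<Longrightarrow> x \<in> {0..pi} \<Longrightarrow> g integrable_on {0..x}"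
  by (rule integrable_on_subinterval[OF set_lebesgue_integral_eq_integral(1)]) auto

text \<open>The double integral \<open>T\<close> is split because the inner integral is, up to sign
  and the initial slope, the derivative of the solution; holomorphy of that derivative in \<rho> is
  later read off from it.\<close>

definition inner_int :: "complex \<Rightarrow> (real \<Rightarrow> complex^'k^'m) \<Rightarrow> real \<Rightarrow> complex^'k^'m" where
  "inner_int \<rho> f s = integral {0..s} (\<lambda>t. coef L \<rho> t ** f t)"

definition T :: "complex \<Rightarrow> (real \<Rightarrow> complex^'k^'m) \<Rightarrow> real \<Rightarrow> complex^'k^'m" where
  "T \<rho> f x = - integral {0..x} (inner_int \<rho> f)"

lemma inner_int_cont:
  assumes "continuous_on {0..pi} f"
  shows "continuous_on {0..pi} (inner_int \<rho> f)"
  unfolding inner_int_def[abs_def]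
  by (intro indefinite_integral_continuous_1 set_lebesgue_integral_eq_integral(1) coef_mult_L1 assms)

lemma inner_int_add:
  assumes "continuous_on {0..pi} f" "continuous_on {0..pi} g" "x \<in> {0..pi}"
  shows "inner_int \<rho> (\<lambda>x. f x + g x) x = inner_int \<rho> f x + inner_int \<rho> g x"
  unfolding inner_int_def matrix_mult.add_right
  by (intro Henstock_Kurzweil_Integration.integral_add integrable_subset_0 coef_mult_L1 assms)

lemma integrable_cont_0: "continuous_on {0..pi} (g :: real \<Rightarrow> 'e::euclidean_space) \<Longrightarrow> x \<in> {0..pi} \<Longrightarrow> g integrable_on {0..x}"
  by (rule integrable_continuous_real) (auto elim: continuous_on_subset)

lemma T_add:
  assumes "continuous_on {0..pi} f" "continuous_on {0..pi} g" "x \<in> {0..pi}"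
  shows "T \<rho> (\<lambda>x. f x + g x) x = T \<rho> f x + T \<rho> g x"
proof -
  have "integral {0..x} (inner_int \<rho> (\<lambda>x. f x + g x)) = integral {0..x} (\<lambda>s. inner_int \<rho> f s + inner_int \<rho> g s)"
    by (rule Henstock_Kurzweil_Integration.integral_cong) (use assms in \<open>auto intro!: inner_int_add\<close>)
  also have "\<dots> = integral {0..x} (inner_int \<rho> f) + integral {0..x} (inner_int \<rho> g)"
    by (intro Henstock_Kurzweil_Integration.integral_add integrable_cont_0 inner_int_cont assms)
  finally show ?thesis by (simp add: T_def)
qed

lemma inner_int_bound:
  assumes "continuous_on {0..pi} f" "x \<in> {0..pi}" "cmod \<rho> \<le> R" "0 \<le> B"
    and f: "\<And>t. t \<in> {0..pi} \<Longrightarrow> norm (f t) \<le> B * K R t ^ n"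
  shows "norm (inner_int \<rho> f x) \<le> B * K R x ^ Suc n / real (Suc n)"
proof -
  note pw = integral_antiderivative_power[OF kap_L1[of R] assms(2), where n=n, folded K_def]
  have "norm (inner_int \<rho> f x) \<le> integral {0..x} (\<lambda>t. B * (kap R t * K R t ^ n))"
    unfolding inner_int_def
  proof (rule integral_norm_bound_integral)
    show "(\<lambda>t. coef L \<rho> t ** f t) integrable_on {0..x}"
      by (intro integrable_subset_0 coef_mult_L1 assms)
    show "(\<lambda>t. B * (kap R t * K R t ^ n)) integrable_on {0..x}"
      using pw(1) by (rule integrable_on_mult_right)
    fix t assume t: "t \<in> {0..x}"
    have "norm (coef L \<rho> t ** f t) \<le> norm (coef L \<rho> t) * norm (f t)" by (rule norm_matrix_mult_le)
    also have "\<dots> \<le> kap R t * (B * K R t ^ n)"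
      using t assms(2) by (intro mult_mono kap[OF assms(3)] f) auto
    finally show "norm (coef L \<rho> t ** f t) \<le> B * (kap R t * K R t ^ n)" by (simp add: mult_ac)
  qed
  also have "\<dots> = B * K R x ^ Suc n / real (Suc n)" using pw(2) by simp
  finally show ?thesis .
qed

text \<open>The inner integration raises the power of \<open>K\<close> and supplies 1/(n+1); the
  outer one is estimated crudely by the length \<pi> of the interval. Iterated, this gives the
  factor \<pi>^n K^n / n! of \<open>picard_bound\<close>.\<close>

lemma T_bound:
  assumes "continuous_on {0..pi} f" "x \<in> {0..pi}" "cmod \<rho> \<le> R" "0 \<le> B"
    and f: "\<And>t. t \<in> {0..pi} \<Longrightarrow> norm (f t) \<le> B * K R t ^ n"
  shows "norm (T \<rho> f x) \<le> pi * B * K R x ^ Suc n / real (Suc n)"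
proof -
  have R: "0 \<le> R" using assms(3) norm_ge_zero order_trans by blast
  have "norm (integral {0..x} (inner_int \<rho> f)) \<le> (B * K R x ^ Suc n / real (Suc n)) * (x - 0)"
  proof (rule integral_bound)
    show "continuous_on {0..x} (inner_int \<rho> f)"
      by (rule continuous_on_subset[OF inner_int_cont[OF assms(1)]]) (use assms in auto)
    fix s assume s: "s \<in> {0..x}"
    have "norm (inner_int \<rho> f s) \<le> B * K R s ^ Suc n / real (Suc n)"
      by (rule inner_int_bound) (use s assms in auto)
    also have "\<dots> \<le> B * K R x ^ Suc n / real (Suc n)"
      using s assms(2,4) R by (intro divide_right_mono mult_left_mono power_mono K_mono K_nonneg) auto
    finally show "norm (inner_int \<rho> f s) \<le> B * K R x ^ Suc n / real (Suc n)" .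
  qed (use assms in auto)
  also have "\<dots> \<le> (B * K R x ^ Suc n / real (Suc n)) * pi"
    using assms R by (intro mult_left_mono) (auto intro!: divide_nonneg_nonneg mult_nonneg_nonneg zero_le_power K_nonneg simp del: power_Suc)
  finally show ?thesis by (simp add: T_def mult_ac)
qed

end

text \<open>Polynomials in \<open>\<rho>\<close> with continuous coefficients. The Picard iterates are of this form, hence entire in \<open>\<rho>\<close>.\<close>

inductive polyfam :: "(complex \<Rightarrow> real \<Rightarrow> complex^'k^'m) \<Rightarrow> bool" where
  mono: "continuous_on {0..pi} c \<Longrightarrow> polyfam (\<lambda>\<rho> x. mat (\<rho> ^ k) ** c x)"
| add: "polyfam f \<Longrightarrow> polyfam g \<Longrightarrow> polyfam (\<lambda>\<rho> x. f \<rho> x + g \<rho> x)"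
| cong: "polyfam f \<Longrightarrow> (\<And>\<rho> x. x \<in> {0..pi} \<Longrightarrow> g \<rho> x = f \<rho> x) \<Longrightarrow> polyfam g"

lemma polyfam_continuous: "polyfam f \<Longrightarrow> continuous_on {0..pi} (f \<rho>)"
proof (induction rule: polyfam.induct)
  case (cong f g)
  then show ?case by (metis (no_types, lifting) continuous_on_cong)
qed (auto intro!: continuous_intros matrix_mult.continuous_on)

lemma polyfam_holomorphic: "polyfam f \<Longrightarrow> x \<in> {0..pi} \<Longrightarrow> (\<lambda>\<rho>. f \<rho> x $ i $ j) holomorphic_on UNIV"
proof (induction rule: polyfam.induct)
  case (cong f g)
  have "(\<lambda>\<rho>. g \<rho> x $ i $ j) = (\<lambda>\<rho>. f \<rho> x $ i $ j)" using cong.hyps(2)[OF cong.prems] by simp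
  then show ?case using cong by simp
qed (auto intro!: holomorphic_intros)

context regular_pencil
begin

section \<open>Polynomial dependence of the iterates on \<rho>\<close>

lemma integral_mat_mult:
  fixes f :: "real \<Rightarrow> complex^'m^'m"
  assumes "f integrable_on S"
  shows "integral S (\<lambda>x. mat z ** f x) = mat z ** integral S f" "(\<lambda>x. mat z ** f x) integrable_on S"
  using integral_linear[OF assms matrix_mult.bounded_linear_right[of "mat z"]]
    integrable_linear[OF assms matrix_mult.bounded_linear_right[of "mat z"]] by (simp_all add: o_def)

text \<open>The coefficient is quadratic in \<rho>, so a monomial of degree k produces the degrees k
  to k + 2. The product with \<open>Q0\<close> is only integrable, but its indefinite integral is
  continuous again, and so the class \<open>polyfam\<close> stays closed.\<close>

lemma inner_int_monomial:
  fixes c :: "real \<Rightarrow> complex^'m^'m"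
  assumes c: "continuous_on {0..pi} c" and s: "s \<in> {0..pi}"
  shows "inner_int \<rho> (\<lambda>x. mat (\<rho> ^ k) ** c x) s =
     mat (\<rho> ^ (k + 2)) ** integral {0..s} c
   + (mat (\<rho> ^ (k + 1)) ** integral {0..s} (\<lambda>t. mat (2 * \<i>) ** (Q1 L t ** c t))
   + mat (\<rho> ^ k) ** integral {0..s} (\<lambda>t. Q0 L t ** c t))"
proof -
  have c1: "continuous_on {0..pi} (\<lambda>t. mat (2 * \<i>) ** (Q1 L t ** c t))"
    by (intro matrix_mult.continuous_on continuous_intros Q1_cont c)
  have c2: "(\<lambda>t. Q0 L t ** c t) absolutely_integrable_on {0..pi}"
    by (rule absolutely_integrable_prod_continuous[OF bounded_bilinear_matrix_mult Q0_L1 c])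
  have i0: "c integrable_on {0..s}" by (rule integrable_cont_0[OF c s])
  have i1: "(\<lambda>t. mat (2 * \<i>) ** (Q1 L t ** c t)) integrable_on {0..s}" by (rule integrable_cont_0[OF c1 s])
  have i2: "(\<lambda>t. Q0 L t ** c t) integrable_on {0..s}" by (rule integrable_subset_0[OF c2 s])
  have "coef L \<rho> t ** (mat (\<rho> ^ k) ** c t) = mat (\<rho> ^ (k+2)) ** c t
       + (mat (\<rho> ^ (k+1)) ** (mat (2 * \<i>) ** (Q1 L t ** c t)) + mat (\<rho> ^ k) ** (Q0 L t ** c t))" for t
  proof -
    have "mat (2 * \<i> * \<rho>) ** Q1 L t ** (mat (\<rho> ^ k) ** c t) = mat (2 * \<i> * \<rho>) ** (mat (\<rho> ^ k) ** (Q1 L t ** c t))"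
      by (simp only: matrix_mul_assoc[symmetric] mult_mat_mult[of "Q1 L t" "\<rho> ^ k"])
    moreover have "mat (\<rho>\<^sup>2) ** (mat (\<rho> ^ k) ** c t) = mat (\<rho> ^ (k+2)) ** c t"
      by (simp add: power_add power2_eq_square mult_ac)
    moreover have "Q0 L t ** (mat (\<rho> ^ k) ** c t) = mat (\<rho> ^ k) ** (Q0 L t ** c t)" by (rule mult_mat_mult)
    ultimately show ?thesis by (simp add: coef_def matrix_mult.add_left mult_ac)
  qed
  then have "inner_int \<rho> (\<lambda>x. mat (\<rho> ^ k) ** c x) s = integral {0..s} (\<lambda>t. mat (\<rho> ^ (k+2)) ** c t
       + (mat (\<rho> ^ (k+1)) ** (mat (2 * \<i>) ** (Q1 L t ** c t)) + mat (\<rho> ^ k) ** (Q0 L t ** c t)))"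
    unfolding inner_int_def by presburger
  also have "\<dots> = integral {0..s} (\<lambda>t. mat (\<rho> ^ (k+2)) ** c t)
       + (integral {0..s} (\<lambda>t. mat (\<rho> ^ (k+1)) ** (mat (2 * \<i>) ** (Q1 L t ** c t)))
        + integral {0..s} (\<lambda>t. mat (\<rho> ^ k) ** (Q0 L t ** c t)))"
    unfolding Henstock_Kurzweil_Integration.integral_add[OF integral_mat_mult(2)[OF i0]
        integrable_add[OF integral_mat_mult(2)[OF i1] integral_mat_mult(2)[OF i2]]]
      Henstock_Kurzweil_Integration.integral_add[OF integral_mat_mult(2)[OF i1] integral_mat_mult(2)[OF i2]] ..
  finally show ?thesis unfolding integral_mat_mult(1)[OF i0] integral_mat_mult(1)[OF i1] integral_mat_mult(1)[OF i2] .
qed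

lemma polyfam_inner_int:
  fixes f :: "complex \<Rightarrow> real \<Rightarrow> complex^'m^'m"
  shows "polyfam f \<Longrightarrow> polyfam (\<lambda>\<rho>. inner_int \<rho> (f \<rho>))"
proof (induction rule: polyfam.induct)
  case (mono c k)
  have c1: "continuous_on {0..pi} (\<lambda>t. mat (2 * \<i>) ** (Q1 L t ** c t))"
    by (intro matrix_mult.continuous_on continuous_intros Q1_cont mono)
  have c2: "(\<lambda>t. Q0 L t ** c t) absolutely_integrable_on {0..pi}"
    by (rule absolutely_integrable_prod_continuous[OF bounded_bilinear_matrix_mult Q0_L1 mono])
  show ?case
    by (rule polyfam.cong[OF _ inner_int_monomial[OF mono]])
       (intro polyfam.add polyfam.mono indefinite_integral_continuous_1 set_lebesgue_integral_eq_integral(1)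
          absolutely_integrable_continuous_real mono c1 c2)
next
  case (add f g)
  then show ?case
    by (intro polyfam.cong[OF polyfam.add[OF add.IH] inner_int_add] polyfam_continuous)
next
  case (cong f g)
  have "inner_int \<rho> (g \<rho>) s = inner_int \<rho> (f \<rho>) s" if "s \<in> {0..pi}" for \<rho> s
    unfolding inner_int_def by (rule Henstock_Kurzweil_Integration.integral_cong) (use that cong.hyps(2) in auto)
  then show ?case by (intro polyfam.cong[OF cong.IH])
qed

lemma polyfam_integral:
  fixes f :: "complex \<Rightarrow> real \<Rightarrow> complex^'m^'m"
  shows "polyfam f \<Longrightarrow> polyfam (\<lambda>\<rho> x. - integral {0..x} (f \<rho>))"
proof (induction rule: polyfam.induct)
  case (mono c k)
  have "polyfam (\<lambda>\<rho> x. mat (\<rho> ^ k) ** (- integral {0..x} c))"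
    by (intro polyfam.mono continuous_intros indefinite_integral_continuous_1 integrable_continuous_real mono)
  then show ?case
    by (rule polyfam.cong) (simp add: integral_mat_mult(1)[OF integrable_cont_0[OF mono]] matrix_mult.minus_right)
next
  case (add f g)
  have "integral {0..x} (\<lambda>t. f \<rho> t + g \<rho> t) = integral {0..x} (f \<rho>) + integral {0..x} (g \<rho>)" if "x \<in> {0..pi}" for \<rho> x
    by (intro Henstock_Kurzweil_Integration.integral_add integrable_cont_0[OF _ that] polyfam_continuous add.hyps)
  then show ?case
    by (intro polyfam.cong[OF polyfam.add[OF add.IH]]) simp
next
  case (cong f g)
  have "integral {0..x} (g \<rho>) = integral {0..x} (f \<rho>)" if "x \<in> {0..pi}" for \<rho> x
    by (rule Henstock_Kurzweil_Integration.integral_cong) (use that cong.hyps(2) in auto)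
  then show ?case by (intro polyfam.cong[OF cong.IH]) simp
qed

lemma polyfam_T:
  fixes f :: "complex \<Rightarrow> real \<Rightarrow> complex^'m^'m"
  shows "polyfam f \<Longrightarrow> polyfam (\<lambda>\<rho>. T \<rho> (f \<rho>))"
  unfolding T_def[abs_def] by (intro polyfam_integral polyfam_inner_int)

text \<open>These are the terms of the Neumann series, not its partial sums: the n-th one is the
  n-th power of \<open>T\<close> applied to a + x b. The solution with initial values a and b is
  their sum \<open>psum\<close>.\<close>

fun picard :: "complex^'m^'m \<Rightarrow> complex^'m^'m \<Rightarrow> nat \<Rightarrow> complex \<Rightarrow> real \<Rightarrow> complex^'m^'m" where
  "picard a b 0 \<rho> x = a + x *\<^sub>R b"
| "picard a b (Suc n) \<rho> x = T \<rho> (picard a b n \<rho>) x"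

lemma polyfam_picard: "polyfam (picard a b n)"
proof (induction n)
  case 0
  have "polyfam (\<lambda>\<rho> x. mat (\<rho> ^ 0) ** (a + x *\<^sub>R b))"
    by (intro polyfam.mono continuous_intros)
  then show ?case by (rule polyfam.cong) simp
next
  case (Suc n)
  show ?case by (rule polyfam.cong[OF polyfam_T[OF Suc]]) simp
qed

lemma picard_continuous: "continuous_on {0..pi} (picard a b n \<rho>)"
  by (rule polyfam_continuous[OF polyfam_picard])

lemma picard_bound:
  assumes "cmod \<rho> \<le> R" "x \<in> {0..pi}"
  shows "norm (picard a b n \<rho> x) \<le> (norm a + pi * norm b) * pi ^ n / fact n * K R x ^ n"
  using assms(2)
proof (induction n arbitrary: x)
  case 0
  have "norm (a + x *\<^sub>R b) \<le> norm a + \<bar>x\<bar> * norm b" by (metis norm_triangle_ineq norm_scaleR)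
  also have "\<dots> \<le> norm a + pi * norm b" using 0 by (intro add_left_mono mult_right_mono) auto
  finally show ?case by simp
next
  case (Suc n)
  have "norm (T \<rho> (picard a b n \<rho>) x) \<le> pi * ((norm a + pi * norm b) * pi ^ n / fact n) * K R x ^ Suc n / real (Suc n)"
    by (rule T_bound[OF picard_continuous]) (use Suc assms in auto)
  then show ?case by (simp add: field_simps)
qed

section \<open>The sum of the Neumann series\<close>

definition psum where "psum a b \<rho> x = (\<Sum>n. picard a b n \<rho> x)"

text \<open>Uniformity in \<rho> and x together, obtained from a summable majorant, serves
  continuity in x, holomorphy in \<rho> and later joint continuity alike.\<close>

lemma psum_uniform:
  assumes "0 \<le> R"
  shows "uniform_limit (cball 0 R \<times> {0..pi}) (\<lambda>N (\<rho>, x). \<Sum>n<N. picard a b n \<rho> x) (\<lambda>(\<rho>, x). psum a b \<rho> x) sequentially"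
proof -
  have "uniform_limit (cball 0 R \<times> {0..pi}) (\<lambda>N p. \<Sum>n<N. picard a b n (fst p) (snd p)) (\<lambda>p. \<Sum>n. picard a b n (fst p) (snd p)) sequentially"
  proof (rule Weierstrass_m_test)
    show "summable (\<lambda>n. (norm a + pi * norm b) * (inverse (fact n) * (pi * K R pi) ^ n))"
      by (intro summable_mult summable_exp)
    fix n and p :: "complex \<times> real" assume p: "p \<in> cball 0 R \<times> {0..pi}"
    have "norm (picard a b n (fst p) (snd p)) \<le> (norm a + pi * norm b) * pi ^ n / fact n * K R (snd p) ^ n"
      by (rule picard_bound) (use p in auto)
    also have "\<dots> \<le> (norm a + pi * norm b) * pi ^ n / fact n * K R pi ^ n"
      using p assms by (intro mult_left_mono power_mono K_mono K_nonneg) auto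
    also have "\<dots> = (norm a + pi * norm b) * (inverse (fact n) * (pi * K R pi) ^ n)"
      by (simp add: power_mult_distrib field_simps)
    finally show "norm (picard a b n (fst p) (snd p)) \<le> \<dots>" .
  qed
  then show ?thesis unfolding psum_def case_prod_beta .
qed

lemma psum_continuous: "continuous_on {0..pi} (psum a b \<rho>)"
proof (rule uniform_limit_theorem)
  show "uniform_limit {0..pi} (\<lambda>N x. \<Sum>n<N. picard a b n \<rho> x) (psum a b \<rho>) sequentially"
    unfolding uniform_limit_iff
  proof (intro allI impI)
    fix e :: real assume e: "e > 0"
    have "\<forall>\<^sub>F N in sequentially. \<forall>p\<in>cball 0 (cmod \<rho>) \<times> {0..pi}.
       dist (case p of (\<rho>, x) \<Rightarrow> \<Sum>n<N. picard a b n \<rho> x) (case p of (\<rho>, x) \<Rightarrow> psum a b \<rho> x) < e"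
      using psum_uniform[of "cmod \<rho>" a b] e unfolding uniform_limit_iff by simp
    then show "\<forall>\<^sub>F N in sequentially. \<forall>x\<in>{0..pi}. dist (\<Sum>n<N. picard a b n \<rho> x) (psum a b \<rho> x) < e"
      by (rule eventually_mono) auto
  qed
  show "\<forall>\<^sub>F n in sequentially. continuous_on {0..pi} (\<lambda>x. \<Sum>i<n. picard a b i \<rho> x)"
    by (intro always_eventually allI continuous_intros picard_continuous)
qed simp

lemma psum_uniform_ball:
  assumes "e > 0"
  shows "\<forall>\<^sub>F N in sequentially. \<forall>\<rho>\<in>cball z 1. \<forall>x\<in>{0..pi}. norm (psum a b \<rho> x - (\<Sum>n<N. picard a b n \<rho> x)) < e"
proof -
  have "0 \<le> cmod z + 1" by simp
  have sub: "cmod \<rho> \<le> cmod z + 1" if "\<rho> \<in> cball z 1" for \<rho>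
    using that norm_triangle_sub[of \<rho> z] by (simp add: dist_norm norm_minus_commute)
  have "\<forall>\<^sub>F N in sequentially. \<forall>p\<in>cball 0 (cmod z + 1) \<times> {0..pi}.
     dist (case p of (\<rho>, x) \<Rightarrow> \<Sum>n<N. picard a b n \<rho> x) (case p of (\<rho>, x) \<Rightarrow> psum a b \<rho> x) < e"
    using psum_uniform[OF \<open>0 \<le> cmod z + 1\<close>, of a b] \<open>e > 0\<close> unfolding uniform_limit_iff by blast
  then show ?thesis
    by (rule eventually_mono) (use sub in \<open>auto simp: dist_norm norm_minus_commute\<close>)
qed

lemma holomorphic_matrix_uniform_limit:
  fixes G :: "complex \<Rightarrow> complex^'k^'n" and F :: "nat \<Rightarrow> complex \<Rightarrow> complex^'k^'n"
  assumes "\<And>N i j. (\<lambda>\<rho>. F N \<rho> $ i $ j) holomorphic_on UNIV"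
    and lim: "\<And>z e. e > 0 \<Longrightarrow> \<forall>\<^sub>F N in sequentially. \<forall>\<rho>\<in>cball z 1. norm (G \<rho> - F N \<rho>) < e"
  shows "(\<lambda>\<rho>. G \<rho> $ i $ j) holomorphic_on UNIV"
proof (rule holomorphic_uniform_sequence)
  show "(\<lambda>\<rho>. F N \<rho> $ i $ j) holomorphic_on UNIV" for N by fact
  fix z :: complex
  have "uniform_limit (cball z 1) (\<lambda>N \<rho>. F N \<rho> $ i $ j) (\<lambda>\<rho>. G \<rho> $ i $ j) sequentially"
    unfolding uniform_limit_iff
  proof (intro allI impI)
    fix e :: real assume "e > 0"
    show "\<forall>\<^sub>F N in sequentially. \<forall>\<rho>\<in>cball z 1. dist (F N \<rho> $ i $ j) (G \<rho> $ i $ j) < e"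
    proof (rule eventually_mono[OF lim[OF \<open>e > 0\<close>]], intro ballI)
      fix N \<rho>
      assume "\<forall>\<rho>\<in>cball z 1. norm (G \<rho> - F N \<rho>) < e" "\<rho> \<in> cball z 1"
      then have "dist (F N \<rho>) (G \<rho>) < e" by (simp add: dist_norm norm_minus_commute)
      then show "dist (F N \<rho> $ i $ j) (G \<rho> $ i $ j) < e"
        by (meson dist_vec_nth_le order_le_less_trans)
    qed
  qed
  then show "\<exists>d>0. cball z d \<subseteq> UNIV \<and> uniform_limit (cball z d) (\<lambda>N \<rho>. F N \<rho> $ i $ j) (\<lambda>\<rho>. G \<rho> $ i $ j) sequentially"
    by (intro exI[of _ 1]) auto
qed simp

lemma polyfam_sum: "(\<And>n. polyfam (f n)) \<Longrightarrow> polyfam (\<lambda>\<rho> x. \<Sum>n<N::nat. f n \<rho> x)"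
proof (induction N)
  case 0
  have "polyfam (\<lambda>\<rho> x. mat (\<rho> ^ 0) ** 0)" by (intro polyfam.mono continuous_intros)
  then show ?case by simp
next
  case (Suc N)
  then show ?case by (simp add: polyfam.add)
qed

lemma psum_holomorphic:
  assumes x: "x \<in> {0..pi}"
  shows "(\<lambda>\<rho>. psum a b \<rho> x $ i $ j) holomorphic_on UNIV"
proof (rule holomorphic_matrix_uniform_limit)
  show "(\<lambda>\<rho>. (\<Sum>n<N. picard a b n \<rho> x) $ i $ j) holomorphic_on UNIV" for N i j
    by (intro polyfam_holomorphic[OF _ x] polyfam_sum polyfam_picard)
  show "\<forall>\<^sub>F N in sequentially. \<forall>\<rho>\<in>cball z 1. norm (psum a b \<rho> x - (\<Sum>n<N. picard a b n \<rho> x)) < e" if "e > 0" for z e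
    by (rule eventually_mono[OF psum_uniform_ball[OF that, of z a b]]) (use x in auto)
qed

lemma picard_partial_sum:
  assumes "x \<in> {0..pi}"
  shows "(\<Sum>n<Suc N. picard a b n \<rho> x) = a + x *\<^sub>R b + T \<rho> (\<lambda>x. \<Sum>n<N. picard a b n \<rho> x) x"
proof (induction N)
  case 0
  have "T \<rho> (\<lambda>x. 0 :: complex^'m^'m) x = 0" by (simp add: T_def inner_int_def[abs_def])
  then show ?case by simp
next
  case (Suc N)
  have "T \<rho> (\<lambda>x. (\<Sum>n<N. picard a b n \<rho> x) + picard a b N \<rho> x) x
     = T \<rho> (\<lambda>x. \<Sum>n<N. picard a b n \<rho> x) x + T \<rho> (picard a b N \<rho>) x"
    by (rule T_add) (intro continuous_intros picard_continuous assms)+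
  then show ?case using Suc by simp
qed

text \<open>With \<open>D\<close> the remainder after N terms, the recursion for the partial sums
  leaves exactly \<open>D (Suc N) x - T \<rho> (D N) x\<close> as the defect of the equation. The
  remainder is uniformly small and \<open>T\<close> is bounded, so the defect is zero.\<close>

lemma psum_fixed_point:
  assumes x: "x \<in> {0..pi}"
  shows "psum a b \<rho> x = a + x *\<^sub>R b + T \<rho> (psum a b \<rho>) x"
proof -
  define R where "R = cmod \<rho>"
  define D where "D N x = psum a b \<rho> x - (\<Sum>n<N. picard a b n \<rho> x)" for N x
  have D_cont: "continuous_on {0..pi} (D N)" for N
    unfolding D_def by (intro continuous_intros picard_continuous psum_continuous)
  have "norm (psum a b \<rho> x - (a + x *\<^sub>R b + T \<rho> (psum a b \<rho>) x)) \<le> 0 + e" if "e > 0" for e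
  proof -
    \<comment> \<open>A remainder of size d contributes d directly and \<pi> K d through
      \<open>T\<close>; the constant adds the two.\<close>
    define c where "c = 1 + pi * K R pi"
    have c: "c > 0" unfolding c_def R_def by (intro add_pos_nonneg mult_nonneg_nonneg K_nonneg) auto
    define d where "d = e / c"
    have "d > 0" using c that by (simp add: d_def)
    have "\<forall>\<^sub>F N in sequentially. \<forall>x\<in>{0..pi}. norm (D N x) \<le> d"
      using psum_uniform[of R a b, unfolded uniform_limit_iff, rule_format, OF _ \<open>d > 0\<close>]
      by (rule eventually_mono) (auto simp: R_def D_def dist_norm norm_minus_commute intro!: less_imp_le)
    then obtain N where N: "\<And>M x. M \<ge> N \<Longrightarrow> x \<in> {0..pi} \<Longrightarrow> norm (D M x) \<le> d"
      unfolding eventually_sequentially by blast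
    have "T \<rho> (psum a b \<rho>) x = T \<rho> (\<lambda>x. (\<Sum>n<N. picard a b n \<rho> x) + D N x) x"
      by (simp add: D_def)
    also have "\<dots> = T \<rho> (\<lambda>x. (\<Sum>n<N. picard a b n \<rho> x)) x + T \<rho> (D N) x"
      by (rule T_add) (intro continuous_intros picard_continuous D_cont x)+
    finally have "psum a b \<rho> x - (a + x *\<^sub>R b + T \<rho> (psum a b \<rho>) x) = D (Suc N) x - T \<rho> (D N) x"
      using picard_partial_sum[OF x, where N=N and a=a and b=b and \<rho>=\<rho>] unfolding D_def by simp
    then have "norm (psum a b \<rho> x - (a + x *\<^sub>R b + T \<rho> (psum a b \<rho>) x)) \<le> norm (D (Suc N) x) + norm (T \<rho> (D N) x)"
      by (simp add: norm_triangle_ineq4)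
    moreover have "norm (D (Suc N) x) \<le> d" by (rule N) (use x in auto)
    moreover have "norm (T \<rho> (D N) x) \<le> pi * d * K R x ^ Suc 0 / real (Suc 0)"
      by (rule T_bound[OF D_cont x]) (use N[of N] \<open>d > 0\<close> in \<open>auto simp: R_def\<close>)
    moreover have "pi * d * K R x ^ Suc 0 / real (Suc 0) \<le> pi * d * K R pi"
      using x \<open>d > 0\<close> K_mono[of R x pi] by (auto simp: R_def intro!: mult_left_mono)
    moreover have "d + pi * d * K R pi = d * c" by (simp add: c_def field_simps)
    moreover have "d * c = e" using c by (simp add: d_def)
    ultimately show ?thesis by linarith
  qed
  then have "norm (psum a b \<rho> x - (a + x *\<^sub>R b + T \<rho> (psum a b \<rho>) x)) \<le> 0"
    by (rule field_le_epsilon)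
  then show ?thesis by simp
qed

definition psum_deriv where "psum_deriv a b \<rho> x = b - inner_int \<rho> (psum a b \<rho>) x"

lemma psum_sol: "sol L \<rho> (psum a b \<rho>) (psum_deriv a b \<rho>)"
  unfolding sol_def
proof (intro conjI ballI)
  note inner_int_cont[OF psum_continuous, of \<rho> a b \<rho>]
  fix x assume x: "x \<in> {0..pi}"
  have "((\<lambda>x. a + x *\<^sub>R b + T \<rho> (psum a b \<rho>) x) has_vector_derivative 0 + 1 *\<^sub>R b + - inner_int \<rho> (psum a b \<rho>) x) (at x within {0..pi})"
    unfolding T_def
    by (intro has_vector_derivative_add has_vector_derivative_minus has_vector_derivative_const
         has_vector_derivative_scaleR[where g="\<lambda>_. b" and g'=0, simplified] integral_has_vector_derivative inner_int_cont psum_continuous x)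
       (auto intro!: derivative_eq_intros)
  then have "((\<lambda>x. a + x *\<^sub>R b + T \<rho> (psum a b \<rho>) x) has_vector_derivative psum_deriv a b \<rho> x) (at x within {0..pi})"
    by (simp add: psum_deriv_def)
  then show "(psum a b \<rho> has_vector_derivative psum_deriv a b \<rho> x) (at x within {0..pi})"
    by (rule has_vector_derivative_transform[rotated 2]) (use x psum_fixed_point[where a=a and b=b and \<rho>=\<rho>] in auto)
next
  have "(\<lambda>x. - (coef L \<rho> x ** psum a b \<rho> x)) absolutely_integrable_on {0..pi}"
    using absolutely_integrable_linear[OF coef_mult_L1[OF psum_continuous] bounded_linear_minus[OF bounded_linear_ident]]
    by (simp add: o_def)
  then show "has_W11_derivative (psum_deriv a b \<rho>) (\<lambda>x. - (coef L \<rho> x ** psum a b \<rho> x))"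
    by (rule has_W11_derivativeI) (simp add: psum_deriv_def inner_int_def)
qed

lemma psum_0: "psum a b \<rho> 0 = a" "psum_deriv a b \<rho> 0 = b"
  using psum_fixed_point[of 0 a b \<rho>] by (simp_all add: T_def psum_deriv_def inner_int_def)

text \<open>Gronwall's inequality for |Y| + |Z| with constant 0 and the integrable weight 1 +
  \<open>kap\<close>.\<close>

lemma sol_unique_0:
  fixes Y :: "real \<Rightarrow> complex^'k^'m"
  assumes s: "sol L \<rho> Y Z" and "Y 0 = 0" "Z 0 = 0" and x: "x \<in> {0..pi}"
  shows "Y x = 0" "Z x = 0"
proof -
  define R where "R = cmod \<rho>"
  define v where "v x = norm (Y x) + norm (Z x)" for x
  note W = sol_W11[OF s] and c = sol_continuous[OF s]
  have q: "(\<lambda>x. 1 + kap R x) absolutely_integrable_on {0..pi}"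
    by (rule set_integral_add(1)[OF absolutely_integrable_continuous_real kap_L1]) (intro continuous_intros)
  have "v x \<le> 0 * exp (integral {0..x} (\<lambda>x. 1 + kap R x))"
  proof (rule gronwall[OF q])
    show "continuous_on {0..pi} v" unfolding v_def by (intro continuous_intros c)
    show "0 \<le> 1 + kap R x" for x using kap(2)[of \<rho> R x] by (simp add: R_def)
    fix x assume x: "x \<in> {0..pi}"
    have i1: "(\<lambda>t. norm (Z t)) integrable_on {0..x}"
      by (rule integrable_cont_0[OF _ x]) (intro continuous_intros c)
    have i2: "(\<lambda>t. kap R t * norm (Y t)) integrable_on {0..x}"
      by (rule integrable_subset_0[OF absolutely_integrable_prod_continuous[OF bounded_bilinear_mult kap_L1] x])
         (intro continuous_intros c)
    have i3: "(\<lambda>t. (1 + kap R t) * v t) integrable_on {0..x}"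
      by (rule integrable_subset_0[OF absolutely_integrable_prod_continuous[OF bounded_bilinear_mult q] x])
         (unfold v_def, intro continuous_intros c)
    have "norm (Y x) = norm (integral {0..x} Z)"
      using has_W11_derivativeD(2)[OF W(1) x] assms by simp
    also have "\<dots> \<le> integral {0..x} (\<lambda>t. norm (Z t))"
      by (rule integral_norm_bound_integral[OF integrable_cont_0[OF c(2) x] i1]) simp
    finally have 1: "norm (Y x) \<le> integral {0..x} (\<lambda>t. norm (Z t))" .
    have "norm (Z x) = norm (integral {0..x} (\<lambda>x. - (coef L \<rho> x ** Y x)))"
      using has_W11_derivativeD(2)[OF W(2) x] assms by simp
    also have "\<dots> \<le> integral {0..x} (\<lambda>t. kap R t * norm (Y t))"
    proof (rule integral_norm_bound_integral[OF integrable_subset_0[OF has_W11_derivativeD(1)[OF W(2)] x] i2])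
      fix t
      have "norm (coef L \<rho> t ** Y t) \<le> norm (coef L \<rho> t) * norm (Y t)" by (rule norm_matrix_mult_le)
      also have "\<dots> \<le> kap R t * norm (Y t)" by (intro mult_right_mono kap) (auto simp: R_def)
      finally show "norm (- (coef L \<rho> t ** Y t)) \<le> kap R t * norm (Y t)" by simp
    qed
    finally have 2: "norm (Z x) \<le> integral {0..x} (\<lambda>t. kap R t * norm (Y t))" .
    have "v x \<le> integral {0..x} (\<lambda>t. norm (Z t) + kap R t * norm (Y t))"
      using 1 2 Henstock_Kurzweil_Integration.integral_add[OF i1 i2] by (simp add: v_def)
    also have "\<dots> \<le> integral {0..x} (\<lambda>t. (1 + kap R t) * v t)"
    proof (rule integral_le[OF integrable_add[OF i1 i2] i3])
      fix t
      have "0 \<le> kap R t" by (rule kap(2)[of \<rho>]) (simp add: R_def)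
      then show "norm (Z t) + kap R t * norm (Y t) \<le> (1 + kap R t) * v t"
        by (simp add: v_def algebra_simps)
    qed
    finally show "v x \<le> 0 + integral {0..x} (\<lambda>t. (1 + kap R t) * v t)" by simp
  qed (rule x)
  then have "v x \<le> 0" by simp
  then have "norm (Y x) + norm (Z x) \<le> 0" unfolding v_def .
  then have "norm (Y x) = 0" "norm (Z x) = 0"
    using norm_ge_zero[of "Y x"] norm_ge_zero[of "Z x"] by linarith+
  then show "Y x = 0" "Z x = 0" by simp_all
qed

lemma sol_unique:
  fixes Y :: "real \<Rightarrow> complex^'k^'m"
  assumes "sol L \<rho> Y Z" "sol L \<rho> Y' Z'" "Y 0 = Y' 0" "Z 0 = Z' 0" "x \<in> {0..pi}"
  shows "Y x = Y' x" "Z x = Z' x"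
  using sol_unique_0[OF sol_diff[OF assms(1,2)] _ _ assms(5)] assms by simp_all

text \<open>The limit is taken under the integral sign: \<open>inner_int\<close> of the partial sums
  is polynomial in \<rho> and converges uniformly on unit discs, so nothing has to be differentiated
  in x.\<close>

lemma psum_deriv_holomorphic:
  assumes x: "x \<in> {0..pi}"
  shows "(\<lambda>\<rho>. psum_deriv a b \<rho> x $ i $ j) holomorphic_on UNIV"
proof -
  have "(\<lambda>\<rho>. inner_int \<rho> (psum a b \<rho>) x $ i $ j) holomorphic_on UNIV"
  proof (rule holomorphic_matrix_uniform_limit)
    show "(\<lambda>\<rho>. inner_int \<rho> (\<lambda>x. \<Sum>n<N. picard a b n \<rho> x) x $ i $ j) holomorphic_on UNIV" for N i j
      by (intro polyfam_holomorphic[OF _ x] polyfam_inner_int polyfam_sum polyfam_picard)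
    fix z e assume e: "(e::real) > 0"
    define R where "R = cmod z + 1"
    have c: "K R pi + 1 > 0" unfolding R_def by (intro add_nonneg_pos K_nonneg) auto
    define d where "d = e / (K R pi + 1)"
    have d: "d > 0" using c e by (simp add: d_def)
    show "\<forall>\<^sub>F N in sequentially. \<forall>\<rho>\<in>cball z 1. norm (inner_int \<rho> (psum a b \<rho>) x - inner_int \<rho> (\<lambda>x. \<Sum>n<N. picard a b n \<rho> x) x) < e"
    proof (rule eventually_mono[OF psum_uniform_ball[OF d, of z a b]], intro ballI)
      fix N \<rho> assume N: "\<forall>\<rho>\<in>cball z 1. \<forall>x\<in>{0..pi}. norm (psum a b \<rho> x - (\<Sum>n<N. picard a b n \<rho> x)) < d"
        and \<rho>: "\<rho> \<in> cball z 1"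
      have R: "cmod \<rho> \<le> R"
        using \<rho> norm_triangle_sub[of \<rho> z] by (simp add: dist_norm norm_minus_commute R_def)
      define D where "D x = psum a b \<rho> x - (\<Sum>n<N. picard a b n \<rho> x)" for x
      have D: "continuous_on {0..pi} D" unfolding D_def
        by (intro continuous_intros psum_continuous picard_continuous)
      have "inner_int \<rho> (\<lambda>x. (\<Sum>n<N. picard a b n \<rho> x) + D x) x = inner_int \<rho> (\<lambda>x. \<Sum>n<N. picard a b n \<rho> x) x + inner_int \<rho> D x"
        by (intro inner_int_add D continuous_intros picard_continuous x)
      then have "norm (inner_int \<rho> (psum a b \<rho>) x - inner_int \<rho> (\<lambda>x. \<Sum>n<N. picard a b n \<rho> x) x) = norm (inner_int \<rho> D x)"
        by (simp add: D_def)
      also have "\<dots> \<le> d * K R x ^ Suc 0 / real (Suc 0)"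
        by (rule inner_int_bound[OF D x R]) (use N \<rho> d in \<open>auto simp: D_def intro!: less_imp_le\<close>)
      also have "\<dots> \<le> d * K R pi"
        using x d K_mono[of R x pi] by (auto simp: R_def intro!: mult_left_mono)
      also have "\<dots> < d * (K R pi + 1)" using d by simp
      also have "\<dots> = e" using c by (simp add: d_def)
      finally show "norm (inner_int \<rho> (psum a b \<rho>) x - inner_int \<rho> (\<lambda>x. \<Sum>n<N. picard a b n \<rho> x) x) < e" .
    qed
  qed
  then show ?thesis unfolding psum_deriv_def by (auto intro!: holomorphic_intros)
qed

end

section \<open>Asymptotics of solutions\<close>

text \<open>The vector space structure of the type is real, and a complex scalar acts only through
  \<open>mat c\<close>. A separate bilinear operation lets rewriting move scalars to the front of
  products; the rules are collected in \<open>matrix_ring_simps\<close>.\<close>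

definition scm :: "complex \<Rightarrow> complex^'k^'m \<Rightarrow> complex^'k^'m" (infixr "*\<^sub>C" 75) where
  "c *\<^sub>C A = (\<chi> i j. c * A $ i $ j)"

lemma scm_nth [simp]: "(c *\<^sub>C A) $ i $ j = c * A $ i $ j"
  by (simp add: scm_def)

lemma mat_mult_scm: "mat c ** A = c *\<^sub>C A"
  by (simp add: vec_eq_iff)

lemma mult_mat_scm: "A ** mat c = c *\<^sub>C A"
  by (simp add: vec_eq_iff mat_commute)

lemma scm_scm: "a *\<^sub>C b *\<^sub>C A = (a * b) *\<^sub>C A"
  by (simp add: vec_eq_iff)

lemma scm_mult_left: "(c *\<^sub>C A) ** B = c *\<^sub>C (A ** B)"
  by (simp add: mat_mult_scm[symmetric] matrix_mul_assoc)

lemma scm_mult_right: "A ** (c *\<^sub>C B) = c *\<^sub>C (A ** B)"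
  by (simp add: mat_mult_scm[symmetric] mult_mat_mult)

lemma scm_one [simp]: "1 *\<^sub>C A = A"
  by (simp add: vec_eq_iff)

lemma norm_scm [simp]: "norm (c *\<^sub>C A) = cmod c * norm A"
  by (simp add: mat_mult_scm[symmetric])

lemma bounded_bilinear_scm: "bounded_bilinear (scm :: complex \<Rightarrow> complex^'k^'m \<Rightarrow> complex^'k^'m)"
proof -
  have "bounded_bilinear (\<lambda>c (A :: complex^'k^'m). mat c ** A)"
    by (rule bounded_bilinear.comp1[OF bounded_bilinear_matrix_mult bounded_linear_mat])
  then show ?thesis by (simp add: mat_mult_scm)
qed

interpretation scm: bounded_bilinear "scm :: complex \<Rightarrow> complex^'k^'m \<Rightarrow> complex^'k^'m"
  by (rule bounded_bilinear_scm)

lemmas scm_simps = scm_scm scm_mult_left scm_mult_right mat_mult_scm mult_mat_scm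

lemmas matrix_ring_simps = scm_simps matrix_mul_assoc[symmetric] matrix_mult.add_left matrix_mult.add_right
  matrix_mult.diff_left matrix_mult.diff_right matrix_mult.minus_left matrix_mult.minus_right
  scm.add_left scm.add_right scm.diff_left scm.diff_right scm.minus_left scm.minus_right

section \<open>Growth of solutions for large |\<rho>|\<close>

lemma exp_has_vector_derivative:
  "((\<lambda>x. exp (c * complex_of_real x)) has_vector_derivative c * exp (c * complex_of_real x)) (at x within S)"
proof -
  have "((\<lambda>z. exp (c * z)) has_field_derivative c * exp (c * complex_of_real x)) (at (complex_of_real x))"
    by (auto intro!: derivative_eq_intros)
  from has_vector_derivative_real_field[OF this] show ?thesis .
qed

lemma exp_W11:
  "has_W11_derivative (\<lambda>x. exp (c * complex_of_real x)) (\<lambda>x. c * exp (c * complex_of_real x))"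
  by (intro has_W11_derivative_of_continuous exp_has_vector_derivative continuous_intros)

lemma W11_integrable_0: "(g :: real \<Rightarrow> 'e::euclidean_space) absolutely_integrable_on {0..pi} \<Longrightarrow> x \<in> {0..pi} \<Longrightarrow> g integrable_on {0..x}"
  by (rule integrable_on_subinterval[OF set_lebesgue_integral_eq_integral(1)]) auto

text \<open>Variation of constants with the integrating factor exp(-c x). The weight exp(-\<tau> x),
  with \<tau> at least |Re c|, is smaller than the natural one, but it is common to c = i \<rho> and
  c = -i \<rho>, so both components of the system can be estimated in the same norm.\<close>

lemma linear_equation_growth:
  fixes a :: "real \<Rightarrow> complex^'k^'m"
  assumes W: "has_W11_derivative a (\<lambda>x. c *\<^sub>C a x + g x)" and g: "g absolutely_integrable_on {0..pi}"
    and \<tau>: "\<bar>Re c\<bar> \<le> \<tau>" and x: "x \<in> {0..pi}"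
  shows "exp (- \<tau> * x) * norm (a x) \<le> norm (a 0) + integral {0..x} (\<lambda>t. exp (- \<tau> * t) * norm (g t))"
proof -
  define E where "E x = exp (- c * complex_of_real x)" for x
  have gE: "(\<lambda>t. E t *\<^sub>C g t) absolutely_integrable_on {0..pi}"
    unfolding E_def by (intro absolutely_integrable_continuous_prod[OF bounded_bilinear_scm _ g] continuous_intros)
  have "has_W11_derivative (\<lambda>x. E x *\<^sub>C a x) (\<lambda>x. (- c * E x) *\<^sub>C a x + E x *\<^sub>C (c *\<^sub>C a x + g x))"
    unfolding E_def by (rule has_W11_derivative_prod[OF bounded_bilinear_scm exp_W11 W])
  then have "has_W11_derivative (\<lambda>x. E x *\<^sub>C a x) (\<lambda>x. E x *\<^sub>C g x)"
    by (rule has_W11_derivative_cong) (simp_all add: matrix_ring_simps mult.commute)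
  from has_W11_derivativeD(2)[OF this x]
  have *: "E x *\<^sub>C a x = a 0 + integral {0..x} (\<lambda>t. E t *\<^sub>C g t)" by (simp add: E_def)
  have nE: "norm (E t) = exp (- Re c * t)" for t by (simp add: E_def)
  have ge: "(\<lambda>t. exp (- \<tau> * t) * norm (g t)) integrable_on {0..x}"
    by (intro W11_integrable_0[OF _ x] absolutely_integrable_continuous_prod[OF bounded_bilinear_mult _ absolutely_integrable_norm[OF g, unfolded o_def]] continuous_intros)
  \<comment> \<open>Ratio of the desired weight at x to the integrating factor. Since Re c \<le>
    \<tau> it is at most 1, and for t \<le> x it reduces |E t| to at most exp(-\<tau> t).\<close>
  define \<sigma> where "\<sigma> = exp ((Re c - \<tau>) * x)"
  have \<sigma>: "0 < \<sigma>" "\<sigma> \<le> 1" using \<tau> x by (auto simp: \<sigma>_def mult_nonpos_nonneg)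
  have "exp (- \<tau> * x) * norm (a x) = \<sigma> * norm (E x *\<^sub>C a x)"
  proof -
    have "(Re c - \<tau>) * x + (- Re c * x) = - \<tau> * x" by (simp add: algebra_simps)
    then have "\<sigma> * norm (E x) = exp (- \<tau> * x)" unfolding nE \<sigma>_def exp_add[symmetric] by (simp only:)
    then show ?thesis by (simp add: mult.assoc[symmetric])
  qed
  also have "\<dots> \<le> \<sigma> * (norm (a 0) + norm (integral {0..x} (\<lambda>t. E t *\<^sub>C g t)))"
    unfolding * using \<sigma> by (intro mult_left_mono norm_triangle_ineq) auto
  also have "\<dots> = \<sigma> * norm (a 0) + norm (integral {0..x} (\<lambda>t. \<sigma> *\<^sub>R (E t *\<^sub>C g t)))"
    using \<sigma> by (simp add: distrib_left)
  finally have 1: "exp (- \<tau> * x) * norm (a x) \<le> \<sigma> * norm (a 0) + norm (integral {0..x} (\<lambda>t. \<sigma> *\<^sub>R (E t *\<^sub>C g t)))" .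
  have 2: "norm (integral {0..x} (\<lambda>t. \<sigma> *\<^sub>R (E t *\<^sub>C g t))) \<le> integral {0..x} (\<lambda>t. exp (- \<tau> * t) * norm (g t))"
  proof (rule integral_norm_bound_integral[OF _ ge])
    show "(\<lambda>t. \<sigma> *\<^sub>R (E t *\<^sub>C g t)) integrable_on {0..x}"
      by (intro integrable_cmul W11_integrable_0[OF gE x])
    fix t assume t: "t \<in> {0..x}"
    have "(Re c - \<tau>) * x + (- Re c * t) \<le> - \<tau> * t"
      using mult_right_mono_neg[of t x "Re c - \<tau>"] t \<tau> by (simp add: algebra_simps)
    then have "\<sigma> * norm (E t) \<le> exp (- \<tau> * t)"
      unfolding nE \<sigma>_def exp_add[symmetric] by (simp only: exp_le_cancel_iff)
    then show "norm (\<sigma> *\<^sub>R (E t *\<^sub>C g t)) \<le> exp (- \<tau> * t) * norm (g t)"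
      using \<sigma> by (simp add: mult.assoc[symmetric] mult_right_mono)
  qed
  have "\<sigma> * norm (a 0) \<le> norm (a 0)" using \<sigma> by (simp add: mult_left_le_one_le)
  with 1 2 show ?thesis by linarith
qed

context regular_pencil
begin

definition \<kappa> :: "real \<Rightarrow> real" where "\<kappa> x = 2 * norm (Q1 L x) + norm (Q0 L x)"

lemma \<kappa>_L1: "\<kappa> absolutely_integrable_on {0..pi}"
proof -
  have "(\<lambda>x. 2 * norm (Q1 L x)) absolutely_integrable_on {0..pi}"
    by (intro absolutely_integrable_continuous_real continuous_intros Q1_cont)
  from set_integral_add(1)[OF this absolutely_integrable_norm[OF Q0_L1]] show ?thesis
    by (simp add: \<kappa>_def[abs_def] o_def)
qed

text \<open>The functions \<open>D' + i\<rho>D\<close> and \<open>D' - i\<rho>D\<close> satisfy a first order system whose coefficients are dominated,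
  uniformly for \<open>|\<rho>| \<ge> 1\<close>, by the integrable function \<open>\<kappa>\<close>.\<close>

lemma perturbed_solution_growth:
  fixes D :: "real \<Rightarrow> complex^'k^'m"
  assumes \<rho>: "1 \<le> cmod \<rho>"
    and D: "has_W11_derivative D D'" "has_W11_derivative D' (\<lambda>x. - (coef L \<rho> x ** D x) - R x)"
    and R: "R absolutely_integrable_on {0..pi}" "\<And>t. t \<in> {0..pi} \<Longrightarrow> norm (R t) \<le> exp (\<bar>Im \<rho>\<bar> * t) * r t"
    and r: "r absolutely_integrable_on {0..pi}" "\<And>t. t \<in> {0..pi} \<Longrightarrow> 0 \<le> r t"
    and x: "x \<in> {0..pi}"
  shows "cmod \<rho> * norm (D x) + norm (D' x) \<le>
     2 * exp (integral {0..pi} \<kappa>) * exp (\<bar>Im \<rho>\<bar> * x) * (cmod \<rho> * norm (D 0) + norm (D' 0) + integral {0..pi} r)"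
proof -
  define \<tau> where "\<tau> = \<bar>Im \<rho>\<bar>"
  define a where "a x = D' x + (\<i> * \<rho>) *\<^sub>C D x" for x
  define b where "b x = D' x - (\<i> * \<rho>) *\<^sub>C D x" for x
  define g where "g x = - (((2 * \<i> * \<rho>) *\<^sub>C Q1 L x + Q0 L x) ** D x) - R x" for x
  define v where "v x = exp (- \<tau> * x) * (norm (a x) + norm (b x))" for x
  have cont: "continuous_on {0..pi} D" "continuous_on {0..pi} D'"
    using D has_W11_derivative_continuous by blast+
  have cQ: "(\<lambda>x. (2 * \<i> * \<rho>) *\<^sub>C Q1 L x + Q0 L x) absolutely_integrable_on {0..pi}"
    by (rule set_integral_add(1)[OF absolutely_integrable_continuous_real Q0_L1])
       (intro scm.continuous_on continuous_intros Q1_cont)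
  have "(\<lambda>x. - (((2 * \<i> * \<rho>) *\<^sub>C Q1 L x + Q0 L x) ** D x)) absolutely_integrable_on {0..pi}"
    using absolutely_integrable_linear[OF absolutely_integrable_prod_continuous[OF bounded_bilinear_matrix_mult cQ cont(1)] bounded_linear_minus[OF bounded_linear_ident]]
    by (simp add: o_def)
  from set_integral_diff(1)[OF this R(1)] have g: "g absolutely_integrable_on {0..pi}"
    by (simp add: g_def[abs_def])
  have D1: "has_W11_derivative (\<lambda>x. (\<i> * \<rho>) *\<^sub>C D x) (\<lambda>x. (\<i> * \<rho>) *\<^sub>C D' x)"
    by (rule has_W11_derivative_linear[OF D(1) scm.bounded_linear_right])
  have coef: "coef L \<rho> x ** D x = (\<rho> * \<rho>) *\<^sub>C D x + ((2 * \<i> * \<rho>) *\<^sub>C Q1 L x + Q0 L x) ** D x" for x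
    by (simp add: coef_def matrix_ring_simps power2_eq_square)
  have aW: "has_W11_derivative a (\<lambda>x. (\<i> * \<rho>) *\<^sub>C a x + g x)"
    using has_W11_derivative_add[OF D(2) D1]
    by (rule has_W11_derivative_cong) (simp_all add: a_def g_def coef scm_scm scm.add_right scm.minus_left algebra_simps)
  have bW: "has_W11_derivative b (\<lambda>x. (- \<i> * \<rho>) *\<^sub>C b x + g x)"
    using has_W11_derivative_diff[OF D(2) D1]
    by (rule has_W11_derivative_cong) (simp_all add: b_def g_def coef scm_scm scm.diff_right scm.minus_left algebra_simps)
  have ge: "(\<lambda>t. exp (- \<tau> * t) * norm (g t)) absolutely_integrable_on {0..pi}"
    by (intro absolutely_integrable_continuous_prod[OF bounded_bilinear_mult _ absolutely_integrable_norm[OF g, unfolded o_def]] continuous_intros)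
  have v_cont: "continuous_on {0..pi} v"
    unfolding v_def a_def b_def by (intro continuous_intros scm.continuous_on cont)
  have \<kappa>v: "(\<lambda>t. \<kappa> t * v t) absolutely_integrable_on {0..pi}"
    by (rule absolutely_integrable_prod_continuous[OF bounded_bilinear_mult \<kappa>_L1 v_cont])
  have r0: "0 \<le> integral {0..pi} r" by (intro integral_nonneg W11_integrable_0 r) auto
  have key: "2 * (exp (- \<tau> * t) * norm (g t)) \<le> \<kappa> t * v t + 2 * r t" if t: "t \<in> {0..pi}" for t
  proof -
    \<comment> \<open>Recovers D from a and b with a factor 1/\<rho>. This compensates the factor
      \<rho> in front of \<open>Q1\<close>, which is why the dominating function
      \<open>\<kappa>\<close> can be independent of \<rho>.\<close>
    have "(2 * \<i> * \<rho>) *\<^sub>C D t = a t - b t"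
      unfolding a_def b_def by (simp add: vec_eq_iff)
    then have "norm ((2 * \<i> * \<rho>) *\<^sub>C D t) \<le> norm (a t) + norm (b t)" by (simp add: norm_triangle_ineq4 del: norm_scm)
    then have 1: "2 * cmod \<rho> * norm (D t) \<le> norm (a t) + norm (b t)" by (simp add: norm_mult)
    have 2: "norm (g t) \<le> norm (((2 * \<i> * \<rho>) *\<^sub>C Q1 L t + Q0 L t) ** D t) + norm (R t)"
      unfolding g_def by norm
    have 3: "norm (R t) \<le> exp (\<tau> * t) * r t" using R(2)[OF t] by (simp add: \<tau>_def)
    have "norm ((2 * \<i> * \<rho>) *\<^sub>C Q1 L t + Q0 L t) \<le> 2 * cmod \<rho> * norm (Q1 L t) + norm (Q0 L t)"
      by (rule norm_triangle_le) (simp add: norm_mult)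
    also have "\<dots> \<le> cmod \<rho> * \<kappa> t"
      using mult_right_mono[OF \<rho> norm_ge_zero[of "Q0 L t"]] by (simp add: \<kappa>_def algebra_simps)
    finally have "norm ((2 * \<i> * \<rho>) *\<^sub>C Q1 L t + Q0 L t) \<le> cmod \<rho> * \<kappa> t" .
    then have 4: "norm (((2 * \<i> * \<rho>) *\<^sub>C Q1 L t + Q0 L t) ** D t) \<le> (cmod \<rho> * \<kappa> t) * norm (D t)"
      by (rule order_trans[OF norm_matrix_mult_le mult_right_mono]) simp
    have 5: "\<kappa> t * (2 * cmod \<rho> * norm (D t)) \<le> \<kappa> t * (norm (a t) + norm (b t))"
      by (rule mult_left_mono[OF 1]) (simp add: \<kappa>_def)
    have "2 * norm (g t) \<le> \<kappa> t * (norm (a t) + norm (b t)) + 2 * (exp (\<tau> * t) * r t)"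
      using 2 3 4 5 by (simp add: mult_ac)
    then have "exp (- \<tau> * t) * (2 * norm (g t)) \<le> exp (- \<tau> * t) * (\<kappa> t * (norm (a t) + norm (b t)) + 2 * (exp (\<tau> * t) * r t))"
      by (rule mult_left_mono) simp
    also have "\<dots> = \<kappa> t * v t + 2 * r t"
    proof -
      have "exp (- \<tau> * t) * exp (\<tau> * t) = 1" by (simp add: exp_add[symmetric])
      then have "exp (- \<tau> * t) * (2 * (exp (\<tau> * t) * r t)) = 2 * r t" by (simp add: mult.assoc[symmetric])
      then show ?thesis by (simp only: v_def distrib_left mult_ac)
    qed
    finally show ?thesis by (simp add: mult_ac)
  qed
  have "v x \<le> (v 0 + 2 * integral {0..pi} r) * exp (integral {0..x} \<kappa>)"
  proof (rule gronwall[OF \<kappa>_L1 _ v_cont _ x])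
    show "0 \<le> \<kappa> x" for x by (simp add: \<kappa>_def)
    fix x assume x: "x \<in> {0..pi}"
    have "exp (- \<tau> * x) * norm (a x) \<le> norm (a 0) + integral {0..x} (\<lambda>t. exp (- \<tau> * t) * norm (g t))"
      by (rule linear_equation_growth[OF aW g _ x]) (simp add: \<tau>_def)
    moreover have "exp (- \<tau> * x) * norm (b x) \<le> norm (b 0) + integral {0..x} (\<lambda>t. exp (- \<tau> * t) * norm (g t))"
      by (rule linear_equation_growth[OF bW g _ x]) (simp add: \<tau>_def)
    ultimately have v1: "v x \<le> v 0 + 2 * integral {0..x} (\<lambda>t. exp (- \<tau> * t) * norm (g t))"
      by (simp add: v_def distrib_left)
    have "2 * integral {0..x} (\<lambda>t. exp (- \<tau> * t) * norm (g t)) = integral {0..x} (\<lambda>t. 2 * (exp (- \<tau> * t) * norm (g t)))"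
      by simp
    also have "\<dots> \<le> integral {0..x} (\<lambda>t. \<kappa> t * v t + 2 * r t)"
    proof (rule integral_le)
      show "(\<lambda>t. 2 * (exp (- \<tau> * t) * norm (g t))) integrable_on {0..x}"
        by (rule integrable_on_mult_right[OF W11_integrable_0[OF ge x]])
      show "(\<lambda>t. \<kappa> t * v t + 2 * r t) integrable_on {0..x}"
        by (rule integrable_add[OF W11_integrable_0[OF \<kappa>v x] integrable_on_mult_right[OF W11_integrable_0[OF r(1) x]]])
      show "2 * (exp (- \<tau> * t) * norm (g t)) \<le> \<kappa> t * v t + 2 * r t" if "t \<in> {0..x}" for t
        by (rule key) (use that x in auto)
    qed
    also have "\<dots> = integral {0..x} (\<lambda>t. \<kappa> t * v t) + 2 * integral {0..x} r"
      using Henstock_Kurzweil_Integration.integral_add[OF W11_integrable_0[OF \<kappa>v x] integrable_on_mult_right[OF W11_integrable_0[OF r(1) x], of 2]]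
      by simp
    finally have v2: "2 * integral {0..x} (\<lambda>t. exp (- \<tau> * t) * norm (g t)) \<le> integral {0..x} (\<lambda>t. \<kappa> t * v t) + 2 * integral {0..x} r" .
    have "integral {0..x} r \<le> integral {0..pi} r"
      by (rule integral_subset_le) (use x r W11_integrable_0[OF r(1), of x] W11_integrable_0[OF r(1), of pi] in auto)
    with v1 v2 show "v x \<le> v 0 + 2 * integral {0..pi} r + integral {0..x} (\<lambda>t. \<kappa> t * v t)" by linarith
  qed
  also have "\<dots> \<le> (v 0 + 2 * integral {0..pi} r) * exp (integral {0..pi} \<kappa>)"
  proof (intro mult_left_mono)
    show "exp (integral {0..x} \<kappa>) \<le> exp (integral {0..pi} \<kappa>)"
      unfolding exp_le_cancel_iff
      by (rule integral_subset_le) (use x W11_integrable_0[OF \<kappa>_L1, of x] W11_integrable_0[OF \<kappa>_L1, of pi] in \<open>auto simp: \<kappa>_def\<close>)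
    show "0 \<le> v 0 + 2 * integral {0..pi} r" using r0 by (simp add: v_def)
  qed
  also have "\<dots> \<le> (2 * (cmod \<rho> * norm (D 0) + norm (D' 0)) + 2 * integral {0..pi} r) * exp (integral {0..pi} \<kappa>)"
  proof (intro mult_right_mono add_right_mono)
    have "norm (a 0) \<le> norm (D' 0) + cmod \<rho> * norm (D 0)"
      unfolding a_def by (rule norm_triangle_le) (simp add: norm_mult)
    moreover have "norm (b 0) \<le> norm (D' 0) + cmod \<rho> * norm (D 0)"
      unfolding b_def by (rule norm_triangle_le_diff) (simp add: norm_mult)
    ultimately show "v 0 \<le> 2 * (cmod \<rho> * norm (D 0) + norm (D' 0))" by (simp add: v_def)
  qed auto
  finally have v: "v x \<le> 2 * exp (integral {0..pi} \<kappa>) * (cmod \<rho> * norm (D 0) + norm (D' 0) + integral {0..pi} r)"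
    by (simp add: algebra_simps)
  have "norm ((2 * \<i> * \<rho>) *\<^sub>C D x) = norm (a x - b x)"
    unfolding a_def b_def by (rule arg_cong[where f=norm]) (simp add: vec_eq_iff)
  then have "norm ((2 * \<i> * \<rho>) *\<^sub>C D x) \<le> norm (a x) + norm (b x)" by (simp only: norm_triangle_ineq4)
  then have "2 * cmod \<rho> * norm (D x) \<le> norm (a x) + norm (b x)" by (simp add: norm_mult)
  moreover have "norm (2 *\<^sub>R D' x) = norm (a x + b x)"
    unfolding a_def b_def by (rule arg_cong[where f=norm]) (simp add: scaleR_2)
  then have "norm (2 *\<^sub>R D' x) \<le> norm (a x) + norm (b x)" by (simp only: norm_triangle_ineq)
  then have "2 * norm (D' x) \<le> norm (a x) + norm (b x)" by simp
  ultimately have "cmod \<rho> * norm (D x) + norm (D' x) \<le> norm (a x) + norm (b x)" by linarith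
  also have "\<dots> = exp (\<tau> * x) * v x"
    by (simp add: v_def mult.assoc[symmetric] exp_add[symmetric])
  also have "\<dots> \<le> exp (\<tau> * x) * (2 * exp (integral {0..pi} \<kappa>) * (cmod \<rho> * norm (D 0) + norm (D' 0) + integral {0..pi} r))"
    using v by (intro mult_left_mono) auto
  finally show ?thesis by (simp add: \<tau>_def mult_ac)
qed

end

text \<open>Differentiating exp(i \<rho> x) P twice produces 2 i \<rho> P', which by P' = -Q P
  cancels 2 i \<rho> Q P. The remaining error q P - Q Q P is integrable and carries no power of
  \<rho>. Reversing the signs of both Q and \<rho> gives the second exponential.\<close>

lemma approximate_solution:
  fixes P Q :: "real \<Rightarrow> complex^'m^'m" and \<rho> :: complex
  assumes Q: "has_W11_derivative Q q"
    and P: "\<And>x. x \<in> {0..pi} \<Longrightarrow> (P has_vector_derivative - (Q x ** P x)) (at x within {0..pi})"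
  defines "F \<equiv> \<lambda>x. exp (\<i> * \<rho> * complex_of_real x) *\<^sub>C P x"
    and "F' \<equiv> \<lambda>x. exp (\<i> * \<rho> * complex_of_real x) *\<^sub>C ((\<i> * \<rho>) *\<^sub>C P x - Q x ** P x)"
  shows "has_W11_derivative F F'"
    and "has_W11_derivative F' (\<lambda>x. - ((\<rho> * \<rho>) *\<^sub>C F x + (2 * \<i> * \<rho>) *\<^sub>C (Q x ** F x))
       - exp (\<i> * \<rho> * complex_of_real x) *\<^sub>C (q x ** P x - Q x ** (Q x ** P x)))"
proof -
  have cQ: "continuous_on {0..pi} Q" by (rule has_W11_derivative_continuous[OF Q])
  have cP: "continuous_on {0..pi} P"
    unfolding continuous_on_eq_continuous_within using P has_vector_derivative_continuous by blast
  have PW: "has_W11_derivative P (\<lambda>x. - (Q x ** P x))"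
    by (rule has_W11_derivative_of_continuous) (intro P continuous_intros matrix_mult.continuous_on cQ cP | assumption)+
  have QP: "has_W11_derivative (\<lambda>x. Q x ** P x) (\<lambda>x. q x ** P x + Q x ** - (Q x ** P x))"
    by (rule has_W11_derivative_prod[OF bounded_bilinear_matrix_mult Q PW])
  have "has_W11_derivative F (\<lambda>x. (\<i> * \<rho> * exp (\<i> * \<rho> * complex_of_real x)) *\<^sub>C P x
      + exp (\<i> * \<rho> * complex_of_real x) *\<^sub>C - (Q x ** P x))"
    unfolding F_def by (rule has_W11_derivative_prod[OF bounded_bilinear_scm exp_W11 PW])
  then show "has_W11_derivative F F'"
    by (rule has_W11_derivative_cong) (simp_all add: F'_def matrix_ring_simps mult_ac)
  have "has_W11_derivative F' (\<lambda>x. (\<i> * \<rho> * exp (\<i> * \<rho> * complex_of_real x)) *\<^sub>C ((\<i> * \<rho>) *\<^sub>C P x - Q x ** P x)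
     + exp (\<i> * \<rho> * complex_of_real x) *\<^sub>C ((\<i> * \<rho>) *\<^sub>C - (Q x ** P x) - (q x ** P x + Q x ** - (Q x ** P x))))"
    unfolding F'_def
    by (intro has_W11_derivative_prod[OF bounded_bilinear_scm exp_W11] has_W11_derivative_diff QP
        has_W11_derivative_linear[OF PW scm.bounded_linear_right])
  then show "has_W11_derivative F' (\<lambda>x. - ((\<rho> * \<rho>) *\<^sub>C F x + (2 * \<i> * \<rho>) *\<^sub>C (Q x ** F x))
       - exp (\<i> * \<rho> * complex_of_real x) *\<^sub>C (q x ** P x - Q x ** (Q x ** P x)))"
    by (rule has_W11_derivative_cong) (simp_all add: F_def matrix_ring_simps vec_eq_iff algebra_simps)
qed

locale asymptotic_pencil = regular_pencil L for L :: "'m::finite pencil" +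
  fixes P_plus P_minus :: "real \<Rightarrow> complex^'m^'m" and q1 :: "real \<Rightarrow> complex^'m^'m"
  assumes Q1_W11: "has_W11_derivative (Q1 L) q1"
    and P_plus: "P_plus 0 = mat 1"
      "\<And>x. x \<in> {0..pi} \<Longrightarrow> (P_plus has_vector_derivative Q1 L x ** P_plus x) (at x within {0..pi})"
    and P_minus: "P_minus 0 = mat 1"
      "\<And>x. x \<in> {0..pi} \<Longrightarrow> (P_minus has_vector_derivative - (Q1 L x ** P_minus x)) (at x within {0..pi})"
begin

section \<open>The two exponentials and the boundary form at \<pi>\<close>

definition Fm where "Fm \<rho> x = exp (\<i> * \<rho> * complex_of_real x) *\<^sub>C P_minus x"
definition Fm' where "Fm' \<rho> x = exp (\<i> * \<rho> * complex_of_real x) *\<^sub>C ((\<i> * \<rho>) *\<^sub>C P_minus x - Q1 L x ** P_minus x)"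
definition Fp where "Fp \<rho> x = exp (- \<i> * \<rho> * complex_of_real x) *\<^sub>C P_plus x"
definition Fp' where "Fp' \<rho> x = exp (- \<i> * \<rho> * complex_of_real x) *\<^sub>C (Q1 L x ** P_plus x - (\<i> * \<rho>) *\<^sub>C P_plus x)"
text \<open>What the two approximate solutions leave over in the equation, divided by their
  exponential factor; both are independent of \<rho>.\<close>

definition Rm where "Rm x = q1 x ** P_minus x - Q1 L x ** (Q1 L x ** P_minus x) - Q0 L x ** P_minus x"
definition Rp where "Rp x = - (q1 x ** P_plus x) - Q1 L x ** (Q1 L x ** P_plus x) - Q0 L x ** P_plus x"

lemma P_continuous: "continuous_on {0..pi} P_minus" "continuous_on {0..pi} P_plus"
  unfolding continuous_on_eq_continuous_within using P_plus P_minus has_vector_derivative_continuous by blast+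

lemma Fm_W11: "has_W11_derivative (Fm \<rho>) (Fm' \<rho>)"
  "has_W11_derivative (Fm' \<rho>) (\<lambda>x. - (coef L \<rho> x ** Fm \<rho> x) - exp (\<i> * \<rho> * complex_of_real x) *\<^sub>C Rm x)"
proof -
  note * = approximate_solution[OF Q1_W11 P_minus(2), of \<rho>]
  show "has_W11_derivative (Fm \<rho>) (Fm' \<rho>)"
    using *(1) by (rule has_W11_derivative_cong) (simp_all add: Fm_def Fm'_def)
  show "has_W11_derivative (Fm' \<rho>) (\<lambda>x. - (coef L \<rho> x ** Fm \<rho> x) - exp (\<i> * \<rho> * complex_of_real x) *\<^sub>C Rm x)"
    using *(2) by (rule has_W11_derivative_cong)
      (simp_all add: Fm_def Fm'_def Rm_def coef_def matrix_ring_simps power2_eq_square vec_eq_iff algebra_simps)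
qed

lemma Fp_W11: "has_W11_derivative (Fp \<rho>) (Fp' \<rho>)"
  "has_W11_derivative (Fp' \<rho>) (\<lambda>x. - (coef L \<rho> x ** Fp \<rho> x) - exp (- \<i> * \<rho> * complex_of_real x) *\<^sub>C Rp x)"
proof -
  have Q: "has_W11_derivative (\<lambda>x. - Q1 L x) (\<lambda>x. - q1 x)"
    by (rule has_W11_derivative_linear[OF Q1_W11 bounded_linear_minus[OF bounded_linear_ident]])
  have P: "(P_plus has_vector_derivative - (- Q1 L x ** P_plus x)) (at x within {0..pi})" if "x \<in> {0..pi}" for x
    using P_plus(2)[OF that] by (simp add: matrix_mult.minus_left)
  note * = approximate_solution[OF Q P, of "- \<rho>"]
  show "has_W11_derivative (Fp \<rho>) (Fp' \<rho>)"
    using *(1) by (rule has_W11_derivative_cong) (simp_all add: Fp_def Fp'_def matrix_ring_simps)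
  show "has_W11_derivative (Fp' \<rho>) (\<lambda>x. - (coef L \<rho> x ** Fp \<rho> x) - exp (- \<i> * \<rho> * complex_of_real x) *\<^sub>C Rp x)"
    using *(2) by (rule has_W11_derivative_cong)
      (simp_all add: Fp_def Fp'_def Rp_def coef_def matrix_ring_simps power2_eq_square vec_eq_iff algebra_simps)
qed

lemma R_L1: "Rm absolutely_integrable_on {0..pi}" "Rp absolutely_integrable_on {0..pi}"
proof -
  have q1: "q1 absolutely_integrable_on {0..pi}" by (rule has_W11_derivativeD(1)[OF Q1_W11])
  have m: "(\<lambda>x. A x ** P x) absolutely_integrable_on {0..pi}" if "A absolutely_integrable_on {0..pi}" "continuous_on {0..pi} P"
    for A P :: "real \<Rightarrow> complex^'m^'m"
    by (rule absolutely_integrable_prod_continuous[OF bounded_bilinear_matrix_mult that])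
  have Q: "(\<lambda>x. Q1 L x ** (Q1 L x ** P x)) absolutely_integrable_on {0..pi}" if "continuous_on {0..pi} P"
    for P :: "real \<Rightarrow> complex^'m^'m"
    by (intro absolutely_integrable_continuous_real matrix_mult.continuous_on Q1_cont that)
  show "Rm absolutely_integrable_on {0..pi}"
    unfolding Rm_def[abs_def] by (intro set_integral_diff(1) m Q q1 Q0_L1 P_continuous)
  have "(\<lambda>x. - (q1 x ** P_plus x)) absolutely_integrable_on {0..pi}"
    using absolutely_integrable_linear[OF m[OF q1 P_continuous(2)] bounded_linear_minus[OF bounded_linear_ident]]
    by (simp add: o_def)
  then show "Rp absolutely_integrable_on {0..pi}"
    unfolding Rp_def[abs_def] by (intro set_integral_diff(1) m Q q1 Q0_L1 P_continuous)
qed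

text \<open>The terms with the factor \<rho> when V is applied to
  \<open>Fm \<rho> x ** C1 + Fp \<rho> x ** C2\<close>; the terms with \<open>Q1 L pi\<close> and
  \<open>H0 L\<close> are of lower order.\<close>

definition V0 :: "complex \<Rightarrow> complex^'m^'m \<Rightarrow> complex^'m^'m \<Rightarrow> complex^'m^'m" where
  "V0 \<rho> C1 C2 = (\<i> * \<rho>) *\<^sub>C (exp (\<i> * \<rho> * pi) *\<^sub>C ((mat 1 + H1 L) ** P_minus pi ** C1)
     - exp (- \<i> * \<rho> * pi) *\<^sub>C ((mat 1 - H1 L) ** P_plus pi ** C2))"

text \<open>For the difference D between the solution and the combination of exponentials, D(0) = 0
  and D'(0) = Q_1(0) (C1 - C2) has no factor \<rho>. Hence |\<rho>| |D| + |D'| at \<pi> is bounded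
  by the exponential times |C1| + |C2|. Arbitrary C1 and C2 let this one estimate serve both
  \<Delta> and \<Theta>.\<close>

lemma boundary_form_asymptotics:
  "\<exists>C>0. \<forall>\<rho> Y Z C1 C2. 1 \<le> cmod \<rho> \<longrightarrow> sol L \<rho> Y Z \<longrightarrow> Y 0 = C1 + C2 \<longrightarrow> Z 0 = (\<i> * \<rho>) *\<^sub>C (C1 - C2) \<longrightarrow>
     norm (Z pi + ((\<i> * \<rho>) *\<^sub>C H1 L + H0 L) ** Y pi - V0 \<rho> C1 C2) \<le> C * exp (\<bar>Im \<rho>\<bar> * pi) * (norm C1 + norm C2)"
proof -
  define r0 where "r0 x = norm (Rm x) + norm (Rp x)" for x
  have r0: "r0 absolutely_integrable_on {0..pi}"
    unfolding r0_def[abs_def] by (intro set_integral_add(1) absolutely_integrable_norm[unfolded o_def] R_L1)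
  define G where "G = 2 * exp (integral {0..pi} \<kappa>) * (norm (Q1 L 0) + integral {0..pi} r0)"
  have r0i: "0 \<le> integral {0..pi} r0" by (intro integral_nonneg W11_integrable_0 r0) (auto simp: r0_def)
  then have G: "G \<ge> 0" by (simp add: G_def)
  define B where "B = norm ((H0 L - Q1 L pi) ** P_minus pi) + norm ((H0 L + Q1 L pi) ** P_plus pi)"
  define C where "C = G * (1 + norm (H1 L) + norm (H0 L)) + B + 1"
  have bound: "norm (Z pi + ((\<i> * \<rho>) *\<^sub>C H1 L + H0 L) ** Y pi - V0 \<rho> C1 C2) \<le> C * exp (\<bar>Im \<rho>\<bar> * pi) * (norm C1 + norm C2)"
    if \<rho>: "1 \<le> cmod \<rho>" and s: "sol L \<rho> Y Z" and Y0: "Y 0 = C1 + C2" and Z0: "Z 0 = (\<i> * \<rho>) *\<^sub>C (C1 - C2)"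
    for \<rho> Y Z C1 C2
  proof -
    define \<tau> where "\<tau> = \<bar>Im \<rho>\<bar>"
    define c where "c = norm C1 + norm C2"
    have c0: "c \<ge> 0" by (simp add: c_def)
    define D where "D x = Y x - (Fm \<rho> x ** C1 + Fp \<rho> x ** C2)" for x
    define D' where "D' x = Z x - (Fm' \<rho> x ** C1 + Fp' \<rho> x ** C2)" for x
    define em where "em x = exp (\<i> * \<rho> * complex_of_real x)" for x
    define ep where "ep x = exp (- \<i> * \<rho> * complex_of_real x)" for x
    define R where "R x = - ((em x *\<^sub>C Rm x) ** C1 + (ep x *\<^sub>C Rp x) ** C2)" for x
    have e_bound: "cmod (em x) \<le> exp (\<tau> * x)" "cmod (ep x) \<le> exp (\<tau> * x)" if "x \<ge> 0" for x
      using that mult_right_mono[of "- Im \<rho>" \<tau> x] mult_right_mono[of "Im \<rho>" \<tau> x] by (simp_all add: em_def ep_def \<tau>_def)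
    note lin = has_W11_derivative_linear[OF _ matrix_mult.bounded_linear_left]
    have DW: "has_W11_derivative D D'"
      unfolding D_def[abs_def] D'_def[abs_def]
      by (intro has_W11_derivative_diff has_W11_derivative_add sol_W11(1)[OF s] lin Fm_W11(1) Fp_W11(1))
    have "has_W11_derivative D' (\<lambda>x. - (coef L \<rho> x ** Y x) - 
       ((- (coef L \<rho> x ** Fm \<rho> x) - em x *\<^sub>C Rm x) ** C1 + (- (coef L \<rho> x ** Fp \<rho> x) - ep x *\<^sub>C Rp x) ** C2))"
      unfolding D'_def[abs_def] em_def ep_def
      by (intro has_W11_derivative_diff has_W11_derivative_add sol_W11(2)[OF s] lin Fm_W11(2) Fp_W11(2))
    then have D'W: "has_W11_derivative D' (\<lambda>x. - (coef L \<rho> x ** D x) - R x)"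
      by (rule has_W11_derivative_cong)
        (simp_all add: D_def R_def matrix_mult.add_left matrix_mult.add_right matrix_mult.diff_left matrix_mult.diff_right
           matrix_mult.minus_left matrix_mult.minus_right matrix_mul_assoc)
    have RL: "R absolutely_integrable_on {0..pi}"
    proof -
      have "(\<lambda>x. (em x *\<^sub>C Rm x) ** C1 + (ep x *\<^sub>C Rp x) ** C2) absolutely_integrable_on {0..pi}"
        unfolding em_def ep_def
        by (intro set_integral_add(1) absolutely_integrable_prod_continuous[OF bounded_bilinear_matrix_mult]
             absolutely_integrable_continuous_prod[OF bounded_bilinear_scm] R_L1 continuous_intros)
      from absolutely_integrable_linear[OF this bounded_linear_minus[OF bounded_linear_ident]] show ?thesis
        by (simp add: o_def R_def[abs_def])
    qed
    have Rb: "norm (R t) \<le> exp (\<bar>Im \<rho>\<bar> * t) * (c * r0 t)" if t: "t \<in> {0..pi}" for t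
    proof -
      have "norm (R t) \<le> norm ((em t *\<^sub>C Rm t) ** C1) + norm ((ep t *\<^sub>C Rp t) ** C2)"
        unfolding R_def by norm
      also have "\<dots> \<le> (cmod (em t) * norm (Rm t)) * norm C1 + (cmod (ep t) * norm (Rp t)) * norm C2"
        using norm_matrix_mult_le[of "em t *\<^sub>C Rm t" C1] norm_matrix_mult_le[of "ep t *\<^sub>C Rp t" C2] by simp
      also have "\<dots> \<le> (exp (\<tau> * t) * norm (Rm t)) * c + (exp (\<tau> * t) * norm (Rp t)) * c"
        using e_bound[of t] t by (intro add_mono mult_mono) (auto simp: c_def)
      finally show ?thesis by (simp add: \<tau>_def r0_def algebra_simps)
    qed
    have cr: "(\<lambda>t. c * r0 t) absolutely_integrable_on {0..pi}"
      using absolutely_integrable_linear[OF r0 bounded_linear_mult_right[of c]] by (simp add: o_def)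
    have D0: "D 0 = 0" by (simp add: D_def Y0 Fm_def Fp_def P_plus P_minus)
    have D'0: "D' 0 = Q1 L 0 ** (C1 - C2)"
      by (simp add: D'_def Z0 Fm'_def Fp'_def P_plus P_minus matrix_ring_simps)
    have "cmod \<rho> * norm (D pi) + norm (D' pi) \<le> 2 * exp (integral {0..pi} \<kappa>) * exp (\<bar>Im \<rho>\<bar> * pi) * 
        (cmod \<rho> * norm (D 0) + norm (D' 0) + integral {0..pi} (\<lambda>t. c * r0 t))"
      by (rule perturbed_solution_growth[OF \<rho> DW D'W RL Rb cr]) (auto simp: c_def r0_def)
    also have "\<dots> \<le> 2 * exp (integral {0..pi} \<kappa>) * exp (\<bar>Im \<rho>\<bar> * pi) * (norm (Q1 L 0) * c + c * integral {0..pi} r0)"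
    proof -
      have "norm (D' 0) \<le> norm (Q1 L 0) * norm (C1 - C2)" unfolding D'0 by (rule norm_matrix_mult_le)
      also have "\<dots> \<le> norm (Q1 L 0) * c" unfolding c_def by (intro mult_left_mono norm_triangle_ineq4) auto
      finally show ?thesis using D0 by (intro mult_left_mono) auto
    qed
    also have "\<dots> = G * exp (\<tau> * pi) * c" by (simp add: G_def \<tau>_def algebra_simps)
    finally have Dpi: "cmod \<rho> * norm (D pi) + norm (D' pi) \<le> G * exp (\<tau> * pi) * c" .
    define g where "g = G * exp (\<tau> * pi) * c"
    have D1: "cmod \<rho> * norm (D pi) \<le> g" "norm (D' pi) \<le> g"
      using Dpi mult_nonneg_nonneg[of "cmod \<rho>" "norm (D pi)"] unfolding g_def by (smt (verit) norm_ge_zero)+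
    have D2: "norm (D pi) \<le> g"
      using D1(1) mult_right_mono[OF \<rho> norm_ge_zero[of "D pi"]] by simp
    \<comment> \<open>Exact decomposition: the terms with the factor \<rho> cancel against
      \<open>V0\<close>, leaving D and D' at \<pi> and the lower order boundary terms collected in
      \<open>B\<close>.\<close>
    have "Z pi + ((\<i> * \<rho>) *\<^sub>C H1 L + H0 L) ** Y pi - V0 \<rho> C1 C2
      = D' pi + (\<i> * \<rho>) *\<^sub>C (H1 L ** D pi) + H0 L ** D pi
        + (em pi *\<^sub>C (((H0 L - Q1 L pi) ** P_minus pi) ** C1) + ep pi *\<^sub>C (((H0 L + Q1 L pi) ** P_plus pi) ** C2))"
      unfolding D'_def D_def V0_def Fm_def Fp_def Fm'_def Fp'_def em_def[symmetric] ep_def[symmetric]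
      by (simp add: matrix_ring_simps vec_eq_iff)
    also have "norm \<dots> \<le> norm (D' pi) + norm ((\<i> * \<rho>) *\<^sub>C (H1 L ** D pi)) + norm (H0 L ** D pi)
        + (norm (em pi *\<^sub>C (((H0 L - Q1 L pi) ** P_minus pi) ** C1)) + norm (ep pi *\<^sub>C (((H0 L + Q1 L pi) ** P_plus pi) ** C2)))"
      by (intro norm_triangle_le add_mono norm_triangle_ineq order_refl)
    also have "\<dots> \<le> g + norm (H1 L) * g + norm (H0 L) * g
        + (exp (\<tau> * pi) * (norm ((H0 L - Q1 L pi) ** P_minus pi) * c) + exp (\<tau> * pi) * (norm ((H0 L + Q1 L pi) ** P_plus pi) * c))"
    proof (intro add_mono)
      have "norm ((\<i> * \<rho>) *\<^sub>C (H1 L ** D pi)) \<le> cmod \<rho> * (norm (H1 L) * norm (D pi))"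
        by (simp add: norm_mult mult_left_mono norm_matrix_mult_le)
      also have "\<dots> \<le> norm (H1 L) * g" using mult_left_mono[OF D1(1) norm_ge_zero[of "H1 L"]] by (simp add: mult_ac)
      finally show "norm ((\<i> * \<rho>) *\<^sub>C (H1 L ** D pi)) \<le> norm (H1 L) * g" .
      show "norm (H0 L ** D pi) \<le> norm (H0 L) * g"
        by (rule order_trans[OF norm_matrix_mult_le mult_left_mono[OF D2]]) simp
      have m: "norm (z *\<^sub>C (A ** X)) \<le> exp (\<tau> * pi) * (norm A * c)" if "cmod z \<le> exp (\<tau> * pi)" "norm X \<le> c" 
        for z and A X :: "complex^'m^'m"
        unfolding norm_scm
        by (intro mult_mono that order_trans[OF norm_matrix_mult_le] mult_left_mono) auto
      show "norm (em pi *\<^sub>C (((H0 L - Q1 L pi) ** P_minus pi) ** C1)) \<le> exp (\<tau> * pi) * (norm ((H0 L - Q1 L pi) ** P_minus pi) * c)"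
        by (intro m e_bound) (auto simp: c_def)
      show "norm (ep pi *\<^sub>C (((H0 L + Q1 L pi) ** P_plus pi) ** C2)) \<le> exp (\<tau> * pi) * (norm ((H0 L + Q1 L pi) ** P_plus pi) * c)"
        by (intro m e_bound) (auto simp: c_def)
    qed (rule D1)
    also have "\<dots> = (C - 1) * exp (\<tau> * pi) * c" by (simp add: C_def g_def B_def algebra_simps)
    also have "\<dots> \<le> C * exp (\<tau> * pi) * c" using c0 by (intro mult_right_mono) auto
    finally show ?thesis by (simp add: c_def \<tau>_def)
  qed
  have "C > 0" using G by (simp add: C_def B_def add_nonneg_pos)
  then show ?thesis using bound by blast
qed

end

section \<open>Analytic matrix functions\<close>

lemma det_eq_0_iff_kernel:
  fixes A :: "complex^'n^'n"
  shows "det A = 0 \<longleftrightarrow> (\<exists>v. v \<noteq> 0 \<and> A *v v = 0)"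
  by (metis invertible_det_nz invertible_left_inverse matrix_left_invertible_ker)

lemma holomorphic_matrix_mult:
  fixes A :: "complex \<Rightarrow> complex^'n^'l" and B :: "complex \<Rightarrow> complex^'k^'n"
  assumes "\<And>i j. (\<lambda>z. A z $ i $ j) holomorphic_on S" "\<And>i j. (\<lambda>z. B z $ i $ j) holomorphic_on S"
  shows "(\<lambda>z. (A z ** B z) $ i $ j) holomorphic_on S"
  unfolding matrix_matrix_mult_def using assms by (auto intro!: holomorphic_intros)

lemma holomorphic_det:
  fixes A :: "complex \<Rightarrow> complex^'n^'n"
  assumes "\<And>i j. (\<lambda>z. A z $ i $ j) holomorphic_on S"
  shows "(\<lambda>z. det (A z)) holomorphic_on S"
  unfolding det_def using assms by (intro holomorphic_intros) auto

text \<open>Cramer's rule column by column. It exhibits the entries of a matrix quotient as ratios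
  of determinants, so that their holomorphy and singularities become visible.\<close>

lemma matrix_cramer:
  fixes A :: "complex^'n^'n" and X :: "complex^'k^'n"
  assumes "det A \<noteq> 0" "A ** X = B"
  shows "X $ k $ l = det (\<chi> i j. if j = k then B $ i $ l else A $ i $ j) / det A"
proof -
  have "A *v (\<chi> i. X $ i $ l) = (\<chi> i. B $ i $ l)"
    using assms(2) by (auto simp: vec_eq_iff matrix_vector_mult_def matrix_matrix_mult_def)
  then have "(\<chi> i. X $ i $ l) = (\<chi> k. det (\<chi> i j. if j = k then (\<chi> i. B $ i $ l) $ i else A $ i $ j) / det A)"
    using cramer[OF assms(1)] by blast
  then have "(\<chi> i. X $ i $ l) $ k = (\<chi> k. det (\<chi> i j. if j = k then (\<chi> i. B $ i $ l) $ i else A $ i $ j) / det A) $ k"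
    by (rule arg_cong)
  then show ?thesis unfolding vec_lambda_beta .
qed

text \<open>A basis of the kernel, completed to a basis of the whole space.\<close>

definition kernel_adapted :: "complex^'n^'n \<Rightarrow> complex^'n^'n \<Rightarrow> complex^'n^'n \<Rightarrow> 'n set \<Rightarrow> bool" where
  "kernel_adapted A T T' J \<longleftrightarrow> T ** T' = mat 1 \<and> T' ** T = mat 1 \<and>
     (\<forall>i. \<forall>j\<in>J. (A ** T) $ i $ j = 0) \<and>
     (\<forall>w. (A ** T) *v w = 0 \<longrightarrow> (\<forall>j. j \<notin> J \<longrightarrow> w $ j = 0))"

text \<open>A basis of the kernel is extended to a basis of the whole space. A bijection with the
  index type turns its vectors into the columns of \<open>T\<close>, and \<open>J\<close> marks the
  columns that lie in the kernel.\<close>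

lemma kernel_adapted_basis:
  fixes A :: "complex^'n^'n"
  shows "\<exists>T T' J. kernel_adapted A T T' J"
proof -
  define K where "K = {u. A *v u = 0}"
  obtain B where B: "B \<subseteq> K" "vec.independent B" "K \<subseteq> vec.span B"
    using vec.basis_exists by metis
  define B' where "B' = vec.extend_basis B"
  have B': "B \<subseteq> B'" "vec.independent B'" "vec.span B' = UNIV"
    unfolding B'_def using B(2) vec.extend_basis_superset vec.independent_extend_basis vec.span_extend_basis by blast+
  have fin: "finite B'" using vec.finiteI_independent[OF B'(2)] .
  have "vec.dim (UNIV :: (complex^'n) set) = card B'"
    by (rule vec.dim_eq_card) (simp_all add: B' vec.span_UNIV)
  with vec_dim_card[where 'a=complex and 'n='n] have cB: "card (UNIV :: 'n set) = card B'"
    by (rule trans[OF sym])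
  obtain f where f: "bij_betw f (UNIV :: 'n set) B'"
    using finite_same_card_bij[OF finite_class.finite_UNIV fin cB] ..
  define T :: "complex^'n^'n" where "T = (\<chi> i j. f j $ i)"
  have Tv: "T *v w = (\<Sum>j\<in>UNIV. w $ j *s f j)" for w
    by (simp add: T_def matrix_vector_mult_def vec_eq_iff mult.commute)
  have inj: "w = 0" if "T *v w = 0" for w
  proof -
    define g where "g = inv_into UNIV f"
    have gf: "g (f j) = j" for j unfolding g_def using f by (simp add: bij_betw_def inv_into_f_f)
    have "(\<Sum>b\<in>B'. w $ g b *s b) = (\<Sum>j\<in>UNIV. w $ g (f j) *s f j)"
      by (rule sum.reindex_bij_betw[OF f, symmetric])
    then have s0: "(\<Sum>b\<in>B'. w $ g b *s b) = 0" using that by (simp add: gf Tv)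
    have "w $ g b = 0" if "b \<in> B'" for b
      using vec.independentD[OF B'(2) fin subset_refl s0 that] .
    moreover have "f j \<in> B'" for j using bij_betw_apply[OF f] by simp
    ultimately have "w $ g (f j) = 0" for j .
    then have "w $ j = 0" for j by (simp only: gf)
    then show ?thesis by (simp add: vec_eq_iff)
  qed
  obtain T' where T': "T' ** T = mat 1" using inj matrix_left_invertible_ker[of T] by blast
  then have T'': "T ** T' = mat 1" using matrix_left_right_inverse by blast
  define J where "J = {j. f j \<in> B}"
  have "kernel_adapted A T T' J"
    unfolding kernel_adapted_def
  proof (intro conjI T' T'' allI ballI impI)
    fix i j assume "j \<in> J"
    then have "A *v f j = 0" using B(1) by (auto simp: J_def K_def)
    then have "(A *v f j) $ i = 0" by simp
    then show "(A ** T) $ i $ j = 0" by (simp add: T_def matrix_matrix_mult_def matrix_vector_mult_def)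
  next
    fix w j assume "(A ** T) *v w = 0" and j: "j \<notin> J"
    then have "T *v w \<in> K" by (simp add: K_def matrix_vector_mul_assoc)
    then have "T *v w \<in> vec.span B" using B(3) by blast
    then obtain u where u: "T *v w = (\<Sum>b\<in>B. u b *s b)"
      using vec.span_finite[OF finite_subset[OF B'(1) fin]] by auto
    define w' :: "complex^'n" where "w' = (\<chi> j. if f j \<in> B then u (f j) else 0)"
    have "T *v w' = (\<Sum>j\<in>UNIV. (if f j \<in> B then u (f j) else 0) *s f j)" by (simp add: Tv w'_def)
    also have "\<dots> = (\<Sum>b\<in>B'. (if b \<in> B then u b else 0) *s b)"
      by (rule sum.reindex_bij_betw[OF f])
    also have "\<dots> = (\<Sum>b\<in>B. u b *s b)"
      by (rule sum.mono_neutral_cong_right[OF fin B'(1)]) auto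
    finally have "T *v (w - w') = 0" using u by (simp add: matrix_vector_mult_diff_distrib)
    then have "w - w' = 0" by (rule inj)
    then have "w = w'" by simp
    then show "w $ j = 0" using j by (simp add: w'_def J_def)
  qed
  then show ?thesis by blast
qed

locale entire_matrix =
  fixes D :: "complex \<Rightarrow> complex^'n^'n"
  assumes holo: "\<And>i j. (\<lambda>z. D z $ i $ j) holomorphic_on UNIV"
begin

definition D' where "D' z = (\<chi> i j. deriv (\<lambda>z. D z $ i $ j) z)"

text \<open>Local Smith form of \<open>D\<close> at \<open>z0\<close> in the case where only the
  exponents 0 and 1 occur; \<open>J\<close> marks the exponents 1.\<close>

definition kernel_factors where
  "kernel_factors z0 T T' J E \<longleftrightarrow> T ** T' = mat 1 \<and> T' ** T = (mat 1 :: complex^'n^'n) \<and>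
     (\<forall>i j. (\<lambda>z. (E z :: complex^'n^'n) $ i $ j) holomorphic_on UNIV) \<and> det (E z0) \<noteq> 0 \<and>
     (\<forall>z. D z ** T = E z ** diag_mat (\<lambda>j. if j \<in> J then z - z0 else 1))"

text \<open>The hypothesis excludes Jordan chains of length two. The columns of D T in
  \<open>J\<close> vanish at \<open>z0\<close> and are divided by z - z0; at \<open>z0\<close> they
  become columns of D' T. A null vector of \<open>E z0\<close>, split along \<open>J\<close> into w1
  and w2, would give the chain T w1, T w2. Hence w1 = 0, and then w2 is a kernel vector supported
  outside \<open>J\<close>, so it vanishes too.\<close>

lemma kernel_factorization:
  assumes no_chain: "\<And>u v. u \<noteq> 0 \<Longrightarrow> D z0 *v u = 0 \<Longrightarrow> D' z0 *v u + D z0 *v v \<noteq> 0"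
  shows "\<exists>T T' J E. kernel_factors z0 T T' J E"
proof -
  obtain T T' J where ka: "kernel_adapted (D z0) T T' J" using kernel_adapted_basis by blast
  have T: "T ** T' = mat 1" "T' ** T = mat 1"
    and J: "\<And>i j. j \<in> J \<Longrightarrow> (D z0 ** T) $ i $ j = 0"
    and Jc: "\<And>w. (D z0 ** T) *v w = 0 \<Longrightarrow> (\<forall>j. j \<notin> J \<longrightarrow> w $ j = 0)"
    using ka unfolding kernel_adapted_def by blast+
  define f where "f i j z = (D z ** T) $ i $ j" for i j z
  have fh: "f i j holomorphic_on UNIV" for i j
    unfolding f_def by (intro holomorphic_matrix_mult holo) simp
  define E :: "complex \<Rightarrow> complex^'n^'n" where
    "E z = (\<chi> i j. if j \<in> J then (if z = z0 then deriv (f i j) z0 else (f i j z - f i j z0) / (z - z0)) else f i j z)" for z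
  have f0: "f i j z0 = 0" if "j \<in> J" for i j using J[OF that] by (simp add: f_def)
  have Eh: "(\<lambda>z. E z $ i $ j) holomorphic_on UNIV" for i j
  proof (cases "j \<in> J")
    case True
    have "(\<lambda>z. if z = z0 then deriv (f i j) z0 else (f i j z - f i j z0) / (z - z0)) holomorphic_on UNIV"
      by (rule pole_lemma_open[OF fh]) simp
    then show ?thesis using True by (simp add: E_def)
  qed (simp add: E_def fh)
  have fac: "D z ** T = E z ** diag_mat (\<lambda>j. if j \<in> J then z - z0 else 1)" for z
  proof -
    have "(E z ** diag_mat (\<lambda>j. if j \<in> J then z - z0 else 1)) $ i $ j = E z $ i $ j * (if j \<in> J then z - z0 else 1)" for i j
      by (simp add: matrix_matrix_mult_def diag_mat_def if_distrib[where f="\<lambda>x. E z $ i $ _ * x"] cong: if_cong)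
    then show ?thesis by (auto simp: vec_eq_iff E_def f0 f_def[symmetric])
  qed
  have deriv_f: "deriv (f i j) z0 = (D' z0 ** T) $ i $ j" for i j
  proof -
    have "((\<lambda>z. \<Sum>k\<in>UNIV. D z $ i $ k * T $ k $ j) has_field_derivative (\<Sum>k\<in>UNIV. deriv (\<lambda>z. D z $ i $ k) z0 * T $ k $ j)) (at z0)"
      using holo by (intro DERIV_sum DERIV_cmult_right holomorphic_derivI[of _ UNIV]) auto
    then show ?thesis
      unfolding f_def matrix_matrix_mult_def D'_def by (simp add: DERIV_imp_deriv)
  qed
  have "det (E z0) \<noteq> 0"
  proof
    assume "det (E z0) = 0"
    then obtain w where w: "w \<noteq> 0" "E z0 *v w = 0" using det_eq_0_iff_kernel by blast
    define w1 :: "complex^'n" where "w1 = (\<chi> j. if j \<in> J then w $ j else 0)"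
    define w2 :: "complex^'n" where "w2 = (\<chi> j. if j \<in> J then 0 else w $ j)"
    have "(E z0 *v w) $ i = ((D' z0 ** T) *v w1 + (D z0 ** T) *v w2) $ i" for i
      unfolding matrix_vector_mult_def
      by (simp add: sum.distrib[symmetric]) (rule sum.cong, auto simp: E_def w1_def w2_def deriv_f f_def)
    then have e: "D' z0 *v (T *v w1) + D z0 *v (T *v w2) = 0"
      using w(2) by (simp add: vec_eq_iff matrix_vector_mul_assoc)
    have k: "D z0 *v (T *v w1) = 0"
      unfolding matrix_vector_mul_assoc
      by (simp add: vec_eq_iff matrix_vector_mult_def) (auto intro!: sum.neutral simp: w1_def J)
    have "T *v w1 = 0" using no_chain[OF _ k] e by blast
    then have "T' *v (T *v w1) = 0" by simp
    then have w1: "w1 = 0" by (simp add: matrix_vector_mul_assoc T)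
    then have "(D z0 ** T) *v w2 = 0" using e by (simp add: matrix_vector_mul_assoc)
    then have "w2 = 0" using Jc[of w2] by (auto simp: vec_eq_iff w2_def)
    moreover have "w = w1 + w2" by (simp add: vec_eq_iff w1_def w2_def)
    ultimately show False using w1 w(1) by simp
  qed
  then have "kernel_factors z0 T T' J E"
    unfolding kernel_factors_def using T Eh fac by blast
  then show ?thesis by blast
qed

end

section \<open>Poles, residues and ranks of matrix quotients\<close>

lemma det_diag_mat: "det (diag_mat d :: complex^'n^'n) = (\<Prod>i\<in>UNIV. d i)"
  by (subst det_diagonal) (auto simp: diag_mat_def)

lemma diag_mat_mult_nth: "(diag_mat d ** A) $ i $ j = d i * A $ i $ j"
proof -
  have "(diag_mat d ** A) $ i $ j = (\<Sum>k\<in>UNIV. if k = i then d i * A $ i $ j else 0)"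
    unfolding matrix_matrix_mult_def diag_mat_def vec_lambda_beta by (rule sum.cong) auto
  then show ?thesis by simp
qed

lemma row_mult: "row i (A ** B) = (\<Sum>k\<in>UNIV. A $ i $ k *s row k (B :: complex^'k^'n))"
  by (simp add: vec_eq_iff row_def matrix_matrix_mult_def)

text \<open>Multiplication by the invertible \<open>T\<close> preserves the row space, and the
  diagonal factor keeps only the rows of \<open>N\<close> with index in \<open>J\<close>.
  Independence is phrased through coefficient vectors supported in \<open>J\<close> because it must
  also exclude equal rows, which a set of rows would merge.\<close>

lemma rank_adapted:
  fixes T T' :: "complex^'n^'n" and N :: "complex^'k^'n"
  assumes T: "T' ** T = mat 1"
    and indep: "\<And>y. (\<And>j. j \<notin> J \<Longrightarrow> y $ j = 0) \<Longrightarrow> (\<Sum>j\<in>UNIV. y $ j *s row j N) = 0 \<Longrightarrow> y = 0"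
  shows "rank (T ** (diag_mat (\<lambda>j. if j \<in> J then 1 else 0) ** N)) = card J"
proof -
  define d :: "'n \<Rightarrow> complex" where "d j = (if j \<in> J then 1 else 0)" for j
  define R where "R = T ** (diag_mat d ** N)"
  define S where "S = (\<lambda>j. row j N) ` J"
  have rd: "row j (diag_mat d ** N) = d j *s row j N" for j
    by (simp add: vec_eq_iff row_def diag_mat_mult_nth)
  have inj: "inj_on (\<lambda>j. row j N) J"
  proof (rule inj_onI)
    fix a b assume ab: "a \<in> J" "b \<in> J" "row a N = row b N"
    show "a = b"
    proof (rule ccontr)
      assume "a \<noteq> b"
      define y :: "complex^'n" where "y = axis a 1 - axis b 1"
      have ax: "(\<Sum>j\<in>UNIV. axis c 1 $ j *s row j N) = row c N" for c
      proof -
        have "(\<Sum>j\<in>UNIV. axis c 1 $ j *s row j N) = (\<Sum>j\<in>UNIV. if j = c then row j N else 0)"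
          by (rule sum.cong) (auto simp: axis_def)
        then show ?thesis by simp
      qed
      have "(\<Sum>j\<in>UNIV. y $ j *s row j N) = (\<Sum>j\<in>UNIV. axis a 1 $ j *s row j N) - (\<Sum>j\<in>UNIV. axis b 1 $ j *s row j N)"
        unfolding y_def vector_minus_component vec.scale_left_diff_distrib by (rule sum_subtractf)
      then have "(\<Sum>j\<in>UNIV. y $ j *s row j N) = 0" by (simp only: ax ab(3) diff_self)
      then have "y = 0" by (intro indep) (use ab in \<open>auto simp: y_def axis_def\<close>)
      then have "y $ a = 0" by simp
      then show False using \<open>a \<noteq> b\<close> by (simp add: y_def axis_def)
    qed
  qed
  have "vec.independent S"
    unfolding S_def
  proof (rule vec.independent_if_scalars_zero)
    fix f x assume s: "(\<Sum>x\<in>(\<lambda>j. row j N) ` J. f x *s x) = 0" and x: "x \<in> (\<lambda>j. row j N) ` J"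
    then obtain j where j: "j \<in> J" "x = row j N" by auto
    define y :: "complex^'n" where "y = (\<chi> j. if j \<in> J then f (row j N) else 0)"
    have "(\<Sum>j\<in>UNIV. y $ j *s row j N) = (\<Sum>j\<in>J. f (row j N) *s row j N)"
      by (rule sum.mono_neutral_cong_right) (auto simp: y_def)
    also have "\<dots> = 0" using s by (simp add: sum.reindex[OF inj])
    finally have "y = 0" by (intro indep) (auto simp: y_def)
    then have "y $ j = 0" by simp
    then show "f x = 0" using j by (simp add: y_def)
  qed auto
  moreover have "vec.span S = vec.span (rows R)"
  proof (rule vec.span_eq[THEN iffD2], intro conjI subsetI)
    fix x assume "x \<in> S"
    then obtain j where j: "j \<in> J" "x = row j N" by (auto simp: S_def)
    have "T' ** R = diag_mat d ** N" by (simp add: R_def matrix_mul_assoc T)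
    then have "x = row j (T' ** R)" using j by (simp add: rd d_def)
    then show "x \<in> vec.span (rows R)"
      by (simp only: row_mult) (intro vec.span_sum vec.span_scale vec.span_base, auto simp: rows_def)
  next
    fix x assume "x \<in> rows R"
    then obtain i where "x = row i R" by (auto simp: rows_def)
    then have "x = (\<Sum>k\<in>UNIV. T $ i $ k *s row k (diag_mat d ** N))" unfolding R_def by (simp only: row_mult[of i T])
    then have xs: "x = (\<Sum>k\<in>UNIV. T $ i $ k *s (d k *s row k N))" unfolding rd .
    have k: "d k *s row k N \<in> vec.span S" for k
    proof (cases "k \<in> J")
      case True
      then have "row k N \<in> S" unfolding S_def by (rule imageI)
      then show ?thesis by (intro vec.span_scale vec.span_base)
    next
      case False
      then have "d k *s row k N = 0" by (simp add: d_def)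
      then show ?thesis by (simp only: vec.span_zero)
    qed
    have "(\<Sum>k\<in>UNIV. T $ i $ k *s (d k *s row k N)) \<in> vec.span S"
      by (intro vec.span_sum vec.span_scale[OF k])
    with xs show "x \<in> vec.span S" by (rule ssubst)
  qed
  ultimately have "rank R = card S"
    unfolding row_rank_def_gen by (rule vec.dim_eq_card[rotated])
  also have "\<dots> = card J" unfolding S_def by (rule card_image[OF inj])
  finally show ?thesis by (simp add: R_def d_def[abs_def])
qed

text \<open>Where \<open>det D\<close> vanishes, \<open>M\<close> is an arbitrary junk value.\<close>

locale matrix_quotient = entire_matrix D for D :: "complex \<Rightarrow> complex^'n^'n" +
  fixes Th M :: "complex \<Rightarrow> complex^'n^'n"
  assumes Th_holo: "\<And>i j. (\<lambda>z. Th z $ i $ j) holomorphic_on UNIV"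
    and quotient: "\<And>z. det (D z) \<noteq> 0 \<Longrightarrow> D z ** M z = - Th z"
    and full_rank: "\<And>z (y :: complex^'n^'n). y ** D z = 0 \<Longrightarrow> y ** Th z = 0 \<Longrightarrow> y = 0"
    and nontrivial: "\<exists>z. det (D z) \<noteq> 0"
begin

lemma det_holo: "(\<lambda>z. det (D z)) holomorphic_on UNIV"
  by (rule holomorphic_det[OF holo])

lemma eventually_det_nonzero: "\<forall>\<^sub>F z in at z0. det (D z) \<noteq> 0"
proof -
  obtain z1 where "det (D z1) \<noteq> 0" using nontrivial by blast
  then show ?thesis
    using non_zero_neighbour_alt[OF det_holo, of z0 z1] by (auto elim: eventually_mono)
qed

definition num where "num k l z = - det (\<chi> i j. if j = k then Th z $ i $ l else D z $ i $ j)"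

lemma num_holo: "num k l holomorphic_on UNIV"
proof -
  have "(\<lambda>z. (\<chi> i j. if j = k then Th z $ i $ l else D z $ i $ j) $ i $ j) holomorphic_on UNIV" for i j
    by (cases "j = k") (simp_all add: holo Th_holo)
  then show ?thesis unfolding num_def by (intro holomorphic_intros holomorphic_det)
qed

lemma M_eq: 
  assumes "det (D z) \<noteq> 0"
  shows "M z $ k $ l = num k l z / det (D z)"
proof -
  have "D z ** (- M z) = Th z" using quotient[OF assms] by (simp add: matrix_mult.minus_right)
  from matrix_cramer[OF assms this, of k l]
  have "- (M z $ k $ l) = - num k l z / det (D z)" by (simp add: num_def)
  then show ?thesis by simp
qed

lemma M_singularity:
  "isolated_singularity_at (\<lambda>z. M z $ k $ l) z0" "not_essential (\<lambda>z. M z $ k $ l) z0"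
proof -
  have ev: "\<forall>\<^sub>F z in at z0. num k l z / det (D z) = M z $ k $ l"
    using eventually_det_nonzero by (rule eventually_mono) (simp add: M_eq)
  have an: "num k l analytic_on {z0}" "(\<lambda>z. det (D z)) analytic_on {z0}"
    using num_holo det_holo by (simp_all add: analytic_on_holomorphic) auto
  have "isolated_singularity_at (\<lambda>z. num k l z / det (D z)) z0"
    by (intro singularity_intros isolated_singularity_at_analytic not_essential_analytic an)
  then show "isolated_singularity_at (\<lambda>z. M z $ k $ l) z0" 
    using isolated_singularity_at_cong[OF ev refl] by simp
  have "not_essential (\<lambda>z. num k l z / det (D z)) z0"
    by (intro singularity_intros isolated_singularity_at_analytic not_essential_analytic an)
  then show "not_essential (\<lambda>z. M z $ k $ l) z0"
    using not_essential_cong[OF ev refl] by simp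
qed

text \<open>Without a pole, M has a limit C with D(z0) C = -Th(z0). A left null vector of D(z0) then
  annihilates Th(z0) as well, against \<open>full_rank\<close>; so no zero of the determinant is
  cancelled by the numerators.\<close>

lemma matrix_pole_iff: "matrix_pole M z0 \<longleftrightarrow> det (D z0) = 0"
proof
  assume p: "matrix_pole M z0"
  show "det (D z0) = 0"
  proof (rule ccontr)
    assume d: "det (D z0) \<noteq> 0"
    have ev: "\<forall>\<^sub>F z in at z0. num k l z / det (D z) = M z $ k $ l" for k l
      using eventually_det_nonzero by (rule eventually_mono) (simp add: M_eq)
    have c: "continuous_on UNIV (num k l)" "continuous_on UNIV (\<lambda>z. det (D z))" for k l
      using num_holo det_holo holomorphic_on_imp_continuous_on by blast+
    have "((\<lambda>z. num k l z / det (D z)) \<longlongrightarrow> num k l z0 / det (D z0)) (at z0)" for k l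
      by (intro tendsto_divide) (use c(1)[of k l] c(2) d in \<open>auto simp: continuous_on_eq_continuous_within isCont_def\<close>)
    then have "((\<lambda>z. M z $ k $ l) \<longlongrightarrow> num k l z0 / det (D z0)) (at z0)" for k l
      using tendsto_cong[OF ev[of k l]] by blast
    then have "\<not> is_pole (\<lambda>z. M z $ k $ l) z0" for k l
      by (metis at_neq_bot not_tendsto_and_filterlim_at_infinity is_pole_def)
    then show False using p by (simp add: matrix_pole_def)
  qed
next
  assume d: "det (D z0) = 0"
  show "matrix_pole M z0"
  proof (rule ccontr)
    assume "\<not> matrix_pole M z0"
    then have np: "\<not> is_pole (\<lambda>z. M z $ k $ l) z0" for k l
      using M_singularity by (auto simp: matrix_pole_def)
    then have "\<exists>c. ((\<lambda>z. M z $ k $ l) \<longlongrightarrow> c) (at z0)" for k l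
      using M_singularity(2)[of k l z0] by (auto simp: not_essential_def)
    then obtain c where c: "\<And>k l. ((\<lambda>z. M z $ k $ l) \<longlongrightarrow> c k l) (at z0)" by metis
    define C :: "complex^'n^'n" where "C = (\<chi> k l. c k l)"
    have Dc: "((\<lambda>z. D z $ i $ j) \<longlongrightarrow> D z0 $ i $ j) (at z0)" "((\<lambda>z. Th z $ i $ j) \<longlongrightarrow> Th z0 $ i $ j) (at z0)" for i j
      using holomorphic_on_imp_continuous_on[OF holo[of i j]] holomorphic_on_imp_continuous_on[OF Th_holo[of i j]]
      by (auto simp: continuous_on_eq_continuous_within isCont_def)
    have "(D z0 ** C) $ i $ j = (- Th z0) $ i $ j" for i j
    proof (rule tendsto_unique[of "at z0"])
      show "((\<lambda>z. (D z ** M z) $ i $ j) \<longlongrightarrow> (D z0 ** C) $ i $ j) (at z0)"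
        unfolding matrix_matrix_mult_def by (simp add: C_def) (intro tendsto_intros Dc c)
      have "((\<lambda>z. (- Th z) $ i $ j) \<longlongrightarrow> (- Th z0) $ i $ j) (at z0)" by (simp add: tendsto_minus Dc)
      then show "((\<lambda>z. (D z ** M z) $ i $ j) \<longlongrightarrow> (- Th z0) $ i $ j) (at z0)"
      proof (rule Lim_transform_eventually)
        show "\<forall>\<^sub>F z in at z0. (- Th z) $ i $ j = (D z ** M z) $ i $ j"
          using eventually_det_nonzero by (rule eventually_mono) (simp add: quotient)
      qed
    qed auto
    then have DC: "D z0 ** C = - Th z0" by (simp add: vec_eq_iff)
    have "det (transpose (D z0)) = 0" using d by simp
    then obtain v where v: "v \<noteq> 0" "transpose (D z0) *v v = 0" using det_eq_0_iff_kernel by blast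
    \<comment> \<open>\<open>full_rank\<close> speaks of square matrices, so the left null vector is
      repeated in every row.\<close>
    define y :: "complex^'n^'n" where "y = (\<chi> i j. v $ j)"
    have "y ** D z0 = 0"
      using v(2) by (simp add: y_def vec_eq_iff matrix_matrix_mult_def matrix_vector_mult_def transpose_def mult.commute)
    moreover have "y ** Th z0 = - (y ** D z0 ** C)" by (simp add: matrix_mul_assoc[symmetric] DC matrix_mult.minus_right)
    ultimately have "y = 0" using full_rank[of y z0] by simp
    then show False using v(1) by (simp add: y_def vec_eq_iff)
  qed
qed

text \<open>By the factorization M = T G^{-1} N, where N = -E^{-1} Th is holomorphic near
  \<open>z0\<close> and G is diagonal with entries z - z0 on \<open>J\<close> and 1 elsewhere.
  Keeping the rows of N(z0) in \<open>J\<close> and multiplying by T gives the residue;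
  \<open>full_rank\<close> makes these rows independent. So the rank is card J, which is also the
  order of the zero of det D.\<close>

lemma no_chain_imp_simple_pole:
  assumes no_chain: "\<And>u v. u \<noteq> 0 \<Longrightarrow> D z0 *v u = 0 \<Longrightarrow> D' z0 *v u + D z0 *v v \<noteq> 0"
    and d: "det (D z0) = 0"
  shows "simple_matrix_pole M z0" "rank (matrix_residue M z0) = nat (zorder (\<lambda>z. det (D z)) z0)"
proof -
  obtain T T' J E where kf: "kernel_factors z0 T T' J E"
    using kernel_factorization[OF no_chain] by blast
  have T: "T ** T' = mat 1" "T' ** T = mat 1"
    and Eh: "\<And>i j. (\<lambda>z. E z $ i $ j) holomorphic_on UNIV" and E0: "det (E z0) \<noteq> 0"
    and fac: "\<And>z. D z ** T = E z ** diag_mat (\<lambda>j. if j \<in> J then z - z0 else 1)"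
    using kf unfolding kernel_factors_def by blast+
  have detEh: "(\<lambda>z. det (E z)) holomorphic_on UNIV" by (rule holomorphic_det[OF Eh])
  have dT: "det T \<noteq> 0" using T by (metis det_I det_mul mult_zero_left zero_neq_one)
  have detD: "det (D z) = det (E z) / det T * (z - z0) ^ card J" for z
  proof -
    have "det (D z) * det T = det (E z) * (\<Prod>j\<in>UNIV. if j \<in> J then z - z0 else 1)"
      using fac[of z] by (metis det_mul det_diag_mat)
    also have "(\<Prod>j\<in>UNIV. if j \<in> J then z - z0 else 1) = (\<Prod>j\<in>J. z - z0)"
      by (rule prod.mono_neutral_cong_right) auto
    finally show ?thesis using dT by (simp add: field_simps)
  qed
  have "zorder (\<lambda>z. det (D z)) z0 = int (card J)"
    by (rule zorder_eqI[of UNIV _ "\<lambda>z. det (E z) / det T"])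
       (use E0 dT detD detEh in \<open>auto intro!: holomorphic_intros\<close>)
  then have zo: "nat (zorder (\<lambda>z. det (D z)) z0) = card J" by simp
  \<comment> \<open>E^{-1} applied to -Th, written by Cramer's rule so that the entries are visibly
    holomorphic where det E does not vanish.\<close>
  define N :: "complex \<Rightarrow> complex^'n^'n" where
    "N z = (\<chi> k l. det (\<chi> i j. if j = k then - Th z $ i $ l else E z $ i $ j) / det (E z))" for z
  define U where "U = {z. det (E z) \<noteq> 0}"
  have U: "open U" "z0 \<in> U"
    using holomorphic_on_imp_continuous_on[OF detEh] E0 by (auto simp: U_def intro!: open_Collect_neq)
  have Nh: "(\<lambda>z. N z $ k $ l) holomorphic_on U" for k l
  proof -
    have "(\<lambda>z. (\<chi> i j. if j = k then - Th z $ i $ l else E z $ i $ j) $ i $ j) holomorphic_on U" for i j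
      by (cases "j = k") (auto intro!: holomorphic_intros holomorphic_on_subset[OF Eh] holomorphic_on_subset[OF Th_holo])
    then show ?thesis
      unfolding N_def by (auto intro!: holomorphic_intros holomorphic_det holomorphic_on_subset[OF detEh] simp: U_def)
  qed
  have EN: "E z ** N z = - Th z" if "z \<in> U" for z
  proof -
    have dE: "det (E z) \<noteq> 0" using that by (simp add: U_def)
    obtain X where X: "E z ** X = mat 1" using dE by (metis invertible_def invertible_det_nz)
    have "E z ** (X ** - Th z) = - Th z" unfolding matrix_mul_assoc X by simp
    note c = matrix_cramer[OF dE this]
    have "(X ** - Th z) $ k $ l = N z $ k $ l" for k l
      unfolding c N_def vec_lambda_beta vector_uminus_component ..
    then have "X ** - Th z = N z" unfolding vec_eq_iff by blast
    then show ?thesis using \<open>E z ** (X ** - Th z) = - Th z\<close> by simp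
  qed
  \<comment> \<open>Only the rows in \<open>J\<close> carry the factor 1/(z - z0): their sum P
    determines the residue, while H is holomorphic.\<close>
  define P where "P p l z = (\<Sum>k\<in>J. T $ p $ k * N z $ k $ l)" for p l z
  define H where "H p l z = (\<Sum>k\<in>-J. T $ p $ k * N z $ k $ l)" for p l z
  have Ph: "P p l holomorphic_on U" "H p l holomorphic_on U" for p l
    unfolding P_def H_def by (intro holomorphic_intros Nh)+
  have M: "M z $ p $ l = P p l z / (z - z0) + H p l z" if z: "z \<in> U" "z \<noteq> z0" for z p l
  proof -
    have dE: "det (E z) \<noteq> 0" using z by (simp add: U_def)
    then have dD: "det (D z) \<noteq> 0" using z dT by (simp add: detD)
    define G :: "complex^'n^'n" where "G = diag_mat (\<lambda>j. if j \<in> J then z - z0 else 1)"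
    have "E z ** (G ** (T' ** M z)) = D z ** T ** T' ** M z" by (simp add: fac G_def matrix_mul_assoc)
    also have "\<dots> = E z ** N z" using quotient[OF dD] EN[OF z(1)] T by (simp add: matrix_mul_assoc[symmetric])
    finally have "E z ** (G ** (T' ** M z)) = E z ** N z" .
    then have "X ** (E z ** (G ** (T' ** M z))) = X ** (E z ** N z)" for X :: "complex^'n^'n" by (simp only:)
    moreover obtain X where X: "X ** E z = mat 1" using dE by (metis invertible_def invertible_det_nz)
    ultimately have "X ** (E z ** (G ** (T' ** M z))) = X ** (E z ** N z)" by blast
    then have g: "G ** (T' ** M z) = N z" unfolding matrix_mul_assoc[of X] X by simp
    have t: "(T' ** M z) $ k $ l = N z $ k $ l / (if k \<in> J then z - z0 else 1)" for k
      using diag_mat_mult_nth[of "\<lambda>j. if j \<in> J then z - z0 else 1" "T' ** M z" k l] z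
      unfolding G_def[symmetric] g by (auto simp: field_simps)
    have e: "(T ** (T' ** M z)) $ p $ l = (\<Sum>k\<in>UNIV. T $ p $ k * (T' ** M z) $ k $ l)"
      by (simp only: matrix_matrix_mult_def[of T "T' ** M z"] vec_lambda_beta)
    have "T ** (T' ** M z) = M z" unfolding matrix_mul_assoc T by simp
    with e have "M z $ p $ l = (\<Sum>k\<in>UNIV. T $ p $ k * (T' ** M z) $ k $ l)"
      by (simp only:)
    also have "\<dots> = (\<Sum>k\<in>J. T $ p $ k * (T' ** M z) $ k $ l) + (\<Sum>k\<in>-J. T $ p $ k * (T' ** M z) $ k $ l)"
      using sum.Int_Diff[of UNIV "\<lambda>k. T $ p $ k * (T' ** M z) $ k $ l" J] by (simp add: Compl_eq_Diff_UNIV)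
    also have "\<dots> = P p l z / (z - z0) + H p l z"
      by (simp add: P_def H_def t sum_divide_distrib)
    finally show ?thesis .
  qed
  have res: "residue (\<lambda>z. M z $ p $ l) z0 = P p l z0" for p l
  proof -
    have "residue (\<lambda>z. M z $ p $ l) z0 = residue (\<lambda>z. (P p l z + H p l z * (z - z0)) / (z - z0)) z0"
    proof (rule residue_cong[OF _ refl])
      have "\<forall>\<^sub>F z in at z0. z \<in> U" using U eventually_at_topological by blast
      moreover have "\<forall>\<^sub>F z in at z0. z \<noteq> z0" by (simp add: eventually_at_filter)
      ultimately show "\<forall>\<^sub>F z in at z0. M z $ p $ l = (P p l z + H p l z * (z - z0)) / (z - z0)"
        by eventually_elim (simp add: M field_simps)
    qed
    also have "\<dots> = P p l z0 + H p l z0 * (z0 - z0)"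
      by (rule residue_simple[OF U]) (intro holomorphic_intros Ph)
    finally show ?thesis by simp
  qed
  have R: "matrix_residue M z0 = T ** (diag_mat (\<lambda>j. if j \<in> J then 1 else 0) ** N z0)"
  proof -
    have "P p l z0 = (\<Sum>k\<in>UNIV. T $ p $ k * (diag_mat (\<lambda>j. if j \<in> J then 1 else 0) ** N z0) $ k $ l)" for p l
      unfolding P_def diag_mat_mult_nth by (rule sum.mono_neutral_cong_left) auto
    then show ?thesis
      unfolding matrix_residue_def by (simp add: res vec_eq_iff) (simp add: matrix_matrix_mult_def)
  qed
  show rank: "rank (matrix_residue M z0) = nat (zorder (\<lambda>z. det (D z)) z0)"
    unfolding R zo
  proof (rule rank_adapted[OF T(2)])
    fix y :: "complex^'n" assume yJ: "\<And>j. j \<notin> J \<Longrightarrow> y $ j = 0" and s: "(\<Sum>j\<in>UNIV. y $ j *s row j (N z0)) = 0"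
    define Y :: "complex^'n^'n" where "Y = (\<chi> i j. y $ j)"
    obtain X where X: "X ** E z0 = mat 1" "E z0 ** X = mat 1" using E0 by (metis invertible_def invertible_det_nz)
    have YN: "Y ** N z0 = 0"
      using s by (simp add: vec_eq_iff Y_def matrix_matrix_mult_def row_def)
    have XE: "X ** (E z0 ** B) = B" for B :: "complex^'n^'n" by (simp add: matrix_mul_assoc X)
    \<comment> \<open>At \<open>z0\<close> the diagonal factor vanishes on \<open>J\<close>, where
      alone y is supported. Hence Y E(z0)^{-1} annihilates D(z0); it annihilates Th(z0) because Y
      N(z0) = 0.\<close>
    have "Y ** diag_mat (\<lambda>j. if j \<in> J then z0 - z0 else 1) = 0"
      using yJ by (auto simp: vec_eq_iff Y_def matrix_matrix_mult_def diag_mat_def intro!: sum.neutral)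
    then have "Y ** (X ** (D z0 ** T)) = 0" by (simp only: fac XE)
    then have "Y ** (X ** (D z0 ** T)) ** T' = 0" by simp
    then have "(Y ** X) ** D z0 ** (T ** T') = 0" by (simp only: matrix_mul_assoc)
    then have 1: "(Y ** X) ** D z0 = 0" by (simp add: T)
    have "Y ** (X ** (E z0 ** N z0)) = 0" by (simp only: XE YN)
    then have "(Y ** X) ** Th z0 = 0"
      unfolding EN[OF U(2)] by (simp add: matrix_mult.minus_right matrix_mul_assoc)
    with 1 have "Y ** X = 0" by (rule full_rank)
    then have "(Y ** X) ** E z0 = 0" by simp
    then have "Y ** (X ** E z0) = 0" by (simp only: matrix_mul_assoc)
    then have "Y = 0" by (simp add: X)
    then show "y = 0" by (simp add: Y_def vec_eq_iff)
  qed
  show "simple_matrix_pole M z0"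
    unfolding simple_matrix_pole_def
  proof (intro conjI allI impI)
    show "matrix_pole M z0" using d matrix_pole_iff by blast
    fix p l assume pole: "is_pole (\<lambda>z. M z $ p $ l) z0"
    define g where "g z = P p l z + H p l z * (z - z0)" for z
    have gh: "g holomorphic_on U" unfolding g_def by (intro holomorphic_intros Ph)
    have Mg: "M z $ p $ l = g z / (z - z0)" if "z \<in> U" "z \<noteq> z0" for z
      using M[OF that] that by (simp add: g_def field_simps)
    \<comment> \<open>Otherwise the difference quotient of g would give this entry a finite limit at
      \<open>z0\<close>.\<close>
    have "g z0 \<noteq> 0"
    proof
      assume g0: "g z0 = 0"
      have "(g has_field_derivative deriv g z0) (at z0)"
        using gh U holomorphic_derivI by blast
      then have "((\<lambda>z. (g z - g z0) / (z - z0)) \<longlongrightarrow> deriv g z0) (at z0)"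
        by (simp add: has_field_derivative_iff)
      then have "((\<lambda>z. M z $ p $ l) \<longlongrightarrow> deriv g z0) (at z0)"
      proof (rule Lim_transform_eventually)
        have "\<forall>\<^sub>F z in at z0. z \<in> U" using U eventually_at_topological by blast
        moreover have "\<forall>\<^sub>F z in at z0. z \<noteq> z0" by (simp add: eventually_at_filter)
        ultimately show "\<forall>\<^sub>F z in at z0. (g z - g z0) / (z - z0) = M z $ p $ l"
          by eventually_elim (simp add: Mg g0)
      qed
      then show False using pole
        by (metis at_neq_bot not_tendsto_and_filterlim_at_infinity is_pole_def)
    qed
    then show "zorder (\<lambda>z. M z $ p $ l) z0 = - 1"
      by (intro zorder_eqI[OF U gh]) (auto simp: Mg power_int_minus field_simps)
  qed
qed

end

section \<open>The characteristic matrix\<close>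

lemma has_integral_reflect_pi:
  fixes g :: "real \<Rightarrow> 'e::euclidean_space"
  assumes "(g has_integral i) {pi - b..pi - a}"
  shows "((\<lambda>t. g (pi - t)) has_integral i) {a..b}"
proof -
  have "((\<lambda>t. g (pi + t)) has_integral i) {- b..- a}"
    using assms has_integral_shift_Icc_real[of g pi i "-b" "-a"] by (simp add: o_def add.commute)
  then have "((\<lambda>t. g (pi + - t)) has_integral i) {a..b}"
    using has_integral_reflect_real[of "\<lambda>t. g (pi + - t)" i "b" "a"] by simp
  then show ?thesis by simp
qed

lemma absolutely_integrable_reflect_pi:
  fixes g :: "real \<Rightarrow> 'e::euclidean_space"
  assumes "g absolutely_integrable_on {0..pi}"
  shows "(\<lambda>t. g (pi - t)) absolutely_integrable_on {0..pi}"
proof (rule absolutely_integrable_onI)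
  have "g integrable_on {0..pi}" "(\<lambda>t. norm (g t)) integrable_on {0..pi}"
    using assms absolutely_integrable_on_def by blast+
  then show "(\<lambda>t. g (pi - t)) integrable_on {0..pi}" "(\<lambda>t. norm (g (pi - t))) integrable_on {0..pi}"
    using has_integral_reflect_pi[of g _ pi 0] has_integral_reflect_pi[of "\<lambda>t. norm (g t)" _ pi 0]
    by (auto simp: integrable_on_def)
qed

lemma has_W11_derivative_reflect:
  assumes W: "has_W11_derivative f g"
  shows "has_W11_derivative (\<lambda>x. f (pi - x)) (\<lambda>x. - g (pi - x))"
proof (rule has_W11_derivativeI)
  show "(\<lambda>x. - g (pi - x)) absolutely_integrable_on {0..pi}"
    using absolutely_integrable_linear[OF absolutely_integrable_reflect_pi[OF has_W11_derivativeD(1)[OF W]] bounded_linear_minus[OF bounded_linear_ident]]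
    by (simp add: o_def)
  fix x :: real assume x: "x \<in> {0..pi}"
  have "(g has_integral (f pi - f (pi - x))) {pi - x..pi - 0}"
    using has_W11_derivative_nth[OF W, of "pi - x" pi] x by (simp add: has_integral_iff)
  from has_integral_reflect_pi[OF this] show "f (pi - x) = f (pi - 0) + integral {0..x} (\<lambda>x. - g (pi - x))"
    by (simp add: integral_unique)
qed

definition reflected :: "'m::finite pencil \<Rightarrow> 'm pencil" where
  "reflected L = L\<lparr>Q1 := (\<lambda>x. Q1 L (pi - x)), Q0 := (\<lambda>x. Q0 L (pi - x))\<rparr>"

context regular_pencil
begin

lemma reflected_regular: "regular_pencil (reflected L)"
proof
  show "continuous_on {0..pi} (Q1 (reflected L))"
    unfolding reflected_def by (simp, rule continuous_on_compose2[OF Q1_cont]) (auto intro!: continuous_intros)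
  show "Q0 (reflected L) absolutely_integrable_on {0..pi}"
    using absolutely_integrable_reflect_pi[OF Q0_L1] by (simp add: reflected_def)
qed

text \<open>The reflection of x to \<pi> - x turns data at \<pi> into initial data with opposite
  slope. The reflected pencil satisfies the same regularity conditions, so the Neumann series
  applies to it.\<close>

lemma terminal_value_problem:
  fixes a b :: "complex^'m^'m"
  shows "\<exists>Y Z. sol L \<rho> Y Z \<and> Y pi = a \<and> Z pi = b"
proof -
  interpret r: regular_pencil "reflected L" by (rule reflected_regular)
  define X where "X = r.psum a (- b) \<rho>"
  define X' where "X' = r.psum_deriv a (- b) \<rho>"
  have s: "sol (reflected L) \<rho> X X'" unfolding X_def X'_def by (rule r.psum_sol)
  have c: "coef (reflected L) \<rho> x = coef L \<rho> (pi - x)" for x by (simp add: coef_def reflected_def)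
  have "sol L \<rho> (\<lambda>x. X (pi - x)) (\<lambda>x. - X' (pi - x))"
    unfolding sol_def
  proof (intro conjI ballI)
    fix x assume x: "x \<in> {0..pi}"
    have "(X has_vector_derivative X' (pi - x)) (at (pi - x) within {0..pi})"
      using s x by (auto simp: sol_def)
    moreover have "(\<lambda>x. pi - x) ` {0..pi} = {0..pi}" by (auto simp: image_iff intro!: bexI[of _ "pi - _"])
    ultimately have "(X has_vector_derivative X' (pi - x)) (at (pi - x) within (\<lambda>x. pi - x) ` {0..pi})" by simp
    moreover have "((\<lambda>x. pi - x) has_vector_derivative 0 - 1) (at x within {0..pi})"
      by (intro has_vector_derivative_diff has_vector_derivative_const has_vector_derivative_id)
    ultimately have "(X \<circ> (\<lambda>x. pi - x) has_vector_derivative (0 - 1) *\<^sub>R X' (pi - x)) (at x within {0..pi})"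
      by (rule vector_diff_chain_within[rotated])
    then show "((\<lambda>x. X (pi - x)) has_vector_derivative - X' (pi - x)) (at x within {0..pi})" by (simp add: o_def)
  next
    have "has_W11_derivative X' (\<lambda>x. - (coef L \<rho> (pi - x) ** X x))" using s by (simp add: sol_def c)
    from has_W11_derivative_linear[OF has_W11_derivative_reflect[OF this] bounded_linear_minus[OF bounded_linear_ident]]
    show "has_W11_derivative (\<lambda>x. - X' (pi - x)) (\<lambda>x. - (coef L \<rho> x ** X (pi - x)))" by simp
  qed
  moreover have "X (pi - pi) = a" "- X' (pi - pi) = b" by (simp_all add: X_def X'_def r.psum_0)
  ultimately show ?thesis by blast
qed

text \<open>Explicit counterpart of \<open>phi\<close>. A choice made separately for each \<rho>
  says nothing about the dependence on \<rho>, whereas this combination of Neumann series is entire.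
  \<open>phi_eq\<close> identifies the two on [0, \<pi>].\<close>

definition ph where "ph \<rho> x = psum (mat 1) 0 \<rho> x - psum 0 (mat 1) \<rho> x ** ((\<i> * \<rho>) *\<^sub>C h1 L + h0 L)"
definition ph' where "ph' \<rho> x = psum_deriv (mat 1) 0 \<rho> x - psum_deriv 0 (mat 1) \<rho> x ** ((\<i> * \<rho>) *\<^sub>C h1 L + h0 L)"

definition Delta where "Delta \<rho> = ph' \<rho> pi + ((\<i> * \<rho>) *\<^sub>C H1 L + H0 L) ** ph \<rho> pi"
definition Theta where "Theta \<rho> = psum_deriv 0 (mat 1) \<rho> pi + ((\<i> * \<rho>) *\<^sub>C H1 L + H0 L) ** psum 0 (mat 1) \<rho> pi"

lemma ph_sol: "sol L \<rho> (ph \<rho>) (ph' \<rho>)"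
  unfolding ph_def[abs_def] ph'_def[abs_def] by (intro sol_diff sol_mult psum_sol)

lemma ph_0: "ph \<rho> 0 = mat 1" "ph' \<rho> 0 = - ((\<i> * \<rho>) *\<^sub>C h1 L + h0 L)"
  by (simp_all add: ph_def ph'_def psum_0)

lemma ph_holomorphic:
  assumes "x \<in> {0..pi}"
  shows "(\<lambda>\<rho>. ph \<rho> x $ i $ j) holomorphic_on UNIV" "(\<lambda>\<rho>. ph' \<rho> x $ i $ j) holomorphic_on UNIV"
  unfolding ph_def ph'_def vector_minus_component
  by (intro holomorphic_intros psum_holomorphic psum_deriv_holomorphic holomorphic_matrix_mult assms,
      simp, intro holomorphic_intros)+

lemma Delta_holomorphic: "(\<lambda>\<rho>. Delta \<rho> $ i $ j) holomorphic_on UNIV"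
  unfolding Delta_def vector_add_component
  by (intro holomorphic_intros holomorphic_matrix_mult ph_holomorphic) (auto intro!: holomorphic_intros)

lemma Theta_holomorphic: "(\<lambda>\<rho>. Theta \<rho> $ i $ j) holomorphic_on UNIV"
  unfolding Theta_def vector_add_component
  by (intro holomorphic_intros holomorphic_matrix_mult psum_holomorphic psum_deriv_holomorphic) (auto intro!: holomorphic_intros)

lemma bc_eq:
  "bc_U L \<rho> Y = deriv_I Y 0 + ((\<i> * \<rho>) *\<^sub>C h1 L + h0 L) ** Y 0"
  "bc_V L \<rho> Y = deriv_I Y pi + ((\<i> * \<rho>) *\<^sub>C H1 L + H0 L) ** Y pi"
  by (simp_all add: bc_U_def bc_V_def mat_mult_scm)

text \<open>U(Y) = 0 expresses the slope at 0 through Y(0), so uniqueness leaves only right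
  multiples of \<phi>. Any number of columns is allowed, in order to cover eigenfunctions and matrix
  solutions at once.\<close>

lemma solution_of_U:
  fixes Y :: "real \<Rightarrow> complex^'k^'m"
  assumes s: "solves L \<rho> Y" and U: "bc_U L \<rho> Y = 0" and x: "x \<in> {0..pi}"
  shows "Y x = ph \<rho> x ** Y 0" "deriv_I Y x = ph' \<rho> x ** Y 0"
proof -
  have "deriv_I Y 0 = - (((\<i> * \<rho>) *\<^sub>C h1 L + h0 L) ** Y 0)" using U by (simp add: bc_eq add_eq_0_iff2)
  then have *: "Y 0 = ph \<rho> 0 ** Y 0" "deriv_I Y 0 = ph' \<rho> 0 ** Y 0"
    by (simp_all add: ph_0 matrix_mult.minus_left matrix_mult.diff_left matrix_mult.add_left)
  show "Y x = ph \<rho> x ** Y 0" "deriv_I Y x = ph' \<rho> x ** Y 0"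
    using sol_unique[OF s[unfolded solves_iff_sol] sol_mult[OF ph_sol, of \<rho> "Y 0"] * x] by auto
qed

lemma phi_eq:
  assumes x: "x \<in> {0..pi}"
  shows "phi L \<rho> x = ph \<rho> x" "deriv_I (phi L \<rho>) x = ph' \<rho> x"
proof -
  have "solves L \<rho> (ph \<rho>) \<and> ph \<rho> 0 = mat 1 \<and> bc_U L \<rho> (ph \<rho>) = 0"
    using sol_imp_solves[OF ph_sol] sol_deriv_I[OF ph_sol, of 0 \<rho>] by (simp add: bc_eq ph_0)
  then have "solves L \<rho> (phi L \<rho>) \<and> phi L \<rho> 0 = mat 1 \<and> bc_U L \<rho> (phi L \<rho>) = 0"
    unfolding phi_def by (rule someI[where P="\<lambda>Y. solves L \<rho> Y \<and> Y 0 = mat 1 \<and> bc_U L \<rho> Y = 0"])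
  then show "phi L \<rho> x = ph \<rho> x" "deriv_I (phi L \<rho>) x = ph' \<rho> x"
    using solution_of_U[OF _ _ x, of \<rho> "phi L \<rho>"] by auto
qed

lemma bc_V_phi: "bc_V L \<rho> (phi L \<rho>) = Delta \<rho>"
  by (simp add: bc_eq phi_eq Delta_def)

lemma bc_V_of_U:
  fixes Y :: "real \<Rightarrow> complex^'k^'m"
  assumes "solves L \<rho> Y" "bc_U L \<rho> Y = 0"
  shows "bc_V L \<rho> Y = Delta \<rho> ** Y 0"
  using solution_of_U[OF assms, of pi] by (simp add: bc_eq Delta_def matrix_mult.add_left matrix_mul_assoc)

lemma ph_mult_solution:
  fixes u :: "complex^'k^'m"
  shows "solves L \<rho> (\<lambda>x. ph \<rho> x ** u)" "bc_U L \<rho> (\<lambda>x. ph \<rho> x ** u) = 0"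
    "bc_V L \<rho> (\<lambda>x. ph \<rho> x ** u) = Delta \<rho> ** u"
proof -
  have s: "sol L \<rho> (\<lambda>x. ph \<rho> x ** u) (\<lambda>x. ph' \<rho> x ** u)" by (intro sol_mult ph_sol)
  then show so: "solves L \<rho> (\<lambda>x. ph \<rho> x ** u)" by (rule sol_imp_solves)
  show U: "bc_U L \<rho> (\<lambda>x. ph \<rho> x ** u) = 0"
    using sol_deriv_I[OF s, of 0] by (simp add: bc_eq ph_0 matrix_mult.minus_left matrix_mult.diff_left matrix_mult.add_left)
  show "bc_V L \<rho> (\<lambda>x. ph \<rho> x ** u) = Delta \<rho> ** u"
    using bc_V_of_U[OF so U] by (simp add: ph_0)
qed

text \<open>Solutions with values in vectors are one-column matrices, whereas kernel elements are
  plain vectors; this translates between the two.\<close>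

definition colm :: "complex^'n \<Rightarrow> complex^1^'n" where "colm v = (\<chi> i j. v $ i)"

lemma colm_mult: "A ** colm v = colm (A *v v)"
  by (simp add: vec_eq_iff colm_def matrix_matrix_mult_def matrix_vector_mult_def)

lemma colm_eq_0 [simp]: "colm v = 0 \<longleftrightarrow> v = 0"
  by (simp add: vec_eq_iff colm_def)

lemma colm_surj: "\<exists>v. u = colm v"
  by (rule exI[of _ "\<chi> i. u $ i $ 1"]) (simp add: vec_eq_iff colm_def forall_1)

lemma eigenvalues_iff: "\<rho> \<in> eigenvalues L \<longleftrightarrow> det (Delta \<rho>) = 0"
proof
  assume "\<rho> \<in> eigenvalues L"
  then obtain Y :: "real \<Rightarrow> complex^1^'m" and x where Y: "solves L \<rho> Y" "bc_U L \<rho> Y = 0" "bc_V L \<rho> Y = 0" "x \<in> {0..pi}" "Y x \<noteq> 0"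
    unfolding eigenvalues_def by auto
  have "Y 0 \<noteq> 0" using solution_of_U(1)[OF Y(1,2,4)] Y(5) by auto
  obtain v where v: "Y 0 = colm v" using colm_surj by blast
  have "Delta \<rho> ** Y 0 = 0" using bc_V_of_U[OF Y(1,2)] Y(3) by simp
  then have "Delta \<rho> *v v = 0" "v \<noteq> 0" using v \<open>Y 0 \<noteq> 0\<close> by (auto simp: colm_mult)
  then show "det (Delta \<rho>) = 0" using det_eq_0_iff_kernel by blast
next
  assume "det (Delta \<rho>) = 0"
  then obtain v where v: "v \<noteq> 0" "Delta \<rho> *v v = 0" using det_eq_0_iff_kernel by blast
  have "solves L \<rho> (\<lambda>x. ph \<rho> x ** colm v) \<and> bc_U L \<rho> (\<lambda>x. ph \<rho> x ** colm v) = 0 \<and>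
     bc_V L \<rho> (\<lambda>x. ph \<rho> x ** colm v) = 0 \<and> (\<exists>x\<in>{0..pi}. ph \<rho> x ** colm v \<noteq> 0)"
    using v ph_mult_solution[of \<rho> "colm v"] by (auto simp: colm_mult ph_0 intro!: bexI[of _ 0])
  then show "\<rho> \<in> eigenvalues L" unfolding eigenvalues_def by blast
qed

text \<open>\<Phi> - S satisfies the condition at 0 and has the value M there, so V(\<Phi> - S) =
  \<Delta> M, while V(\<Phi>) = 0 and V(S) = \<Theta>. The choice defining \<Phi> is justified by
  the explicit solution S - \<phi> \<Delta>^{-1} \<Theta>.\<close>

lemma Delta_weyl:
  assumes d: "det (Delta \<rho>) \<noteq> 0"
  shows "Delta \<rho> ** weyl_matrix L \<rho> = - Theta \<rho>"
proof -
  obtain B where B: "Delta \<rho> ** B = mat 1"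
    using d by (metis invertible_def invertible_det_nz)
  define S where "S = psum 0 (mat 1) \<rho>"
  define S' where "S' = psum_deriv 0 (mat 1) \<rho>"
  have S: "sol L \<rho> S S'" unfolding S_def S'_def by (rule psum_sol)
  have S0: "S 0 = 0" "S' 0 = mat 1" by (simp_all add: S_def S'_def psum_0)
  have V_lin: "bc_V L \<rho> (\<lambda>x. Y x - S x) = bc_V L \<rho> Y - Theta \<rho>" "bc_U L \<rho> (\<lambda>x. Y x - S x) = bc_U L \<rho> Y - mat 1"
    "solves L \<rho> (\<lambda>x. Y x - S x)"
    if "solves L \<rho> Y" for Y
  proof -
    have s: "sol L \<rho> (\<lambda>x. Y x - S x) (\<lambda>x. deriv_I Y x - S' x)"
      using that unfolding solves_iff_sol by (rule sol_diff[OF _ S])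
    show "solves L \<rho> (\<lambda>x. Y x - S x)" by (rule sol_imp_solves[OF s])
    show "bc_V L \<rho> (\<lambda>x. Y x - S x) = bc_V L \<rho> Y - Theta \<rho>" "bc_U L \<rho> (\<lambda>x. Y x - S x) = bc_U L \<rho> Y - mat 1"
      using sol_deriv_I[OF s, of 0] sol_deriv_I[OF s, of pi] S0
      by (simp_all add: bc_eq Theta_def matrix_mult.diff_right S_def S'_def)
  qed
  define Y where "Y x = S x - ph \<rho> x ** (B ** Theta \<rho>)" for x
  have Ys: "sol L \<rho> Y (\<lambda>x. S' x - ph' \<rho> x ** (B ** Theta \<rho>))"
    unfolding Y_def[abs_def] by (intro sol_diff sol_mult S ph_sol)
  have "bc_V L \<rho> Y = Theta \<rho> - Delta \<rho> ** (B ** Theta \<rho>)"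
    using sol_deriv_I[OF Ys, of pi]
    by (simp add: bc_eq Y_def Theta_def Delta_def S_def S'_def matrix_mult.diff_right matrix_mult.add_left matrix_mul_assoc)
  then have YV: "bc_V L \<rho> Y = 0" by (simp add: matrix_mul_assoc B)
  have YU: "bc_U L \<rho> Y = mat 1"
    using sol_deriv_I[OF Ys, of 0] by (simp add: bc_eq Y_def S0 ph_0 matrix_mult.diff_right matrix_mult.minus_left matrix_mult.diff_left matrix_mult.add_left matrix_mult.minus_right)
  have "solves L \<rho> Y \<and> bc_U L \<rho> Y = mat 1 \<and> bc_V L \<rho> Y = 0"
    using sol_imp_solves[OF Ys] YU YV by blast
  then have w: "solves L \<rho> (weyl_solution L \<rho>) \<and> bc_U L \<rho> (weyl_solution L \<rho>) = mat 1 \<and> bc_V L \<rho> (weyl_solution L \<rho>) = 0"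
    unfolding weyl_solution_def by (rule someI[where P="\<lambda>Y. solves L \<rho> Y \<and> bc_U L \<rho> Y = mat 1 \<and> bc_V L \<rho> Y = 0"])
  have "bc_V L \<rho> (\<lambda>x. weyl_solution L \<rho> x - S x) = Delta \<rho> ** (weyl_solution L \<rho> 0 - S 0)"
    by (rule bc_V_of_U) (use V_lin[of "weyl_solution L \<rho>"] w in auto)
  then show ?thesis using V_lin(1)[of "weyl_solution L \<rho>"] w S0 by (simp add: weyl_matrix_def)
qed

text \<open>The block row (\<Delta>, \<Theta>) has a right inverse. The solution with Y(\<pi>) = 0
  and Y'(\<pi>) = I satisfies V(Y) = I, and its expansion \<phi> Y(0) + S U(Y) gives I = \<Delta>
  Y(0) + \<Theta> U(Y).\<close>

lemma Delta_Theta_full_rank: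
  fixes y :: "complex^'m^'k"
  assumes "y ** Delta \<rho> = 0" "y ** Theta \<rho> = 0"
  shows "y = 0"
proof -
  obtain Y Z :: "real \<Rightarrow> complex^'m^'m" where s: "sol L \<rho> Y Z" and b: "Y pi = 0" "Z pi = mat 1"
    using terminal_value_problem by blast
  define c where "c = Z 0 + ((\<i> * \<rho>) *\<^sub>C h1 L + h0 L) ** Y 0"
  have s': "sol L \<rho> (\<lambda>x. ph \<rho> x ** Y 0 + psum 0 (mat 1) \<rho> x ** c) (\<lambda>x. ph' \<rho> x ** Y 0 + psum_deriv 0 (mat 1) \<rho> x ** c)"
    by (intro sol_add sol_mult ph_sol psum_sol)
  have e: "Y 0 = ph \<rho> 0 ** Y 0 + psum 0 (mat 1) \<rho> 0 ** c" "Z 0 = ph' \<rho> 0 ** Y 0 + psum_deriv 0 (mat 1) \<rho> 0 ** c"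
    by (simp_all only: ph_0 psum_0 c_def matrix_mult.minus_left matrix_mul_lid matrix_mult.zero_left) simp_all
  have "Y pi = ph \<rho> pi ** Y 0 + psum 0 (mat 1) \<rho> pi ** c"
    by (rule sol_unique(1)[OF s s' e]) simp
  moreover have "Z pi = ph' \<rho> pi ** Y 0 + psum_deriv 0 (mat 1) \<rho> pi ** c"
    by (rule sol_unique(2)[OF s s' e]) simp
  ultimately have "mat 1 = Delta \<rho> ** Y 0 + Theta \<rho> ** c"
    using b by (simp add: Delta_def Theta_def matrix_mult.add_left matrix_mul_assoc[symmetric]
      add.commute add.left_commute matrix_mult.add_right[symmetric])
  then have "y = y ** Delta \<rho> ** Y 0 + y ** Theta \<rho> ** c"
    by (metis matrix_mul_assoc matrix_mul_rid matrix_mult.add_right)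
  then show ?thesis using assms by simp
qed

end

section \<open>Consequences of self-adjointness\<close>

definition cip :: "complex^1^'m \<Rightarrow> complex^1^'m \<Rightarrow> complex" where
  "cip X Y = (\<Sum>i\<in>UNIV. cnj (X $ i $ 1) * Y $ i $ 1)"

lemma cip_self: "cip X X = complex_of_real ((norm X)\<^sup>2)"
proof -
  have "cip X X = (\<Sum>i\<in>UNIV. complex_of_real ((cmod (X $ i $ 1))\<^sup>2))"
    unfolding cip_def by (rule sum.cong) (simp_all only: complex_norm_square mult.commute)
  also have "\<dots> = complex_of_real (\<Sum>i\<in>UNIV. (cmod (X $ i $ 1))\<^sup>2)" by simp
  also have "(\<Sum>i\<in>UNIV. (cmod (X $ i $ 1))\<^sup>2) = (norm X)\<^sup>2"
    by (simp add: norm_matrix_sq sum_1)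
  finally show ?thesis .
qed

lemma cip_cnj: "cnj (cip X Y) = cip Y X"
  by (simp add: cip_def mult.commute)

lemma cip_add_left: "cip (X + X') Y = cip X Y + cip X' Y"
  and cip_add_right: "cip X (Y + Y') = cip X Y + cip X Y'"
  and cip_diff_right: "cip X (Y - Y') = cip X Y - cip X Y'"
  and cip_minus_left: "cip (- X) Y = - cip X Y"
  and cip_minus_right: "cip X (- Y) = - cip X Y"
  and cip_scm_left: "cip (c *\<^sub>C X) Y = cnj c * cip X Y"
  and cip_scm_right: "cip X (c *\<^sub>C Y) = c * cip X Y"
  by (simp_all add: cip_def algebra_simps sum.distrib sum_subtractf sum_negf sum_distrib_left)

lemma cip_matrix_left: "cip (A ** X) Y = cip X (A\<^sup>\<dagger> ** Y)"
proof -
  have "cip (A ** X) Y = (\<Sum>i\<in>UNIV. \<Sum>k\<in>UNIV. cnj (A $ i $ k) * cnj (X $ k $ 1) * Y $ i $ 1)"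
    by (simp add: cip_def matrix_matrix_mult_def sum_distrib_right)
  also have "\<dots> = (\<Sum>k\<in>UNIV. \<Sum>i\<in>UNIV. cnj (A $ i $ k) * cnj (X $ k $ 1) * Y $ i $ 1)"
    by (rule sum.swap)
  also have "\<dots> = cip X (A\<^sup>\<dagger> ** Y)"
    by (simp add: cip_def matrix_matrix_mult_def hermitian_conj_def sum_distrib_left mult_ac)
  finally show ?thesis .
qed

lemma cip_le: "cmod (cip X Y) \<le> norm X * norm Y"
proof -
  have "cmod (cip X Y) \<le> (\<Sum>i\<in>UNIV. cmod (X $ i $ 1) * cmod (Y $ i $ 1))"
    unfolding cip_def by (rule sum_norm_le) (simp add: norm_mult)
  then have "(cmod (cip X Y))\<^sup>2 \<le> (\<Sum>i\<in>UNIV. cmod (X $ i $ 1) * cmod (Y $ i $ 1))\<^sup>2"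
    by (simp add: power_mono)
  also have "\<dots> \<le> (\<Sum>i\<in>UNIV. (cmod (X $ i $ 1))\<^sup>2) * (\<Sum>i\<in>UNIV. (cmod (Y $ i $ 1))\<^sup>2)"
    by (rule Cauchy_Schwarz_ineq_sum)
  also have "\<dots> = (norm X * norm Y)\<^sup>2"
    by (simp add: norm_matrix_sq sum_1 power_mult_distrib)
  finally show ?thesis by (rule power2_le_imp_le) simp
qed

lemma bounded_bilinear_cip: "bounded_bilinear (cip :: complex^1^'m \<Rightarrow> complex^1^'m \<Rightarrow> complex)"
proof
  show "\<exists>K. \<forall>(a :: complex^1^'m) b. norm (cip a b) \<le> norm a * norm b * K"
    by (rule exI[of _ 1]) (simp add: cip_le)
qed (simp_all add: cip_add_left cip_add_right, simp_all add: cip_def scaleR_sum_right algebra_simps)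

text \<open>Needed to pass to a limit in \<rho> under an integral over x when Jordan chains are
  excluded. Continuity is inherited from the partial sums by uniform convergence on products of
  discs with [0, \<pi>].\<close>

lemma continuous_on_psum_joint:
  assumes "regular_pencil L" 
  shows "continuous_on (UNIV \<times> {0..pi}) (\<lambda>(\<rho>, x). regular_pencil.psum L a b \<rho> x)"
proof -
  interpret regular_pencil L by fact
  have pf: "continuous_on (S \<times> {0..pi}) (\<lambda>(\<rho>, x). f \<rho> x)" if "polyfam f" for f :: "complex \<Rightarrow> real \<Rightarrow> complex^'m^'m" and S
    using that
  proof (induction rule: polyfam.induct)
    case (mono c k)
    have "continuous_on (S \<times> {0..pi}) (\<lambda>p. c (snd p))"
      by (rule continuous_on_compose2[OF mono continuous_on_snd[OF continuous_on_id]]) auto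
    then have "continuous_on (S \<times> {0..pi}) (\<lambda>p. fst p ^ k *\<^sub>C c (snd p))"
      by (intro scm.continuous_on continuous_intros)
    then show ?case by (simp add: case_prod_beta mat_mult_scm)
  next
    case (add f g)
    then show ?case by (simp add: case_prod_beta continuous_on_add)
  next
    case (cong f g)
    show ?case by (rule continuous_on_eq[OF cong.IH]) (auto simp: cong.hyps(2))
  qed
  have c: "continuous_on (cball 0 R \<times> {0..pi}) (\<lambda>(\<rho>, x). psum a b \<rho> x)" if "0 \<le> R" for R
  proof (rule uniform_limit_theorem[OF _ psum_uniform[OF that]])
    have "continuous_on (cball 0 R \<times> {0..pi}) (\<lambda>(\<rho>, x). \<Sum>i<n. picard a b i \<rho> x)" for n
      by (rule pf) (intro polyfam_sum polyfam_picard)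
    then show "\<forall>\<^sub>F n in sequentially. continuous_on (cball 0 R \<times> {0..pi}) (\<lambda>(\<rho>, x). \<Sum>i<n. picard a b i \<rho> x)"
      by (intro always_eventually allI)
  qed simp
  show ?thesis
    unfolding continuous_on_eq_continuous_within
  proof
    fix p :: "complex \<times> real" assume p: "p \<in> UNIV \<times> {0..pi}"
    define R where "R = cmod (fst p) + 1"
    have "p \<in> cball 0 R \<times> {0..pi}" using p by (auto simp: R_def)
    then have "continuous (at p within cball 0 R \<times> {0..pi}) (\<lambda>(\<rho>, x). psum a b \<rho> x)"
      using c[of R] by (auto simp: continuous_on_eq_continuous_within R_def)
    \<comment> \<open>The open disc of radius R is a neighbourhood of the first component, so near p
      the two domains agree and the local statement transfers.\<close>
    moreover have "at p within UNIV \<times> {0..pi} = at p within cball 0 R \<times> {0..pi}"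
    proof (rule at_within_nhd[of _ "ball 0 R \<times> UNIV"])
      show "p \<in> ball 0 R \<times> UNIV" using p by (auto simp: R_def)
    qed (auto simp: open_Times)
    ultimately show "continuous (at p within UNIV \<times> {0..pi}) (\<lambda>(\<rho>, x). psum a b \<rho> x)" by simp
  qed
qed

text \<open>At a minimum of |X|^2 the value is at most the mean. From there |X|^2 grows by at most
  the integral of 2 |X| |X'|, which Young's inequality splits with parameter \<open>e\<close>. The
  small weight on X' is what later allows boundary terms and an integrable potential to be absorbed
  into the Dirichlet integral.\<close>

lemma sup_norm_interpolation:
  fixes X :: "real \<Rightarrow> complex^1^'m"
  assumes X: "has_W11_derivative X X'" and cX': "continuous_on {0..pi} X'" and e: "e > 0" and x: "x \<in> {0..pi}"
  shows "(norm (X x))\<^sup>2 \<le> (1 / pi + 1 / e) * integral {0..pi} (\<lambda>t. (norm (X t))\<^sup>2) + e * integral {0..pi} (\<lambda>t. (norm (X' t))\<^sup>2)"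
proof -
  have cX: "continuous_on {0..pi} X" by (rule has_W11_derivative_continuous[OF X])
  define N where "N t = X t \<bullet> X t" for t
  have N: "N t = (norm (X t))\<^sup>2" for t by (simp add: N_def power2_norm_eq_inner)
  have Nf: "N = (\<lambda>t. (norm (X t))\<^sup>2)" by (simp add: N fun_eq_iff)
  have NW: "has_W11_derivative N (\<lambda>t. X' t \<bullet> X t + X t \<bullet> X' t)"
    unfolding N_def[abs_def] by (rule has_W11_derivative_prod[OF bounded_bilinear_inner X X])
  define g where "g t = (1 / e) * (norm (X t))\<^sup>2 + e * (norm (X' t))\<^sup>2" for t
  have cg: "continuous_on {0..pi} g" unfolding g_def by (intro continuous_intros cX cX')
  have "\<exists>t\<in>{0..pi}. \<forall>s\<in>{0..pi}. N t \<le> N s"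
    by (rule continuous_attains_inf) (auto intro!: has_W11_derivative_continuous[OF NW])
  then obtain t where t: "t \<in> {0..pi}" "\<And>s. s \<in> {0..pi} \<Longrightarrow> N t \<le> N s" by blast
  have Ni: "N integrable_on {0..pi}"
    by (rule integrable_continuous_real[OF has_W11_derivative_continuous[OF NW]])
  have "integral {0..pi} (\<lambda>_. N t) \<le> integral {0..pi} N"
    by (rule integral_le) (use t Ni in auto)
  then have t1: "N t \<le> (1 / pi) * integral {0..pi} N" by (simp add: field_simps)
  have bound: "norm (integral {a..b} (\<lambda>t. X' t \<bullet> X t + X t \<bullet> X' t)) \<le> integral {0..pi} g"
    if "0 \<le> a" "a \<le> b" "b \<le> pi" for a b
  proof -
    have gi: "g integrable_on {0..pi}" by (rule integrable_continuous_real[OF cg])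
    have gab: "g integrable_on {a..b}" by (rule integrable_on_subinterval[OF gi]) (use that in auto)
    have "norm (integral {a..b} (\<lambda>t. X' t \<bullet> X t + X t \<bullet> X' t)) \<le> integral {a..b} g"
    proof (rule integral_norm_bound_integral[OF has_W11_derivative_nth(2)[OF NW that] gab])
      fix s
      have "\<bar>X s \<bullet> X' s\<bar> \<le> norm (X s) * norm (X' s)" by (rule Cauchy_Schwarz_ineq2)
      moreover have "2 * (norm (X s) * norm (X' s)) \<le> g s"
      proof -
        have "0 \<le> (1 / e) * (norm (X s) - e * norm (X' s))\<^sup>2" using e by simp
        also have "\<dots> = g s - 2 * (norm (X s) * norm (X' s))" using e by (simp add: g_def power2_eq_square field_simps)
        finally show ?thesis by simp
      qed
      ultimately show "norm (X' s \<bullet> X s + X s \<bullet> X' s) \<le> g s" by (simp add: inner_commute)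
    qed
    also have "\<dots> \<le> integral {0..pi} g"
      by (rule integral_subset_le[OF _ gab gi]) (use that e in \<open>auto simp: g_def\<close>)
    finally show ?thesis .
  qed
  have "\<bar>N x - N t\<bar> \<le> integral {0..pi} g"
  proof (cases "t \<le> x")
    case True
    then show ?thesis using bound[of t x] has_W11_derivative_nth(1)[OF NW, of t x] x t(1) by auto
  next
    case False
    then show ?thesis using bound[of x t] has_W11_derivative_nth(1)[OF NW, of x t] x t(1) by auto
  qed
  also have "integral {0..pi} g = (1 / e) * integral {0..pi} N + e * integral {0..pi} (\<lambda>t. (norm (X' t))\<^sup>2)"
  proof -
    have i: "(\<lambda>t. (norm (X t))\<^sup>2) integrable_on {0..pi}" "(\<lambda>t. (norm (X' t))\<^sup>2) integrable_on {0..pi}"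
      by (intro integrable_continuous_real continuous_intros cX cX')+
    have "integral {0..pi} g = integral {0..pi} (\<lambda>t. (1 / e) * (norm (X t))\<^sup>2) + integral {0..pi} (\<lambda>t. e * (norm (X' t))\<^sup>2)"
      unfolding g_def by (intro Henstock_Kurzweil_Integration.integral_add integrable_on_mult_right i)
    then show ?thesis by (simp add: Nf)
  qed
  finally have "\<bar>N x - N t\<bar> \<le> (1 / e) * integral {0..pi} N + e * integral {0..pi} (\<lambda>t. (norm (X' t))\<^sup>2)" .
  then show ?thesis using t1 unfolding Nf by (simp add: distrib_right)
qed

section \<open>Green's identity and the quadratic equation for \<rho>\<close>

lemma hermitian_conj_simps:
  "(c *\<^sub>C A)\<^sup>\<dagger> = cnj c *\<^sub>C A\<^sup>\<dagger>" "(A + B)\<^sup>\<dagger> = A\<^sup>\<dagger> + B\<^sup>\<dagger>" "(mat c)\<^sup>\<dagger> = mat (cnj c)"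
  by (simp_all add: hermitian_conj_def vec_eq_iff mat_def)

locale selfadjoint_pencil = regular_pencil L for L :: "'m::finite pencil" +
  assumes Q1_skew: "AE x in lebesgue_on {0..pi}. (Q1 L x)\<^sup>\<dagger> = - Q1 L x"
    and Q0_herm: "AE x in lebesgue_on {0..pi}. (Q0 L x)\<^sup>\<dagger> = Q0 L x"
    and h1_skew: "(h1 L)\<^sup>\<dagger> = - h1 L" and h0_herm: "(h0 L)\<^sup>\<dagger> = h0 L"
    and H1_skew: "(H1 L)\<^sup>\<dagger> = - H1 L" and H0_herm: "(H0 L)\<^sup>\<dagger> = H0 L"
begin

definition bad where "bad = {x\<in>{0..pi}. \<not> ((Q1 L x)\<^sup>\<dagger> = - Q1 L x \<and> (Q0 L x)\<^sup>\<dagger> = Q0 L x)}"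

lemma bad: "negligible bad" "x \<in> {0..pi} - bad \<Longrightarrow> (Q1 L x)\<^sup>\<dagger> = - Q1 L x" "x \<in> {0..pi} - bad \<Longrightarrow> (Q0 L x)\<^sup>\<dagger> = Q0 L x"
proof -
  have "AE x in lebesgue_on {0..pi}. (Q1 L x)\<^sup>\<dagger> = - Q1 L x \<and> (Q0 L x)\<^sup>\<dagger> = Q0 L x"
    using Q1_skew Q0_herm by eventually_elim simp
  then show "negligible bad" unfolding bad_def by (rule AE_negligible)
qed (auto simp: bad_def)

lemma coef_adjoint:
  assumes "x \<in> {0..pi} - bad"
  shows "(coef L \<sigma> x)\<^sup>\<dagger> = coef L (cnj \<sigma>) x"
  using bad(2,3)[OF assms] by (simp add: coef_def mat_mult_scm hermitian_conj_simps scm.minus_left scm.minus_right)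

text \<open>Almost everywhere the adjoint of the coefficient at \<sigma> is the coefficient at
  \<open>cnj \<sigma>\<close>. The difference of two values of a quadratic polynomial factors, here
  into \<open>cnj \<sigma> - \<rho>\<close> and \<open>cnj \<sigma> + \<rho>\<close> + 2 i
  Q_1.\<close>

lemma green_identity:
  fixes X Y :: "real \<Rightarrow> complex^1^'m"
  assumes X: "sol L \<sigma> X X'" and Y: "sol L \<rho> Y Y'"
  shows "cip (X pi) (Y' pi) - cip (X' pi) (Y pi) - (cip (X 0) (Y' 0) - cip (X' 0) (Y 0))
    = (cnj \<sigma> - \<rho>) * integral {0..pi} (\<lambda>x. cip (X x) ((cnj \<sigma> + \<rho>) *\<^sub>C Y x + (2 * \<i>) *\<^sub>C (Q1 L x ** Y x)))"
proof -
  define g where "g x = cip (X x) ((cnj \<sigma> + \<rho>) *\<^sub>C Y x + (2 * \<i>) *\<^sub>C (Q1 L x ** Y x))" for x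
  note p = has_W11_derivative_prod[OF bounded_bilinear_cip]
  have "has_W11_derivative (\<lambda>x. cip (X x) (Y' x) - cip (X' x) (Y x))
     (\<lambda>x. (cip (X' x) (Y' x) + cip (X x) (- (coef L \<rho> x ** Y x))) - (cip (- (coef L \<sigma> x ** X x)) (Y x) + cip (X' x) (Y' x)))"
    by (intro has_W11_derivative_diff p sol_W11[OF X] sol_W11[OF Y])
  then have "has_W11_derivative (\<lambda>x. cip (X x) (Y' x) - cip (X' x) (Y x)) (\<lambda>x. (cnj \<sigma> - \<rho>) * g x)"
  proof (rule has_W11_derivative_spike[OF _ bad(1)])
    fix x assume x: "x \<in> {0..pi} - bad"
    show "(cip (X' x) (Y' x) + cip (X x) (- (coef L \<rho> x ** Y x))) - (cip (- (coef L \<sigma> x ** X x)) (Y x) + cip (X' x) (Y' x))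
      = (cnj \<sigma> - \<rho>) * g x"
      unfolding cip_minus_left cip_matrix_left coef_adjoint[OF x] g_def
      by (simp add: coef_def matrix_ring_simps cip_minus_right cip_add_right cip_diff_right cip_scm_right power2_eq_square algebra_simps)
  qed
  from has_W11_derivativeD(2)[OF this, of pi] show ?thesis by (simp add: g_def)
qed

text \<open>Together with \<open>energy_b\<close> and \<open>energy_a\<close> these are the
  coefficients of the quadratic equation, after integration by parts and elimination of X'(0) and
  X'(\<pi>) by the boundary conditions. The Dirichlet integral enters c with a negative sign, which
  is why c is bounded above.\<close>

definition energy_c :: "(real \<Rightarrow> complex^1^'m) \<Rightarrow> (real \<Rightarrow> complex^1^'m) \<Rightarrow> complex" where
  "energy_c X X' = integral {0..pi} (\<lambda>x. cip (X x) (Q0 L x ** X x)) - integral {0..pi} (\<lambda>x. cip (X' x) (X' x))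
     - cip (X pi) (H0 L ** X pi) + cip (X 0) (h0 L ** X 0)"

definition energy_b :: "(real \<Rightarrow> complex^1^'m) \<Rightarrow> complex" where
  "energy_b X = integral {0..pi} (\<lambda>x. cip (X x) ((2 * \<i>) *\<^sub>C (Q1 L x ** X x)))
     - \<i> * cip (X pi) (H1 L ** X pi) + \<i> * cip (X 0) (h1 L ** X 0)"

definition energy_a :: "(real \<Rightarrow> complex^1^'m) \<Rightarrow> real" where
  "energy_a X = integral {0..pi} (\<lambda>x. (norm (X x))\<^sup>2)"

lemma cip_integrable:
  assumes "continuous_on {0..pi} X" "g absolutely_integrable_on {0..pi}"
  shows "(\<lambda>x. cip (X x) (g x)) integrable_on {0..pi}"
  by (rule set_lebesgue_integral_eq_integral(1)[OF absolutely_integrable_continuous_prod[OF bounded_bilinear_cip assms]])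

lemma integral_of_real_norm:
  assumes "continuous_on {0..pi} (X :: real \<Rightarrow> complex^1^'m)"
  shows "integral {0..pi} (\<lambda>x. cip (X x) (X x)) = complex_of_real (energy_a X)"
proof -
  have i: "(\<lambda>x. (norm (X x))\<^sup>2) integrable_on {0..pi}" by (intro integrable_continuous_real continuous_intros assms)
  show ?thesis
    unfolding energy_a_def cip_self using integral_linear[OF i bounded_linear_of_real] by (simp add: o_def)
qed

lemma energy_identity:
  fixes X :: "real \<Rightarrow> complex^1^'m" and \<rho> :: complex
  assumes X: "sol L \<rho> X X'" and U: "X' 0 = - (((\<i> * \<rho>) *\<^sub>C h1 L + h0 L) ** X 0)"
    and V: "X' pi = - (((\<i> * \<rho>) *\<^sub>C H1 L + H0 L) ** X pi)"
  shows "energy_a X * \<rho>\<^sup>2 + energy_b X * \<rho> + energy_c X X' = 0"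
proof -
  note c = sol_continuous[OF X]
  have Q0i: "(\<lambda>x. Q0 L x ** X x) absolutely_integrable_on {0..pi}"
    by (rule absolutely_integrable_prod_continuous[OF bounded_bilinear_matrix_mult Q0_L1 c(1)])
  have Q1i: "(\<lambda>x. (2 * \<i>) *\<^sub>C (Q1 L x ** X x)) absolutely_integrable_on {0..pi}"
    by (intro absolutely_integrable_continuous_real scm.continuous_on matrix_mult.continuous_on continuous_intros Q1_cont c)
  have i0: "(\<lambda>x. cip (X x) (Q0 L x ** X x)) integrable_on {0..pi}"
    and i1: "(\<lambda>x. cip (X x) ((2 * \<i>) *\<^sub>C (Q1 L x ** X x))) integrable_on {0..pi}"
    and i2: "(\<lambda>x. cip (X x) (X x)) integrable_on {0..pi}" and i3: "(\<lambda>x. cip (X' x) (X' x)) integrable_on {0..pi}"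
    by (intro cip_integrable Q0i Q1i c absolutely_integrable_continuous_real)+
  have W: "has_W11_derivative (\<lambda>x. cip (X x) (X' x)) (\<lambda>x. cip (X' x) (X' x) + cip (X x) (- (coef L \<rho> x ** X x)))"
    by (rule has_W11_derivative_prod[OF bounded_bilinear_cip sol_W11[OF X]])
  have "(\<lambda>x. cip (X' x) (X' x) + cip (X x) (- (coef L \<rho> x ** X x))) = 
    (\<lambda>x. cip (X' x) (X' x) - (\<rho>\<^sup>2 * cip (X x) (X x) + (\<rho> * cip (X x) ((2 * \<i>) *\<^sub>C (Q1 L x ** X x)) + cip (X x) (Q0 L x ** X x))))"
    by (simp add: fun_eq_iff coef_def matrix_ring_simps cip_minus_right cip_diff_right cip_add_right cip_scm_right)
  then have "integral {0..pi} (\<lambda>x. cip (X' x) (X' x) + cip (X x) (- (coef L \<rho> x ** X x))) = 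
    integral {0..pi} (\<lambda>x. cip (X' x) (X' x) - (\<rho>\<^sup>2 * cip (X x) (X x) + (\<rho> * cip (X x) ((2 * \<i>) *\<^sub>C (Q1 L x ** X x)) + cip (X x) (Q0 L x ** X x))))"
    by (simp only:)
  also have "\<dots> = integral {0..pi} (\<lambda>x. cip (X' x) (X' x)) - (\<rho>\<^sup>2 * integral {0..pi} (\<lambda>x. cip (X x) (X x))
      + (\<rho> * integral {0..pi} (\<lambda>x. cip (X x) ((2 * \<i>) *\<^sub>C (Q1 L x ** X x))) + integral {0..pi} (\<lambda>x. cip (X x) (Q0 L x ** X x))))"
    by (rule integral_unique)
       (intro has_integral_diff has_integral_add has_integral_mult_right integrable_integral i0 i1 i2 i3)
  finally have I: "integral {0..pi} (\<lambda>x. cip (X' x) (X' x) + cip (X x) (- (coef L \<rho> x ** X x))) = \<dots>" .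
  have "cip (X pi) (X' pi) = cip (X 0) (X' 0) + integral {0..pi} (\<lambda>x. cip (X' x) (X' x) + cip (X x) (- (coef L \<rho> x ** X x)))"
    using has_W11_derivativeD(2)[OF W, of pi] by simp
  then show ?thesis
    unfolding I integral_of_real_norm[OF c(1)] U V energy_b_def energy_c_def
    by (simp add: cip_minus_right matrix_mult.add_left cip_add_right cip_diff_right scm_mult_left cip_scm_right algebra_simps)
qed

lemma cnj_integral: 
  assumes "f integrable_on {0..pi::real}"
  shows "cnj (integral {0..pi} f) = integral {0..pi} (\<lambda>x. cnj (f x))"
  using integral_linear[OF assms bounded_linear_cnj] by (simp add: o_def)

text \<open>The factor i turns the skew-Hermitian matrices Q_1, h_1 and H_1 into Hermitian
  ones.\<close>

lemma energy_b_real: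
  assumes c: "continuous_on {0..pi} X"
  shows "energy_b X \<in> \<real>"
proof -
  have Q1i: "(\<lambda>x. (2 * \<i>) *\<^sub>C (Q1 L x ** X x)) absolutely_integrable_on {0..pi}"
    by (intro absolutely_integrable_continuous_real scm.continuous_on matrix_mult.continuous_on continuous_intros Q1_cont c)
  have "cnj (integral {0..pi} (\<lambda>x. cip (X x) ((2 * \<i>) *\<^sub>C (Q1 L x ** X x)))) = integral {0..pi} (\<lambda>x. cnj (cip (X x) ((2 * \<i>) *\<^sub>C (Q1 L x ** X x))))"
    by (rule cnj_integral[OF cip_integrable[OF c Q1i]])
  also have "\<dots> = integral {0..pi} (\<lambda>x. cip (X x) ((2 * \<i>) *\<^sub>C (Q1 L x ** X x)))"
    by (rule integral_spike[OF bad(1)])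
       (simp add: cip_cnj cip_scm_left cip_scm_right cip_matrix_left bad matrix_mult.minus_left cip_minus_right)
  finally have 1: "cnj (integral {0..pi} (\<lambda>x. cip (X x) ((2 * \<i>) *\<^sub>C (Q1 L x ** X x)))) = \<dots>" .
  have 2: "cnj (cip Z (H1 L ** Z)) = - cip Z (H1 L ** Z)" "cnj (cip Z (h1 L ** Z)) = - cip Z (h1 L ** Z)" for Z
    by (simp_all add: cip_cnj cip_matrix_left H1_skew h1_skew matrix_mult.minus_left cip_minus_right)
  have "cnj (energy_b X) = energy_b X"
    unfolding energy_b_def by (simp add: 1 2)
  then show ?thesis using Reals_cnj_iff by blast
qed

lemma energy_c_real:
  assumes c: "continuous_on {0..pi} X" "continuous_on {0..pi} X'"
  shows "energy_c X X' \<in> \<real>"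
proof -
  have Q0i: "(\<lambda>x. Q0 L x ** X x) absolutely_integrable_on {0..pi}"
    by (rule absolutely_integrable_prod_continuous[OF bounded_bilinear_matrix_mult Q0_L1 c(1)])
  have "cnj (integral {0..pi} (\<lambda>x. cip (X x) (Q0 L x ** X x))) = integral {0..pi} (\<lambda>x. cnj (cip (X x) (Q0 L x ** X x)))"
    by (rule cnj_integral[OF cip_integrable[OF c(1) Q0i]])
  also have "\<dots> = integral {0..pi} (\<lambda>x. cip (X x) (Q0 L x ** X x))"
    by (rule integral_spike[OF bad(1)]) (simp add: cip_cnj cip_matrix_left bad)
  finally have 1: "cnj (integral {0..pi} (\<lambda>x. cip (X x) (Q0 L x ** X x))) = \<dots>" .
  have 2: "cnj (cip Z (H0 L ** Z)) = cip Z (H0 L ** Z)" "cnj (cip Z (h0 L ** Z)) = cip Z (h0 L ** Z)" for Z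
    by (simp_all add: cip_cnj cip_matrix_left H0_herm h0_herm)
  have "cnj (energy_c X X') = energy_c X X'"
    unfolding energy_c_def integral_of_real_norm[OF c(2)] by (simp add: 1 2)
  then show ?thesis using Reals_cnj_iff by blast
qed

text \<open>Every other term of c is at most a constant times the squared supremum of |X|.
  Interpolation with a small parameter charges the derivative part to the negative Dirichlet
  integral and leaves a multiple of \<open>energy_a X\<close>.\<close>

lemma energy_c_bound:
  "\<exists>C. \<forall>X X'. has_W11_derivative X X' \<longrightarrow> continuous_on {0..pi} X' \<longrightarrow> Re (energy_c X X') \<le> C * energy_a X"
proof -
  define q where "q = integral {0..pi} (\<lambda>x. norm (Q0 L x)) + norm (H0 L) + norm (h0 L)"
  have nQ: "(\<lambda>x. norm (Q0 L x)) absolutely_integrable_on {0..pi}"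
    using absolutely_integrable_norm[OF Q0_L1] by (simp add: o_def)
  have nQi: "(\<lambda>x. norm (Q0 L x)) integrable_on {0..pi}" by (rule set_lebesgue_integral_eq_integral(1)[OF nQ])
  have q: "0 \<le> q" unfolding q_def by (intro add_nonneg_nonneg integral_nonneg nQi) auto
  have "Re (energy_c X X') \<le> (q * (1 / pi + (q + 1))) * energy_a X"
    if X: "has_W11_derivative X X'" and c': "continuous_on {0..pi} X'" for X X'
  proof -
    have c: "continuous_on {0..pi} X" by (rule has_W11_derivative_continuous[OF X])
    \<comment> \<open>Chosen so that q e \<le> 1; the Dirichlet part of q s is then covered by
      -A'.\<close>
    define e where "e = 1 / (q + 1)"
    have e: "e > 0" "1 / e = q + 1" using q by (simp_all add: e_def)
    define A' where "A' = integral {0..pi} (\<lambda>t. (norm (X' t))\<^sup>2)"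
    have A': "A' \<ge> 0" unfolding A'_def by (intro integral_nonneg integrable_continuous_real continuous_intros c') auto
    define s where "s = (1 / pi + (q + 1)) * energy_a X + e * A'"
    have sb: "(norm (X x))\<^sup>2 \<le> s" if "x \<in> {0..pi}" for x
      using sup_norm_interpolation[OF X c' e(1) that] by (simp add: s_def A'_def energy_a_def e(2))
    have cb: "cmod (cip Z (B ** Z)) \<le> norm B * s" if "(norm Z)\<^sup>2 \<le> s" for Z :: "complex^1^'m" and B :: "complex^'m^'m"
    proof -
      have "cmod (cip Z (B ** Z)) \<le> norm Z * (norm B * norm Z)"
        by (rule order_trans[OF cip_le mult_left_mono[OF norm_matrix_mult_le]]) simp
      also have "\<dots> = norm B * (norm Z)\<^sup>2" by (simp add: power2_eq_square)
      also have "\<dots> \<le> norm B * s" using that by (intro mult_left_mono) auto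
      finally show ?thesis .
    qed
    have Q0i: "(\<lambda>x. Q0 L x ** X x) absolutely_integrable_on {0..pi}"
      by (rule absolutely_integrable_prod_continuous[OF bounded_bilinear_matrix_mult Q0_L1 c])
    have "cmod (integral {0..pi} (\<lambda>x. cip (X x) (Q0 L x ** X x))) \<le> integral {0..pi} (\<lambda>x. norm (Q0 L x) * s)"
      by (rule integral_norm_bound_integral[OF cip_integrable[OF c Q0i] integrable_on_mult_left[OF nQi]]) (intro cb sb)
    also have "\<dots> = integral {0..pi} (\<lambda>x. norm (Q0 L x)) * s" by simp
    finally have 1: "cmod (integral {0..pi} (\<lambda>x. cip (X x) (Q0 L x ** X x))) \<le> integral {0..pi} (\<lambda>x. norm (Q0 L x)) * s" .
    have 2: "cmod (cip (X pi) (H0 L ** X pi)) \<le> norm (H0 L) * s" "cmod (cip (X 0) (h0 L ** X 0)) \<le> norm (h0 L) * s"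
      by (intro cb sb, simp)+
    have 3: "integral {0..pi} (\<lambda>x. cip (X' x) (X' x)) = complex_of_real A'"
      unfolding integral_of_real_norm[OF c'] energy_a_def A'_def ..
    have "Re (energy_c X X') \<le> q * s - A'"
      unfolding energy_c_def 3 q_def
      using 1 2 complex_Re_le_cmod[of "integral {0..pi} (\<lambda>x. cip (X x) (Q0 L x ** X x))"]
        abs_Re_le_cmod[of "cip (X pi) (H0 L ** X pi)"] complex_Re_le_cmod[of "cip (X 0) (h0 L ** X 0)"]
      by (simp add: algebra_simps)
    also have "q * s = (q * (1 / pi + (q + 1))) * energy_a X + (q * e) * A'" by (simp add: s_def algebra_simps)
    also have "(q * e) * A' \<le> 1 * A'" using A' q by (intro mult_right_mono) (auto simp: e_def)
    finally show ?thesis by simp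
  qed
  then show ?thesis by blast
qed

lemma energy_a_pos:
  assumes c: "continuous_on {0..pi} X" and "x \<in> {0..pi}" "X x \<noteq> 0"
  shows "energy_a X > 0"
proof -
  have cc: "continuous_on {0..pi} (\<lambda>x. (norm (X x))\<^sup>2)" by (intro continuous_intros c)
  have "energy_a X \<noteq> 0"
  proof
    assume "energy_a X = 0"
    then have "((\<lambda>x. (norm (X x))\<^sup>2) has_integral 0) (cbox 0 pi)"
      using integrable_integral[OF integrable_continuous_real[OF cc]] by (simp add: energy_a_def)
    then have "(norm (X x))\<^sup>2 = 0"
      by (rule has_integral_0_cbox_imp_0[of 0 pi, rotated 2]) (use cc assms pi_gt_zero in \<open>auto simp del: pi_gt_zero\<close>)
    then show False using assms(3) by simp
  qed
  moreover have "energy_a X \<ge> 0" unfolding energy_a_def by (intro integral_nonneg integrable_continuous_real cc) auto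
  ultimately show ?thesis by simp
qed

definition energy_C where "energy_C = (SOME C. \<forall>X X'. has_W11_derivative X X' \<longrightarrow> continuous_on {0..pi} X' \<longrightarrow> Re (energy_c X X') \<le> C * energy_a X)"

lemma energy_C:
  assumes "has_W11_derivative X X'" "continuous_on {0..pi} X'"
  shows "Re (energy_c X X') \<le> energy_C * energy_a X"
  using someI_ex[OF energy_c_bound] assms unfolding energy_C_def by blast

text \<open>For a nonreal eigenvalue the quadratic equation \<open>a\<rho>\<^sup>2 + b\<rho> + c = 0\<close> with real coefficients forces
  \<open>c = a |\<rho>|\<^sup>2\<close>; since \<open>c \<le> C a\<close>, such eigenvalues are bounded.\<close>

lemma degenerate_bounded:
  fixes u :: "complex^1^'m"
  assumes D: "Delta \<rho> ** u = 0" and u: "u \<noteq> 0"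
    and deg: "\<rho> \<notin> \<real> \<or> (\<rho> \<in> \<real> \<and> 2 * \<rho> * energy_a (\<lambda>x. ph \<rho> x ** u) + energy_b (\<lambda>x. ph \<rho> x ** u) = 0)"
  shows "(cmod \<rho>)\<^sup>2 \<le> energy_C"
proof -
  define X where "X x = ph \<rho> x ** u" for x
  define X' where "X' x = ph' \<rho> x ** u" for x
  have Xf: "(\<lambda>x. ph \<rho> x ** u) = X" by (simp add: X_def fun_eq_iff)
  have s: "sol L \<rho> X X'" unfolding X_def X'_def by (intro sol_mult ph_sol)
  note c = sol_continuous[OF s]
  have X0: "X 0 = u" by (simp add: X_def ph_0)
  have U: "X' 0 = - (((\<i> * \<rho>) *\<^sub>C h1 L + h0 L) ** X 0)"
    by (simp add: X_def X'_def ph_0 matrix_mult.minus_left matrix_mult.diff_left matrix_mult.add_left)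
  have "X' pi + ((\<i> * \<rho>) *\<^sub>C H1 L + H0 L) ** X pi = Delta \<rho> ** u"
    by (simp add: X_def X'_def Delta_def matrix_mult.add_left matrix_mul_assoc)
  then have V: "X' pi = - (((\<i> * \<rho>) *\<^sub>C H1 L + H0 L) ** X pi)" using D by (simp only: add_eq_0_iff2)
  obtain b where b: "energy_b X = complex_of_real b" using energy_b_real[OF c(1)] Reals_cases by blast
  obtain cc where cc: "energy_c X X' = complex_of_real cc" using energy_c_real[OF c] Reals_cases by blast
  define a where "a = energy_a X"
  have a: "a > 0" unfolding a_def by (rule energy_a_pos[OF c(1), of 0]) (use u X0 in auto)
  have E: "a * \<rho>\<^sup>2 + b * \<rho> + cc = 0"
    using energy_identity[OF s U V] by (simp add: a_def b cc)
  \<comment> \<open>In either case the real quadratic has the roots \<rho> and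
    \<open>cnj \<rho>\<close>, a double root when \<rho> is real, and c/a is their product.\<close>
  have "cc = a * (cmod \<rho>)\<^sup>2"
  proof (cases "\<rho> \<in> \<real>")
    case True
    then obtain r where r: "\<rho> = complex_of_real r" by (auto elim: Reals_cases)
    have "2 * r * a + b = 0"
    proof -
      have "complex_of_real (2 * r * a + b) = 0" using deg[unfolded Xf b a_def[symmetric]] True by (simp add: r del: of_real_eq_0_iff)
      then show ?thesis by (simp only: of_real_eq_0_iff)
    qed
    moreover have "a * r\<^sup>2 + b * r + cc = 0"
    proof -
      have "complex_of_real (a * r\<^sup>2 + b * r + cc) = 0" using E r by simp
      then show ?thesis by (simp only: of_real_eq_0_iff)
    qed
    ultimately have "cc = a * r\<^sup>2" by algebra
    then show ?thesis by (simp add: r)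
  next
    case False
    define x where "x = Re \<rho>"
    define y where "y = Im \<rho>"
    have y: "y \<noteq> 0" using False by (simp add: y_def complex_is_Real_iff)
    have "Im (a * \<rho>\<^sup>2 + b * \<rho> + cc) = 0" "Re (a * \<rho>\<^sup>2 + b * \<rho> + cc) = 0" using E by simp_all
    then have 1: "a * (2 * x * y) + b * y = 0" and 2: "a * (x\<^sup>2 - y\<^sup>2) + b * x + cc = 0"
      by (simp_all add: x_def y_def Im_power2 Re_power2)
    have "b = - (2 * a * x)" using 1 y by algebra
    with 2 have "cc = a * (x\<^sup>2 + y\<^sup>2)" by algebra
    then show ?thesis by (simp add: x_def y_def cmod_power2)
  qed
  moreover have "cc \<le> energy_C * a"
    using energy_C[OF sol_W11(1)[OF s] c(2)] by (simp add: cc a_def)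
  ultimately show ?thesis using a by (simp add: mult.commute)
qed

lemma large_eigenvalue_real:
  assumes "\<rho> \<in> eigenvalues L" "(cmod \<rho>)\<^sup>2 > energy_C"
  shows "\<rho> \<in> \<real>"
proof (rule ccontr)
  assume n: "\<rho> \<notin> \<real>"
  obtain v where v: "v \<noteq> 0" "Delta \<rho> *v v = 0"
    using assms(1) unfolding eigenvalues_iff det_eq_0_iff_kernel by blast
  have "(cmod \<rho>)\<^sup>2 \<le> energy_C"
    by (rule degenerate_bounded[of \<rho> "colm v"]) (use v n in \<open>auto simp: colm_mult\<close>)
  then show False using assms(2) by simp
qed

sublocale entire_matrix Delta
  by unfold_locales (rule Delta_holomorphic)

text \<open>A chain would make the quadratic equation degenerate, \<open>2a\<rho> + b = 0\<close>, so that again \<open>c = a \<rho>\<^sup>2\<close>.\<close>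

lemma no_jordan_chain:
  fixes u v :: "complex^'m"
  assumes r: "\<rho>0 \<in> \<real>" and large: "(cmod \<rho>0)\<^sup>2 > energy_C" and u: "u \<noteq> 0" and D: "Delta \<rho>0 *v u = 0"
  shows "D' \<rho>0 *v u + Delta \<rho>0 *v v \<noteq> 0"
proof
  assume chain: "D' \<rho>0 *v u + Delta \<rho>0 *v v = 0"
  have cr: "cnj \<rho>0 = \<rho>0" using r by (simp add: Reals_cnj_iff)
  define X where "X x = ph \<rho>0 x ** colm u" for x
  define X' where "X' x = ph' \<rho>0 x ** colm u" for x
  have s: "sol L \<rho>0 X X'" unfolding X_def X'_def by (intro sol_mult ph_sol)
  \<comment> \<open>A root function: for a chain u, v the product of \<Delta>(\<rho>) and w(\<rho>)
    vanishes at \<rho>_0 together with its derivative.\<close>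
  define w where "w \<rho> = colm u + (\<rho> - \<rho>0) *\<^sub>C colm v" for \<rho>
  define Y where "Y \<rho> x = ph \<rho> x ** w \<rho>" for \<rho> x
  define Y' where "Y' \<rho> x = ph' \<rho> x ** w \<rho>" for \<rho> x
  have sY: "sol L \<rho> (Y \<rho>) (Y' \<rho>)" for \<rho> unfolding Y_def Y'_def by (intro sol_mult ph_sol)
  \<comment> \<open>Green's identity between \<rho>_0 and \<rho> gives \<open>cip (X pi) (Delta
    \<rho> ** w \<rho>) = (\<rho>0 - \<rho>) * F \<rho>\<close>; the terms outside the integral come
    from the boundary matrices. A double zero on the left forces F(\<rho>_0) = 0, and F(\<rho>_0) is
    2 a \<rho>_0 + b.\<close>
  define F where "F \<rho> = integral {0..pi} (\<lambda>x. cip (X x) ((\<rho>0 + \<rho>) *\<^sub>C Y \<rho> x + (2 * \<i>) *\<^sub>C (Q1 L x ** Y \<rho> x)))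
     - \<i> * cip (X pi) (H1 L ** Y \<rho> pi) + \<i> * cip (X 0) (h1 L ** Y \<rho> 0)" for \<rho>
  have X0: "X 0 = colm u" "X' 0 = - (((\<i> * \<rho>0) *\<^sub>C h1 L + h0 L) ** X 0)"
    by (simp_all add: X_def X'_def ph_0 matrix_mult.minus_left matrix_mult.diff_left matrix_mult.add_left)
  have Y0: "Y \<rho> 0 = w \<rho>" "Y' \<rho> 0 = - (((\<i> * \<rho>) *\<^sub>C h1 L + h0 L) ** Y \<rho> 0)" for \<rho>
    by (simp_all add: Y_def Y'_def ph_0 matrix_mult.minus_left matrix_mult.diff_left matrix_mult.add_left)
  have "X' pi + ((\<i> * \<rho>0) *\<^sub>C H1 L + H0 L) ** X pi = Delta \<rho>0 ** colm u"
    by (simp add: X_def X'_def Delta_def matrix_mult.add_left matrix_mul_assoc)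
  also have "\<dots> = 0" unfolding colm_mult D by simp
  finally have Xpi: "X' pi = - (((\<i> * \<rho>0) *\<^sub>C H1 L + H0 L) ** X pi)" by (simp only: add_eq_0_iff2)
  have Ypi: "Y' \<rho> pi = Delta \<rho> ** w \<rho> - ((\<i> * \<rho>) *\<^sub>C H1 L + H0 L) ** Y \<rho> pi" for \<rho>
    by (simp add: Y_def Y'_def Delta_def matrix_mult.add_left matrix_mul_assoc)
  have key: "cip (X pi) (Delta \<rho> ** w \<rho>) = (\<rho>0 - \<rho>) * F \<rho>" for \<rho>
  proof -
    define I where "I = integral {0..pi} (\<lambda>x. cip (X x) ((\<rho>0 + \<rho>) *\<^sub>C Y \<rho> x + (2 * \<i>) *\<^sub>C (Q1 L x ** Y \<rho> x)))"
    have "cip (X pi) (Y' \<rho> pi) - cip (X' pi) (Y \<rho> pi) - (cip (X 0) (Y' \<rho> 0) - cip (X' 0) (Y \<rho> 0)) = (\<rho>0 - \<rho>) * I"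
      using green_identity[OF s sY[of \<rho>]] unfolding cr I_def .
    then have "cip (X pi) (Delta \<rho> ** w \<rho>) - cip (X pi) (((\<i> * \<rho>) *\<^sub>C H1 L + H0 L) ** Y \<rho> pi)
       + cip (X pi) (((\<i> * \<rho>0) *\<^sub>C H1 L + H0 L)\<^sup>\<dagger> ** Y \<rho> pi)
       + cip (X 0) (((\<i> * \<rho>) *\<^sub>C h1 L + h0 L) ** Y \<rho> 0)
       - cip (X 0) (((\<i> * \<rho>0) *\<^sub>C h1 L + h0 L)\<^sup>\<dagger> ** Y \<rho> 0) = (\<rho>0 - \<rho>) * I"
      unfolding Ypi Xpi Y0(2) X0(2) cip_minus_left cip_minus_right cip_diff_right cip_matrix_left
      by (simp add: algebra_simps)
    then have "cip (X pi) (Delta \<rho> ** w \<rho>) = (\<rho>0 - \<rho>) * (I - \<i> * cip (X pi) (H1 L ** Y \<rho> pi) + \<i> * cip (X 0) (h1 L ** Y \<rho> 0))"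
      by (simp add: hermitian_conj_simps H1_skew H0_herm h1_skew h0_herm cr matrix_ring_simps cip_add_right cip_scm_right
          cip_minus_right algebra_simps)
    then show ?thesis by (simp only: F_def I_def)
  qed
  have ph_joint: "continuous_on (UNIV \<times> {0..pi}) (\<lambda>p. ph (fst p) (snd p))"
    using continuous_on_psum_joint[OF regular_pencil_axioms]
    unfolding ph_def case_prod_beta by (intro continuous_intros matrix_mult.continuous_on scm.continuous_on) auto
  have Y_joint: "continuous_on (UNIV \<times> {0..pi}) (\<lambda>p. Y (fst p) (snd p))"
    unfolding Y_def w_def by (intro ph_joint continuous_intros matrix_mult.continuous_on scm.continuous_on)
  have Y_cont: "continuous_on UNIV (\<lambda>\<rho>. Y \<rho> x)" if "x \<in> {0..pi}" for x
  proof -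
    have "continuous_on UNIV (\<lambda>\<rho>::complex. (\<rho>, x))" by (intro continuous_intros)
    from continuous_on_compose2[OF Y_joint this] have "continuous_on UNIV (\<lambda>\<rho>. Y (fst (\<rho>, x)) (snd (\<rho>, x)))"
      using that by blast
    then show ?thesis by simp
  qed
  have "continuous_on UNIV (\<lambda>\<rho>. integral (cbox 0 pi) (\<lambda>x. cip (X x) ((\<rho>0 + \<rho>) *\<^sub>C Y \<rho> x + (2 * \<i>) *\<^sub>C (Q1 L x ** Y \<rho> x))))"
  proof (rule integral_continuous_on_param)
    have "continuous_on (UNIV \<times> {0..pi}) (\<lambda>p. X (snd p))" "continuous_on (UNIV \<times> {0..pi}) (\<lambda>p. Q1 L (snd p))"
      by (rule continuous_on_compose2[OF sol_continuous(1)[OF s] continuous_on_snd[OF continuous_on_id]], force)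
         (rule continuous_on_compose2[OF Q1_cont continuous_on_snd[OF continuous_on_id]], force)
    then show "continuous_on (UNIV \<times> cbox 0 pi) (\<lambda>(\<rho>, x). cip (X x) ((\<rho>0 + \<rho>) *\<^sub>C Y \<rho> x + (2 * \<i>) *\<^sub>C (Q1 L x ** Y \<rho> x)))"
      unfolding case_prod_beta cbox_interval
      by (intro bounded_bilinear.continuous_on[OF bounded_bilinear_cip] Y_joint continuous_intros matrix_mult.continuous_on scm.continuous_on)
  qed
  then have "continuous_on UNIV F"
    unfolding F_def cbox_interval
    by (intro bounded_bilinear.continuous_on[OF bounded_bilinear_cip] Y_cont continuous_intros matrix_mult.continuous_on) auto
  then have "F \<midarrow>\<rho>0\<rightarrow> F \<rho>0" by (simp add: continuous_on_eq_continuous_at isCont_def)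
  then have lim1: "(\<lambda>\<rho>. - F \<rho>) \<midarrow>\<rho>0\<rightarrow> - F \<rho>0" by (rule tendsto_minus)
  define g where "g \<rho> = cip (X pi) (Delta \<rho> ** w \<rho>)" for \<rho>
  have "(g has_field_derivative (\<Sum>i\<in>UNIV. cnj (X pi $ i $ 1) * (D' \<rho>0 *v u + Delta \<rho>0 *v v) $ i)) (at \<rho>0)"
  proof -
    have d: "((\<lambda>\<rho>. Delta \<rho> $ i $ j) has_field_derivative D' \<rho>0 $ i $ j) (at \<rho>0)" for i j
      unfolding D'_def using holomorphic_derivI[OF Delta_holomorphic[of i j], of \<rho>0] by simp
    have lin: "((\<lambda>\<rho>. u $ j + (\<rho> - \<rho>0) * v $ j) has_field_derivative v $ j) (at \<rho>0)" for j
      by (auto intro!: derivative_eq_intros)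
    have "((\<lambda>\<rho>. \<Sum>i\<in>UNIV. cnj (X pi $ i $ 1) * (\<Sum>j\<in>UNIV. Delta \<rho> $ i $ j * (u $ j + (\<rho> - \<rho>0) * v $ j)))
      has_field_derivative (\<Sum>i\<in>UNIV. cnj (X pi $ i $ 1) * (\<Sum>j\<in>UNIV. D' \<rho>0 $ i $ j * (u $ j + (\<rho>0 - \<rho>0) * v $ j) + v $ j * Delta \<rho>0 $ i $ j))) (at \<rho>0)"
      by (intro DERIV_sum DERIV_cmult DERIV_mult d lin)
    moreover have "g = (\<lambda>\<rho>. \<Sum>i\<in>UNIV. cnj (X pi $ i $ 1) * (\<Sum>j\<in>UNIV. Delta \<rho> $ i $ j * (u $ j + (\<rho> - \<rho>0) * v $ j)))"
      by (simp add: g_def cip_def matrix_matrix_mult_def w_def colm_def fun_eq_iff)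
    moreover have "(D' \<rho>0 *v u + Delta \<rho>0 *v v) $ i = (\<Sum>j\<in>UNIV. D' \<rho>0 $ i $ j * (u $ j + (\<rho>0 - \<rho>0) * v $ j) + v $ j * Delta \<rho>0 $ i $ j)" for i
      by (simp add: matrix_vector_mult_def sum.distrib mult.commute)
    ultimately show ?thesis by (simp only:)
  qed
  then have "(g has_field_derivative 0) (at \<rho>0)" by (simp add: chain)
  then have "(\<lambda>\<rho>. (g \<rho> - g \<rho>0) / (\<rho> - \<rho>0)) \<midarrow>\<rho>0\<rightarrow> 0" by (simp add: has_field_derivative_iff)
  then have "(\<lambda>\<rho>. - F \<rho>) \<midarrow>\<rho>0\<rightarrow> 0"
  proof (rule Lim_transform_eventually)
    have "(g \<rho> - g \<rho>0) / (\<rho> - \<rho>0) = - F \<rho>" if "\<rho> \<noteq> \<rho>0" for \<rho>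
    proof -
      have "g \<rho> - g \<rho>0 = - F \<rho> * (\<rho> - \<rho>0)" by (simp add: g_def key algebra_simps)
      then show ?thesis using that by simp
    qed
    then show "\<forall>\<^sub>F \<rho> in at \<rho>0. (g \<rho> - g \<rho>0) / (\<rho> - \<rho>0) = - F \<rho>"
      by (auto simp: eventually_at_filter)
  qed
  with lim1 have F0: "F \<rho>0 = 0" using tendsto_unique[of "at \<rho>0"] by force
  have Y_X: "Y \<rho>0 = X" by (simp add: Y_def X_def w_def fun_eq_iff scm.zero_left)
  have "integral {0..pi} (\<lambda>x. cip (X x) ((\<rho>0 + \<rho>0) *\<^sub>C X x + (2 * \<i>) *\<^sub>C (Q1 L x ** X x)))
     = (2 * \<rho>0) * integral {0..pi} (\<lambda>x. cip (X x) (X x)) + integral {0..pi} (\<lambda>x. cip (X x) ((2 * \<i>) *\<^sub>C (Q1 L x ** X x)))"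
  proof -
    note c = sol_continuous(1)[OF s]
    have i: "(\<lambda>x. cip (X x) (X x)) integrable_on {0..pi}" "(\<lambda>x. cip (X x) ((2 * \<i>) *\<^sub>C (Q1 L x ** X x))) integrable_on {0..pi}"
      by (intro cip_integrable c absolutely_integrable_continuous_real scm.continuous_on matrix_mult.continuous_on continuous_intros Q1_cont)+
    have "(\<lambda>x. cip (X x) ((\<rho>0 + \<rho>0) *\<^sub>C X x + (2 * \<i>) *\<^sub>C (Q1 L x ** X x))) =
       (\<lambda>x. (2 * \<rho>0) * cip (X x) (X x) + cip (X x) ((2 * \<i>) *\<^sub>C (Q1 L x ** X x)))"
      by (simp add: fun_eq_iff cip_add_right cip_scm_right)
    then show ?thesis
      using integral_unique[OF has_integral_add[OF has_integral_mult_right[OF integrable_integral[OF i(1)]] integrable_integral[OF i(2)]]]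
      by simp
  qed
  then have "2 * \<rho>0 * energy_a X + energy_b X = 0"
    using F0 unfolding F_def Y_X energy_b_def integral_of_real_norm[OF sol_continuous(1)[OF s]] by (simp add: algebra_simps)
  then have "(cmod \<rho>0)\<^sup>2 \<le> energy_C"
    using degenerate_bounded[of \<rho>0 "colm u"] r u D by (simp add: colm_mult X_def[abs_def])
  then show False using large by simp
qed

end

section \<open>Counting zeros\<close>

text \<open>The quotient (exp w - 1)/w, completed by 1 at the origin, vanishes only at the nonzero
  multiples of 2 \<pi> i. The rectangle avoids these, so by compactness the modulus has a positive
  minimum.\<close>

lemma exp_minus_one_lower_bound_aux:
  obtains c where "c > 0" "\<And>w. -1 \<le> Re w \<Longrightarrow> Re w \<le> 0 \<Longrightarrow> \<bar>Im w\<bar> \<le> pi \<Longrightarrow> c * cmod w \<le> cmod (exp w - 1)"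
proof -
  define S where "S = cbox (Complex (-1) (-pi)) (Complex 0 pi)"
  define f where "f w = (if w = 0 then deriv exp 0 else (exp w - exp 0) / (w - 0))" for w :: complex
  have S: "w \<in> S \<longleftrightarrow> -1 \<le> Re w \<and> Re w \<le> 0 \<and> - pi \<le> Im w \<and> Im w \<le> pi" for w
    by (auto simp: S_def in_cbox_complex_iff)
  have "f holomorphic_on UNIV" unfolding f_def by (rule pole_lemma_open) (auto intro: holomorphic_intros)
  then have cont: "continuous_on S (\<lambda>w. cmod (f w))"
    by (intro continuous_on_norm continuous_on_subset[OF holomorphic_on_imp_continuous_on]) auto
  have "\<exists>w\<in>S. \<forall>v\<in>S. cmod (f w) \<le> cmod (f v)"
  proof (rule continuous_attains_inf[OF _ _ cont])
    show "compact S" by (simp add: S_def)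
    have "0 \<in> S" by (simp add: S)
    then show "S \<noteq> {}" by blast
  qed
  then obtain w where w: "w \<in> S" "\<And>v. v \<in> S \<Longrightarrow> cmod (f w) \<le> cmod (f v)" by blast
  have d0: "deriv exp (0::complex) = 1" by (simp add: DERIV_imp_deriv[OF DERIV_exp])
  have "f w \<noteq> 0"
  proof (cases "w = 0")
    case False
    have "exp w \<noteq> 1"
    proof
      assume "exp w = 1"
      then obtain n :: int where n: "Re w = 0" "Im w = of_int (2 * n) * pi" by (auto simp: exp_eq_1)
      have "\<bar>of_int (2 * n)\<bar> * pi \<le> 1 * pi" using w(1) n by (simp add: S abs_mult)
      then have "\<bar>of_int (2 * n) :: real\<bar> \<le> 1" by (rule mult_right_le_imp_le) simp
      then have "n = 0" by linarith
      then show False using False n by (simp add: complex_eq_iff)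
    qed
    then show ?thesis using False by (simp add: f_def)
  qed (simp add: f_def d0)
  show ?thesis
  proof (rule that[of "cmod (f w)"])
    show "cmod (f w) > 0" using \<open>f w \<noteq> 0\<close> by simp
    fix v assume "-1 \<le> Re v" "Re v \<le> 0" "\<bar>Im v\<bar> \<le> pi"
    then have "cmod (f w) \<le> cmod (f v)" by (intro w) (auto simp: S)
    then have "cmod (f w) * cmod v \<le> cmod (f v) * cmod v" by (rule mult_right_mono) simp
    also have "\<dots> = cmod (f v * v)" by (simp add: norm_mult)
    also have "f v * v = exp v - 1" by (simp add: f_def)
    finally show "cmod (f w) * cmod v \<le> cmod (exp v - 1)" .
  qed
qed

text \<open>Close to the real axis periodicity reduces to the nearest integer; high up the
  exponential is small; the lower half plane is carried to the upper one by changing the sign of z.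
  The bound is linear in \<delta> with a constant independent of \<delta>, as required when \<delta>
  shrinks like 1/|n|.\<close>

lemma exp_minus_one_lower_bound:
  obtains c where "c > 0" "c \<le> 1" "\<And>z \<delta>. 0 \<le> \<delta> \<Longrightarrow> \<delta> \<le> 1 \<Longrightarrow> (\<And>n::int. \<delta> \<le> cmod (z - of_int n)) \<Longrightarrow>
    c * \<delta> * max 1 (cmod (exp (2 * pi * \<i> * z))) \<le> cmod (exp (2 * pi * \<i> * z) - 1)"
proof -
  obtain c0 where c0: "c0 > 0" "\<And>w. -1 \<le> Re w \<Longrightarrow> Re w \<le> 0 \<Longrightarrow> \<bar>Im w\<bar> \<le> pi \<Longrightarrow> c0 * cmod w \<le> cmod (exp w - 1)"
    using exp_minus_one_lower_bound_aux by blast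
  define c where "c = min c0 (1/2)"
  have c: "c > 0" "c \<le> 1" using c0 by (auto simp: c_def)
  have lower: "c * \<delta> \<le> cmod (exp (2 * pi * \<i> * z) - 1)"
    if \<delta>: "0 \<le> \<delta>" "\<delta> \<le> 1" and z: "\<And>n::int. \<delta> \<le> cmod (z - of_int n)" and "0 \<le> Im z" for z \<delta>
  \<comment> \<open>The threshold 1/(2 \<pi>) makes Re w range over [-1, 0], the width of the
    rectangle in the auxiliary bound.\<close>
  proof (cases "Im z \<le> 1 / (2 * pi)")
    case True
    define n where "n = round (Re z)"
    define w where "w = 2 * pi * \<i> * (z - of_int n)"
    have "\<bar>Re z - of_int n\<bar> \<le> 1/2" unfolding n_def using of_int_round_abs_le[of "Re z"] by (simp add: abs_minus_commute)
    then have "2 * pi * \<bar>Re z - of_int n\<bar> \<le> 2 * pi * (1/2)" by (intro mult_left_mono) auto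
    then have "\<bar>Im w\<bar> \<le> pi" by (simp add: w_def abs_mult)
    moreover have "Re w = - (2 * pi * Im z)" by (simp add: w_def)
    moreover have "2 * pi * Im z \<le> 1" using True by (simp add: field_simps)
    ultimately have "c0 * cmod w \<le> cmod (exp w - 1)" using \<open>0 \<le> Im z\<close> by (intro c0) auto
    moreover have "exp w = exp (2 * pi * \<i> * z)"
    proof -
      have "exp w = exp (2 * pi * \<i> * z) / exp (2 * pi * \<i> * of_int n)" by (simp add: w_def right_diff_distrib exp_diff)
      also have "exp (2 * pi * \<i> * of_int n) = 1" by (auto simp: exp_eq_1)
      finally show ?thesis by simp
    qed
    moreover have "c * \<delta> \<le> c0 * cmod w"
    proof (rule mult_mono)
      have "1 * cmod (z - of_int n) \<le> 2 * pi * cmod (z - of_int n)" using pi_gt3 by (intro mult_right_mono) auto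
      also have "\<dots> = cmod w" by (simp add: w_def norm_mult)
      finally show "\<delta> \<le> cmod w" using z[of n] by simp
    qed (use c0 \<delta> in \<open>auto simp: c_def\<close>)
    ultimately show ?thesis by simp
  next
    case False
    have "2 * pi * Im z > 1" using False by (simp add: field_simps)
    then have "exp (- (2 * pi * Im z)) \<le> exp (-1)" by simp
    also have "exp (-1) \<le> (1/2 :: real)" using exp_ge_add_one_self[of "1::real"] by (simp add: exp_minus field_simps)
    finally have "cmod (exp (2 * pi * \<i> * z)) \<le> 1/2" by simp
    then have "1/2 \<le> cmod (exp (2 * pi * \<i> * z) - 1)"
      using norm_triangle_ineq2[of 1 "exp (2 * pi * \<i> * z)"] by (simp add: norm_minus_commute)
    moreover have "c * \<delta> \<le> (1/2) * 1" using \<delta> c0 by (intro mult_mono) (auto simp: c_def)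
    ultimately show ?thesis by simp
  qed
  show ?thesis
  proof (rule that[OF c])
    fix z \<delta> assume \<delta>: "0 \<le> \<delta>" "\<delta> \<le> 1" and z: "\<And>n::int. \<delta> \<le> cmod (z - of_int n)"
    define e where "e = exp (2 * pi * \<i> * z)"
    have e: "cmod e = exp (- (2 * pi * Im z))" by (simp add: e_def)
    show "c * \<delta> * max 1 (cmod (exp (2 * pi * \<i> * z))) \<le> cmod (exp (2 * pi * \<i> * z) - 1)"
    proof (cases "0 \<le> Im z")
      case True
      then have "cmod e \<le> 1" unfolding e by simp
      then show ?thesis using lower[OF \<delta> z True] by (simp add: e_def)
    next
      case False
      have z': "\<delta> \<le> cmod (- z - of_int n)" for n :: int
        using z[of "- n"] by (metis add.inverse_inverse minus_diff_eq norm_minus_cancel of_int_minus diff_minus_eq_add add.commute)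
      \<comment> \<open>Clearing the denominator e in the bound at -z turns it into one relative to
        |e|, which is at least 1 in the lower half plane.\<close>
      have "c * \<delta> \<le> cmod (exp (2 * pi * \<i> * (- z)) - 1)" using lower[OF \<delta> z'] False by simp
      also have "exp (2 * pi * \<i> * (- z)) - 1 = (1 - e) / e" by (simp add: e_def exp_minus field_simps)
      finally have "c * \<delta> * cmod e \<le> cmod (1 - e)" by (simp add: norm_divide e_def field_simps)
      moreover have "1 \<le> cmod e" unfolding e using False by (simp add: mult_nonneg_nonpos2 mult_nonneg_nonpos)
      ultimately show ?thesis by (simp add: e_def norm_minus_commute)
    qed
  qed
qed

text \<open>Rouche's theorem with the winding numbers evaluated: 1 inside the circle and 0 outside,
  while the strict inequality keeps zeros off the circle itself.\<close>

lemma rouche_disc: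
  fixes f g :: "complex \<Rightarrow> complex"
  assumes f: "f holomorphic_on UNIV" and g: "g holomorphic_on UNIV" and r: "r > 0"
    and less: "\<And>z. cmod (z - c) = r \<Longrightarrow> cmod (g z - f z) < cmod (f z)"
  shows "(\<Sum>p\<in>{p\<in>ball c r. g p = 0}. zorder g p) = (\<Sum>p\<in>{p\<in>ball c r. f p = 0}. zorder f p)"
    and "finite {p\<in>ball c r. g p = 0}" "finite {p\<in>ball c r. f p = 0}"
proof -
  define s where "s = ball c (r + 1)"
  define h where "h z = g z - f z" for z
  have fh: "(\<lambda>p. f p + h p) = g" by (simp add: h_def fun_eq_iff)
  \<comment> \<open>At this point of the circle neither function vanishes, so neither is identically
    zero and each has finitely many zeros in a bounded disc.\<close>
  define z0 where "z0 = c + of_real r"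
  have "cmod (z0 - c) = r" using r by (simp add: z0_def)
  then have nz: "f z0 \<noteq> 0" "g z0 \<noteq> 0" using less[of z0] by auto
  have fin: "finite {p\<in>s. k p = 0}" if "k holomorphic_on UNIV" "k z0 \<noteq> 0" for k :: "complex \<Rightarrow> complex"
  proof -
    show ?thesis
    proof (cases "\<exists>p. k p = 0")
      case True
      then obtain p where "k p = 0" by blast
      have nc: "\<not> k constant_on UNIV"
      proof
        assume "k constant_on UNIV"
        then obtain y where "\<And>x. k x = y" by (auto simp: constant_on_def)
        then have "k z0 = k p" by metis
        then show False using \<open>k z0 \<noteq> 0\<close> \<open>k p = 0\<close> by simp
      qed
      have "finite {z \<in> cball c (r + 1). k z = 0}"
        by (rule holomorphic_compact_finite_zeros[OF that(1) open_UNIV connected_UNIV compact_cball subset_UNIV nc])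
      then show ?thesis by (rule rev_finite_subset) (auto simp: s_def)
    next
      case False
      then have "{p\<in>s. k p = 0} = {}" by auto
      then show ?thesis by (simp only: finite.emptyI)
    qed
  qed
  note ff = fin[OF f nz(1)] and gf = fin[OF g nz(2)]
  show gfin: "finite {p\<in>ball c r. g p = 0}" by (rule rev_finite_subset[OF gf]) (auto simp: s_def)
  show ffin: "finite {p\<in>ball c r. f p = 0}" by (rule rev_finite_subset[OF ff]) (auto simp: s_def)
  have R: "(\<Sum>p\<in>{p\<in>s. f p + h p = 0}. winding_number (circlepath c r) p * zorder (\<lambda>p. f p + h p) p)
     = (\<Sum>p\<in>{p\<in>s. f p = 0}. winding_number (circlepath c r) p * zorder f p)"
  proof (rule Rouche_theorem)
    show "open s" "connected s" by (auto simp: s_def)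
    show "finite {p\<in>s. f p + h p = 0}" using gf unfolding fun_cong[OF fh] .
    show "finite {p\<in>s. f p = 0}" by (rule ff)
    show "f holomorphic_on s" by (rule holomorphic_on_subset[OF f]) simp
    show "h holomorphic_on s" unfolding h_def
      by (intro holomorphic_on_diff holomorphic_on_subset[OF f] holomorphic_on_subset[OF g]) auto
    show "path_image (circlepath c r) \<subseteq> s" using r by (auto simp: s_def)
    show "\<forall>z\<in>path_image (circlepath c r). cmod (h z) < cmod (f z)"
      using less r by (auto simp: h_def dist_norm norm_minus_commute)
    show "\<forall>z. z \<notin> s \<longrightarrow> winding_number (circlepath c r) z = 0"
      using r by (auto simp: s_def intro!: winding_number_zero_outside[of _ "cball c r"])
  qed auto
  have wind: "(\<Sum>p\<in>{p\<in>s. k p = 0}. winding_number (circlepath c r) p * zorder k p) = of_int (\<Sum>p\<in>{p\<in>ball c r. k p = 0}. zorder k p)"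
    if k: "finite {p\<in>s. k p = 0}" "\<And>z. cmod (z - c) = r \<Longrightarrow> k z \<noteq> 0" for k
  proof -
    have "(\<Sum>p\<in>{p\<in>s. k p = 0}. winding_number (circlepath c r) p * zorder k p)
       = (\<Sum>p\<in>{p\<in>ball c r. k p = 0}. of_int (zorder k p))"
    proof (rule sum.mono_neutral_cong_right[OF k(1)])
      show "\<forall>p\<in>{p \<in> s. k p = 0} - {p \<in> ball c r. k p = 0}. winding_number (circlepath c r) p * of_int (zorder k p) = 0"
      proof
        fix p assume p: "p \<in> {p \<in> s. k p = 0} - {p \<in> ball c r. k p = 0}"
        then have "p \<notin> cball c r" using k(2)[of p] by (auto simp: dist_norm norm_minus_commute)
        then have "winding_number (circlepath c r) p = 0"
          using r by (intro winding_number_zero_outside[of _ "cball c r"]) auto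
        then show "winding_number (circlepath c r) p * of_int (zorder k p) = 0" by simp
      qed
      fix p assume "p \<in> {p \<in> ball c r. k p = 0}"
      then have "winding_number (circlepath c r) p = 1"
        by (intro winding_number_circlepath) (auto simp: dist_norm norm_minus_commute)
      then show "winding_number (circlepath c r) p * of_int (zorder k p) = of_int (zorder k p)" by simp
    qed (auto simp: s_def)
    then show ?thesis by simp
  qed
  have "of_int (\<Sum>p\<in>{p\<in>ball c r. g p = 0}. zorder g p) = (of_int (\<Sum>p\<in>{p\<in>ball c r. f p = 0}. zorder f p) :: complex)"
  proof -
    have gz: "g z \<noteq> 0" if "cmod (z - c) = r" for z using less[OF that] by auto
    have fz: "f z \<noteq> 0" if "cmod (z - c) = r" for z using less[OF that] by auto
    have "(\<Sum>p\<in>{p\<in>s. g p = 0}. winding_number (circlepath c r) p * zorder g p)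
     = (\<Sum>p\<in>{p\<in>s. f p = 0}. winding_number (circlepath c r) p * zorder f p)"
      using R unfolding fh fun_cong[OF fh] .
    moreover note wind[OF gf gz] wind[OF ff fz]
    ultimately show ?thesis by (metis (no_types, lifting))
  qed
  then show "(\<Sum>p\<in>{p\<in>ball c r. g p = 0}. zorder g p) = (\<Sum>p\<in>{p\<in>ball c r. f p = 0}. zorder f p)"
    by (simp only: of_int_eq_iff)
qed

text \<open>The points repeated according to multiplicity, encoded as pairs (z, i) with i <
  \<mu>(z), are equinumerous with S; a bijection followed by the first projection is the
  assignment.\<close>

lemma fibre_assignment:
  fixes \<mu> :: "'z \<Rightarrow> nat"
  assumes S: "finite S" and Z: "finite Z" and card: "(\<Sum>z\<in>Z. \<mu> z) = card S"
  shows "\<exists>f. (\<forall>s\<in>S. f s \<in> Z) \<and> (\<forall>z\<in>Z. card {s\<in>S. f s = z} = \<mu> z)"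
proof -
  define T where "T = (SIGMA z:Z. {..<\<mu> z})"
  have "finite T" unfolding T_def using Z by auto
  moreover have "card S = card T" unfolding T_def using Z card by (subst card_SigmaI) auto
  ultimately obtain h where h: "bij_betw h S T" using finite_same_card_bij[OF S] by blast
  have "card {s\<in>S. fst (h s) = z} = \<mu> z" if z: "z \<in> Z" for z
  proof -
    have "bij_betw h {s\<in>S. fst (h s) = z} {t\<in>T. fst t = z}"
      using h unfolding bij_betw_def by (auto simp: inj_on_def)
    then have "card {s\<in>S. fst (h s) = z} = card {t\<in>T. fst t = z}" by (rule bij_betw_same_card)
    also have "{t\<in>T. fst t = z} = {z} \<times> {..<\<mu> z}" using z by (auto simp: T_def)
    finally show ?thesis by simp
  qed
  moreover have "fst (h s) \<in> Z" if "s \<in> S" for s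
    using bij_betw_apply[OF h that] by (auto simp: T_def)
  ultimately show ?thesis by (intro exI[of _ "fst \<circ> h"]) auto
qed

text \<open>Multiplicities are known only disc by disc, but the numbering must be global. Points and
  indices are sorted into classes by keys, and equal totals in each class permit local assignments.
  As the key of the assigned point is prescribed, all indices of a point lie in one class, so the
  local fibres are the global ones.\<close>

lemma numbering_by_keys:
  fixes \<mu> :: "'z \<Rightarrow> nat" and \<kappa> :: "'i \<Rightarrow> 'k" and key :: "'z \<Rightarrow> 'k"
  assumes fin: "\<And>k. finite {i. \<kappa> i = k}" "\<And>k. finite {z\<in>E. key z = k}"
    and sum: "\<And>k. (\<Sum>z\<in>{z\<in>E. key z = k}. \<mu> z) = card {i. \<kappa> i = k}"
    and pos: "\<And>z. z \<in> E \<Longrightarrow> \<mu> z > 0"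
  shows "\<exists>r. range r = E \<and> (\<forall>i. key (r i) = \<kappa> i) \<and> (\<forall>z\<in>E. finite {i. r i = z} \<and> card {i. r i = z} = \<mu> z)"
proof -
  have "\<forall>k. \<exists>f. (\<forall>i\<in>{i. \<kappa> i = k}. f i \<in> {z\<in>E. key z = k}) \<and> (\<forall>z\<in>{z\<in>E. key z = k}. card {i\<in>{i. \<kappa> i = k}. f i = z} = \<mu> z)"
    (is "\<forall>k. \<exists>f. ?P k f")
    by (intro allI fibre_assignment[OF fin sum])
  from choice[OF this] obtain f where "\<forall>k. ?P k (f k)" ..
  then have Pf: "?P k (f k)" for k by (rule spec)
  have f: "f k i \<in> E \<and> key (f k i) = k" if "\<kappa> i = k" for k i
    using bspec[OF conjunct1[OF Pf[of k]], of i] that by simp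
  have fc: "card {i\<in>{i. \<kappa> i = k}. f k i = z} = \<mu> z" if "z \<in> E" "key z = k" for k z
    using bspec[OF conjunct2[OF Pf[of k]], of z] that by simp
  define r where "r i = f (\<kappa> i) i" for i
  have r: "r i \<in> E" "key (r i) = \<kappa> i" for i using f[of i "\<kappa> i"] by (auto simp: r_def)
  have fib: "{i. r i = z} = {i\<in>{i. \<kappa> i = key z}. f (key z) i = z}" if "z \<in> E" for z
    using r(2) by (auto simp: r_def)
  have c: "card {i. r i = z} = \<mu> z" if "z \<in> E" for z
    unfolding fib[OF that] by (rule fc[OF that refl])
  have "z \<in> range r" if "z \<in> E" for z
  proof -
    have "card {i. r i = z} > 0" using c[OF that] pos[OF that] by simp
    then have "{i. r i = z} \<noteq> {}" by (metis card.empty less_numeral_extra(3))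
    then show ?thesis by auto
  qed
  then have "range r = E" using r(1) by auto
  moreover have "finite {i. r i = z}" if "z \<in> E" for z
    unfolding fib[OF that] using fin(1)[of "key z"] by simp
  ultimately show ?thesis using c r(2) by blast
qed

lemma det_near_one:
  obtains \<eta> where "\<eta> > 0" "\<And>X :: complex^'n^'n. norm X < \<eta> \<Longrightarrow> cmod (det (mat 1 + X) - 1) < 1"
proof -
  have "continuous_on UNIV (\<lambda>X :: complex^'n^'n. det (mat 1 + X))"
    unfolding det_def by (intro continuous_intros bounded_linear.continuous_on[OF bounded_linear_vec_nth])
  then have "isCont (\<lambda>X :: complex^'n^'n. det (mat 1 + X)) 0"
    by (simp add: continuous_on_eq_continuous_at)
  then obtain \<eta> where \<eta>: "\<eta> > 0" "\<And>X :: complex^'n^'n. dist X 0 < \<eta> \<Longrightarrow> dist (det (mat 1 + X)) (det (mat 1 + 0 :: complex^'n^'n)) < 1"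
    unfolding continuous_at_eps_delta by (metis zero_less_one)
  show ?thesis by (rule that[OF \<eta>(1)]) (use \<eta>(2) in \<open>auto simp: dist_norm\<close>)
qed

section \<open>The main terms\<close>

lemma matrix_inv:
  fixes A :: "complex^'n^'n"
  assumes "det A \<noteq> 0"
  shows "A ** matrix_inv A = mat 1" "matrix_inv A ** A = mat 1"
proof -
  have "\<exists>A'. A ** A' = mat 1 \<and> A' ** A = mat 1" using assms by (metis invertible_def invertible_det_nz)
  then have "A ** matrix_inv A = mat 1 \<and> matrix_inv A ** A = mat 1"
    unfolding matrix_inv_def by (rule someI_ex)
  then show "A ** matrix_inv A = mat 1" "matrix_inv A ** A = mat 1" by auto
qed

lemma norm_diag_mat_le: "norm (diag_mat d :: complex^'n^'n) \<le> (\<Sum>p\<in>UNIV. cmod (d p))"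
proof -
  have "diag_mat d = (\<Sum>p\<in>UNIV. d p *\<^sub>C (diag_mat (\<lambda>q. if q = p then 1 else 0) :: complex^'n^'n))"
    by (auto simp: vec_eq_iff diag_mat_def if_distrib[where f="\<lambda>x. _ * x"] cong: if_cong)
  also have "norm \<dots> \<le> (\<Sum>p\<in>UNIV. norm (d p *\<^sub>C (diag_mat (\<lambda>q. if q = p then 1 else 0) :: complex^'n^'n)))"
    by (rule norm_sum)
  also have "\<dots> = (\<Sum>p\<in>UNIV. cmod (d p))"
  proof (rule sum.cong[OF refl])
    fix p :: 'n
    have "(norm (diag_mat (\<lambda>q. if q = p then 1 else 0) :: complex^'n^'n))\<^sup>2 = (\<Sum>i\<in>UNIV. \<Sum>j\<in>UNIV. if j = p then (if i = p then 1 else 0) else 0)"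
      unfolding norm_matrix_sq by (intro sum.cong refl) (auto simp: diag_mat_def)
    also have "\<dots> = 1" by simp
    finally have "norm (diag_mat (\<lambda>q. if q = p then 1 else 0) :: complex^'n^'n) = 1"
      by (rule power2_eq_imp_eq[OF trans[OF _ one_power2[symmetric]]]) auto
    then show "norm (d p *\<^sub>C (diag_mat (\<lambda>q. if q = p then 1 else 0) :: complex^'n^'n)) = cmod (d p)" by simp
  qed
  finally show ?thesis .
qed

lemma diag_mat_mult: "diag_mat a ** diag_mat b = (diag_mat (\<lambda>p. a p * b p) :: complex^'n^'n)"
  by (simp add: vec_eq_iff diag_mat_mult_nth) (simp add: diag_mat_def)

lemma hermitian_conj_mult: "(A ** B)\<^sup>\<dagger> = B\<^sup>\<dagger> ** A\<^sup>\<dagger>"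
  by (simp add: vec_eq_iff hermitian_conj_def matrix_matrix_mult_def mult.commute)

lemma bounded_linear_hermitian_conj: "bounded_linear (hermitian_conj :: complex^'n^'m \<Rightarrow> complex^'m^'n)"
proof -
  have "linear (hermitian_conj :: complex^'n^'m \<Rightarrow> complex^'m^'n)"
    by (rule linearI) (simp_all add: hermitian_conj_def vec_eq_iff)
  then show ?thesis by (simp add: linear_conv_bounded_linear)
qed

definition e :: "complex \<Rightarrow> complex" where "e \<rho> = exp (2 * pi * \<i> * \<rho>)"

definition far :: "('m \<Rightarrow> real) \<Rightarrow> real \<Rightarrow> complex \<Rightarrow> bool" where
  "far \<omega> \<delta> \<rho> \<longleftrightarrow> (\<forall>p. \<forall>n::int. \<delta> \<le> cmod (\<rho> - (of_int n + of_real (\<omega> p))))"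

locale weyl_pencil = asymptotic_pencil L P_plus P_minus q1 + selfadjoint_pencil L
  for L :: "'m::finite pencil" and P_plus P_minus q1 +
  fixes W :: "complex^'m^'m" and \<omega> :: "'m \<Rightarrow> real"
  assumes I_h1: "det (mat 1 + h1 L) \<noteq> 0" "det (mat 1 - h1 L) \<noteq> 0"
    and I_H1: "det (mat 1 + H1 L) \<noteq> 0" "det (mat 1 - H1 L) \<noteq> 0"
    and W: "unitary_mat W"
    and \<omega>: "\<And>q. 0 \<le> \<omega> q" "\<And>q. \<omega> q < 1"
    and A: "matrix_inv (P_minus pi) ** matrix_inv (mat 1 + H1 L) ** (mat 1 - H1 L) **
              P_plus pi ** (mat 1 + h1 L) ** matrix_inv (mat 1 - h1 L)
            = W\<^sup>\<dagger> ** diag_mat (\<lambda>q. exp (2 * pi * \<i> * \<omega> q)) ** W"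
begin

definition \<mu> where "\<mu> p = exp (2 * pi * \<i> * \<omega> p)"
definition Am where "Am = W\<^sup>\<dagger> ** diag_mat \<mu> ** W"
definition B1 where "B1 = (mat 1 + H1 L) ** P_minus pi"
definition ih where "ih = matrix_inv (mat 1 - h1 L)"
definition ih' where "ih' = matrix_inv (mat 1 + h1 L)"
definition iB where "iB = matrix_inv B1"

lemma WW: "W\<^sup>\<dagger> ** W = mat 1" "W ** W\<^sup>\<dagger> = mat 1"
  using W by (auto simp: unitary_mat_def)

lemma ih: "(mat 1 - h1 L) ** ih = mat 1" "ih ** (mat 1 - h1 L) = mat 1"
  unfolding ih_def by (rule matrix_inv[OF I_h1(2)])+

lemma ih': "(mat 1 + h1 L) ** ih' = mat 1" "ih' ** (mat 1 + h1 L) = mat 1"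
  unfolding ih'_def by (rule matrix_inv[OF I_h1(1)])+

lemma norm_\<mu> [simp]: "cmod (\<mu> p) = 1" "\<mu> p \<noteq> 0"
  by (simp_all add: \<mu>_def)

text \<open>\<open>P_minus\<close> stays unitary: the derivative of
  \<open>(P_minus x)\<^sup>\<dagger> ** P_minus x\<close> vanishes wherever Q_1 is skew-Hermitian,
  hence almost everywhere, and the product is the identity at 0.\<close>

lemma P_minus_det: "det (P_minus pi) \<noteq> 0"
proof -
  have PW: "has_W11_derivative P_minus (\<lambda>x. - (Q1 L x ** P_minus x))"
    by (rule has_W11_derivative_of_continuous)
       (intro P_minus continuous_intros matrix_mult.continuous_on Q1_cont P_continuous | assumption)+
  have PW': "has_W11_derivative (\<lambda>x. (P_minus x)\<^sup>\<dagger>) (\<lambda>x. (- (Q1 L x ** P_minus x))\<^sup>\<dagger>)"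
    by (rule has_W11_derivative_linear[OF PW bounded_linear_hermitian_conj])
  have "has_W11_derivative (\<lambda>x. (P_minus x)\<^sup>\<dagger> ** P_minus x) (\<lambda>x. (- (Q1 L x ** P_minus x))\<^sup>\<dagger> ** P_minus x + (P_minus x)\<^sup>\<dagger> ** - (Q1 L x ** P_minus x))"
    by (rule has_W11_derivative_prod[OF bounded_bilinear_matrix_mult PW' PW])
  then have "has_W11_derivative (\<lambda>x. (P_minus x)\<^sup>\<dagger> ** P_minus x) (\<lambda>x. 0)"
  proof (rule has_W11_derivative_spike[OF _ bad(1)])
    fix x assume x: "x \<in> {0..pi} - bad"
    have "(- (Q1 L x ** P_minus x))\<^sup>\<dagger> = (P_minus x)\<^sup>\<dagger> ** Q1 L x"
      using linear_neg[OF bounded_linear.linear[OF bounded_linear_hermitian_conj], of "Q1 L x ** P_minus x"]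
      by (simp add: hermitian_conj_mult bad(2)[OF x] matrix_mult.minus_right)
    then show "(- (Q1 L x ** P_minus x))\<^sup>\<dagger> ** P_minus x + (P_minus x)\<^sup>\<dagger> ** - (Q1 L x ** P_minus x) = 0"
      by (simp add: matrix_mult.minus_right matrix_mul_assoc)
  qed
  from has_W11_derivativeD(2)[OF this, of pi]
  have "(P_minus pi)\<^sup>\<dagger> ** P_minus pi = mat 1" by (simp add: P_minus hermitian_conj_simps)
  then have "det ((P_minus pi)\<^sup>\<dagger>) * det (P_minus pi) = 1" by (metis det_mul det_I)
  then show ?thesis by auto
qed

lemma B1_det: "det B1 \<noteq> 0"
  unfolding B1_def det_mul using I_H1 P_minus_det by simp

lemma iB: "B1 ** iB = mat 1" "iB ** B1 = mat 1"
  unfolding iB_def by (rule matrix_inv[OF B1_det])+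

text \<open>Explains the form of A: the coefficient of the second exponential is rewritten with the
  outer factors \<open>B1\<close> and \<open>mat 1 - h1 L\<close> of the first one. Both
  exponentials then combine to \<open>mat (e \<rho>) - Am\<close> between common invertible
  factors.\<close>

lemma B1_Am: "B1 ** (Am ** (mat 1 - h1 L)) = (mat 1 - H1 L) ** (P_plus pi ** (mat 1 + h1 L))"
proof -
  have A': "Am = matrix_inv (P_minus pi) ** (matrix_inv (mat 1 + H1 L) ** ((mat 1 - H1 L) ** (P_plus pi ** ((mat 1 + h1 L) ** ih))))"
    unfolding Am_def \<mu>_def[abs_def] A[symmetric] ih_def by (simp only: matrix_mul_assoc)
  have "B1 ** (Am ** (mat 1 - h1 L)) = (mat 1 + H1 L) ** ((P_minus pi ** matrix_inv (P_minus pi)) ** (matrix_inv (mat 1 + H1 L) ** ((mat 1 - H1 L) ** (P_plus pi ** ((mat 1 + h1 L) ** (ih ** (mat 1 - h1 L)))))))"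
    unfolding A' B1_def by (simp only: matrix_mul_assoc)
  also have "\<dots> = ((mat 1 + H1 L) ** matrix_inv (mat 1 + H1 L)) ** ((mat 1 - H1 L) ** (P_plus pi ** (mat 1 + h1 L)))"
    unfolding matrix_inv[OF P_minus_det] ih by (simp only: matrix_mul_lid matrix_mul_rid matrix_mul_assoc)
  finally show ?thesis unfolding matrix_inv[OF I_H1(1)] by (simp only: matrix_mul_lid)
qed

lemma B1_Am': "(mat 1 - H1 L) ** P_plus pi = B1 ** (Am ** ((mat 1 - h1 L) ** ih'))"
proof -
  have "B1 ** (Am ** ((mat 1 - h1 L) ** ih')) = B1 ** (Am ** (mat 1 - h1 L)) ** ih'" by (simp only: matrix_mul_assoc)
  also have "\<dots> = (mat 1 - H1 L) ** (P_plus pi ** ((mat 1 + h1 L) ** ih'))" unfolding B1_Am by (simp only: matrix_mul_assoc)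
  finally show ?thesis unfolding ih' by (simp only: matrix_mul_rid)
qed

section \<open>Asymptotics of \<Delta> and \<Theta> with relative errors\<close>

definition ex where "ex \<rho> = exp (\<i> * \<rho> * pi)"
definition exm where "exm \<rho> = exp (- \<i> * \<rho> * pi)"

lemma ex_exm: "exm \<rho> * ex \<rho> = 1" "ex \<rho> * exm \<rho> = 1" "exm \<rho> * e \<rho> = ex \<rho>" "exm \<rho> \<noteq> 0"
  by (simp_all add: ex_def exm_def e_def exp_add[symmetric] algebra_simps)

text \<open>The last identity converts an absolute error of size exp(|Im \<rho>| \<pi>) into one
  relative to max 1 |e(\<rho>)| once the prefactor exp(-i \<rho> \<pi>) is divided out.\<close>

lemma ex_bound: "cmod (ex \<rho>) \<le> exp (\<bar>Im \<rho>\<bar> * pi)" "cmod (exm \<rho>) \<le> exp (\<bar>Im \<rho>\<bar> * pi)"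
  "cmod (ex \<rho>) * exp (\<bar>Im \<rho>\<bar> * pi) = max 1 (cmod (e \<rho>))"
proof -
  show "cmod (ex \<rho>) \<le> exp (\<bar>Im \<rho>\<bar> * pi)" "cmod (exm \<rho>) \<le> exp (\<bar>Im \<rho>\<bar> * pi)"
    by (simp_all add: ex_def exm_def) (use mult_right_mono[of "- Im \<rho>" "\<bar>Im \<rho>\<bar>" pi] in simp_all)
  have 1: "cmod (ex \<rho>) * exp (\<bar>Im \<rho>\<bar> * pi) = exp ((\<bar>Im \<rho>\<bar> - Im \<rho>) * pi)" by (simp add: ex_def exp_add[symmetric] algebra_simps)
  have 2: "cmod (e \<rho>) = exp (- (2 * pi * Im \<rho>))" by (simp add: e_def)
  show "cmod (ex \<rho>) * exp (\<bar>Im \<rho>\<bar> * pi) = max 1 (cmod (e \<rho>))"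
  proof (cases "0 \<le> Im \<rho>")
    case True
    then show ?thesis unfolding 1 2 by (simp add: max_def order_antisym)
  next
    case False
    then have "Im \<rho> * pi \<le> 0" by (intro mult_nonpos_nonneg) auto
    then show ?thesis using False unfolding 1 2 by (simp add: max_def algebra_simps)
  qed
qed

definition Delta0 where "Delta0 \<rho> = (\<i> * \<rho> / 2 * exm \<rho>) *\<^sub>C (B1 ** ((mat (e \<rho>) - Am) ** (mat 1 - h1 L)))"
definition Theta0 where "Theta0 \<rho> = (exm \<rho> / 2) *\<^sub>C (B1 ** (mat (e \<rho>) + Am ** ((mat 1 - h1 L) ** ih')))"

lemma Delta_asymptotics: "\<exists>C>0. \<forall>\<rho>. 1 \<le> cmod \<rho> \<longrightarrow> norm (Delta \<rho> - Delta0 \<rho>) \<le> C * exp (\<bar>Im \<rho>\<bar> * pi)"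
proof -
  obtain C where C: "C > 0" "\<And>\<rho> Y Z C1 C2. 1 \<le> cmod \<rho> \<Longrightarrow> sol L \<rho> Y Z \<Longrightarrow> Y 0 = C1 + C2 \<Longrightarrow> Z 0 = (\<i> * \<rho>) *\<^sub>C (C1 - C2) \<Longrightarrow>
     norm (Z pi + ((\<i> * \<rho>) *\<^sub>C H1 L + H0 L) ** Y pi - V0 \<rho> C1 C2) \<le> C * exp (\<bar>Im \<rho>\<bar> * pi) * (norm C1 + norm C2)"
    using boundary_form_asymptotics by blast
  define a where "a = norm (mat 1 - h1 L) + norm (mat 1 + h1 L) + norm (h0 L)"
  define b where "b = norm (B1 ** h0 L) + norm (((mat 1 - H1 L) ** P_plus pi) ** h0 L)"
  have "norm (Delta \<rho> - Delta0 \<rho>) \<le> (C * a + b + 1) * exp (\<bar>Im \<rho>\<bar> * pi)" if \<rho>: "1 \<le> cmod \<rho>" for \<rho>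
  proof -
    have \<rho>0: "\<rho> \<noteq> 0" using \<rho> by auto
    \<comment> \<open>C1 and C2 solve C1 + C2 = I and i \<rho> (C1 - C2) = -(i \<rho> h_1 + h_0).
      The number k carries the share of h_0, which in \<open>V0\<close> contributes only bounded
      multiples of the exponentials because i \<rho> k = 1/2.\<close>
    define k where "k = 1 / (2 * (\<i> * \<rho>))"
    have k: "cmod k \<le> 1/2" using \<rho> \<rho>0 by (simp add: k_def norm_divide norm_mult divide_simps)
    have ik: "(\<i> * \<rho>) * k = 1/2" using \<rho>0 by (simp add: k_def)
    define C1 where "C1 = (1/2) *\<^sub>C (mat 1 - h1 L) - k *\<^sub>C h0 L"
    define C2 where "C2 = (1/2) *\<^sub>C (mat 1 + h1 L) + k *\<^sub>C h0 L"
    have c0: "ph \<rho> 0 = C1 + C2" by (simp add: ph_0 C1_def C2_def vec_eq_iff) (simp add: field_simps)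
    have "(\<i> * \<rho>) *\<^sub>C (C1 - C2) = - ((\<i> * \<rho>) *\<^sub>C h1 L) - (2 * ((\<i> * \<rho>) * k)) *\<^sub>C h0 L"
      by (simp add: C1_def C2_def vec_eq_iff field_simps)
    then have c1: "ph' \<rho> 0 = (\<i> * \<rho>) *\<^sub>C (C1 - C2)" unfolding ik by (simp add: ph_0)
    have nC1: "norm C1 \<le> norm (mat 1 - h1 L) / 2 + norm (h0 L) / 2"
    proof -
      have "norm C1 \<le> norm ((1/2) *\<^sub>C (mat 1 - h1 L)) + norm (k *\<^sub>C h0 L)" unfolding C1_def by norm
      moreover have "norm (k *\<^sub>C h0 L) \<le> (1/2) * norm (h0 L)" using mult_right_mono[OF k norm_ge_zero[of "h0 L"]] by simp
      ultimately show ?thesis by simp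
    qed
    have nC2: "norm C2 \<le> norm (mat 1 + h1 L) / 2 + norm (h0 L) / 2"
    proof -
      have "norm C2 \<le> norm ((1/2) *\<^sub>C (mat 1 + h1 L)) + norm (k *\<^sub>C h0 L)" unfolding C2_def by norm
      moreover have "norm (k *\<^sub>C h0 L) \<le> (1/2) * norm (h0 L)" using mult_right_mono[OF k norm_ge_zero[of "h0 L"]] by simp
      ultimately show ?thesis by simp
    qed
    have nC: "norm C1 + norm C2 \<le> a"
      using nC1 nC2 norm_ge_zero[of "mat 1 - h1 L"] norm_ge_zero[of "mat 1 + h1 L"] unfolding a_def by linarith
    have 1: "norm (Delta \<rho> - V0 \<rho> C1 C2) \<le> C * exp (\<bar>Im \<rho>\<bar> * pi) * a"
    proof -
      have "norm (Delta \<rho> - V0 \<rho> C1 C2) \<le> C * exp (\<bar>Im \<rho>\<bar> * pi) * (norm C1 + norm C2)"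
        unfolding Delta_def by (rule C(2)[OF \<rho> ph_sol c0 c1])
      also have "\<dots> \<le> C * exp (\<bar>Im \<rho>\<bar> * pi) * a" using nC C(1) by (intro mult_left_mono) auto
      finally show ?thesis .
    qed
    define U where "U = B1 ** (mat 1 - h1 L)"
    define U' where "U' = (mat 1 - H1 L) ** (P_plus pi ** (mat 1 + h1 L))"
    have V: "V0 \<rho> C1 C2 = (\<i> * \<rho>) *\<^sub>C (ex \<rho> *\<^sub>C ((1/2) *\<^sub>C U - k *\<^sub>C (B1 ** h0 L)) - exm \<rho> *\<^sub>C ((1/2) *\<^sub>C U' + k *\<^sub>C (((mat 1 - H1 L) ** P_plus pi) ** h0 L)))"
      unfolding V0_def ex_def[symmetric] exm_def[symmetric] B1_def[symmetric] C1_def C2_def U_def U'_def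
      by (simp only: matrix_mult.diff_right matrix_mult.add_right scm_mult_right matrix_mul_assoc)
    have "B1 ** ((mat (e \<rho>) - Am) ** (mat 1 - h1 L)) = e \<rho> *\<^sub>C U - U'"
      unfolding U_def U'_def B1_Am[symmetric]
      by (simp only: matrix_mult.diff_left mat_mult_scm) (simp only: matrix_mult.diff_right[of B1] scm_mult_right)
    then have D0: "Delta0 \<rho> = (\<i> * \<rho> / 2 * (exm \<rho> * e \<rho>)) *\<^sub>C U - (\<i> * \<rho> / 2 * exm \<rho>) *\<^sub>C U'"
      unfolding Delta0_def by (simp add: scm.diff_right scm_scm mult_ac)
    have "V0 \<rho> C1 C2 - Delta0 \<rho> = - ((((\<i> * \<rho>) * k) * ex \<rho>) *\<^sub>C (B1 ** h0 L)) - (((\<i> * \<rho>) * k) * exm \<rho>) *\<^sub>C (((mat 1 - H1 L) ** P_plus pi) ** h0 L)"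
      unfolding V D0 ex_exm by (simp add: vec_eq_iff algebra_simps)
    moreover have "norm (- x - y) \<le> norm x + norm y" for x y :: "complex^'m^'m"
      using norm_triangle_ineq4[of "- x" y] by simp
    ultimately have "norm (V0 \<rho> C1 C2 - Delta0 \<rho>) \<le> norm ((1/2 * ex \<rho>) *\<^sub>C (B1 ** h0 L)) + norm ((1/2 * exm \<rho>) *\<^sub>C (((mat 1 - H1 L) ** P_plus pi) ** h0 L))"
      unfolding ik by metis
    also have "\<dots> \<le> exp (\<bar>Im \<rho>\<bar> * pi) * norm (B1 ** h0 L) + exp (\<bar>Im \<rho>\<bar> * pi) * norm (((mat 1 - H1 L) ** P_plus pi) ** h0 L)"
      unfolding norm_scm norm_mult 
      using ex_bound(1,2)[of \<rho>] norm_ge_zero[of "ex \<rho>"] norm_ge_zero[of "exm \<rho>"]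
      by (intro add_mono mult_right_mono norm_ge_zero) (simp_all del: norm_ge_zero add: norm_divide)
    also have "\<dots> = b * exp (\<bar>Im \<rho>\<bar> * pi)" by (simp add: b_def algebra_simps)
    finally have 2: "norm (V0 \<rho> C1 C2 - Delta0 \<rho>) \<le> b * exp (\<bar>Im \<rho>\<bar> * pi)" .
    have "norm (Delta \<rho> - Delta0 \<rho>) \<le> norm (Delta \<rho> - V0 \<rho> C1 C2) + norm (V0 \<rho> C1 C2 - Delta0 \<rho>)"
      using norm_triangle_ineq[of "Delta \<rho> - V0 \<rho> C1 C2" "V0 \<rho> C1 C2 - Delta0 \<rho>"] by simp
    also have "\<dots> \<le> C * exp (\<bar>Im \<rho>\<bar> * pi) * a + b * exp (\<bar>Im \<rho>\<bar> * pi)" by (rule add_mono[OF 1 2])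
    also have "\<dots> \<le> (C * a + b + 1) * exp (\<bar>Im \<rho>\<bar> * pi)" by (simp add: algebra_simps)
    finally show ?thesis .
  qed
  moreover have "C * a + b + 1 > 0" using C(1) by (intro add_nonneg_pos add_nonneg_nonneg mult_nonneg_nonneg) (auto simp: a_def b_def)
  ultimately show ?thesis by blast
qed

lemma Theta_asymptotics: "\<exists>C>0. \<forall>\<rho>. 1 \<le> cmod \<rho> \<longrightarrow> norm (Theta \<rho> - Theta0 \<rho>) \<le> C / cmod \<rho> * exp (\<bar>Im \<rho>\<bar> * pi)"
proof -
  obtain C where C: "C > 0" "\<And>\<rho> Y Z C1 C2. 1 \<le> cmod \<rho> \<Longrightarrow> sol L \<rho> Y Z \<Longrightarrow> Y 0 = C1 + C2 \<Longrightarrow> Z 0 = (\<i> * \<rho>) *\<^sub>C (C1 - C2) \<Longrightarrow>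
     norm (Z pi + ((\<i> * \<rho>) *\<^sub>C H1 L + H0 L) ** Y pi - V0 \<rho> C1 C2) \<le> C * exp (\<bar>Im \<rho>\<bar> * pi) * (norm C1 + norm C2)"
    using boundary_form_asymptotics by blast
  define c where "c = norm (mat 1 :: complex^'m^'m)"
  have "norm (Theta \<rho> - Theta0 \<rho>) \<le> (C * c + 1) / cmod \<rho> * exp (\<bar>Im \<rho>\<bar> * pi)" if \<rho>: "1 \<le> cmod \<rho>" for \<rho>
  proof -
    have \<rho>0: "\<rho> \<noteq> 0" using \<rho> by auto
    define k where "k = 1 / (2 * (\<i> * \<rho>))"
    have ik: "(\<i> * \<rho>) * k = 1/2" using \<rho>0 by (simp add: k_def)
    \<comment> \<open>For S(0) = 0 and S'(0) = I both coefficients are of size 1/|\<rho>|, so the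
      general estimate gains that factor; here \<open>V0\<close> is exactly
      \<open>Theta0\<close>.\<close>
    define C1 :: "complex^'m^'m" where "C1 = k *\<^sub>C mat 1"
    define C2 :: "complex^'m^'m" where "C2 = - (k *\<^sub>C mat 1)"
    have c0: "psum 0 (mat 1) \<rho> 0 = C1 + C2" by (simp add: psum_0 C1_def C2_def)
    have "(\<i> * \<rho>) *\<^sub>C (C1 - C2) = (2 * ((\<i> * \<rho>) * k)) *\<^sub>C mat 1"
      by (simp add: C1_def C2_def vec_eq_iff)
    then have c1: "psum_deriv 0 (mat 1) \<rho> 0 = (\<i> * \<rho>) *\<^sub>C (C1 - C2)" unfolding ik by (simp add: psum_0)
    have nC: "norm C1 + norm C2 = c / cmod \<rho>" by (simp add: C1_def C2_def c_def k_def norm_divide norm_mult)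
    have "V0 \<rho> C1 C2 = (((\<i> * \<rho>) * k) * ex \<rho>) *\<^sub>C B1 + (((\<i> * \<rho>) * k) * exm \<rho>) *\<^sub>C ((mat 1 - H1 L) ** P_plus pi)"
      unfolding V0_def ex_def[symmetric] exm_def[symmetric] B1_def[symmetric] C1_def C2_def
      by (simp add: matrix_mult.minus_right scm_mult_right scm.diff_right scm.add_right scm.minus_right scm_scm mult_ac)
    also have "\<dots> = Theta0 \<rho>"
      unfolding ik B1_Am' Theta0_def
      by (simp add: matrix_mult.add_right mult_mat_scm scm.add_right scm_scm ex_exm(3)[symmetric] mult_ac)
    finally have V: "V0 \<rho> C1 C2 = Theta0 \<rho>" .
    have "norm (Theta \<rho> - V0 \<rho> C1 C2) \<le> C * exp (\<bar>Im \<rho>\<bar> * pi) * (norm C1 + norm C2)"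
      unfolding Theta_def by (rule C(2)[OF \<rho> psum_sol c0 c1])
    also have "\<dots> = (C * c) / cmod \<rho> * exp (\<bar>Im \<rho>\<bar> * pi)" unfolding nC by simp
    also have "\<dots> \<le> (C * c + 1) / cmod \<rho> * exp (\<bar>Im \<rho>\<bar> * pi)" by (intro mult_right_mono divide_right_mono) auto
    finally show ?thesis unfolding V .
  qed
  moreover have "C * c + 1 > 0" using C(1) by (simp add: c_def add_nonneg_pos)
  ultimately show ?thesis by blast
qed

text \<open>The inverse of \<open>mat (e \<rho>) - Am\<close> in the eigenbasis of A; its size is
  governed by the distances of e(\<rho>) from the numbers \<mu>_p.\<close>

definition G where "G \<rho> = W\<^sup>\<dagger> ** (diag_mat (\<lambda>p. 1 / (e \<rho> - \<mu> p)) ** W)"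

lemma e_minus_Am: "mat (e \<rho>) - Am = W\<^sup>\<dagger> ** (diag_mat (\<lambda>p. e \<rho> - \<mu> p) ** W)"
proof -
  have "diag_mat (\<lambda>p. e \<rho> - \<mu> p) = (mat (e \<rho>) - diag_mat \<mu> :: complex^'m^'m)"
    by (simp add: vec_eq_iff diag_mat_def mat_def)
  moreover have "W\<^sup>\<dagger> ** (mat (e \<rho>) ** W) = mat (e \<rho>)"
    by (simp add: mat_mult_scm scm_mult_right WW) (simp add: vec_eq_iff mat_def)
  ultimately show ?thesis unfolding Am_def by (simp add: matrix_mult.diff_left matrix_mult.diff_right matrix_mul_assoc)
qed

lemma G_inverse:
  assumes "\<And>p. e \<rho> \<noteq> \<mu> p"
  shows "G \<rho> ** (mat (e \<rho>) - Am) = mat 1" "(mat (e \<rho>) - Am) ** G \<rho> = mat 1"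
proof -
  have "G \<rho> ** (mat (e \<rho>) - Am) = W\<^sup>\<dagger> ** (diag_mat (\<lambda>p. 1 / (e \<rho> - \<mu> p)) ** ((W ** W\<^sup>\<dagger>) ** (diag_mat (\<lambda>p. e \<rho> - \<mu> p) ** W)))"
    unfolding G_def e_minus_Am by (simp only: matrix_mul_assoc)
  also have "\<dots> = W\<^sup>\<dagger> ** ((diag_mat (\<lambda>p. 1 / (e \<rho> - \<mu> p)) ** diag_mat (\<lambda>p. e \<rho> - \<mu> p)) ** W)"
    unfolding WW by (simp only: matrix_mul_assoc matrix_mul_lid)
  also have "diag_mat (\<lambda>p. 1 / (e \<rho> - \<mu> p)) ** diag_mat (\<lambda>p. e \<rho> - \<mu> p) = (mat 1 :: complex^'m^'m)"
    using assms by (simp add: diag_mat_mult) (simp add: vec_eq_iff diag_mat_def mat_def)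
  finally show 1: "G \<rho> ** (mat (e \<rho>) - Am) = mat 1" by (simp add: WW)
  then show "(mat (e \<rho>) - Am) ** G \<rho> = mat 1" using matrix_left_right_inverse by blast
qed

text \<open>Since e(\<rho>) is \<mu>_p times exp(2 \<pi> i (\<rho> - \<omega>_p)) and |\<mu>_p| = 1,
  the lower bound for the exponential applies at \<rho> - \<omega>_p for each p. The factor max 1
  |e(\<rho>)| in the denominator matches the one in the error terms, so it cancels in
  products.\<close>

lemma far_bound:
  obtains c where "c > 0" "\<And>\<delta> \<rho>. 0 < \<delta> \<Longrightarrow> \<delta> \<le> 1 \<Longrightarrow> far \<omega> \<delta> \<rho> \<Longrightarrow>
     (\<forall>p. e \<rho> \<noteq> \<mu> p) \<and> norm (G \<rho>) \<le> c / (\<delta> * max 1 (cmod (e \<rho>)))"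
proof -
  obtain c0 where c0: "c0 > 0" "c0 \<le> 1" "\<And>z \<delta>. 0 \<le> \<delta> \<Longrightarrow> \<delta> \<le> 1 \<Longrightarrow> (\<And>n::int. \<delta> \<le> cmod (z - of_int n)) \<Longrightarrow>
    c0 * \<delta> * max 1 (cmod (exp (2 * pi * \<i> * z))) \<le> cmod (exp (2 * pi * \<i> * z) - 1)"
    using exp_minus_one_lower_bound by metis
  define c where "c = norm (W\<^sup>\<dagger>) * norm W * real CARD('m) / c0 + 1"
  have "c > 0" using c0 by (simp add: c_def add_nonneg_pos)
  moreover have "(\<forall>p. e \<rho> \<noteq> \<mu> p) \<and> norm (G \<rho>) \<le> c / (\<delta> * max 1 (cmod (e \<rho>)))"
    if \<delta>: "0 < \<delta>" "\<delta> \<le> 1" and f: "far \<omega> \<delta> \<rho>" for \<delta> \<rho>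
  proof -
    define mx where "mx = max 1 (cmod (e \<rho>))"
    have mx: "mx > 0" by (simp add: mx_def)
    have lower: "c0 * \<delta> * mx \<le> cmod (e \<rho> - \<mu> p)" for p
    proof -
      define z where "z = \<rho> - of_real (\<omega> p)"
      have e: "e \<rho> = \<mu> p * exp (2 * pi * \<i> * z)" by (simp add: e_def \<mu>_def z_def exp_add[symmetric] algebra_simps)
      have "c0 * \<delta> * max 1 (cmod (exp (2 * pi * \<i> * z))) \<le> cmod (exp (2 * pi * \<i> * z) - 1)"
      proof (rule c0(3))
        show "\<delta> \<le> cmod (z - of_int n)" for n
          using f by (simp add: far_def z_def diff_diff_eq add.commute)
      qed (use \<delta> in auto)
      moreover have "e \<rho> - \<mu> p = \<mu> p * (exp (2 * pi * \<i> * z) - 1)" by (simp add: e algebra_simps)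
      ultimately show ?thesis by (simp add: mx_def e norm_mult)
    qed
    have pos: "c0 * \<delta> * mx > 0" using c0 \<delta> mx by simp
    have "norm (G \<rho>) \<le> norm (W\<^sup>\<dagger>) * (norm (diag_mat (\<lambda>p. 1 / (e \<rho> - \<mu> p)) :: complex^'m^'m) * norm W)"
      unfolding G_def by (rule order_trans[OF norm_matrix_mult_le mult_left_mono[OF norm_matrix_mult_le]]) simp
    also have "\<dots> \<le> norm (W\<^sup>\<dagger>) * ((real CARD('m) / (c0 * \<delta> * mx)) * norm W)"
    proof (intro mult_left_mono mult_right_mono)
      have "norm (diag_mat (\<lambda>p. 1 / (e \<rho> - \<mu> p)) :: complex^'m^'m) \<le> (\<Sum>p\<in>UNIV. cmod (1 / (e \<rho> - \<mu> p)))"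
        by (rule norm_diag_mat_le)
      also have "\<dots> \<le> (\<Sum>p\<in>(UNIV::'m set). 1 / (c0 * \<delta> * mx))"
        using lower pos by (intro sum_mono) (auto simp: norm_divide intro!: divide_left_mono mult_pos_pos order.strict_trans2[OF pos lower])
      finally show "norm (diag_mat (\<lambda>p. 1 / (e \<rho> - \<mu> p)) :: complex^'m^'m) \<le> real CARD('m) / (c0 * \<delta> * mx)" by simp
    qed auto
    also have "\<dots> = (c - 1) / (\<delta> * mx)" using c0 \<delta> mx by (simp add: c_def mult_ac)
    also have "\<dots> \<le> c / (\<delta> * mx)" using \<delta> mx by (intro divide_right_mono) auto
    finally have "norm (G \<rho>) \<le> c / (\<delta> * mx)" .
    moreover have "e \<rho> \<noteq> \<mu> p" for p using order.strict_trans2[OF pos lower[of p]] by auto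
    ultimately show ?thesis by (auto simp: mx_def)
  qed
  ultimately show ?thesis using that by blast
qed

text \<open>Relative errors: the deviations of \<Delta> and \<Theta> from their main terms, stripped
  of all outer factors, so that they appear as perturbations added to the middle factors in
  \<open>Delta_E1\<close> and \<open>Theta_E2\<close>.\<close>

definition E1 where "E1 \<rho> = (2 / (\<i> * \<rho>) * ex \<rho>) *\<^sub>C (iB ** ((Delta \<rho> - Delta0 \<rho>) ** ih))"
definition E2 where "E2 \<rho> = (2 * ex \<rho>) *\<^sub>C (iB ** (Theta \<rho> - Theta0 \<rho>))"

lemma Delta_E1:
  assumes "\<rho> \<noteq> 0"
  shows "Delta \<rho> = (\<i> * \<rho> / 2 * exm \<rho>) *\<^sub>C (B1 ** (((mat (e \<rho>) - Am) + E1 \<rho>) ** (mat 1 - h1 L)))"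
proof -
  have "(\<i> * \<rho> / 2 * exm \<rho>) *\<^sub>C (B1 ** (E1 \<rho> ** (mat 1 - h1 L)))
    = (\<i> * \<rho> / 2 * exm \<rho> * (2 / (\<i> * \<rho>) * ex \<rho>)) *\<^sub>C ((B1 ** iB) ** ((Delta \<rho> - Delta0 \<rho>) ** (ih ** (mat 1 - h1 L))))"
    unfolding E1_def by (simp only: scm_mult_left scm_mult_right scm_scm matrix_mul_assoc)
  also have "\<i> * \<rho> / 2 * exm \<rho> * (2 / (\<i> * \<rho>) * ex \<rho>) = exm \<rho> * ex \<rho>" using assms by simp
  finally have "(\<i> * \<rho> / 2 * exm \<rho>) *\<^sub>C (B1 ** (E1 \<rho> ** (mat 1 - h1 L))) = Delta \<rho> - Delta0 \<rho>"
    unfolding ih iB ex_exm by simp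
  then show ?thesis
    by (simp add: Delta0_def matrix_mult.add_left matrix_mult.add_right scm.add_right)
qed

lemma Theta_E2: "Theta \<rho> = (exm \<rho> / 2) *\<^sub>C (B1 ** ((mat (e \<rho>) + Am ** ((mat 1 - h1 L) ** ih')) + E2 \<rho>))"
proof -
  have "(exm \<rho> / 2) *\<^sub>C (B1 ** E2 \<rho>) = (exm \<rho> / 2 * (2 * ex \<rho>)) *\<^sub>C ((B1 ** iB) ** (Theta \<rho> - Theta0 \<rho>))"
    unfolding E2_def by (simp only: scm_mult_left scm_mult_right scm_scm matrix_mul_assoc)
  also have "exm \<rho> / 2 * (2 * ex \<rho>) = 1" using ex_exm(1)[of \<rho>] by simp
  finally have "(exm \<rho> / 2) *\<^sub>C (B1 ** E2 \<rho>) = Theta \<rho> - Theta0 \<rho>" unfolding iB by simp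
  then show ?thesis by (simp add: Theta0_def matrix_mult.add_right scm.add_right)
qed

lemma E_bounds:
  obtains C where "C > 0" "\<And>\<rho>. 1 \<le> cmod \<rho> \<Longrightarrow> norm (E1 \<rho>) \<le> C / cmod \<rho> * max 1 (cmod (e \<rho>))"
    "\<And>\<rho>. 1 \<le> cmod \<rho> \<Longrightarrow> norm (E2 \<rho>) \<le> C / cmod \<rho> * max 1 (cmod (e \<rho>))"
proof -
  obtain C1 where C1: "C1 > 0" "\<And>\<rho>. 1 \<le> cmod \<rho> \<Longrightarrow> norm (Delta \<rho> - Delta0 \<rho>) \<le> C1 * exp (\<bar>Im \<rho>\<bar> * pi)"
    using Delta_asymptotics by blast
  obtain C2 where C2: "C2 > 0" "\<And>\<rho>. 1 \<le> cmod \<rho> \<Longrightarrow> norm (Theta \<rho> - Theta0 \<rho>) \<le> C2 / cmod \<rho> * exp (\<bar>Im \<rho>\<bar> * pi)"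
    using Theta_asymptotics by blast
  define a where "a = 2 * norm iB * C1 * norm ih"
  define b where "b = 2 * norm iB * C2"
  have ab: "a \<ge> 0" "b \<ge> 0" using C1 C2 by (simp_all add: a_def b_def)
  have 1: "norm (E1 \<rho>) \<le> a / cmod \<rho> * max 1 (cmod (e \<rho>))" if \<rho>: "1 \<le> cmod \<rho>" for \<rho>
  proof -
    have "norm (iB ** ((Delta \<rho> - Delta0 \<rho>) ** ih)) \<le> norm iB * (norm (Delta \<rho> - Delta0 \<rho>) * norm ih)"
      by (rule order_trans[OF norm_matrix_mult_le mult_left_mono[OF norm_matrix_mult_le]]) simp
    also have "\<dots> \<le> norm iB * ((C1 * exp (\<bar>Im \<rho>\<bar> * pi)) * norm ih)"
      by (intro mult_left_mono mult_right_mono C1 \<rho>) auto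
    finally have "norm (E1 \<rho>) \<le> (2 / cmod \<rho> * cmod (ex \<rho>)) * (norm iB * ((C1 * exp (\<bar>Im \<rho>\<bar> * pi)) * norm ih))"
      unfolding E1_def norm_scm by (simp add: norm_mult norm_divide) (intro mult_left_mono divide_right_mono, auto)
    also have "\<dots> = a / cmod \<rho> * (cmod (ex \<rho>) * exp (\<bar>Im \<rho>\<bar> * pi))" by (simp add: a_def)
    finally show ?thesis unfolding ex_bound .
  qed
  have 2: "norm (E2 \<rho>) \<le> b / cmod \<rho> * max 1 (cmod (e \<rho>))" if \<rho>: "1 \<le> cmod \<rho>" for \<rho>
  proof -
    have "norm (iB ** (Theta \<rho> - Theta0 \<rho>)) \<le> norm iB * (C2 / cmod \<rho> * exp (\<bar>Im \<rho>\<bar> * pi))"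
      by (rule order_trans[OF norm_matrix_mult_le mult_left_mono[OF C2(2)[OF \<rho>]]]) simp
    then have "norm (E2 \<rho>) \<le> (2 * cmod (ex \<rho>)) * (norm iB * (C2 / cmod \<rho> * exp (\<bar>Im \<rho>\<bar> * pi)))"
      unfolding E2_def norm_scm norm_mult by (intro mult_mono) auto
    also have "\<dots> = b / cmod \<rho> * (cmod (ex \<rho>) * exp (\<bar>Im \<rho>\<bar> * pi))" by (simp add: b_def)
    finally show ?thesis unfolding ex_bound .
  qed
  show ?thesis
  proof (rule that[of "a + b + 1"])
    show "a + b + 1 > 0" using ab by simp
    fix \<rho> :: complex assume \<rho>: "1 \<le> cmod \<rho>"
    have "a / cmod \<rho> * max 1 (cmod (e \<rho>)) \<le> (a + b + 1) / cmod \<rho> * max 1 (cmod (e \<rho>))"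
      "b / cmod \<rho> * max 1 (cmod (e \<rho>)) \<le> (a + b + 1) / cmod \<rho> * max 1 (cmod (e \<rho>))"
      using ab by (intro mult_right_mono divide_right_mono; simp)+
    then show "norm (E1 \<rho>) \<le> (a + b + 1) / cmod \<rho> * max 1 (cmod (e \<rho>))" "norm (E2 \<rho>) \<le> (a + b + 1) / cmod \<rho> * max 1 (cmod (e \<rho>))"
      using 1[OF \<rho>] 2[OF \<rho>] by linarith+
  qed
qed

section \<open>Comparison with the main terms\<close>

lemma det_scm: "det (c *\<^sub>C A) = c ^ CARD('n) * det (A :: complex^'n^'n)"
proof -
  have "det (diag_mat (\<lambda>_. c) ** A) = c ^ CARD('n) * det A" by (simp add: det_mul det_diag_mat)
  moreover have "diag_mat (\<lambda>_. c) ** A = c *\<^sub>C A" by (simp add: vec_eq_iff diag_mat_mult_nth)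
  ultimately show ?thesis by simp
qed

lemma det_Delta0: "det (Delta0 \<rho>) = (\<i> * \<rho> / 2 * exm \<rho>) ^ CARD('m) * (det B1 * (det (mat (e \<rho>) - Am) * det (mat 1 - h1 L)))"
  by (simp add: Delta0_def det_scm det_mul)

text \<open>The quotient of the two determinants is det(I + G E1), and G E1 is of size 1/(\<delta>
  |\<rho>|). The condition C \<le> \<delta> |\<rho>| thus dictates discs of radius of order 1/|n|,
  which becomes the remainder in the eigenvalue asymptotics.\<close>

lemma rouche_condition:
  obtains C where "C > 0" "\<And>\<rho> \<delta>. 1 \<le> cmod \<rho> \<Longrightarrow> 0 < \<delta> \<Longrightarrow> \<delta> \<le> 1 \<Longrightarrow> far \<omega> \<delta> \<rho> \<Longrightarrow> C \<le> \<delta> * cmod \<rho> \<Longrightarrow>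
     cmod (det (Delta \<rho>) - det (Delta0 \<rho>)) < cmod (det (Delta0 \<rho>))"
proof -
  obtain c where c: "c > 0" "\<And>\<delta> \<rho>. 0 < \<delta> \<Longrightarrow> \<delta> \<le> 1 \<Longrightarrow> far \<omega> \<delta> \<rho> \<Longrightarrow>
     (\<forall>p. e \<rho> \<noteq> \<mu> p) \<and> norm (G \<rho>) \<le> c / (\<delta> * max 1 (cmod (e \<rho>)))" using far_bound by metis
  obtain K where K: "K > 0" "\<And>\<rho>. 1 \<le> cmod \<rho> \<Longrightarrow> norm (E1 \<rho>) \<le> K / cmod \<rho> * max 1 (cmod (e \<rho>))"
    using E_bounds by metis
  obtain \<eta> where \<eta>: "\<eta> > 0" "\<And>X :: complex^'m^'m. norm X < \<eta> \<Longrightarrow> cmod (det (mat 1 + X) - 1) < 1"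
    using det_near_one by metis
  \<comment> \<open>Makes the norm of G E1 at most \<eta>/2, inside the neighbourhood on which det(I
    + X) differs from 1 by less than 1.\<close>
  define C where "C = 2 * c * K / \<eta>"
  have C: "C > 0" using c K \<eta> by (simp add: C_def)
  show ?thesis
  proof (rule that[OF C])
    fix \<rho> \<delta> assume \<rho>: "1 \<le> cmod \<rho>" and \<delta>: "0 < \<delta>" "\<delta> \<le> 1" and f: "far \<omega> \<delta> \<rho>" and large: "C \<le> \<delta> * cmod \<rho>"
    define mx where "mx = max 1 (cmod (e \<rho>))"
    have mx: "mx > 0" by (simp add: mx_def)
    have \<rho>0: "\<rho> \<noteq> 0" using \<rho> by auto
    have ne: "\<And>p. e \<rho> \<noteq> \<mu> p" and Gb: "norm (G \<rho>) \<le> c / (\<delta> * mx)" using c(2)[OF \<delta> f] by (auto simp: mx_def)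
    have "norm (G \<rho> ** E1 \<rho>) \<le> (c / (\<delta> * mx)) * (K / cmod \<rho> * mx)"
      by (rule order_trans[OF norm_matrix_mult_le mult_mono]) (use Gb K(2)[OF \<rho>] c mx \<delta> in \<open>auto simp: mx_def\<close>)
    also have "\<dots> = (c * K) / (\<delta> * cmod \<rho>)" using mx by simp
    also have "\<dots> \<le> (c * K) / C" using large C c K \<delta> \<rho>0 by (intro divide_left_mono mult_pos_pos) auto
    also have "\<dots> = \<eta> / 2" using c K by (simp add: C_def)
    also have "\<dots> < \<eta>" using \<eta> by simp
    finally have d1: "cmod (det (mat 1 + G \<rho> ** E1 \<rho>) - 1) < 1" by (rule \<eta>(2))
    have "(mat (e \<rho>) - Am) + E1 \<rho> = (mat (e \<rho>) - Am) ** (mat 1 + G \<rho> ** E1 \<rho>)"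
      by (simp add: matrix_mult.add_right matrix_mul_assoc G_inverse[OF ne])
    then have "det (Delta \<rho>) = det (Delta0 \<rho>) * det (mat 1 + G \<rho> ** E1 \<rho>)"
      unfolding Delta_E1[OF \<rho>0] det_Delta0 by (simp add: det_scm det_mul)
    then have "det (Delta \<rho>) - det (Delta0 \<rho>) = det (Delta0 \<rho>) * (det (mat 1 + G \<rho> ** E1 \<rho>) - 1)" by (simp add: algebra_simps)
    moreover have "det (Delta0 \<rho>) \<noteq> 0"
    proof -
      have "det (G \<rho>) * det (mat (e \<rho>) - Am) = 1" by (metis G_inverse(1)[OF ne] det_mul det_I)
      then have "det (mat (e \<rho>) - Am) \<noteq> 0" by auto
      then show ?thesis using \<rho>0 B1_det I_h1 ex_exm(4) by (simp add: det_Delta0)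
    qed
    then have "cmod (det (Delta0 \<rho>)) * cmod (det (mat 1 + G \<rho> ** E1 \<rho>) - 1) < cmod (det (Delta0 \<rho>)) * 1"
      using d1 by (intro mult_strict_left_mono) auto
    ultimately show "cmod (det (Delta \<rho>) - det (Delta0 \<rho>)) < cmod (det (Delta0 \<rho>))" by (simp add: norm_mult)
  qed
qed

text \<open>This is -Delta0^{-1} Theta0 simplified. Since I + (I - h_1)(I + h_1)^{-1} = 2 (I +
  h_1)^{-1}, the middle factor e + A (I - h_1)(I + h_1)^{-1} of \<open>Theta0\<close> equals (e - A)
  + 2 A (I + h_1)^{-1}.\<close>

definition M0 where "M0 \<rho> = (- 1 / (\<i> * \<rho>)) *\<^sub>C (ih ** (mat 1 + 2 *\<^sub>C (G \<rho> ** (Am ** ih'))))"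

text \<open>With the outer factors removed, the equation for the Weyl matrix reads (I + X) N = N0 +
  X2, where X and X2 are of size 1/|\<rho>|. Smallness of X first bounds N; then N - N0 = X2 - X N
  is of first order, and the prefactor 1/\<rho> gives the second.\<close>

lemma weyl_asymptotics:
  assumes \<delta>: "0 < \<delta>" "\<delta> \<le> 1"
  obtains C R where "C > 0" "R \<ge> 1" "\<And>\<rho>. R \<le> cmod \<rho> \<Longrightarrow> far \<omega> \<delta> \<rho> \<Longrightarrow> det (Delta \<rho>) \<noteq> 0 \<Longrightarrow>
     norm (weyl_matrix L \<rho> - M0 \<rho>) \<le> C / (cmod \<rho>)\<^sup>2"
proof -
  obtain c where c: "c > 0" "\<And>\<rho>. far \<omega> \<delta> \<rho> \<Longrightarrow>
     (\<forall>p. e \<rho> \<noteq> \<mu> p) \<and> norm (G \<rho>) \<le> c / (\<delta> * max 1 (cmod (e \<rho>)))" using far_bound \<delta> by metis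
  obtain K where K: "K > 0" "\<And>\<rho>. 1 \<le> cmod \<rho> \<Longrightarrow> norm (E1 \<rho>) \<le> K / cmod \<rho> * max 1 (cmod (e \<rho>))"
    "\<And>\<rho>. 1 \<le> cmod \<rho> \<Longrightarrow> norm (E2 \<rho>) \<le> K / cmod \<rho> * max 1 (cmod (e \<rho>))"
    using E_bounds by metis
  define k where "k = c * K / \<delta>"
  have k: "k > 0" using c K \<delta> by (simp add: k_def)
  define n0 where "n0 = norm (mat 1 :: complex^'m^'m) + 2 * (c / \<delta> * norm (Am ** ih'))"
  have n0: "n0 \<ge> 0" using c \<delta> by (simp add: n0_def)
  define C where "C = norm ih * (k * (1 + 2 * (n0 + k))) + 1"
  \<comment> \<open>Ensures that X has norm at most 1/2, so that the term X N can be
    absorbed.\<close>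
  define R where "R = max 1 (2 * k)"
  have "C > 0" using k n0 by (simp add: C_def add_nonneg_pos)
  moreover have "R \<ge> 1" by (simp add: R_def)
  moreover have "norm (weyl_matrix L \<rho> - M0 \<rho>) \<le> C / (cmod \<rho>)\<^sup>2"
    if \<rho>: "R \<le> cmod \<rho>" and f: "far \<omega> \<delta> \<rho>" and d: "det (Delta \<rho>) \<noteq> 0" for \<rho>
  proof -
    have \<rho>1: "1 \<le> cmod \<rho>" and \<rho>k: "2 * k \<le> cmod \<rho>" using \<rho> by (auto simp: R_def)
    have \<rho>0: "\<rho> \<noteq> 0" using \<rho>1 by auto
    define mx where "mx = max 1 (cmod (e \<rho>))"
    have mx: "mx \<ge> 1" by (simp add: mx_def)
    have ne: "\<And>p. e \<rho> \<noteq> \<mu> p" and Gb: "norm (G \<rho>) \<le> c / (\<delta> * mx)" using c(2)[OF f] by (auto simp: mx_def)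
    have GE: "norm (G \<rho> ** E) \<le> k / cmod \<rho>" if "norm E \<le> K / cmod \<rho> * mx" for E :: "complex^'m^'m"
    proof -
      have "norm (G \<rho> ** E) \<le> (c / (\<delta> * mx)) * (K / cmod \<rho> * mx)"
        by (rule order_trans[OF norm_matrix_mult_le mult_mono[OF Gb that]]) (use c mx \<delta> in auto)
      then show ?thesis using mx by (simp add: k_def)
    qed
    define X where "X = G \<rho> ** E1 \<rho>"
    define X2 where "X2 = G \<rho> ** E2 \<rho>"
    have Xb: "norm X \<le> k / cmod \<rho>" "norm X2 \<le> k / cmod \<rho>" unfolding X_def X2_def
      using K(2,3)[OF \<rho>1] by (auto intro!: GE simp: mx_def)
    have kr: "k / cmod \<rho> \<le> 1/2" using \<rho>k \<rho>0 by (simp add: divide_simps)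
    define M where "M = weyl_matrix L \<rho>"
    define N where "N = (- (\<i> * \<rho>)) *\<^sub>C ((mat 1 - h1 L) ** M)"
    define N0 where "N0 = mat 1 + 2 *\<^sub>C (G \<rho> ** (Am ** ih'))"
    have M: "M = (- 1 / (\<i> * \<rho>)) *\<^sub>C (ih ** N)"
    proof -
      have "(- 1 / (\<i> * \<rho>)) *\<^sub>C (ih ** N) = (- 1 / (\<i> * \<rho>) * (- (\<i> * \<rho>))) *\<^sub>C ((ih ** (mat 1 - h1 L)) ** M)"
        unfolding N_def by (simp only: scm_mult_right scm_scm matrix_mul_assoc)
      then show ?thesis using \<rho>0 by (simp add: ih)
    qed
    have MM: "M - M0 \<rho> = (- 1 / (\<i> * \<rho>)) *\<^sub>C (ih ** (N - N0))"
      unfolding M0_def N0_def[symmetric] by (subst M) (simp only: matrix_mult.diff_right scm.diff_right)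
    define rhs where "rhs = (mat (e \<rho>) + Am ** ((mat 1 - h1 L) ** ih')) + E2 \<rho>"
    have "iB ** (Delta \<rho> ** M) = - (iB ** Theta \<rho>)"
      unfolding M_def Delta_weyl[OF d] by (simp only: matrix_mult.minus_right)
    also have "iB ** (Delta \<rho> ** M) = (\<i> * \<rho> / 2 * exm \<rho>) *\<^sub>C ((iB ** B1) ** (((mat (e \<rho>) - Am) + E1 \<rho>) ** ((mat 1 - h1 L) ** M)))"
      unfolding Delta_E1[OF \<rho>0] by (simp only: scm_mult_left scm_mult_right matrix_mul_assoc)
    also have "\<dots> = (- (exm \<rho> / 2)) *\<^sub>C (((mat (e \<rho>) - Am) + E1 \<rho>) ** N)"
      unfolding iB N_def by (simp add: scm_mult_right scm_scm mult_ac)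
    also have "- (iB ** Theta \<rho>) = (- (exm \<rho> / 2)) *\<^sub>C ((iB ** B1) ** rhs)"
      unfolding Theta_E2 rhs_def[symmetric] by (simp only: scm_mult_right scm.minus_left matrix_mul_assoc)
    also have "(iB ** B1) ** rhs = rhs" unfolding iB by simp
    finally have "(- (exm \<rho> / 2)) *\<^sub>C (((mat (e \<rho>) - Am) + E1 \<rho>) ** N) = (- (exm \<rho> / 2)) *\<^sub>C rhs" .
    then have "((mat (e \<rho>) - Am) + E1 \<rho>) ** N = rhs"
      using ex_exm(4)[of \<rho>] by (simp add: vec_eq_iff)
    then have "G \<rho> ** (((mat (e \<rho>) - Am) + E1 \<rho>) ** N) = G \<rho> ** rhs" by simp
    then have "(G \<rho> ** (mat (e \<rho>) - Am)) ** N + X ** N = G \<rho> ** rhs"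
      unfolding X_def by (simp only: matrix_mult.add_left matrix_mult.add_right matrix_mul_assoc)
    then have NX: "N + X ** N = G \<rho> ** rhs" unfolding G_inverse[OF ne] by simp
    have "mat 1 + (mat 1 - h1 L) ** ih' = 2 *\<^sub>C ih'"
    proof -
      have "mat 1 + (mat 1 - h1 L) ** ih' = (mat 1 + h1 L) ** ih' + (mat 1 - h1 L) ** ih'" unfolding ih' ..
      also have "\<dots> = ih' + ih'" by (simp add: matrix_mult.add_left matrix_mult.diff_left)
      finally show ?thesis by (simp add: vec_eq_iff)
    qed
    then have "rhs = (mat (e \<rho>) - Am) + Am ** (2 *\<^sub>C ih') + E2 \<rho>"
      unfolding rhs_def by (metis (no_types, lifting) add_diff_eq diff_add_cancel diff_diff_eq2 add.assoc matrix_mul_rid matrix_mult.add_right)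
    then have "G \<rho> ** rhs = N0 + X2"
      unfolding N0_def X2_def by (simp add: matrix_mult.add_right G_inverse[OF ne] scm_mult_right)
    with NX have eq: "N - N0 = X2 - X ** N" by (simp add: algebra_simps)
    have "norm N0 \<le> n0"
    proof -
      have "norm (G \<rho>) \<le> c / \<delta>"
      proof -
        have "c / (\<delta> * mx) \<le> c / \<delta>" using c \<delta> mx by (intro divide_left_mono) auto
        then show ?thesis using Gb by linarith
      qed
      then have "norm (G \<rho> ** (Am ** ih')) \<le> c / \<delta> * norm (Am ** ih')"
        by (intro order_trans[OF norm_matrix_mult_le mult_right_mono]) auto
      moreover have "norm N0 \<le> norm (mat 1 :: complex^'m^'m) + norm (2 *\<^sub>C (G \<rho> ** (Am ** ih')))" unfolding N0_def by norm
      ultimately show ?thesis by (simp add: n0_def)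
    qed
    have XN: "norm (X ** N) \<le> k / cmod \<rho> * norm N"
      by (rule order_trans[OF norm_matrix_mult_le mult_right_mono[OF Xb(1)]]) simp
    have "k / cmod \<rho> * norm N \<le> 1/2 * norm N" using kr by (rule mult_right_mono) simp
    with XN have "norm (X ** N) \<le> 1/2 * norm N" by (rule order_trans)
    moreover have "N = N0 + (X2 - X ** N)" using eq by (simp add: algebra_simps)
    then have "norm N = norm (N0 + (X2 - X ** N))" by (rule arg_cong)
    then have "norm N \<le> norm N0 + (norm X2 + norm (X ** N))"
      using norm_triangle_ineq[of N0 "X2 - X ** N"] norm_triangle_ineq4[of X2 "X ** N"] by linarith
    moreover have "k / cmod \<rho> \<le> k / 1" using k \<rho>1 by (intro divide_left_mono) auto
    then have "norm X2 \<le> k" using Xb(2) by simp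
    ultimately have "norm N \<le> n0 + (k + 1/2 * norm N)"
      using \<open>norm N0 \<le> n0\<close> by (meson add_mono order_trans)
    then have Nb: "norm N \<le> 2 * (n0 + k)" by simp
    have "norm (N - N0) \<le> norm X2 + norm (X ** N)" unfolding eq by (rule norm_triangle_ineq4)
    also have "\<dots> \<le> k / cmod \<rho> + k / cmod \<rho> * (2 * (n0 + k))"
      using Xb(2) XN mult_left_mono[OF Nb, of "k / cmod \<rho>"] k \<rho>1 by auto
    also have "\<dots> = k * (1 + 2 * (n0 + k)) / cmod \<rho>" by (simp add: algebra_simps add_divide_distrib)
    finally have NN: "norm (N - N0) \<le> k * (1 + 2 * (n0 + k)) / cmod \<rho>" .
    have "norm (M - M0 \<rho>) \<le> (1 / cmod \<rho>) * (norm ih * norm (N - N0))"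
      unfolding MM norm_scm by (simp add: norm_divide norm_mult divide_right_mono norm_matrix_mult_le)
    also have "\<dots> \<le> (1 / cmod \<rho>) * (norm ih * (k * (1 + 2 * (n0 + k)) / cmod \<rho>))"
      by (intro mult_left_mono NN) auto
    also have "\<dots> = (C - 1) / (cmod \<rho>)\<^sup>2" by (simp add: C_def power2_eq_square)
    also have "\<dots> \<le> C / (cmod \<rho>)\<^sup>2" by (intro divide_right_mono) auto
    finally show ?thesis by (simp add: M_def)
  qed
  ultimately show ?thesis using that by blast
qed

end

section \<open>Numbering of the eigenvalues\<close>

text \<open>The count is 2 N + 2 and not 2 N + 1, since \<open>Pos 0\<close> and
  \<open>Neg 0\<close> both belong to it. This surplus of one for each q is matched by the m zeros
  that the factor \<rho>^m puts at the origin.\<close>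

lemma card_abs_wval_le: "finite {n. \<bar>wval n\<bar> \<le> int N}" "card {n. \<bar>wval n\<bar> \<le> int N} = 2 * (N + 1)"
proof -
  have eq: "{n. \<bar>wval n\<bar> \<le> int N} = Pos ` {..N} \<union> Neg ` {..N}"
  proof (intro set_eqI iffI)
    fix n assume "n \<in> {n. \<bar>wval n\<bar> \<le> int N}"
    then show "n \<in> Pos ` {..N} \<union> Neg ` {..N}" by (cases n) auto
  qed auto
  show "finite {n. \<bar>wval n\<bar> \<le> int N}" unfolding eq by simp
  have "card (Pos ` {..N} \<union> Neg ` {..N}) = card (Pos ` {..N}) + card (Neg ` {..N})"
    by (rule card_Un_disjoint) auto
  then show "card {n. \<bar>wval n\<bar> \<le> int N} = 2 * (N + 1)"
    unfolding eq by (simp add: card_image inj_on_def)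
qed

lemma wval_eqD: "wval n = wval n' \<Longrightarrow> wval n \<noteq> 0 \<Longrightarrow> n = n'"
  by (cases n; cases n') auto

lemma wval_fibre: "k \<noteq> 0 \<Longrightarrow> \<exists>n0. {n. wval n = k} = {n0}"
proof -
  assume k: "k \<noteq> 0"
  define n0 where "n0 = (if k > 0 then Pos (nat k) else Neg (nat (- k)))"
  have n0: "wval n0 = k" by (simp add: n0_def)
  have "n = n0" if "wval n = k" for n by (rule wval_eqD) (use that k n0 in auto)
  then have "{n. wval n = k} = {n0}" using n0 by blast
  then show ?thesis by blast
qed

text \<open>As the \<omega>_q differ by less than 1, distances below 1 arise only for n in {-1, 0,
  1}, so finitely many positive values compete for the minimum. Inserting 1 keeps the set nonempty
  and bounds g. Distance zero forces n = 0 for the same reason.\<close>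

lemma frequency_gap:
  fixes \<omega> :: "'m::finite \<Rightarrow> real"
  assumes "\<And>q. 0 \<le> \<omega> q" "\<And>q. \<omega> q < 1"
  obtains g where "g > 0" "g \<le> 1" "\<And>p q n. \<bar>real_of_int n + \<omega> p - \<omega> q\<bar> < g \<Longrightarrow> n = 0 \<and> \<omega> p = \<omega> q"
proof -
  define S where "S = (\<lambda>(p, q, n). \<bar>real_of_int n + \<omega> p - \<omega> q\<bar>) ` ((UNIV :: 'm set) \<times> (UNIV :: 'm set) \<times> {-1..1::int})"
  have fin: "finite (insert 1 (S - {0}))" by (simp add: S_def)
  define g where "g = Min (insert 1 (S - {0}))"
  have "g \<in> insert 1 (S - {0})" unfolding g_def by (rule Min_in[OF fin]) simp
  then have "g > 0" by (auto simp: S_def)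
  moreover have "g \<le> 1" unfolding g_def by (rule Min_le[OF fin]) simp
  moreover have "n = 0 \<and> \<omega> p = \<omega> q" if l: "\<bar>real_of_int n + \<omega> p - \<omega> q\<bar> < g" for p q n
  proof -
    note b = assms[of p] assms[of q]
    have "\<bar>real_of_int n\<bar> < 2" using l \<open>g \<le> 1\<close> b by linarith
    then have "n \<in> {-1..1}" by auto
    then have "\<bar>real_of_int n + \<omega> p - \<omega> q\<bar> \<in> S" unfolding S_def by (intro image_eqI[of _ _ "(p, q, n)"]) auto
    then have "\<bar>real_of_int n + \<omega> p - \<omega> q\<bar> = 0"
      using l Min_le[OF fin, of "\<bar>real_of_int n + \<omega> p - \<omega> q\<bar>"] unfolding g_def[symmetric] by force
    then have z: "real_of_int n + \<omega> p - \<omega> q = 0" by simp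
    then have "\<bar>real_of_int n\<bar> < 1" using b by linarith
    then have "n = 0" by linarith
    then show ?thesis using z by simp
  qed
  ultimately show ?thesis using that by blast
qed

context weyl_pencil begin

section \<open>Zeros of the main term and their multiplicities\<close>

definition pt :: "int \<Rightarrow> 'm \<Rightarrow> complex" where "pt k q = of_int k + of_real (\<omega> q)"

lemma pt_dist: "cmod (pt n p - pt k q) = \<bar>real_of_int (n - k) + \<omega> p - \<omega> q\<bar>"
proof -
  have "pt n p - pt k q = of_real (real_of_int (n - k) + \<omega> p - \<omega> q)" by (simp add: pt_def)
  then show ?thesis by (simp only: norm_of_real)
qed

lemma pt_dist': "cmod (pt n p - of_real c) = \<bar>real_of_int n + \<omega> p - c\<bar>"
proof -
  have "pt n p - of_real c = of_real (real_of_int n + \<omega> p - c)" by (simp add: pt_def)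
  then show ?thesis by (simp only: norm_of_real)
qed

lemma far_pt: "far \<omega> \<delta> \<rho> \<longleftrightarrow> (\<forall>p n. \<delta> \<le> cmod (\<rho> - pt n p))"
  by (simp add: far_def pt_def)

text \<open>High up on the imaginary axis all points n + \<omega>_p are at distance at least 1, and
  the main term dominates there.\<close>

lemma det_Delta_nontrivial: "\<exists>z. det (Delta z) \<noteq> 0" "\<exists>z. det (Delta0 z) \<noteq> 0"
proof -
  obtain C where C: "C > 0" "\<And>\<rho> \<delta>. 1 \<le> cmod \<rho> \<Longrightarrow> 0 < \<delta> \<Longrightarrow> \<delta> \<le> 1 \<Longrightarrow> far \<omega> \<delta> \<rho> \<Longrightarrow> C \<le> \<delta> * cmod \<rho> \<Longrightarrow>
     cmod (det (Delta \<rho>) - det (Delta0 \<rho>)) < cmod (det (Delta0 \<rho>))" using rouche_condition by metis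
  define \<rho> where "\<rho> = \<i> * of_real (max 1 C)"
  have n: "cmod \<rho> = max 1 C" using C(1) by (simp add: \<rho>_def norm_mult)
  have "far \<omega> 1 \<rho>" unfolding far_def
  proof (intro allI)
    fix p and n :: int
    have "\<bar>Im (\<rho> - (of_int n + of_real (\<omega> p)))\<bar> \<le> cmod (\<rho> - (of_int n + of_real (\<omega> p)))" by (rule abs_Im_le_cmod)
    then show "1 \<le> cmod (\<rho> - (of_int n + of_real (\<omega> p)))" by (simp add: \<rho>_def)
  qed
  then have "cmod (det (Delta \<rho>) - det (Delta0 \<rho>)) < cmod (det (Delta0 \<rho>))" by (intro C(2)) (auto simp: n)
  then have "det (Delta \<rho>) \<noteq> 0" "det (Delta0 \<rho>) \<noteq> 0" by auto
  then show "\<exists>z. det (Delta z) \<noteq> 0" "\<exists>z. det (Delta0 z) \<noteq> 0" by blast+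
qed

sublocale matrix_quotient Delta Theta "weyl_matrix L"
  by unfold_locales (use Theta_holomorphic Delta_weyl Delta_Theta_full_rank det_Delta_nontrivial in blast)+

lemma multiplicity_ev_eq: "multiplicity_ev L z = nat (zorder (\<lambda>\<rho>. det (Delta \<rho>)) z)"
  by (simp add: multiplicity_ev_def bc_V_phi)

lemma zorder_det_Delta_pos:
  assumes "z \<in> eigenvalues L"
  shows "zorder (\<lambda>\<rho>. det (Delta \<rho>)) z > 0"
proof -
  have "\<exists>\<^sub>F w in at z. det (Delta w) \<noteq> 0" by (rule eventually_frequently[OF _ eventually_det_nonzero]) simp
  then show ?thesis
    using zorder_pos_iff[OF det_holo open_UNIV UNIV_I, of z] assms by (simp add: eigenvalues_iff)
qed

lemma det_e_minus_Am: "det (mat (e \<rho>) - Am) = (\<Prod>p\<in>UNIV. e \<rho> - \<mu> p)"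
proof -
  have "det (W\<^sup>\<dagger>) * det W = 1" by (metis WW(1) det_mul det_I)
  moreover have "det (mat (e \<rho>) - Am) = (\<Prod>p\<in>UNIV. e \<rho> - \<mu> p) * (det (W\<^sup>\<dagger>) * det W)"
    by (simp add: e_minus_Am det_mul det_diag_mat)
  ultimately show ?thesis by simp
qed

lemma e_eq_iff: "e \<rho> = \<mu> p \<longleftrightarrow> (\<exists>n. \<rho> = pt n p)"
proof -
  have "e \<rho> = \<mu> p \<longleftrightarrow> (\<exists>n::int. 2 * pi * \<i> * \<rho> = 2 * pi * \<i> * \<omega> p + (of_int (2 * n) * pi) * \<i>)"
    unfolding e_def \<mu>_def by (rule exp_eq)
  also have "\<dots> \<longleftrightarrow> (\<exists>n. 2 * pi * \<i> * \<rho> = 2 * pi * \<i> * pt n p)" by (simp add: pt_def algebra_simps)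
  finally show ?thesis by simp
qed

lemma e_holomorphic: "(\<lambda>\<rho>. e \<rho> - \<mu> p) holomorphic_on S"
  unfolding e_def by (intro holomorphic_intros)

lemma e_deriv: "((\<lambda>\<rho>. e \<rho> - \<mu> p) has_field_derivative (2 * pi * \<i> * e z)) (at z)"
  unfolding e_def by (auto intro!: derivative_eq_intros)

lemma analytic_of_entire: "f holomorphic_on UNIV \<Longrightarrow> f analytic_on {z}"
  by (auto simp: analytic_at)

lemma zorder_e: "zorder (\<lambda>\<rho>. e \<rho> - \<mu> p) z = (if \<exists>n. z = pt n p then 1 else 0)"
proof (cases "\<exists>n. z = pt n p")
  case True
  then have 0: "e z = \<mu> p" by (simp add: e_eq_iff)
  have "deriv (\<lambda>\<rho>. e \<rho> - \<mu> p) z \<noteq> 0" unfolding DERIV_imp_deriv[OF e_deriv] by (simp add: 0)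
  then have "zorder (\<lambda>\<rho>. e \<rho> - \<mu> p) z = 1"
    by (intro zorder_zero_eqI') (auto simp: 0 intro!: analytic_of_entire e_holomorphic)
  then show ?thesis using True by simp
next
  case False
  then have "zorder (\<lambda>\<rho>. e \<rho> - \<mu> p) z = 0"
    by (intro zorder_eq_0I analytic_of_entire e_holomorphic) (simp add: e_eq_iff)
  then show ?thesis using False by simp
qed

lemma zorder_ident: "zorder (\<lambda>\<rho>. \<rho>) z = (if z = 0 then 1 else 0)" for z :: complex
proof (cases "z = 0")
  case True
  then have "zorder (\<lambda>\<rho>. \<rho>) z = 1" by (intro zorder_zero_eqI') auto
  then show ?thesis using True by simp
qed (auto intro!: zorder_eq_0I)

definition unit0 where "unit0 \<rho> = (\<i> / 2 * exm \<rho>) ^ CARD('m) * (det B1 * det (mat 1 - h1 L))"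

lemma Delta0_product: "det (Delta0 \<rho>) = unit0 \<rho> * (\<Prod>p\<in>UNIV. \<rho> * (e \<rho> - \<mu> p))"
  unfolding det_Delta0 det_e_minus_Am unit0_def
  by (simp add: prod.distrib power_mult_distrib power_divide)

lemma unit0: "unit0 \<rho> \<noteq> 0" "unit0 holomorphic_on UNIV"
proof -
  show "unit0 \<rho> \<noteq> 0" using B1_det I_h1 ex_exm(4) by (simp add: unit0_def)
  show "unit0 holomorphic_on UNIV" unfolding unit0_def[abs_def] exm_def by (intro holomorphic_intros)
qed

lemma Delta0_holomorphic: "(\<lambda>\<rho>. det (Delta0 \<rho>)) holomorphic_on UNIV"
  unfolding Delta0_product by (intro holomorphic_intros holomorphic_on_subset[OF unit0(2)] e_holomorphic) auto

lemma Delta0_zero_iff: "det (Delta0 z) = 0 \<longleftrightarrow> z = 0 \<or> (\<exists>n p. z = pt n p)"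
  unfolding Delta0_product using unit0 by (auto simp: e_eq_iff)

text \<open>Kept as a sum over p, in which coinciding \<omega>_p contribute separately, so that the
  zeros in a disc can be counted for one p at a time.\<close>

lemma zorder_Delta0:
  "zorder (\<lambda>\<rho>. det (Delta0 \<rho>)) z = (\<Sum>p\<in>UNIV. (if z = 0 then 1 else 0) + (if \<exists>n. z = pt n p then 1 else 0))"
proof -
  obtain z1 where "det (Delta0 z1) \<noteq> 0" using det_Delta_nontrivial by blast
  then have ev: "\<forall>\<^sub>F w in at z. det (Delta0 w) \<noteq> 0"
    using non_zero_neighbour_alt[OF Delta0_holomorphic, of z z1] by (auto elim: eventually_mono)
  have ev1: "\<forall>\<^sub>F w in at z. unit0 w * (\<Prod>p\<in>UNIV. w * (e w - \<mu> p)) \<noteq> 0"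
    using ev unfolding Delta0_product .
  have ev2: "\<forall>\<^sub>F w in at z. (\<Prod>p\<in>UNIV. w * (e w - \<mu> p)) \<noteq> 0"
    using ev1 by (rule eventually_mono) auto
  have ev3: "\<forall>\<^sub>F w in at z. w * (e w - \<mu> p) \<noteq> 0" for p
    using ev2 by (rule eventually_mono) auto
  have "zorder (\<lambda>\<rho>. det (Delta0 \<rho>)) z = zorder unit0 z + zorder (\<lambda>w. \<Prod>p\<in>UNIV. w * (e w - \<mu> p)) z"
    unfolding Delta0_product
    by (rule zorder_times_analytic[OF _ _ ev1]) (intro analytic_of_entire unit0(2) holomorphic_intros e_holomorphic)+
  also have "zorder unit0 z = 0" by (rule zorder_eq_0I[OF analytic_of_entire[OF unit0(2)] unit0(1)])
  also have "zorder (\<lambda>w. \<Prod>p\<in>UNIV. w * (e w - \<mu> p)) z = (\<Sum>p\<in>UNIV. zorder (\<lambda>w. w * (e w - \<mu> p)) z)"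
    by (rule zorder_prod_analytic[OF _ ev2]) (intro analytic_of_entire holomorphic_intros e_holomorphic)
  also have "\<dots> = (\<Sum>p\<in>UNIV. (if z = 0 then 1 else 0) + (if \<exists>n. z = pt n p then 1 else 0))"
  proof (rule sum.cong[OF refl])
    fix p
    have "zorder (\<lambda>w. w * (e w - \<mu> p)) z = zorder (\<lambda>w. w) z + zorder (\<lambda>w. e w - \<mu> p) z"
      by (rule zorder_times_analytic[OF _ _ ev3]) (intro analytic_of_entire holomorphic_intros e_holomorphic)+
    then show "zorder (\<lambda>w. w * (e w - \<mu> p)) z = (if z = 0 then 1 else 0) + (if \<exists>n. z = pt n p then 1 else 0)"
      unfolding zorder_ident zorder_e .
  qed
  finally show ?thesis by simp
qed

definition dominated where
  "dominated \<rho> \<longleftrightarrow> cmod (det (Delta \<rho>) - det (Delta0 \<rho>)) < cmod (det (Delta0 \<rho>))"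

lemma dominated_disc:
  assumes r: "r > 0" and d: "\<And>z. cmod (z - c) = r \<Longrightarrow> dominated z"
  shows "finite {z\<in>eigenvalues L. z \<in> ball c r}"
    and "int (\<Sum>z\<in>{z\<in>eigenvalues L. z \<in> ball c r}. multiplicity_ev L z)
      = (\<Sum>p\<in>UNIV. int (card {z\<in>ball c r. z = 0}) + int (card {z\<in>ball c r. \<exists>n. z = pt n p}))"
proof -
  define Z where "Z = {z\<in>ball c r. det (Delta0 z) = 0}"
  have eq: "{z\<in>eigenvalues L. z \<in> ball c r} = {z\<in>ball c r. det (Delta z) = 0}"
    by (auto simp: eigenvalues_iff)
  note R = rouche_disc[OF Delta0_holomorphic det_holo r, of c, OF d[unfolded dominated_def]]
  have fin: "finite Z" unfolding Z_def by (rule R(3))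
  show "finite {z\<in>eigenvalues L. z \<in> ball c r}" unfolding eq by (rule R(2))
  have "int (\<Sum>z\<in>{z\<in>eigenvalues L. z \<in> ball c r}. multiplicity_ev L z)
    = (\<Sum>z\<in>{z\<in>eigenvalues L. z \<in> ball c r}. zorder (\<lambda>\<rho>. det (Delta \<rho>)) z)"
    unfolding of_nat_sum using zorder_det_Delta_pos by (intro sum.cong refl) (simp add: multiplicity_ev_eq less_imp_le)
  also have "\<dots> = (\<Sum>z\<in>Z. zorder (\<lambda>\<rho>. det (Delta0 \<rho>)) z)" unfolding eq Z_def by (rule R(1))
  also have "\<dots> = (\<Sum>p\<in>UNIV. \<Sum>z\<in>Z. (if z = 0 then 1 else 0) + (if \<exists>n. z = pt n p then 1 else 0))"
    unfolding zorder_Delta0 by (rule sum.swap)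
  also have "\<dots> = (\<Sum>p\<in>UNIV. int (card {z\<in>ball c r. z = 0}) + int (card {z\<in>ball c r. \<exists>n. z = pt n p}))"
  proof (rule sum.cong[OF refl])
    fix p
    have c: "(\<Sum>z\<in>Z. (if P z then 1 else 0)) = int (card {z\<in>ball c r. P z})" if "\<And>z. P z \<Longrightarrow> det (Delta0 z) = 0" for P
    proof -
      have "(\<Sum>z\<in>Z. (if P z then 1 else 0)) = (\<Sum>z\<in>{z\<in>Z. P z}. (1::int))"
        using fin by (simp add: sum.If_cases Int_def)
      also have "{z\<in>Z. P z} = {z\<in>ball c r. P z}" using that by (auto simp: Z_def)
      finally show ?thesis by simp
    qed
    show "(\<Sum>z\<in>Z. (if z = 0 then 1 else 0) + (if \<exists>n. z = pt n p then 1 else 0))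
      = int (card {z\<in>ball c r. z = 0}) + int (card {z\<in>ball c r. \<exists>n. z = pt n p})"
      unfolding sum.distrib by (intro arg_cong2[where f="(+)"] c) (auto simp: Delta0_zero_iff)
  qed
  finally show "int (\<Sum>z\<in>{z\<in>eigenvalues L. z \<in> ball c r}. multiplicity_ev L z)
      = (\<Sum>p\<in>UNIV. int (card {z\<in>ball c r. z = 0}) + int (card {z\<in>ball c r. \<exists>n. z = pt n p}))" .
qed

text \<open>Eigenvalues and indices are matched by a key: \<open>None\<close> for the large disc, otherwise the centre
  \<open>(k, \<omega>\<^sub>q)\<close> of the small disc.\<close>

lemma numbering:
  obtains r :: "windex \<Rightarrow> 'm \<Rightarrow> complex" and N :: nat and K :: real
  where "numbers_eigenvalues L r" "K > 0"
    "\<And>n q. \<bar>wval n\<bar> > int N \<Longrightarrow> cmod (r n q - pt (wval n) q) \<le> K / \<bar>real_of_int (wval n)\<bar>"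
proof -
  obtain C where C: "C > 0" "\<And>\<rho> \<delta>. 1 \<le> cmod \<rho> \<Longrightarrow> 0 < \<delta> \<Longrightarrow> \<delta> \<le> 1 \<Longrightarrow> far \<omega> \<delta> \<rho> \<Longrightarrow> C \<le> \<delta> * cmod \<rho> \<Longrightarrow> dominated \<rho>"
    unfolding dominated_def using rouche_condition by metis
  obtain g where g: "g > 0" "g \<le> 1" "\<And>p q n. \<bar>real_of_int n + \<omega> p - \<omega> q\<bar> < g \<Longrightarrow> n = 0 \<and> \<omega> p = \<omega> q"
    using frequency_gap[of \<omega>, OF \<omega>] by metis
  \<comment> \<open>The points with |k| \<le> N lie in [-N, N + wm], so the large disc is centred at
    wm/2 and has radius N + 1/2. Its circle keeps the margin \<open>\<delta>1\<close> = (1 - wm)/2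
    to the points on either side; this is positive because wm < 1.\<close>
  define wm where "wm = Max (range \<omega>)"
  have wm: "\<omega> p \<le> wm" for p unfolding wm_def by (rule Max_ge) auto
  have "wm \<in> range \<omega>" unfolding wm_def by (rule Max_in) auto
  then have wm01: "0 \<le> wm" "wm < 1" using \<omega> by auto
  define \<delta>1 where "\<delta>1 = (1 - wm) / 2"
  have \<delta>1: "\<delta>1 > 0" "\<delta>1 \<le> 1/2" using wm01 by (auto simp: \<delta>1_def)
  \<comment> \<open>Radii up to d keep small discs with different centres disjoint, by half the gap,
    and separate them from the large disc, by the margin.\<close>
  define d where "d = min (g / 2) \<delta>1"
  have d: "d > 0" "d \<le> g / 2" "d \<le> \<delta>1" "d \<le> 1/2" using g \<delta>1 by (auto simp: d_def)
  obtain N :: nat where "max 4 (2 * C / d) \<le> real N" using real_arch_simple by blast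
  then have N4: "4 \<le> real N" and "2 * C / d \<le> real N" by auto
  then have Nd: "2 * C \<le> real N * d" using d by (simp add: pos_divide_le_eq)
  have NC: "C \<le> real N"
  proof -
    have "real N * d \<le> real N * 1" using d by (intro mult_left_mono) auto
    then show ?thesis using Nd C(1) by linarith
  qed
  \<comment> \<open>On such a circle |z| is at least |k|/2, so this radius \<delta> makes \<delta>
    |z| reach the constant C.\<close>
  define rad where "rad k = 2 * C / \<bar>real_of_int k\<bar>" for k :: int
  have rad: "0 < rad k" "rad k \<le> d" if "\<bar>k\<bar> > int N" for k
  proof -
    have k: "\<bar>real_of_int k\<bar> > real N" using that by linarith
    then show "0 < rad k" using C by (simp add: rad_def)
    have "2 * C \<le> d * \<bar>real_of_int k\<bar>"
      using Nd mult_left_mono[OF less_imp_le[OF k], of d] d(1) by (simp only: mult.commute[of _ d]) linarith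
    then show "rad k \<le> d" unfolding rad_def using k by (subst pos_divide_le_eq) auto
  qed
  define c :: complex where "c = of_real (wm / 2)"
  define B where "B = ball c (real N + 1/2)"
  have inside: "cmod (pt k p - c) \<le> real N + 1/2 - \<delta>1" if "\<bar>k\<bar> \<le> int N" for k p
  proof -
    have "\<bar>real_of_int k\<bar> \<le> real N" using that by linarith
    then show ?thesis unfolding c_def pt_dist' \<delta>1_def using \<omega>(1)[of p] wm[of p] by argo
  qed
  have outside: "cmod (pt k p - c) \<ge> real N + 1/2 + \<delta>1" if "\<bar>k\<bar> > int N" for k p
  proof -
    have "\<bar>real_of_int k\<bar> \<ge> real N + 1" using that by linarith
    then show ?thesis unfolding c_def pt_dist' \<delta>1_def using \<omega>(1)[of p] wm[of p] by argo
  qed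
  have cbound: "cmod c \<le> 1/2" using wm01 by (simp add: c_def)
  have big: "dominated z" if z: "cmod (z - c) = real N + 1/2" for z
  proof (rule C(2))
    have "cmod (z - c) \<le> cmod z + cmod c" by (rule norm_triangle_ineq4)
    then have zN: "real N \<le> cmod z" using z cbound by argo
    then show "1 \<le> cmod z" using N4 by linarith
    have "2 * C \<le> \<delta>1 * real N" using Nd mult_left_mono[OF d(3), of "real N"] by (simp add: mult.commute)
    also have "\<dots> \<le> \<delta>1 * cmod z" using zN \<delta>1 by (intro mult_left_mono) auto
    finally show "C \<le> \<delta>1 * cmod z" using C by linarith
    show "far \<omega> \<delta>1 z" unfolding far_pt
    proof (intro allI)
      fix p n
      show "\<delta>1 \<le> cmod (z - pt n p)"
      proof (cases "\<bar>n\<bar> \<le> int N")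
        case True
        have "cmod (z - c) \<le> cmod (z - pt n p) + cmod (pt n p - c)" using norm_triangle_ineq[of "z - pt n p" "pt n p - c"] by simp
        then show ?thesis using inside[OF True, of p] z by argo
      next
        case False
        have "cmod (pt n p - c) \<le> cmod (z - pt n p) + cmod (z - c)" using norm_triangle_ineq[of "pt n p - z" "z - c"] by (simp add: norm_minus_commute)
        moreover have "\<bar>n\<bar> > int N" using False by simp
        ultimately show ?thesis using outside[of n p] z by linarith
      qed
    qed
  qed (use \<delta>1 in auto)
  have small: "dominated z" if k: "\<bar>k\<bar> > int N" and z: "cmod (z - pt k q) = rad k" for z k q
  proof (rule C(2))
    note r = rad[OF k]
    have k5: "\<bar>real_of_int k\<bar> > real N" using k by linarith
    have "\<bar>real_of_int k\<bar> = cmod ((pt k q - z) + (z - of_real (\<omega> q)))" by (simp add: pt_def)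
    also have "\<dots> \<le> cmod (pt k q - z) + (cmod z + cmod (of_real (\<omega> q)))"
      by (intro order_trans[OF norm_triangle_ineq] add_mono norm_triangle_ineq4) auto
    also have "\<dots> \<le> rad k + (cmod z + 1)" using z \<omega>[of q] by (simp add: norm_minus_commute less_imp_le)
    finally have zk: "\<bar>real_of_int k\<bar> / 2 \<le> cmod z" using r d(4) k5 N4 by argo
    then show "1 \<le> cmod z" using k5 N4 by linarith
    have "C = rad k * (\<bar>real_of_int k\<bar> / 2)" using k5 by (simp add: rad_def)
    also have "\<dots> \<le> rad k * cmod z" using zk r by (intro mult_left_mono) auto
    finally show "C \<le> rad k * cmod z" .
    show "0 < rad k" "rad k \<le> 1" using r d by auto
    show "far \<omega> (rad k) z" unfolding far_pt
    proof (intro allI)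
      fix p n
      show "rad k \<le> cmod (z - pt n p)"
      proof (cases "\<bar>real_of_int (n - k) + \<omega> p - \<omega> q\<bar> < g")
        case True
        then have "pt n p = pt k q" using g(3)[OF True] by (simp add: pt_def)
        then show ?thesis using z by simp
      next
        case False
        have "cmod (pt n p - pt k q) \<le> cmod (z - pt n p) + cmod (z - pt k q)" using norm_triangle_ineq[of "pt n p - z" "z - pt k q"] by (simp add: norm_minus_commute)
        then show ?thesis using False r d(2) z unfolding pt_dist by linarith
      qed
    qed
  qed
  \<comment> \<open>An eigenvalue is not dominated, hence it lies within C/|z| of some n +
    \<omega>_p. Outside the large disc this point must have |n| > N, and C/|z| is at most the radius
    2 C/|n| because |n| \<le> 2 |z|.\<close>
  have locate: "\<exists>k q. \<bar>k\<bar> > int N \<and> z \<in> ball (pt k q) (rad k)" if z: "z \<in> eigenvalues L" "z \<notin> B" for z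
  proof -
    have "cmod (z - c) \<le> cmod z + cmod c" by (rule norm_triangle_ineq4)
    then have zN: "real N \<le> cmod z" using z(2) cbound by (simp add: B_def dist_norm norm_minus_commute)
    have z0: "cmod z > 0" using zN N4 by linarith
    have "\<not> dominated z" using z(1) by (simp add: dominated_def eigenvalues_iff)
    then have "\<not> far \<omega> (C / cmod z) z" using C(2)[of z "C / cmod z"] zN z0 N4 NC C(1) by (auto simp: divide_le_eq_1)
    then obtain p n where pn: "cmod (z - pt n p) < C / cmod z" by (auto simp: far_pt not_le)
    have "C / cmod z \<le> C / real N" using C(1) zN N4 z0 by (intro divide_left_mono mult_pos_pos) auto
    moreover have "C / real N \<le> d / 2" using Nd N4 by (simp add: pos_divide_le_eq mult.commute)
    ultimately have pd: "cmod (z - pt n p) < d / 2" using pn by linarith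
    have nN: "\<bar>n\<bar> > int N"
    proof (rule ccontr)
      assume "\<not> \<bar>n\<bar> > int N"
      then have "cmod (pt n p - c) \<le> real N + 1/2 - \<delta>1" by (intro inside) simp
      moreover have "cmod (z - c) \<le> cmod (z - pt n p) + cmod (pt n p - c)" using norm_triangle_ineq[of "z - pt n p" "pt n p - c"] by simp
      ultimately have "cmod (z - c) < real N + 1/2" using pd d \<delta>1 by argo
      then show False using z(2) by (simp add: B_def dist_norm norm_minus_commute)
    qed
    have "\<bar>real_of_int n\<bar> = cmod ((pt n p - z) + (z - of_real (\<omega> p)))" by (simp add: pt_def)
    also have "\<dots> \<le> cmod (pt n p - z) + (cmod z + cmod (of_real (\<omega> p)))"
      by (intro order_trans[OF norm_triangle_ineq] add_mono norm_triangle_ineq4) auto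
    also have "\<dots> \<le> 1 + (cmod z + 1)" using pd d \<omega>[of p] by (simp add: norm_minus_commute less_imp_le)
    finally have "\<bar>real_of_int n\<bar> \<le> 2 * cmod z" using zN N4 by linarith
    moreover have "\<bar>real_of_int n\<bar> > 0" using nN by simp
    ultimately have "C / cmod z \<le> rad n" unfolding rad_def using C z0 by (simp add: divide_simps mult.commute)
    then have "z \<in> ball (pt n p) (rad n)" using pn by (simp add: dist_norm norm_minus_commute)
    then show ?thesis using nN by blast
  qed
  have disjoint: "k = k' \<and> \<omega> q = \<omega> q'"
    if "\<bar>k\<bar> > int N" "\<bar>k'\<bar> > int N" "z \<in> ball (pt k q) (rad k)" "z \<in> ball (pt k' q') (rad k')" for k k' q q' z
  proof -
    have "cmod (pt k q - pt k' q') \<le> cmod (pt k q - z) + cmod (pt k' q' - z)" using norm_triangle_ineq4[of "pt k q - z" "pt k' q' - z"] by simp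
    also have "\<dots> < g" using that(3,4) rad(2)[OF that(1)] rad(2)[OF that(2)] d(2) by (simp add: dist_norm)
    finally show ?thesis using g(3)[of "k - k'" q q'] unfolding pt_dist by auto
  qed
  have disjoint_big: "z \<notin> B" if "\<bar>k\<bar> > int N" "z \<in> ball (pt k q) (rad k)" for k q z
  proof -
    have "cmod (pt k q - c) \<le> cmod (pt k q - z) + cmod (z - c)" using norm_triangle_ineq[of "pt k q - z" "z - c"] by simp
    then have "cmod (z - c) \<ge> real N + 1/2"
      using outside[OF that(1), of q] that(2) rad(2)[OF that(1)] d(3) by (simp add: dist_norm)
    then show ?thesis by (simp add: B_def dist_norm norm_minus_commute)
  qed
  \<comment> \<open>The key records the value of \<omega> at q and not q itself: indices with equal
    \<omega> share a disc.\<close>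
  define key where "key z = (if z \<in> B then None else
      Some (SOME kw. \<exists>q. snd kw = \<omega> q \<and> \<bar>fst kw\<bar> > int N \<and> z \<in> ball (pt (fst kw) q) (rad (fst kw))))" for z
  have key_small: "key z = Some (k, \<omega> q)" if "\<bar>k\<bar> > int N" "z \<in> ball (pt k q) (rad k)" for k q z
  proof -
    have "(SOME kw. \<exists>q. snd kw = \<omega> q \<and> \<bar>fst kw\<bar> > int N \<and> z \<in> ball (pt (fst kw) q) (rad (fst kw))) = (k, \<omega> q)"
    proof (rule some_equality)
      show "\<exists>q'. snd (k, \<omega> q) = \<omega> q' \<and> \<bar>fst (k, \<omega> q)\<bar> > int N \<and> z \<in> ball (pt (fst (k, \<omega> q)) q') (rad (fst (k, \<omega> q)))"
        using that by auto
      fix kw assume "\<exists>q. snd kw = \<omega> q \<and> \<bar>fst kw\<bar> > int N \<and> z \<in> ball (pt (fst kw) q) (rad (fst kw))"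
      then show "kw = (k, \<omega> q)" using disjoint[OF that(1) _ that(2)] by (metis prod.collapse)
    qed
    then show ?thesis using disjoint_big[OF that] by (simp add: key_def)
  qed
  have key_someD: "\<exists>q. w = \<omega> q \<and> \<bar>k\<bar> > int N \<and> z \<in> ball (pt k q) (rad k)" if z: "z \<in> eigenvalues L" "key z = Some (k, w)" for z k w
  proof -
    have "z \<notin> B" using z(2) by (auto simp: key_def)
    then obtain k' q where kq: "\<bar>k'\<bar> > int N" "z \<in> ball (pt k' q) (rad k')" using locate z(1) by blast
    then have "key z = Some (k', \<omega> q)" by (rule key_small)
    then show ?thesis using kq z(2) by auto
  qed
  define \<kappa> where "\<kappa> = (\<lambda>(n, q). if \<bar>wval n\<bar> \<le> int N then None else Some (wval n, \<omega> q))"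
  have key_None: "{z\<in>eigenvalues L. key z = None} = {z\<in>eigenvalues L. z \<in> B}" by (auto simp: key_def)
  have \<kappa>_None: "{i. \<kappa> i = None} = {n. \<bar>wval n\<bar> \<le> int N} \<times> UNIV" by (auto simp: \<kappa>_def split: if_splits)
  have key_Some: "{z\<in>eigenvalues L. key z = Some (k, \<omega> q)} = {z\<in>eigenvalues L. z \<in> ball (pt k q) (rad k)}" if "\<bar>k\<bar> > int N" for k q
  proof (intro set_eqI iffI)
    fix z assume "z \<in> {z\<in>eigenvalues L. key z = Some (k, \<omega> q)}"
    then obtain q' where "z \<in> eigenvalues L" "\<omega> q = \<omega> q'" "z \<in> ball (pt k q') (rad k)" using key_someD[of z k "\<omega> q"] by blast
    then show "z \<in> {z\<in>eigenvalues L. z \<in> ball (pt k q) (rad k)}" by (simp add: pt_def)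
  qed (use key_small[OF that] in blast)
  have \<kappa>_Some: "{i. \<kappa> i = Some (k, \<omega> q)} = {n. wval n = k} \<times> {p. \<omega> p = \<omega> q}" if "\<bar>k\<bar> > int N" for k q
    using that by (auto simp: \<kappa>_def split: if_splits)
  have key_Some': "{z\<in>eigenvalues L. key z = Some (k, w)} = {}" "{i. \<kappa> i = Some (k, w)} = {}" if "\<not> (\<bar>k\<bar> > int N \<and> (\<exists>q. w = \<omega> q))" for k w
  proof -
    show "{z\<in>eigenvalues L. key z = Some (k, w)} = {}" using key_someD[of _ k w] that by blast
    show "{i. \<kappa> i = Some (k, w)} = {}" using that by (auto simp: \<kappa>_def split: if_splits)
  qed
  \<comment> \<open>The origin contributes m through the factor \<rho>^m, and every \<omega>_p
    contributes 2 N + 1 points. The total (2 N + 2) m is the number of indices with |n| \<le>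
    N.\<close>
  have B: "finite {z\<in>eigenvalues L. z \<in> B}" "(\<Sum>z\<in>{z\<in>eigenvalues L. z \<in> B}. multiplicity_ev L z) = 2 * (N + 1) * CARD('m)"
  proof -
    have r: "real N + 1/2 > 0" by simp
    note R = dominated_disc[where c=c, OF r big, folded B_def]
    show "finite {z\<in>eigenvalues L. z \<in> B}" by (rule R(1))
    have "0 \<in> B" using cbound N4 by (simp add: B_def dist_norm)
    then have 1: "{z\<in>B. z = 0} = {0}" by auto
    have 2: "card {z\<in>B. \<exists>n. z = pt n p} = 2 * N + 1" for p
    proof -
      have "pt n p \<in> B \<longleftrightarrow> \<bar>n\<bar> \<le> int N" for n
        using inside[of n p] outside[of n p] \<delta>1 by (cases "\<bar>n\<bar> \<le> int N") (auto simp: B_def dist_norm norm_minus_commute)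
      then have "{z\<in>B. \<exists>n. z = pt n p} = (\<lambda>n. pt n p) ` {n. \<bar>n\<bar> \<le> int N}" by blast
      moreover have "{n. \<bar>n\<bar> \<le> int N} = {- int N..int N}" by auto
      moreover have "inj (\<lambda>n. pt n p)" by (auto simp: inj_def pt_def)
      ultimately have "card {z\<in>B. \<exists>n. z = pt n p} = card {- int N..int N}" by (metis card_image inj_on_subset subset_UNIV)
      then show ?thesis by simp
    qed
    have "int (\<Sum>z\<in>{z\<in>eigenvalues L. z \<in> B}. multiplicity_ev L z) = int (2 * (N + 1) * CARD('m))"
      using R(2) by (simp only: 1 2) (simp add: algebra_simps)
    then show "(\<Sum>z\<in>{z\<in>eigenvalues L. z \<in> B}. multiplicity_ev L z) = 2 * (N + 1) * CARD('m)" by (simp only: of_nat_eq_iff)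
  qed
  have S: "finite {z\<in>eigenvalues L. z \<in> ball (pt k q) (rad k)}"
    "(\<Sum>z\<in>{z\<in>eigenvalues L. z \<in> ball (pt k q) (rad k)}. multiplicity_ev L z) = card {p. \<omega> p = \<omega> q}" if k: "\<bar>k\<bar> > int N" for k q
  proof -
    note R = dominated_disc[where c="pt k q", OF rad(1)[OF k] small[OF k]]
    show "finite {z\<in>eigenvalues L. z \<in> ball (pt k q) (rad k)}" by (rule R(1))
    \<comment> \<open>The factor \<rho>^m is therefore invisible in a small disc, and only
      coinciding points n + \<omega>_p are counted.\<close>
    have "0 \<notin> ball (pt k q) (rad k)"
    proof
      assume 0: "0 \<in> ball (pt k q) (rad k)"
      have "0 \<in> B" using cbound N4 by (simp add: B_def dist_norm)
      then show False using disjoint_big[OF k 0] by simp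
    qed
    then have 1: "{z\<in>ball (pt k q) (rad k). z = 0} = {}" by auto
    have near: "n = k \<and> \<omega> p = \<omega> q" if "pt n p \<in> ball (pt k q) (rad k)" for n p
    proof -
      have "cmod (pt n p - pt k q) < g" using that rad(2)[OF k] d(2) g(1) by (simp add: dist_norm norm_minus_commute)
      then show ?thesis using g(3)[of "n - k" p q] unfolding pt_dist by auto
    qed
    have 2: "card {z\<in>ball (pt k q) (rad k). \<exists>n. z = pt n p} = (if \<omega> p = \<omega> q then 1 else 0)" for p
    proof (cases "\<omega> p = \<omega> q")
      case True
      then have e: "pt k p = pt k q" by (simp add: pt_def)
      have mem: "pt k q \<in> ball (pt k q) (rad k)" using rad(1)[OF k] by simp
      have "{z\<in>ball (pt k q) (rad k). \<exists>n. z = pt n p} = {pt k q}"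
      proof (intro set_eqI iffI)
        fix z assume "z \<in> {z\<in>ball (pt k q) (rad k). \<exists>n. z = pt n p}"
        then obtain n where n: "z = pt n p" "pt n p \<in> ball (pt k q) (rad k)" by auto
        have "n = k" using near[OF n(2)] by simp
        then show "z \<in> {pt k q}" using n(1) e by simp
      next
        fix z assume "z \<in> {pt k q}"
        then show "z \<in> {z\<in>ball (pt k q) (rad k). \<exists>n. z = pt n p}" using mem e[symmetric] by auto
      qed
      then show ?thesis using True by simp
    next
      case False
      then have "{z\<in>ball (pt k q) (rad k). \<exists>n. z = pt n p} = {}" using near by blast
      then show ?thesis using False by (simp only: card.empty if_False)
    qed
    have "int (\<Sum>z\<in>{z\<in>eigenvalues L. z \<in> ball (pt k q) (rad k)}. multiplicity_ev L z) = int (card {p. \<omega> p = \<omega> q})"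
      using R(2) by (simp only: 1 2) (simp add: if_distrib sum.If_cases)
    then show "(\<Sum>z\<in>{z\<in>eigenvalues L. z \<in> ball (pt k q) (rad k)}. multiplicity_ev L z) = card {p. \<omega> p = \<omega> q}" by (simp only: of_nat_eq_iff)
  qed
  have wfib: "finite {n. wval n = k}" "card {n. wval n = k} = 1" if "\<bar>k\<bar> > int N" for k
  proof -
    have "k \<noteq> 0" using that by auto
    then obtain n0 where "{n. wval n = k} = {n0}" using wval_fibre by blast
    then show "finite {n. wval n = k}" "card {n. wval n = k} = 1" by simp_all
  qed
  have all: "finite {i. \<kappa> i = j} \<and> finite {z\<in>eigenvalues L. key z = j} \<and>
      (\<Sum>z\<in>{z\<in>eigenvalues L. key z = j}. multiplicity_ev L z) = card {i. \<kappa> i = j}" for j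
  proof (cases j)
    case None
    show ?thesis unfolding None key_None \<kappa>_None
      using B card_abs_wval_le[of N] by (simp add: card_cartesian_product)
  next
    case (Some kw)
    obtain k w where kw: "kw = (k, w)" by (cases kw)
    show ?thesis
    proof (cases "\<bar>k\<bar> > int N \<and> (\<exists>q. w = \<omega> q)")
      case True
      then obtain q where q: "\<bar>k\<bar> > int N" "w = \<omega> q" by blast
      show ?thesis unfolding Some kw q(2) key_Some[OF q(1)] \<kappa>_Some[OF q(1)]
        using S[OF q(1)] wfib[OF q(1)] by (simp add: card_cartesian_product)
    next
      case False
      show ?thesis unfolding Some kw key_Some'[OF False] by simp
    qed
  qed
  have "\<exists>r. range r = eigenvalues L \<and> (\<forall>i. key (r i) = \<kappa> i) \<and>
     (\<forall>z\<in>eigenvalues L. finite {i. r i = z} \<and> card {i. r i = z} = multiplicity_ev L z)"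
  proof (rule numbering_by_keys)
    show "finite {i. \<kappa> i = j}" "finite {z\<in>eigenvalues L. key z = j}"
      "(\<Sum>z\<in>{z\<in>eigenvalues L. key z = j}. multiplicity_ev L z) = card {i. \<kappa> i = j}" for j using all by blast+
    show "multiplicity_ev L z > 0" if "z \<in> eigenvalues L" for z
      using zorder_det_Delta_pos[OF that] by (simp add: multiplicity_ev_eq)
  qed
  then obtain r where r: "range r = eigenvalues L" "\<And>i. key (r i) = \<kappa> i"
     "\<And>z. z \<in> eigenvalues L \<Longrightarrow> finite {i. r i = z} \<and> card {i. r i = z} = multiplicity_ev L z" by blast
  show ?thesis
  proof (rule that[of "\<lambda>n q. r (n, q)" "2 * C" N])
    have "(\<lambda>(n, q). r (n, q)) = r" "{(n, q). r (n, q) = z} = {i. r i = z}" for z by auto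
    then show "numbers_eigenvalues L (\<lambda>n q. r (n, q))" unfolding numbers_eigenvalues_def using r by simp
    show "2 * C > 0" using C by simp
    fix n q assume n: "\<bar>wval n\<bar> > int N"
    have "r (n, q) \<in> eigenvalues L" using r(1) by blast
    moreover have "key (r (n, q)) = Some (wval n, \<omega> q)" using r(2)[of "(n, q)"] n by (simp add: \<kappa>_def)
    ultimately obtain p where "\<omega> q = \<omega> p" "r (n, q) \<in> ball (pt (wval n) p) (rad (wval n))" using key_someD by blast
    then show "cmod (r (n, q) - pt (wval n) q) \<le> 2 * C / \<bar>real_of_int (wval n)\<bar>"
      by (simp add: pt_def rad_def dist_norm norm_minus_commute)
  qed
qed

end

section \<open>Weight matrices\<close>

text \<open>The larger disc may contain further singularities beyond the circle; they have winding
  number 0 and drop out.\<close>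

lemma circlepath_residues:
  assumes holo: "f holomorphic_on ball c R - S" and S: "finite S" and r: "0 < r" "r < R"
    and off: "\<And>z. z \<in> S \<Longrightarrow> cmod (z - c) \<noteq> r"
  shows "(f has_contour_integral (2 * pi * \<i> * (\<Sum>z\<in>{z\<in>S. z \<in> ball c r}. residue f z))) (circlepath c r)"
proof -
  have im: "path_image (circlepath c r) \<subseteq> ball c R - S"
    using r off by (auto simp: dist_norm norm_minus_commute)
  have "contour_integral (circlepath c r) f = 2 * pi * \<i> * (\<Sum>p\<in>S. winding_number (circlepath c r) p * residue f p)"
  proof (rule Residue_theorem[OF open_ball connected_ball S holo _ _ im])
    show "\<forall>z. z \<notin> ball c R \<longrightarrow> winding_number (circlepath c r) z = 0"
      using r by (auto intro!: winding_number_zero_outside[of _ "cball c r"])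
  qed auto
  also have "(\<Sum>p\<in>S. winding_number (circlepath c r) p * residue f p) = (\<Sum>z\<in>{z\<in>S. z \<in> ball c r}. residue f z)"
  proof (rule sum.mono_neutral_cong_right[OF S])
    show "\<forall>p\<in>S - {z\<in>S. z \<in> ball c r}. winding_number (circlepath c r) p * residue f p = 0"
    proof
      fix p assume p: "p \<in> S - {z\<in>S. z \<in> ball c r}"
      then have "p \<notin> cball c r" using off[of p] by (auto simp: dist_norm norm_minus_commute)
      then have "winding_number (circlepath c r) p = 0"
        using r by (intro winding_number_zero_outside[of _ "cball c r"]) auto
      then show "winding_number (circlepath c r) p * residue f p = 0" by simp
    qed
    fix p assume "p \<in> {z\<in>S. z \<in> ball c r}"
    then have "winding_number (circlepath c r) p = 1"
      by (intro winding_number_circlepath) (auto simp: dist_norm norm_minus_commute)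
    then show "winding_number (circlepath c r) p * residue f p = residue f p" by simp
  qed auto
  finally have eq: "contour_integral (circlepath c r) f = 2 * pi * \<i> * (\<Sum>z\<in>{z\<in>S. z \<in> ball c r}. residue f z)" .
  have "f contour_integrable_on circlepath c r"
    by (rule contour_integrable_continuous_circlepath)
       (rule continuous_on_subset[OF holomorphic_on_imp_continuous_on[OF holo] im])
  then show ?thesis using has_contour_integral_integral eq by metis
qed

text \<open>An eigenvalue of multiplicity m occurs under m indices; the weight 1/m reduces this to
  one occurrence. The numbered sum thereby becomes a sum over distinct points, as the residue
  theorem requires.\<close>

lemma sum_over_fibres:
  fixes h :: "'z \<Rightarrow> complex"
  assumes J: "finite J" and Z: "finite Z" and im: "f ` J \<subseteq> Z"
    and card: "\<And>z. z \<in> Z \<Longrightarrow> card {s\<in>J. f s = z} = m z" and pos: "\<And>z. z \<in> Z \<Longrightarrow> m z > 0"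
  shows "(\<Sum>s\<in>J. (1 / real (m (f s))) *\<^sub>R h (f s)) = (\<Sum>z\<in>Z. h z)"
proof -
  have "(\<Sum>s\<in>J. (1 / real (m (f s))) *\<^sub>R h (f s)) = (\<Sum>z\<in>Z. \<Sum>s\<in>{s\<in>J. f s = z}. (1 / real (m (f s))) *\<^sub>R h (f s))"
    by (rule sum.group[OF J Z im, symmetric])
  also have "\<dots> = (\<Sum>z\<in>Z. h z)"
  proof (rule sum.cong[OF refl])
    fix z assume z: "z \<in> Z"
    have "(\<Sum>s\<in>{s\<in>J. f s = z}. (1 / real (m (f s))) *\<^sub>R h (f s)) = (\<Sum>s\<in>{s\<in>J. f s = z}. (1 / real (m z)) *\<^sub>R h z)"
      by (rule sum.cong) auto
    also have "\<dots> = (real (m z) * (1 / real (m z))) *\<^sub>R h z"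
      using card[OF z] by (simp add: scaleR_conv_of_real)
    also have "\<dots> = h z" using pos[OF z] by simp
    finally show "(\<Sum>s\<in>{s\<in>J. f s = z}. (1 / real (m (f s))) *\<^sub>R h (f s)) = h z" .
  qed
  finally show ?thesis .
qed

lemma norm_matrix_le_sum: "norm (X :: complex^'n^'k) \<le> (\<Sum>i\<in>UNIV. \<Sum>j\<in>UNIV. cmod (X $ i $ j))"
proof -
  have "norm (X $ i) \<le> (\<Sum>j\<in>UNIV. cmod (X $ i $ j))" for i
    unfolding norm_vec_def[of "X $ i"] by (rule L2_set_le_sum) simp
  moreover have "norm X \<le> (\<Sum>i\<in>UNIV. norm (X $ i))"
    unfolding norm_vec_def[of X] by (rule L2_set_le_sum) simp
  ultimately show ?thesis by (meson order_trans sum_mono)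
qed

lemma bigo_windex_at_infinity:
  fixes f :: "windex \<Rightarrow> 'a::real_normed_field"
  assumes "\<And>n. \<bar>wval n\<bar> > int N \<Longrightarrow> norm (f n) \<le> C * norm (g n)"
  shows "f \<in> O[windex_at_infinity](g)"
proof (rule bigoI)
  show "\<forall>\<^sub>F n in windex_at_infinity. norm (f n) \<le> C * norm (g n)"
    unfolding windex_at_infinity_def eventually_filtercomap_at_top_linorder
    using assms by (intro exI[of _ "int N + 1"]) auto
qed

context weyl_pencil begin

definition weight_limit where
  "weight_limit q = ih ** W\<^sup>\<dagger> ** diag_mat (\<lambda>j. if \<omega> j = \<omega> q then 1 else 0) ** W ** ih'"

lemma weight_limit_nth:
  "weight_limit q $ i $ j = (\<Sum>p\<in>UNIV. (ih ** W\<^sup>\<dagger>) $ i $ p * ((if \<omega> p = \<omega> q then 1 else 0) * (W ** ih') $ p $ j))"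
proof -
  have "weight_limit q = (ih ** W\<^sup>\<dagger>) ** (diag_mat (\<lambda>j. if \<omega> j = \<omega> q then 1 else 0) ** (W ** ih'))"
    by (simp only: weight_limit_def matrix_mul_assoc)
  then show ?thesis by (simp add: matrix_matrix_mult_def[of "ih ** W\<^sup>\<dagger>"] diag_mat_mult_nth)
qed

text \<open>In the eigenbasis of A the singular behaviour near the points n + \<omega>_p sits in the
  scalar factors \<mu>_p / (e(w) - \<mu>_p).\<close>

lemma M0_nth:
  "M0 w $ i $ j = (\<i> / w) * (ih $ i $ j + 2 * (\<Sum>p\<in>UNIV. (ih ** W\<^sup>\<dagger>) $ i $ p * ((\<mu> p / (e w - \<mu> p)) * (W ** ih') $ p $ j)))"
proof -
  have "G w ** (Am ** ih') = W\<^sup>\<dagger> ** (diag_mat (\<lambda>p. 1 / (e w - \<mu> p)) ** ((W ** W\<^sup>\<dagger>) ** (diag_mat \<mu> ** (W ** ih'))))"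
    unfolding G_def Am_def by (simp only: matrix_mul_assoc)
  also have "\<dots> = W\<^sup>\<dagger> ** ((diag_mat (\<lambda>p. 1 / (e w - \<mu> p)) ** diag_mat \<mu>) ** (W ** ih'))"
    unfolding WW by (simp only: matrix_mul_lid matrix_mul_assoc)
  finally have "G w ** (Am ** ih') = W\<^sup>\<dagger> ** (diag_mat (\<lambda>p. \<mu> p / (e w - \<mu> p)) ** (W ** ih'))"
    by (simp add: diag_mat_mult)
  then have "M0 w = (- 1 / (\<i> * w)) *\<^sub>C (ih + 2 *\<^sub>C ((ih ** W\<^sup>\<dagger>) ** (diag_mat (\<lambda>p. \<mu> p / (e w - \<mu> p)) ** (W ** ih'))))"
    unfolding M0_def by (simp only: matrix_mult.add_right matrix_mul_rid scm_mult_right matrix_mul_assoc)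
  moreover have "- 1 / (\<i> * w) = \<i> / w" by (cases "w = 0") (auto simp: field_simps)
  ultimately show ?thesis
    by (simp add: matrix_matrix_mult_def[of "ih ** W\<^sup>\<dagger>"] diag_mat_mult_nth)
qed

text \<open>Near \<open>pt k q\<close> exactly the factors with \<omega>_p = \<omega>_q are
  singular. There e - \<mu>_p has the derivative 2 \<pi> i \<mu>_p, so that (i/w) 2 \<mu>_p / (e(w)
  - \<mu>_p) has residue 1/(\<pi> c) at the centre c. The bound of g by |c| keeps the pole of 1/w
  outside the disc.\<close>

lemma residue_M0:
  assumes gap: "\<And>p q n. \<bar>real_of_int n + \<omega> p - \<omega> q\<bar> < g \<Longrightarrow> n = 0 \<and> \<omega> p = \<omega> q"
    and g: "0 < g" "g \<le> cmod (pt k q)"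
  shows "(\<lambda>w. M0 w $ i $ j) holomorphic_on ball (pt k q) g - {pt k q}"
    and "residue (\<lambda>w. M0 w $ i $ j) (pt k q) = weight_limit q $ i $ j / (pi * pt k q)"
proof -
  define c where "c = pt k q"
  have c0: "c \<noteq> 0" using g by (auto simp: c_def)
  have w0: "w \<noteq> 0" if "w \<in> ball c g" for w using that g(2) by (auto simp: c_def dist_norm)
  have ne: "e w \<noteq> \<mu> p" if w: "w \<in> ball c g - {c}" for w p
  proof
    assume "e w = \<mu> p"
    then obtain n where n: "w = pt n p" by (auto simp: e_eq_iff)
    then have "\<bar>real_of_int (n - k) + \<omega> p - \<omega> q\<bar> < g"
      using w unfolding pt_dist[symmetric] by (simp add: c_def dist_norm norm_minus_commute)
    from gap[OF this] have "w = c" by (simp add: n c_def pt_def)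
    then show False using w by simp
  qed
  have "(\<lambda>w. M0 w $ i $ j) holomorphic_on ball c g - {c}"
    unfolding M0_nth using ne w0 by (intro holomorphic_intros e_holomorphic) auto
  then show holo: "(\<lambda>w. M0 w $ i $ j) holomorphic_on ball (pt k q) g - {pt k q}" by (simp add: c_def)
  have lim: "((\<lambda>w. (w - c) / (e w - \<mu> p)) \<longlongrightarrow> (if \<omega> p = \<omega> q then 1 / (2 * pi * \<i> * \<mu> p) else 0)) (at c)" for p
  proof (cases "\<omega> p = \<omega> q")
    case True
    then have ec: "e c = \<mu> p" using e_eq_iff[of c p] by (auto simp: c_def pt_def)
    have "((\<lambda>w. ((e w - \<mu> p) - (e c - \<mu> p)) / (w - c)) \<longlongrightarrow> 2 * pi * \<i> * e c) (at c)"
      using e_deriv[of p c] by (simp only: has_field_derivative_iff)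
    then have "((\<lambda>w. inverse (((e w - \<mu> p) - (e c - \<mu> p)) / (w - c))) \<longlongrightarrow> inverse (2 * pi * \<i> * e c)) (at c)"
      by (rule tendsto_inverse) (simp add: ec)
    then show ?thesis using True by (simp add: ec inverse_eq_divide)
  next
    case False
    have "e c \<noteq> \<mu> p"
    proof
      assume "e c = \<mu> p"
      then obtain n where n: "c = pt n p" by (auto simp: e_eq_iff)
      then have "\<bar>real_of_int (n - k) + \<omega> p - \<omega> q\<bar> < g"
        using g unfolding pt_dist[symmetric] by (simp add: c_def)
      from gap[OF this] show False using False by simp
    qed
    moreover have "isCont e c" unfolding e_def by (intro continuous_intros)
    ultimately have "((\<lambda>w. (w - c) / (e w - \<mu> p)) \<longlongrightarrow> (c - c) / (e c - \<mu> p)) (at c)"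
      by (intro tendsto_intros) (auto simp: isCont_def)
    then show ?thesis using False by simp
  qed
  let ?B = "ih ** W\<^sup>\<dagger>" and ?C = "W ** ih'"
  have "((\<lambda>w. (\<i> / w) * (ih $ i $ j * (w - c) + 2 * (\<Sum>p\<in>UNIV. ?B $ i $ p * (\<mu> p * ((w - c) / (e w - \<mu> p)) * ?C $ p $ j))))
     \<longlongrightarrow> (\<i> / c) * (ih $ i $ j * (c - c) + 2 * (\<Sum>p\<in>UNIV. ?B $ i $ p * (\<mu> p * (if \<omega> p = \<omega> q then 1 / (2 * pi * \<i> * \<mu> p) else 0) * ?C $ p $ j)))) (at c)"
    by (intro tendsto_intros lim c0)
  moreover have "(\<lambda>w. (\<i> / w) * (ih $ i $ j * (w - c) + 2 * (\<Sum>p\<in>UNIV. ?B $ i $ p * (\<mu> p * ((w - c) / (e w - \<mu> p)) * ?C $ p $ j))))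
     = (\<lambda>w. M0 w $ i $ j * (w - c))"
    by (simp add: M0_nth fun_eq_iff distrib_left distrib_right sum_distrib_left sum_distrib_right mult_ac)
  moreover have "(\<i> / c) * (ih $ i $ j * (c - c) + 2 * (\<Sum>p\<in>UNIV. ?B $ i $ p * (\<mu> p * (if \<omega> p = \<omega> q then 1 / (2 * pi * \<i> * \<mu> p) else 0) * ?C $ p $ j)))
     = weight_limit q $ i $ j / (pi * c)"
  proof -
    have "(\<Sum>p\<in>UNIV. ?B $ i $ p * (\<mu> p * (if \<omega> p = \<omega> q then 1 / (2 * pi * \<i> * \<mu> p) else 0) * ?C $ p $ j))
      = (\<Sum>p\<in>UNIV. 1 / (2 * pi * \<i>) * (?B $ i $ p * ((if \<omega> p = \<omega> q then 1 else 0) * ?C $ p $ j)))"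
      by (intro sum.cong refl) auto
    also have "\<dots> = 1 / (2 * pi * \<i>) * weight_limit q $ i $ j" unfolding weight_limit_nth sum_distrib_left ..
    finally show ?thesis using c0 by (simp add: field_simps)
  qed
  ultimately have "((\<lambda>w. M0 w $ i $ j * (w - c)) \<longlongrightarrow> weight_limit q $ i $ j / (pi * c)) (at c)" by simp
  then show "residue (\<lambda>w. M0 w $ i $ j) (pt k q) = weight_limit q $ i $ j / (pi * pt k q)"
    using g(1) holo unfolding c_def by (intro residue_simple'[of "ball (pt k q) g"]) auto
qed

context
  fixes r :: "windex \<Rightarrow> 'm \<Rightarrow> complex" and N :: nat and K :: real
  assumes r: "numbers_eigenvalues L r" and K: "K > 0"
    and asym: "\<And>n q. \<bar>wval n\<bar> > int N \<Longrightarrow> cmod (r n q - pt (wval n) q) \<le> K / \<bar>real_of_int (wval n)\<bar>"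
begin

section \<open>Consequences for a numbering with the given asymptotics\<close>

lemma range_r: "r n q \<in> eigenvalues L" "z \<in> eigenvalues L \<Longrightarrow> \<exists>n q. z = r n q"
proof -
  have R: "range (\<lambda>(n, q). r n q) = eigenvalues L" using r by (simp add: numbers_eigenvalues_def)
  show "r n q \<in> eigenvalues L" unfolding R[symmetric] by (rule image_eqI[of _ _ "(n, q)"]) auto
  show "\<exists>n q. z = r n q" if "z \<in> eigenvalues L" using that unfolding R[symmetric] by auto
qed

lemma r_close: "cmod (r n q - pt (wval n) q) < \<epsilon>"
  if "\<bar>wval n\<bar> > int N'" "N \<le> N'" "K \<le> \<epsilon> * real N'" "\<epsilon> > 0" for \<epsilon>
proof -
  have n: "\<bar>real_of_int (wval n)\<bar> > real N'" using that(1) by linarith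
  have "\<epsilon> * real N' < \<epsilon> * \<bar>real_of_int (wval n)\<bar>" using n that(4) by (rule mult_strict_left_mono)
  then have "K < \<epsilon> * \<bar>real_of_int (wval n)\<bar>" using that(3) by linarith
  then have "K / \<bar>real_of_int (wval n)\<bar> < \<epsilon>" using n by (subst pos_divide_less_eq) auto
  moreover have "\<bar>wval n\<bar> > int N" using that by linarith
  ultimately show ?thesis using asym[of n q] by linarith
qed

lemma pt_norm: "cmod (pt k q) \<ge> \<bar>real_of_int k\<bar> - 1" "\<bar>real_of_int k\<bar> + 1 \<ge> cmod (pt k q)"
proof -
  have "pt k q = of_real (real_of_int k + \<omega> q)" by (simp add: pt_def)
  then have "cmod (pt k q) = \<bar>real_of_int k + \<omega> q\<bar>" by (simp only: norm_of_real)
  then show "cmod (pt k q) \<ge> \<bar>real_of_int k\<bar> - 1" "\<bar>real_of_int k\<bar> + 1 \<ge> cmod (pt k q)" using \<omega>[of q] by linarith+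
qed

lemma r_unbounded: "\<exists>N'. \<forall>n q. \<bar>wval n\<bar> \<ge> int N' \<longrightarrow> cmod (r n q) > B"
proof -
  obtain N1 :: nat where "max (real N) (max K (B + 3)) \<le> real N1" using real_arch_simple by blast
  then have N1: "N \<le> N1" "K \<le> 1 * real N1" "B + 3 \<le> real N1" by auto
  have "cmod (r n q) > B" if n: "\<bar>wval n\<bar> \<ge> int (N1 + 1)" for n q
  proof -
    have n': "\<bar>wval n\<bar> > int N1" using n by simp
    have "cmod (r n q - pt (wval n) q) < 1" by (rule r_close[OF n' N1(1,2)]) simp
    moreover have "cmod (pt (wval n) q) \<le> cmod (r n q) + cmod (r n q - pt (wval n) q)"
      using norm_triangle_ineq4[of "r n q" "r n q - pt (wval n) q"] by simp
    moreover have "\<bar>real_of_int (wval n)\<bar> \<ge> real N1" using n' by linarith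
    ultimately show ?thesis using pt_norm(1)[of "wval n" q] N1(3) by linarith
  qed
  then show ?thesis by blast
qed

text \<open>The eigenvalues with small |n'| are finitely many, hence bounded, and stay away from n +
  \<omega>_q for large |n|. All others lie within \<delta> of their own point, and \<delta> + 2
  \<delta> does not exceed the gap.\<close>

lemma r_separated:
  assumes gap: "\<And>p q n. \<bar>real_of_int n + \<omega> p - \<omega> q\<bar> < 3 * \<delta> \<Longrightarrow> n = 0 \<and> \<omega> p = \<omega> q" and \<delta>: "0 < \<delta>" "\<delta> \<le> 1/3"
  shows "\<exists>N'. \<forall>n q n' s. \<bar>wval n\<bar> > int N' \<longrightarrow> cmod (r n' s - pt (wval n) q) < 2 * \<delta> \<longrightarrow> n' = n \<and> \<omega> s = \<omega> q"
proof -
  obtain N1 :: nat where "max (real N) (K / \<delta>) \<le> real N1" using real_arch_simple by blast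
  then have N1: "N \<le> N1" "K \<le> \<delta> * real N1" using \<delta> by (auto simp: pos_divide_le_eq mult.commute)
  have "finite ((\<lambda>(n, s). r n s) ` ({n. \<bar>wval n\<bar> \<le> int N1} \<times> UNIV))"
    using card_abs_wval_le(1)[of N1] by simp
  then have "bounded ((\<lambda>(n, s). r n s) ` ({n. \<bar>wval n\<bar> \<le> int N1} \<times> UNIV))" by (rule finite_imp_bounded)
  then obtain B where "\<forall>x \<in> (\<lambda>(n, s). r n s) ` ({n. \<bar>wval n\<bar> \<le> int N1} \<times> UNIV). cmod x \<le> B"
    unfolding bounded_iff by blast
  then have B: "cmod (r n s) \<le> B" if "\<bar>wval n\<bar> \<le> int N1" for n s using that by force
  obtain N2 :: nat where "max (real N1) (B + 3) \<le> real N2" using real_arch_simple by blast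
  then have N2: "N1 \<le> N2" "B + 3 \<le> real N2" by auto
  have "n' = n \<and> \<omega> s = \<omega> q" if n: "\<bar>wval n\<bar> > int N2" and cl: "cmod (r n' s - pt (wval n) q) < 2 * \<delta>" for n q n' s
  proof (cases "\<bar>wval n'\<bar> \<le> int N1")
    case True
    have "cmod (pt (wval n) q) \<le> cmod (r n' s) + cmod (r n' s - pt (wval n) q)"
      using norm_triangle_ineq4[of "r n' s" "r n' s - pt (wval n) q"] by simp
    moreover have "\<bar>real_of_int (wval n)\<bar> > real N2" using n by linarith
    moreover have "2 * \<delta> \<le> 1" using \<delta> by simp
    ultimately show ?thesis using pt_norm(1)[of "wval n" q] N2(2) B[OF True, of s] cl by linarith
  next
    case False
    then have n': "\<bar>wval n'\<bar> > int N1" by simp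
    have "cmod (r n' s - pt (wval n') s) < \<delta>" by (rule r_close[OF n' N1 \<delta>(1)])
    moreover have "cmod (pt (wval n') s - pt (wval n) q) \<le> cmod (r n' s - pt (wval n) q) + cmod (r n' s - pt (wval n') s)"
      using norm_triangle_ineq4[of "r n' s - pt (wval n) q" "r n' s - pt (wval n') s"] by simp
    ultimately have "\<bar>real_of_int (wval n' - wval n) + \<omega> s - \<omega> q\<bar> < 3 * \<delta>" using cl unfolding pt_dist by linarith
    from gap[OF this] have "wval n' = wval n" "\<omega> s = \<omega> q" by auto
    moreover have "wval n' \<noteq> 0" using n' by auto
    ultimately show ?thesis using wval_eqD by blast
  qed
  then show ?thesis by blast
qed

text \<open>The constant in \<open>weyl_asymptotics\<close> depends on \<delta>, which is why the
  circle must not shrink with n. A fixed radius is possible because \<open>r_separated\<close>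
  leaves inside only eigenvalues belonging to this n and this value of \<omega>.\<close>

lemma weight_asymptotics:
  "\<exists>C N'. \<forall>n. \<bar>wval n\<bar> > int N' \<longrightarrow>
    norm ((\<Sum>s\<in>{s. \<omega> s = \<omega> q}. (1 / real (multiplicity_ev L (r n s))) *\<^sub>R matrix_residue (weyl_matrix L) (r n s)) -
      (1 / (pi * real_of_int (wval n))) *\<^sub>R weight_limit q) \<le> C / (real_of_int (wval n))\<^sup>2"
proof -
  obtain g where g: "g > 0" "g \<le> 1" "\<And>p q n. \<bar>real_of_int n + \<omega> p - \<omega> q\<bar> < g \<Longrightarrow> n = 0 \<and> \<omega> p = \<omega> q"
    using frequency_gap[of \<omega>, OF \<omega>] by metis
  \<comment> \<open>A third of the gap: circles of radius \<delta> keep at least the distance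
    \<delta> from all points n + \<omega>_p, and discs of radius 2 \<delta> still isolate one group
    of eigenvalues.\<close>
  define \<delta> where "\<delta> = g / 3"
  have \<delta>: "0 < \<delta>" "\<delta> \<le> 1/3" "\<delta> \<le> 1" and g3: "g = 3 * \<delta>" using g by (auto simp: \<delta>_def)
  obtain C1 R1 where C1: "C1 > 0" "R1 \<ge> 1" "\<And>\<rho>. R1 \<le> cmod \<rho> \<Longrightarrow> far \<omega> \<delta> \<rho> \<Longrightarrow> det (Delta \<rho>) \<noteq> 0 \<Longrightarrow>
     norm (weyl_matrix L \<rho> - M0 \<rho>) \<le> C1 / (cmod \<rho>)\<^sup>2"
    using weyl_asymptotics[OF \<delta>(1,3)] by metis
  obtain C2 where C2: "C2 > 0" "\<And>\<rho> \<delta>. 1 \<le> cmod \<rho> \<Longrightarrow> 0 < \<delta> \<Longrightarrow> \<delta> \<le> 1 \<Longrightarrow> far \<omega> \<delta> \<rho> \<Longrightarrow> C2 \<le> \<delta> * cmod \<rho> \<Longrightarrow>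
     cmod (det (Delta \<rho>) - det (Delta0 \<rho>)) < cmod (det (Delta0 \<rho>))" using rouche_condition by metis
  obtain N2 :: nat where N2: "\<And>n q n' s. \<bar>wval n\<bar> > int N2 \<Longrightarrow> cmod (r n' s - pt (wval n) q) < 2 * \<delta> \<Longrightarrow> n' = n \<and> \<omega> s = \<omega> q"
    using r_separated[OF g(3)[unfolded g3] \<delta>(1,2)] by blast
  obtain N3 :: nat where "max (max (real N2) (real N)) (max (max 4 (2 * R1)) (max (K / \<delta>) (2 * C2 / \<delta>))) \<le> real N3"
    using real_arch_simple by blast
  then have N3: "N2 \<le> N3" "N \<le> N3" "4 \<le> real N3" "2 * R1 \<le> real N3" "K \<le> \<delta> * real N3" "2 * C2 \<le> \<delta> * real N3"
    using \<delta> by (auto simp: pos_divide_le_eq mult.commute)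
  \<comment> \<open>The summand 4 C1 comes from |z| \<ge> |k|/2 on the circle; the other one from
    replacing 1/(n + \<omega>_q) by 1/n.\<close>
  define C where "C = (\<Sum>i\<in>UNIV. \<Sum>j\<in>UNIV. 4 * C1 + 2 * cmod (weight_limit q $ i $ j))"
  have "norm ((\<Sum>s\<in>{s. \<omega> s = \<omega> q}. (1 / real (multiplicity_ev L (r n s))) *\<^sub>R matrix_residue (weyl_matrix L) (r n s)) -
      (1 / (pi * real_of_int (wval n))) *\<^sub>R weight_limit q) \<le> C / (real_of_int (wval n))\<^sup>2"
    if n: "\<bar>wval n\<bar> > int N3" for n
  proof -
    define k where "k = wval n"
    define c where "c = pt k q"
    define J where "J = {s. \<omega> s = \<omega> q}"
    \<comment> \<open>Eigenvalues in the doubled disc are removed so that M is holomorphic on a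
      neighbourhood of the circle; those inside the circle itself form Z'.\<close>
    define Z where "Z = {z\<in>eigenvalues L. z \<in> ball c (2 * \<delta>)}"
    define Z' where "Z' = {z\<in>Z. z \<in> ball c \<delta>}"
    have k: "\<bar>real_of_int k\<bar> > real N3" using n unfolding k_def by linarith
    have k0: "k \<noteq> 0" using k by auto
    have nN2: "\<bar>wval n\<bar> > int N2" using n N3 by linarith
    have near: "\<bar>real_of_int k\<bar> / 2 \<le> cmod z" if "cmod (z - c) \<le> 1" for z
    proof -
      have "cmod c \<le> cmod z + cmod (z - c)" using norm_triangle_ineq4[of z "z - c"] by simp
      then show ?thesis using that pt_norm(1)[of k q] k N3(3) unfolding c_def by argo
    qed
    have circ: "R1 \<le> cmod z" "far \<omega> \<delta> z" "det (Delta z) \<noteq> 0" "(\<bar>real_of_int k\<bar> / 2)\<^sup>2 \<le> (cmod z)\<^sup>2" if z: "cmod (z - c) = \<delta>" for z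
    proof -
      have zk: "\<bar>real_of_int k\<bar> / 2 \<le> cmod z" using near z \<delta> by simp
      then show "(\<bar>real_of_int k\<bar> / 2)\<^sup>2 \<le> (cmod z)\<^sup>2" by (intro power_mono) auto
      have zN: "real N3 \<le> 2 * cmod z" using zk k by argo
      then show R: "R1 \<le> cmod z" using N3(4) by linarith
      show f: "far \<omega> \<delta> z" unfolding far_pt
      proof (intro allI)
        fix p m
        show "\<delta> \<le> cmod (z - pt m p)"
        proof (cases "\<bar>real_of_int (m - k) + \<omega> p - \<omega> q\<bar> < g")
          case True
          then have "pt m p = c" using g(3)[OF True] by (simp add: c_def pt_def)
          then show ?thesis using z by simp
        next
          case False
          have "cmod (pt m p - c) \<le> cmod (z - pt m p) + cmod (z - c)" using norm_triangle_ineq[of "pt m p - z" "z - c"] by (simp add: norm_minus_commute)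
          then show ?thesis using False z g3 \<delta>(1) unfolding pt_dist[of m p k q, symmetric] c_def by linarith
        qed
      qed
      have "\<delta> * real N3 \<le> \<delta> * (2 * cmod z)" using zN \<delta>(1) by (intro mult_left_mono) auto
      then have "C2 \<le> \<delta> * cmod z" using N3(6) by simp
      then have "cmod (det (Delta z) - det (Delta0 z)) < cmod (det (Delta0 z))"
        using R C1(2) \<delta> by (intro C2(2)[OF _ \<delta>(1,3) f]) auto
      then show "det (Delta z) \<noteq> 0" by auto
    qed
    have Zr: "\<exists>s\<in>J. z = r n s" if z: "z \<in> Z" for z
    proof -
      have "z \<in> eigenvalues L" using z by (simp add: Z_def)
      then obtain n' s where s: "z = r n' s" using range_r(2) by blast
      then have "cmod (r n' s - pt (wval n) q) < 2 * \<delta>" using z by (simp add: Z_def c_def k_def dist_norm norm_minus_commute)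
      from N2[OF nN2 this] show ?thesis using s by (auto simp: J_def)
    qed
    have "Z \<subseteq> r n ` J" using Zr by blast
    then have finZ: "finite Z" by (rule finite_subset) simp
    then have finZ': "finite Z'" by (simp add: Z'_def)
    have imJ: "r n ` J \<subseteq> Z'"
    proof
      fix z assume "z \<in> r n ` J"
      then obtain s where s: "s \<in> J" "z = r n s" by blast
      have "cmod (r n s - pt (wval n) s) < \<delta>" by (rule r_close[OF n N3(2,5) \<delta>(1)])
      moreover have "pt (wval n) s = c" using s by (simp add: J_def c_def k_def pt_def)
      ultimately show "z \<in> Z'" using range_r(1)[of n s] s(2) \<delta>(1) by (simp add: Z'_def Z_def dist_norm norm_minus_commute)
    qed
    have card: "card {s\<in>J. r n s = z} = multiplicity_ev L z" if z: "z \<in> Z'" for z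
    proof -
      have "{(n', s). r n' s = z} = Pair n ` {s\<in>J. r n s = z}"
      proof (intro set_eqI iffI)
        fix x assume "x \<in> {(n', s). r n' s = z}"
        then obtain n' s where x: "x = (n', s)" "r n' s = z" by auto
        then have "cmod (r n' s - pt (wval n) q) < 2 * \<delta>" using z by (simp add: Z'_def Z_def c_def k_def dist_norm norm_minus_commute)
        from N2[OF nN2 this] show "x \<in> Pair n ` {s\<in>J. r n s = z}" using x by (auto simp: J_def)
      qed auto
      then have "card {(n', s). r n' s = z} = card {s\<in>J. r n s = z}" by (simp add: card_image inj_on_def)
      moreover have "card {(n', s). r n' s = z} = multiplicity_ev L z" using r z by (auto simp: numbers_eigenvalues_def Z'_def Z_def)
      ultimately show ?thesis by simp
    qed
    have pos: "multiplicity_ev L z > 0" if "z \<in> Z'" for z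
      using zorder_det_Delta_pos[of z] that by (simp add: multiplicity_ev_eq Z'_def Z_def)
    have ck: "cmod c \<ge> \<bar>real_of_int k\<bar> / 2" using near[of c] by simp
    then have gc: "g \<le> cmod c" using k N3(3) g(2) by argo
    have c0: "c \<noteq> 0" using gc g(1) by auto
    have entry: "cmod ((\<Sum>s\<in>J. (1 / real (multiplicity_ev L (r n s))) *\<^sub>R residue (\<lambda>\<rho>. weyl_matrix L \<rho> $ i $ j) (r n s)) -
       (1 / (pi * real_of_int k)) *\<^sub>R weight_limit q $ i $ j) \<le> (4 * C1 + 2 * cmod (weight_limit q $ i $ j)) / (real_of_int k)\<^sup>2" for i j
    proof -
      define f where "f = (\<lambda>\<rho>. weyl_matrix L \<rho> $ i $ j)"
      define f0 where "f0 = (\<lambda>\<rho>. M0 \<rho> $ i $ j)"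
      define S1 where "S1 = (\<Sum>z\<in>Z'. residue f z)"
      have S1: "(\<Sum>s\<in>J. (1 / real (multiplicity_ev L (r n s))) *\<^sub>R residue f (r n s)) = S1"
        unfolding S1_def by (rule sum_over_fibres[OF _ finZ' imJ card pos]) simp_all
      have "(\<lambda>z. num i j z / det (Delta z)) holomorphic_on ball c (2 * \<delta>) - Z"
        by (intro holomorphic_on_divide holomorphic_on_subset[OF num_holo] holomorphic_on_subset[OF det_holo])
           (auto simp: Z_def eigenvalues_iff)
      then have "f holomorphic_on ball c (2 * \<delta>) - Z"
        by (rule holomorphic_transform) (auto simp: f_def M_eq Z_def eigenvalues_iff)
      then have 1: "(f has_contour_integral (2 * pi * \<i> * S1)) (circlepath c \<delta>)"
        unfolding S1_def Z'_def using finZ \<delta> circ(3) by (intro circlepath_residues) (auto simp: Z_def eigenvalues_iff)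
      note res0 = residue_M0[OF g(3) g(1) gc[unfolded c_def], folded c_def, of i j]
      have "{z\<in>{c}. z \<in> ball c \<delta>} = {c}" using \<delta> by auto
      moreover have "(f0 has_contour_integral (2 * pi * \<i> * (\<Sum>z\<in>{z\<in>{c}. z \<in> ball c \<delta>}. residue f0 z))) (circlepath c \<delta>)"
        unfolding f0_def using \<delta> g3 by (intro circlepath_residues[OF res0(1)]) auto
      ultimately have 2: "(f0 has_contour_integral (2 * pi * \<i> * residue f0 c)) (circlepath c \<delta>)" by simp
      have "norm (2 * pi * \<i> * S1 - 2 * pi * \<i> * residue f0 c) \<le> (4 * C1 / (real_of_int k)\<^sup>2) * (2 * pi * \<delta>)"
      proof (rule has_contour_integral_bound_circlepath[OF has_contour_integral_diff[OF 1 2] _ \<delta>(1)])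
        show "0 \<le> 4 * C1 / (real_of_int k)\<^sup>2" using C1 by simp
        fix z assume "norm (z - c) = \<delta>"
        note z = circ[OF this]
        have "norm (f z - f0 z) = norm ((weyl_matrix L z - M0 z) $ i $ j)" by (simp add: f_def f0_def)
        also have "\<dots> \<le> norm (weyl_matrix L z - M0 z)"
          by (rule order_trans[OF Finite_Cartesian_Product.norm_nth_le Finite_Cartesian_Product.norm_nth_le])
        also have "\<dots> \<le> C1 / (cmod z)\<^sup>2" by (rule C1(3)[OF z(1-3)])
        also have "\<dots> \<le> C1 / (\<bar>real_of_int k\<bar> / 2)\<^sup>2"
          using z(4) C1(1) k0 order.strict_trans2[OF _ z(4), of 0] by (intro divide_left_mono mult_pos_pos) auto
        also have "\<dots> = 4 * C1 / (real_of_int k)\<^sup>2" by (simp add: power_divide)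
        finally show "norm (f z - f0 z) \<le> 4 * C1 / (real_of_int k)\<^sup>2" .
      qed
      also have "norm (2 * pi * \<i> * S1 - 2 * pi * \<i> * residue f0 c) = 2 * pi * cmod (S1 - residue f0 c)"
        by (simp add: right_diff_distrib[symmetric] norm_mult)
      also have "(4 * C1 / (real_of_int k)\<^sup>2) * (2 * pi * \<delta>) = 2 * pi * ((4 * C1 / (real_of_int k)\<^sup>2) * \<delta>)" by simp
      finally have "cmod (S1 - residue f0 c) \<le> (4 * C1 / (real_of_int k)\<^sup>2) * \<delta>"
        by (rule mult_left_le_imp_le) simp
      also have "\<dots> \<le> (4 * C1 / (real_of_int k)\<^sup>2) * 1" using C1 \<delta> by (intro mult_left_mono) auto
      finally have d1: "cmod (S1 - residue f0 c) \<le> 4 * C1 / (real_of_int k)\<^sup>2" by simp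
      define X where "X = weight_limit q $ i $ j"
      have kc: "(of_int k :: complex) \<noteq> 0" using k0 by simp
      have rc: "residue f0 c = X / (pi * c)" unfolding f0_def X_def c_def by (rule residue_M0(2)[OF g(3) g(1) gc[unfolded c_def]])
      have "residue f0 c - (1 / (pi * real_of_int k)) *\<^sub>R X = X / pi * (1 / c - 1 / of_int k)"
        unfolding rc by (simp add: scaleR_conv_of_real right_diff_distrib)
      also have "1 / c - 1 / of_int k = - of_real (\<omega> q) / (c * of_int k)"
        using c0 kc by (simp add: c_def pt_def divide_simps)
      finally have "cmod (residue f0 c - (1 / (pi * real_of_int k)) *\<^sub>R X) = cmod X / pi * (\<omega> q / (cmod c * \<bar>real_of_int k\<bar>))"
        using \<omega>[of q] by (simp add: norm_mult norm_divide)
      also have "\<dots> \<le> cmod X / 1 * (1 / ((\<bar>real_of_int k\<bar> / 2) * \<bar>real_of_int k\<bar>))"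
      proof (rule mult_mono)
        show "cmod X / pi \<le> cmod X / 1" using pi_gt3 by (intro divide_left_mono) auto
        show "\<omega> q / (cmod c * \<bar>real_of_int k\<bar>) \<le> 1 / ((\<bar>real_of_int k\<bar> / 2) * \<bar>real_of_int k\<bar>)"
          using ck k0 \<omega>[of q] by (intro frac_le mult_right_mono mult_pos_pos) auto
      qed (use \<omega>[of q] in auto)
      also have "\<dots> = 2 * cmod X / (real_of_int k)\<^sup>2" by (simp add: power2_eq_square flip: abs_mult)
      finally have d2: "cmod (residue f0 c - (1 / (pi * real_of_int k)) *\<^sub>R X) \<le> 2 * cmod X / (real_of_int k)\<^sup>2" .
      have "cmod (S1 - (1 / (pi * real_of_int k)) *\<^sub>R X) \<le> cmod (S1 - residue f0 c) + cmod (residue f0 c - (1 / (pi * real_of_int k)) *\<^sub>R X)"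
        using norm_triangle_ineq[of "S1 - residue f0 c" "residue f0 c - (1 / (pi * real_of_int k)) *\<^sub>R X"] by simp
      also have "\<dots> \<le> 4 * C1 / (real_of_int k)\<^sup>2 + 2 * cmod X / (real_of_int k)\<^sup>2" by (rule add_mono[OF d1 d2])
      also have "\<dots> = (4 * C1 + 2 * cmod X) / (real_of_int k)\<^sup>2" by (simp only: add_divide_distrib)
      finally show ?thesis unfolding S1[symmetric] f_def X_def .
    qed
    define D where "D = (\<Sum>s\<in>{s. \<omega> s = \<omega> q}. (1 / real (multiplicity_ev L (r n s))) *\<^sub>R matrix_residue (weyl_matrix L) (r n s)) -
      (1 / (pi * real_of_int (wval n))) *\<^sub>R weight_limit q"
    have Dij: "cmod (D $ i $ j) \<le> (4 * C1 + 2 * cmod (weight_limit q $ i $ j)) / (real_of_int k)\<^sup>2" for i j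
      using entry[of i j] by (simp add: D_def J_def k_def matrix_residue_def)
    have "norm D \<le> (\<Sum>i\<in>UNIV. \<Sum>j\<in>UNIV. cmod (D $ i $ j))" by (rule norm_matrix_le_sum)
    also have "\<dots> \<le> (\<Sum>i\<in>UNIV. \<Sum>j\<in>UNIV. (4 * C1 + 2 * cmod (weight_limit q $ i $ j)) / (real_of_int k)\<^sup>2)"
      by (intro sum_mono Dij)
    also have "\<dots> = C / (real_of_int k)\<^sup>2" by (simp only: C_def sum_divide_distrib)
    finally show ?thesis unfolding D_def k_def .
  qed
  then show ?thesis by blast
qed

lemma countable_infinite_eigenvalues: "countable (eigenvalues L)" "infinite (eigenvalues L)"
proof -
  have "(UNIV :: windex set) = range Pos \<union> range Neg"
  proof (intro set_eqI iffI)
    fix n :: windex show "n \<in> range Pos \<union> range Neg" by (cases n) auto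
  qed auto
  moreover have "countable (range Pos \<union> range Neg)" by simp
  ultimately have "countable (UNIV :: windex set)" by (simp only:)
  then have "countable ((UNIV :: windex set) \<times> (UNIV :: 'm set))" by (intro countable_SIGMA countable_finite[OF finite])
  then have "countable (range (\<lambda>(n, q). r n q))" by (intro countable_image) simp
  then show "countable (eigenvalues L)" using r by (simp add: numbers_eigenvalues_def)
  show "infinite (eigenvalues L)"
  proof
    assume "finite (eigenvalues L)"
    then obtain B where B: "\<forall>z\<in>eigenvalues L. cmod z \<le> B" using finite_imp_bounded bounded_iff by blast
    obtain N' :: nat where N': "\<forall>n q. \<bar>wval n\<bar> \<ge> int N' \<longrightarrow> cmod (r n q) > B" using r_unbounded by blast
    have "cmod (r (Pos N') q) > B" for q using N' by simp
    then show False using B range_r(1) by (meson not_le)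
  qed
qed

lemma eventually_simple_real:
  "\<exists>N'. \<forall>n q. \<bar>wval n\<bar> \<ge> int N' \<longrightarrow> r n q \<in> \<real> \<and> simple_matrix_pole (weyl_matrix L) (r n q) \<and>
     rank (matrix_residue (weyl_matrix L) (r n q)) = multiplicity_ev L (r n q)"
proof -
  \<comment> \<open>A modulus above 1 is at most its square, so this bound makes the square exceed
    \<open>energy_C\<close>.\<close>
  obtain N' :: nat where N': "\<forall>n q. \<bar>wval n\<bar> \<ge> int N' \<longrightarrow> cmod (r n q) > 1 + \<bar>energy_C\<bar>" using r_unbounded by blast
  have "r n q \<in> \<real> \<and> simple_matrix_pole (weyl_matrix L) (r n q) \<and>
     rank (matrix_residue (weyl_matrix L) (r n q)) = multiplicity_ev L (r n q)" if "\<bar>wval n\<bar> \<ge> int N'" for n q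
  proof -
    have "cmod (r n q) > 1 + \<bar>energy_C\<bar>" using N' that by blast
    moreover have "1 * cmod (r n q) \<le> cmod (r n q) * cmod (r n q)" using calculation by (intro mult_right_mono) auto
    ultimately have large: "(cmod (r n q))\<^sup>2 > energy_C" unfolding power2_eq_square by linarith
    have ev: "r n q \<in> eigenvalues L" by (rule range_r)
    have real: "r n q \<in> \<real>" by (rule large_eigenvalue_real[OF ev large])
    have det: "det (Delta (r n q)) = 0" using ev by (simp add: eigenvalues_iff)
    note simple = no_chain_imp_simple_pole[of "r n q", OF no_jordan_chain[OF real large] det]
    show ?thesis using real simple by (simp add: multiplicity_ev_eq)
  qed
  then show ?thesis by blast
qed

end

lemma spectral_asymptotics:
  "countable (eigenvalues L) \<and> infinite (eigenvalues L) \<and>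
    {\<rho>. matrix_pole (weyl_matrix L) \<rho>} = eigenvalues L \<and>
    (\<exists>r :: windex \<Rightarrow> 'm \<Rightarrow> complex.
       numbers_eigenvalues L r \<and>
       (\<forall>q. (\<lambda>n. r n q - (of_int (wval n) + of_real (\<omega> q))) \<in> O[windex_at_infinity](\<lambda>n. 1 / of_int (wval n))) \<and>
       (\<exists>N::nat. \<forall>n q. \<bar>wval n\<bar> \<ge> int N \<longrightarrow> r n q \<in> \<real>) \<and>
       (\<exists>N::nat. \<forall>n q. \<bar>wval n\<bar> \<ge> int N \<longrightarrow>
          simple_matrix_pole (weyl_matrix L) (r n q) \<and>
          rank (matrix_residue (weyl_matrix L) (r n q)) = multiplicity_ev L (r n q)) \<and>
       (\<forall>q. (\<lambda>n. norm (
               (\<Sum>s\<in>{s. \<omega> s = \<omega> q}. (1 / real (multiplicity_ev L (r n s))) *\<^sub>R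
                  matrix_residue (weyl_matrix L) (r n s)) -
               (1 / (pi * real_of_int (wval n))) *\<^sub>R weight_limit q))
              \<in> O[windex_at_infinity](\<lambda>n. 1 / (real_of_int (wval n))\<^sup>2)))"
proof -
  obtain r :: "windex \<Rightarrow> 'm \<Rightarrow> complex" and N :: nat and K :: real
    where r: "numbers_eigenvalues L r" and K: "K > 0"
      and asym: "\<And>n q. \<bar>wval n\<bar> > int N \<Longrightarrow> cmod (r n q - pt (wval n) q) \<le> K / \<bar>real_of_int (wval n)\<bar>"
    using numbering by metis
  note facts = r K asym
  have poles: "{\<rho>. matrix_pole (weyl_matrix L) \<rho>} = eigenvalues L"
    using matrix_pole_iff eigenvalues_iff by blast
  have O1: "(\<lambda>n. r n q - (of_int (wval n) + of_real (\<omega> q))) \<in> O[windex_at_infinity](\<lambda>n. 1 / of_int (wval n))" for q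
    by (rule bigo_windex_at_infinity[of N _ K]) (use asym[of _ q] in \<open>simp add: pt_def norm_divide\<close>)
  obtain N' :: nat where N': "\<forall>n q. \<bar>wval n\<bar> \<ge> int N' \<longrightarrow> r n q \<in> \<real> \<and> simple_matrix_pole (weyl_matrix L) (r n q) \<and>
     rank (matrix_residue (weyl_matrix L) (r n q)) = multiplicity_ev L (r n q)"
    using eventually_simple_real[OF facts] by blast
  have O2: "(\<lambda>n. norm (
               (\<Sum>s\<in>{s. \<omega> s = \<omega> q}. (1 / real (multiplicity_ev L (r n s))) *\<^sub>R
                  matrix_residue (weyl_matrix L) (r n s)) -
               (1 / (pi * real_of_int (wval n))) *\<^sub>R weight_limit q))
              \<in> O[windex_at_infinity](\<lambda>n. 1 / (real_of_int (wval n))\<^sup>2)" for q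
  proof -
    obtain C and M :: nat where C: "\<forall>n. \<bar>wval n\<bar> > int M \<longrightarrow>
      norm ((\<Sum>s\<in>{s. \<omega> s = \<omega> q}. (1 / real (multiplicity_ev L (r n s))) *\<^sub>R matrix_residue (weyl_matrix L) (r n s)) -
      (1 / (pi * real_of_int (wval n))) *\<^sub>R weight_limit q) \<le> C / (real_of_int (wval n))\<^sup>2"
      using weight_asymptotics[OF facts, where q = q] by blast
    show ?thesis by (rule bigo_windex_at_infinity[of M _ C]) (use C in simp)
  qed
  have N1: "\<exists>N::nat. \<forall>n q. \<bar>wval n\<bar> \<ge> int N \<longrightarrow> r n q \<in> \<real>" using N' by blast
  have N2: "\<exists>N::nat. \<forall>n q. \<bar>wval n\<bar> \<ge> int N \<longrightarrow> simple_matrix_pole (weyl_matrix L) (r n q) \<and>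
     rank (matrix_residue (weyl_matrix L) (r n q)) = multiplicity_ev L (r n q)" using N' by blast
  show ?thesis
    by (intro conjI exI[of _ r] allI r O1 O2 N1 N2 poles countable_infinite_eigenvalues[OF facts])
qed

end

theorem theorem1:
  fixes L :: "'m::finite pencil"
    and P_plus P_minus :: "real \<Rightarrow> complex^'m^'m"
    and W :: "complex^'m^'m"
    and \<omega> :: "'m \<Rightarrow> real"
  assumes Q1_W11: "in_W11 (Q1 L)"
    and Q0_L1: "Q0 L absolutely_integrable_on {0..pi}"
    and I_h1: "det (mat 1 + h1 L) \<noteq> 0" "det (mat 1 - h1 L) \<noteq> 0"
    and I_H1: "det (mat 1 + H1 L) \<noteq> 0" "det (mat 1 - H1 L) \<noteq> 0"
    and II_Q1: "AE x in lebesgue_on {0..pi}. (Q1 L x)\<^sup>\<dagger> = - Q1 L x"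
    and II_Q0: "AE x in lebesgue_on {0..pi}. (Q0 L x)\<^sup>\<dagger> = Q0 L x"
    and II_h: "(h1 L)\<^sup>\<dagger> = - h1 L" "(h0 L)\<^sup>\<dagger> = h0 L"
    and II_H: "(H1 L)\<^sup>\<dagger> = - H1 L" "(H0 L)\<^sup>\<dagger> = H0 L"
    and P_plus: "P_plus 0 = mat 1"
      "\<And>x. x \<in> {0..pi} \<Longrightarrow>
         (P_plus has_vector_derivative Q1 L x ** P_plus x) (at x within {0..pi})"
    and P_minus: "P_minus 0 = mat 1"
      "\<And>x. x \<in> {0..pi} \<Longrightarrow>
         (P_minus has_vector_derivative - (Q1 L x ** P_minus x)) (at x within {0..pi})"
    and W: "unitary_mat W"
    and \<omega>: "\<And>q. 0 \<le> \<omega> q" "\<And>q. \<omega> q < 1"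
    and A: "matrix_inv (P_minus pi) ** matrix_inv (mat 1 + H1 L) ** (mat 1 - H1 L) **
              P_plus pi ** (mat 1 + h1 L) ** matrix_inv (mat 1 - h1 L)
            = W\<^sup>\<dagger> ** diag_mat (\<lambda>q. exp (2 * pi * \<i> * \<omega> q)) ** W"
  shows "countable (eigenvalues L) \<and> infinite (eigenvalues L) \<and>
    {\<rho>. matrix_pole (weyl_matrix L) \<rho>} = eigenvalues L \<and>
    (\<exists>r :: windex \<Rightarrow> 'm \<Rightarrow> complex.
       numbers_eigenvalues L r \<and>
       (\<forall>q. (\<lambda>n. r n q - (of_int (wval n) + of_real (\<omega> q)))
              \<in> O[windex_at_infinity](\<lambda>n. 1 / of_int (wval n))) \<and>
       (\<exists>N::nat. \<forall>n q. \<bar>wval n\<bar> \<ge> int N \<longrightarrow> r n q \<in> \<real>) \<and>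
       (\<exists>N::nat. \<forall>n q. \<bar>wval n\<bar> \<ge> int N \<longrightarrow>
          simple_matrix_pole (weyl_matrix L) (r n q) \<and>
          rank (matrix_residue (weyl_matrix L) (r n q)) = multiplicity_ev L (r n q)) \<and>
       (\<forall>q. (\<lambda>n. norm (
               (\<Sum>s\<in>{s. \<omega> s = \<omega> q}. (1 / real (multiplicity_ev L (r n s))) *\<^sub>R
                  matrix_residue (weyl_matrix L) (r n s)) -
               (1 / (pi * real_of_int (wval n))) *\<^sub>R
                 (matrix_inv (mat 1 - h1 L) ** W\<^sup>\<dagger> **
                  diag_mat (\<lambda>j. if \<omega> j = \<omega> q then 1 else 0) ** W **
                  matrix_inv (mat 1 + h1 L))))
              \<in> O[windex_at_infinity](\<lambda>n. 1 / (real_of_int (wval n))\<^sup>2)))"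
proof -
  obtain q1 where q1: "has_W11_derivative (Q1 L) q1" using Q1_W11 by (auto simp: in_W11_def)
  interpret weyl_pencil L P_plus P_minus q1 W \<omega>
  proof unfold_locales
    show "continuous_on {0..pi} (Q1 L)" by (rule has_W11_derivative_continuous[OF q1])
  qed (fact | rule assms q1)+
  show ?thesis using spectral_asymptotics unfolding weight_limit_def ih_def ih'_def .
qed

end
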